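(* Let $N\ge 2$, let $c_1,\dots,c_N\in\mathbb{R}^3$ be pairwise distinct, let $m_1,\dots,m_N>0$ and let $\alpha\in[1,2)$. For any $\xi^-,\xi^+\in\mathbb{S}^2$ with $\xi^+\neq\pm\xi^-$ and any $H>0$, there exists a solution $x:\mathbb{R}\to\mathbb{R}^3\setminus\{c_1,\dots,c_N\}$ of $$\ddot{x} = -\sum_{i=1}^{N} \frac{m_i (x - c_i)}{\vert x - c_i \vert^{\alpha+2}}$$ with energy $H$ such that $$\lim_{t\to+\infty}\frac{x(t)}{|x(t)|}=\xi^+\qquad\text{and}\qquad \lim_{t\to-\infty}\frac{x(t)}{|x(t)|}=\xi^-.$$
   Context: $|\cdot|$ is the Euclidean norm on $\mathbb{R}^3$ and $\mathbb{S}^2$ is its unit sphere. Set $V(x)=\sum_{i=1}^N \frac{m_i}{\alpha|x-c_i|^\alpha}$ for $x\in\mathbb{R}^3\setminus\{c_1,\dots,c_N\}$, so that the equation reads $\ddot x=\nabla V(x)$. A solution $x$ has energy $H$ if $\tfrac12|\dot x(t)|^2-V(x(t))=H$ for every $t$. *)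

theory Defs
  imports "HOL-Analysis.Analysis"
begin

text \<open>
  The \<open>N\<close> centres and their masses are families \<open>c\<close> and \<open>m\<close> on \<open>nat\<close>, of which only the
  indices in \<open>{1..N}\<close> are used.
\<close>

definition potential :: "nat \<Rightarrow> (nat \<Rightarrow> real ^ 3) \<Rightarrow> (nat \<Rightarrow> real) \<Rightarrow> real \<Rightarrow> real ^ 3 \<Rightarrow> real" where
  "potential N c m \<alpha> x = (\<Sum>i = 1..N. m i / (\<alpha> * norm (x - c i) powr \<alpha>))"

text \<open>
  The gradient of \<open>potential N c m \<alpha>\<close> away from the centres, that is, the right-hand side of
  the equation of motion.
\<close>

definition force :: "nat \<Rightarrow> (nat \<Rightarrow> real ^ 3) \<Rightarrow> (nat \<Rightarrow> real) \<Rightarrow> real \<Rightarrow> real ^ 3 \<Rightarrow> real ^ 3" where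
  "force N c m \<alpha> x = - (\<Sum>i = 1..N. (m i / norm (x - c i) powr (\<alpha> + 2)) *\<^sub>R (x - c i))"

text \<open>
  A classical solution on all of \<open>\<real>\<close> which never meets a centre; \<open>v\<close> is its velocity.
\<close>

definition is_solution ::
  "nat \<Rightarrow> (nat \<Rightarrow> real ^ 3) \<Rightarrow> (nat \<Rightarrow> real) \<Rightarrow> real \<Rightarrow> (real \<Rightarrow> real ^ 3) \<Rightarrow> bool" where
  "is_solution N c m \<alpha> x \<longleftrightarrow>
     (\<forall>t. x t \<notin> c ` {1..N}) \<and>
     (\<exists>v. \<forall>t. (x has_vector_derivative v t) (at t) \<and>
              (v has_vector_derivative force N c m \<alpha> (x t)) (at t))"

definition has_energy ::
  "nat \<Rightarrow> (nat \<Rightarrow> real ^ 3) \<Rightarrow> (nat \<Rightarrow> real) \<Rightarrow> real \<Rightarrow> (real \<Rightarrow> real ^ 3) \<Rightarrow> real \<Rightarrow> bool" where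
  "has_energy N c m \<alpha> x H \<longleftrightarrow>
     (\<forall>t. (norm (vector_derivative x (at t)))\<^sup>2 / 2 - potential N c m \<alpha> (x t) = H)"

end

theory Submission
 imports Defs "HOL-Complex_Analysis.Great_Picard"
begin

text \<open>
 Replace \<open>\<bar>x - c\<^sub>i\<bar>\<^sup>2\<close> in the potential by \<open>\<bar>x - c\<^sub>i\<bar>\<^sup>2 + \<delta>\<^sup>2\<close> and join \<open>a = R \<xi>m\<close> to \<open>b = R \<xi>p\<close> by critical points of the
 Jacobi length at energy \<open>H\<close>. Let \<open>M\<close> be the least cost of a path from \<open>a\<close> to \<open>b\<close> through a centre, attained at \<open>c\<^sub>1\<close>.
 The minimal rays from \<open>c\<^sub>1\<close> to \<open>a\<close> and \<open>b\<close> converge as \<open>\<delta> \<rightarrow> 0\<close>, \<open>R \<rightarrow> \<infinity>\<close>, and leave \<open>c\<^sub>1\<close> in different directions: a collision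
 orbit is determined by its initial direction, and equal rays would have equal asymptotic directions.
 Since \<open>\<alpha> < 2\<close>, replacing the collision by an arc around \<open>c\<^sub>1\<close> (to either side) strictly lowers the cost, so there is
 a family of paths, indexed by a circle and sweeping around \<open>c\<^sub>1\<close>, all of cost below \<open>M - \<eta>\<close>.
 The family is essential in the complement of \<open>c\<^sub>1\<close>, so each deformation of it meets the ray from \<open>c\<^sub>1\<close> in direction
 \<open>- (\<xi>m + \<xi>p)\<close> and has cost at least about \<open>2 R \<surd>(2 H)\<close>. The resulting minimax orbits have cost between
 these two bounds. The upper one keeps them at a fixed distance from all centres; by the lower one
 they are longer than the almost straight path from \<open>a\<close> to \<open>b\<close> and hence enter a fixed ball. They converge to the
 wanted solution, as the force is integrable along the outer parts.
\<close>

text \<open>Minimising between \<open>a\<close> and \<open>b\<close> would not do: since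
  \<open>\<xi>p ~= - \<xi>m\<close>, an almost straight chord costs about
  \<open>R * norm (\<xi>p - \<xi>m) * sqrt (2 * H)\<close>, which is less than
  \<open>2 * R * sqrt (2 * H)\<close>, and such chords run off to infinity with \<open>R\<close>.
  Hence a linking argument whose lower bound beats the chord. The complement of a point of space is
  only detected by maps of the 2-sphere, and a circle of paths with common ends is such a map.
  Softening makes the functional smooth on all paths, so that one explicit descent step serves as
  deformation; in return every estimate that is to survive the limit must be uniform in
  \<open>\<delta>\<close>. This is possible because \<open>r powr (- \<alpha> / 2)\<close> is
  integrable along segments: the Jacobi distance has a modulus of continuity free of
  \<open>\<delta>\<close>. The bound \<open>\<alpha> >= 1\<close> makes the force decay at least
  like the inverse square, and it keeps the angle spanned by an arc below pi after the map
  \<open>z powr \<kappa>\<close>, so that arcs exist on either side of the centre. The condition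
  \<open>\<xi>p ~= \<xi>m\<close> is what separates the two rays at the centre.\<close>

notation has_vector_derivative (infix "hvd" 50)
notation LIMSEQ ("(_)/ ----> (_)" [60, 60] 60)
abbreviation hrd (infix "hrd" 50) where "(f hrd D) F == (f has_real_derivative D) F"

section \<open>Action and length functionals\<close>

text \<open>The velocity is carried as data and is one-sided at 0 and 1, so that paths can be cut,
  joined and rescaled without selecting a derivative.\<close>

definition C1 :: "(real => 'a::euclidean_space) => (real => 'a) => bool" where
 "C1 X D \<longleftrightarrow> continuous_on {0..1} D &
  (\<forall>t\<in>{0..1}. (X hvd D t) (at t within {0..1}))"

definition fam :: "'p::topological_space set => ('p => real => 'a::euclidean_space) => ('p => real => 'a) => bool" where
 "fam U X D \<longleftrightarrow> continuous_on (U \<times> {0..1}) (%z. X (fst z) (snd z)) &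
  continuous_on (U \<times> {0..1}) (%z. D (fst z) (snd z)) &
  (\<forall>v\<in>U. \<forall>t\<in>{0..1}. (X v hvd D v t) (at t within {0..1}))"

definition kin :: "(real => 'a::euclidean_space) => real" where
 "kin D = integral {0..1} (%t. (norm (D t))^2) / 2"

definition pot :: "('a => real) => (real => 'a::euclidean_space) => real" where
 "pot G X = integral {0..1} (%t. G (X t))"

text \<open>Not the Jacobi length, the integral of \<open>norm (D t) * sqrt (2 * G (X t))\<close>,
  but its Cauchy-Schwarz upper bound, with equality when \<open>(norm (D t))^2\<close> is
  proportional to \<open>G (X t)\<close>. As a product of two integrals over a fixed interval it has
  no kink at zero velocity, and its critical points already carry the right parametrisation up to
  one time factor.\<close>

definition jlen :: "('a => real) => (real => 'a::euclidean_space) => (real => 'a) => real" where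
 "jlen G X D = 2 * sqrt (kin D * pot G X)"

text \<open>\<open>N\<close> is a lapse, the rate at which the true time runs against the parameter.
  Unlike \<open>jlen\<close>, this functional adds up under concatenation; \<open>jlen\<close> is
  its infimum over constant lapses.\<close>

definition lact :: "('a => real) => (real => real) => (real => 'a::euclidean_space) => (real => 'a) => real" where
 "lact G N X D = integral {0..1} (%t. (norm (D t))^2 / (2 * N t) + N t * G (X t))"

lemma C1_contD: "C1 X D ==> continuous_on {0..1} D"
 by (simp add: C1_def)

lemma C1_deriv: "C1 X D ==> t \<in> {0..1} ==> (X hvd D t) (at t within {0..1})"
 by (simp add: C1_def)

lemma C1_cont: "C1 X D ==> continuous_on {0..1} X"
 unfolding C1_def by (rule continuous_on_vector_derivative[where f'=D]) blast

lemma continuous_on_slice: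
 assumes "continuous_on (U \<times> S) (%z. f (fst z) (snd z))" "v \<in> U"
 shows "continuous_on S (f v)"
proof -
 have "continuous_on S ((%z. f (fst z) (snd z)) \<circ> (%t. (v, t)))"
  using assms by (intro continuous_on_compose continuous_intros) (auto elim: continuous_on_subset)
 then show ?thesis by (simp add: o_def)
qed

lemma fam_C1: "fam U X D ==> v \<in> U ==> C1 (X v) (D v)"
 unfolding fam_def C1_def using continuous_on_slice by blast

lemma C1_fam: "C1 X D ==> fam U (%_. X) (%_. D)"
proof -
 assume a: "C1 X D"
 have "continuous_on (U \<times> {0..1}) (%z. h (snd z))" if "continuous_on {0..1} h" for h :: "real => 'a"
  by (rule continuous_on_compose2[OF that]) (auto intro!: continuous_intros)
 from this[of X] this[of D] show ?thesis using a C1_cont[OF a] by (simp add: fam_def C1_def)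
qed

lemma C1_increment:
 assumes "C1 X D" "0 <= s" "s <= t" "t <= 1"
 shows "(D has_integral (X t - X s)) {s..t}"
 using assms by (intro fundamental_theorem_of_calculus)
  (auto simp: C1_def intro: has_vector_derivative_within_subset[of _ _ _ "{0..1}"])

lemma integral_cauchy_schwarz:
 fixes f :: "real => 'a::euclidean_space"
 assumes "a <= b" "continuous_on {a..b} f"
 shows "(norm (integral {a..b} f))^2 <= (b - a) * integral {a..b} (%t. (norm (f t))^2)"
proof -
 define I where "I = integral {a..b} f"
 define L where "L = b - a"
 have fi: "f integrable_on {a..b}"
  using assms integrable_continuous_real by blast
 have f2: "(%t. (norm (f t))^2) integrable_on {a..b}"
  by (intro integrable_continuous_real continuous_intros assms)
 have "0 <= integral {a..b} (%t. (norm (L *\<^sub>R f t - I))^2)"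
  by (intro integral_nonneg integrable_continuous_real continuous_intros assms) auto
 also have "(%t. (norm (L *\<^sub>R f t - I))^2) = (%t. L^2 * (norm (f t))^2 + ((norm I)^2 - 2 * L * (f t \<bullet> I)))"
  unfolding power2_norm_eq_inner
  by (auto simp: fun_eq_iff algebra_simps inner_commute power2_eq_square inner_diff_left inner_diff_right)
 also have "integral {a..b} ... = L^2 * integral {a..b} (%t. (norm (f t))^2) + (L * (norm I)^2 - 2 * L * (I \<bullet> I))"
 proof -
  have 1: "((%t. f t \<bullet> I) has_integral (I \<bullet> I)) {a..b}"
   unfolding I_def using has_integral_linear[OF integrable_integral[OF fi] bounded_linear_inner_left]
   by (simp add: o_def)
  have 2: "((%t. (norm I)^2) has_integral (L * (norm I)^2)) {a..b}"
   using has_integral_const_real[of "(norm I)^2" a b] assms by (simp add: L_def)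
  have "((%t. L^2 * (norm (f t))^2 + ((norm I)^2 - 2 * L * (f t \<bullet> I))) has_integral
   (L^2 * integral {a..b} (%t. (norm (f t))^2) + (L * (norm I)^2 - 2 * L * (I \<bullet> I)))) {a..b}"
   by (intro has_integral_add has_integral_diff has_integral_mult_right 1 2 integrable_integral f2)
  then show ?thesis by (rule integral_unique)
 qed
 also have "... = L * (L * integral {a..b} (%t. (norm (f t))^2) - (norm I)^2)"
  by (simp add: dot_square_norm algebra_simps power2_eq_square)
 finally have *: "0 <= L * (L * integral {a..b} (%t. (norm (f t))^2) - (norm I)^2)" .
 show ?thesis
 proof (cases "a = b")
  case True then show ?thesis by simp
 next
  case False
  then have "L > 0" using assms by (simp add: L_def)
  then show ?thesis using * by (simp add: zero_le_mult_iff I_def L_def)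
 qed
qed

text \<open>Rescaling by the upper limit turns the moving domain into a fixed one, where continuity
  of integrals in a parameter applies.\<close>

lemma continuous_on_integral_upto:
 fixes f :: "'p::topological_space => real => 'a::euclidean_space"
 assumes "continuous_on (U \<times> {0..1}) (%z. f (fst z) (snd z))"
 shows "continuous_on (U \<times> {0..1}) (%z. integral {0..snd z} (f (fst z)))"
proof -
 have "continuous_on ((U \<times> {0..1}) \<times> cbox 0 1) (%(z, s). snd z *\<^sub>R f (fst z) (snd z * s))"
 proof -
  have "continuous_on ((U \<times> {0..1}) \<times> {0..1::real}) (%w. f (fst (fst w)) (snd (fst w) * snd w))"
   using continuous_on_compose2[OF assms, of "(U \<times> {0..1}) \<times> {0..1::real}" "%w. (fst (fst w), snd (fst w) * snd w)"]
   by (fastforce intro!: continuous_intros simp: mult_le_one)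
  then show ?thesis
   by (auto simp: case_prod_beta intro!: continuous_intros)
 qed
 from integral_continuous_on_param[OF this]
 have c: "continuous_on (U \<times> {0..1}) (%z. integral {0..1} (%s. snd z *\<^sub>R f (fst z) (snd z * s)))"
  by simp
 have "integral {0..1} (%s. t *\<^sub>R f v (t * s)) = integral {0..t} (f v)" if "v \<in> U" "t \<in> {0..1}" for v t
 proof -
  have "((%s. t *\<^sub>R f v (t * s)) has_integral (integral {t*0..t*1} (f v))) {0..1}"
   using that continuous_on_slice[OF assms that(1)]
   by (intro has_integral_substitution[where c=0 and d=1])
    (auto intro!: derivative_eq_intros mult_le_one)
  from integral_unique[OF this] show ?thesis by (simp del: integral_scaleR_right integral_cmul)
 qed
 then show ?thesis
  using c by (rule_tac continuous_on_eq[OF c]) auto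
qed

lemma kin_pos:
 assumes "C1 X D" shows "(norm (X 1 - X 0))^2 / 2 <= kin D"
 using integral_cauchy_schwarz[of 0 1 D] assms C1_increment[OF assms, of 0 1]
 by (auto simp: kin_def C1_def integral_unique)

text \<open>\<open>G\<close> stands for \<open>H\<close> plus a smoothed potential, \<open>g\<close>
  for its gradient. The lower bound \<open>H\<close> makes cost control distance and time, the upper
  bound \<open>B\<close> keeps travel times away from zero, the Lipschitz constant fixes the size of
  a descent step, and the bound on \<open>g\<close> gives compactness.\<close>

locale soft =
 fixes G :: "'a::euclidean_space => real" and g :: "'a => 'a" and H \<Lambda> \<Gamma> B :: real
 assumes Hpos: "0 < H" and GH: "!!x. H <= G x" and GB: "!!x. G x <= B"
  and Gder: "!!x. (G has_derivative (%h. g x \<bullet> h)) (at x)"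
  and gLip: "!!x y. norm (g x - g y) <= \<Lambda> * norm (x - y)"
  and gB: "!!x. norm (g x) <= \<Gamma>"
begin

lemma Lam0: "0 <= \<Lambda>"
proof -
 obtain b :: 'a where "b \<in> Basis" using nonempty_Basis by blast
 then show ?thesis using gLip[of b 0] order_trans[OF norm_ge_zero[of "g b - g 0"]] by fastforce
qed

lemma G_cont: "continuous_on S G"
 by (rule has_derivative_continuous_on[OF has_derivative_at_withinI[OF Gder]])

lemma g_cont: "continuous_on S g"
proof -
 have "\<Lambda>-lipschitz_on S g"
  using gLip Lam0 by (auto simp: lipschitz_on_def dist_norm)
 then show ?thesis by (rule lipschitz_on_continuous_on)
qed

lemma Gpos: "0 < G x" by (rule less_le_trans[OF Hpos GH])

lemma G_comp_cont: "continuous_on S X ==> continuous_on S (%t. G (X t))"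
 by (rule continuous_on_compose2[OF G_cont[of UNIV]]) auto

lemma g_comp_cont: "continuous_on S X ==> continuous_on S (%t. g (X t))"
 by (rule continuous_on_compose2[OF g_cont[of UNIV]]) auto

lemma G_taylor: "G y <= G x + g x \<bullet> (y - x) + \<Lambda> * (norm (y - x))^2"
proof -
 let ?h = "%t. G (x + t *\<^sub>R (y - x))"
 have d: "(?h hrd (g (x + t *\<^sub>R (y - x)) \<bullet> (y - x))) (at t)" for t
 proof -
  have "((%t. x + t *\<^sub>R (y - x)) has_derivative (%s. s *\<^sub>R (y - x))) (at t)"
   by (auto intro!: derivative_eq_intros)
  from has_derivative_compose[OF this Gder]
  show ?thesis by (simp add: has_field_derivative_def mult_commute_abs)
 qed
 obtain z where z: "0 < z" "z < 1" "?h 1 - ?h 0 = (1 - 0) * (g (x + z *\<^sub>R (y - x)) \<bullet> (y - x))"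
  using MVT2[of 0 1 ?h "%z. g (x + z *\<^sub>R (y - x)) \<bullet> (y - x)"] d by auto
 have "(g (x + z *\<^sub>R (y - x)) - g x) \<bullet> (y - x) <= norm (g (x + z *\<^sub>R (y - x)) - g x) * norm (y - x)"
  by (rule norm_cauchy_schwarz)
 also have "... <= (\<Lambda> * norm (z *\<^sub>R (y - x))) * norm (y - x)"
  using gLip[of "x + z *\<^sub>R (y - x)" x] by (intro mult_right_mono) auto
 also have "... <= (\<Lambda> * norm (y - x)) * norm (y - x)"
  using z Lam0 by (intro mult_right_mono mult_left_mono) (auto simp: mult_left_le_one_le)
 finally show ?thesis using z by (simp add: inner_diff_left power2_eq_square)
qed

lemma pot_ge: "continuous_on {0..1} X ==> H <= pot G X"
 using integral_le[of "%_. H" "{0..1::real}" "%t. G (X t)"] GH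
  integrable_continuous_real[OF G_comp_cont, of 0 1 X] by (auto simp: pot_def)

lemma pot_le: "continuous_on {0..1} X ==> pot G X <= B"
 using integral_le[of "%t. G (X t)" "{0..1::real}" "%_. B"] GB
  integrable_continuous_real[OF G_comp_cont, of 0 1 X] by (auto simp: pot_def)

lemma jlen_ge: assumes "C1 X D" shows "sqrt (2 * H) * norm (X 1 - X 0) <= jlen G X D"
proof -
 have "(norm (X 1 - X 0))^2 / 2 * H <= kin D * pot G X"
  using kin_pos[OF assms] order_trans[OF _ kin_pos[OF assms], of 0] pot_ge[OF C1_cont[OF assms]] Hpos
  by (intro mult_mono) auto
 then have "sqrt ((2 * H) * (norm (X 1 - X 0))^2) <= sqrt (4 * (kin D * pot G X))"
  by (intro real_sqrt_le_mono) (simp add: mult.commute mult.left_commute)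
 then show ?thesis by (simp add: jlen_def real_sqrt_mult)
qed

lemma lact_const:
 assumes "C1 X D" "T > 0"
 shows "lact G (%_. T) X D = kin D / T + T * pot G X"
proof -
 have 1: "(%t. (norm (D t))^2) integrable_on {0..1}" "(%t. G (X t)) integrable_on {0..1}"
  using C1_contD[OF assms(1)] G_comp_cont[OF C1_cont[OF assms(1)]]
  by (auto intro!: integrable_continuous_real continuous_intros)
 have "((%t. (1/(2*T)) * (norm (D t))^2 + T * G (X t)) has_integral
  ((1/(2*T)) * integral {0..1} (%t. (norm (D t))^2) + T * integral {0..1} (%t. G (X t)))) {0..1}"
  by (intro has_integral_add has_integral_mult_right integrable_integral 1)
 then show ?thesis by (auto simp: lact_def kin_def pot_def integral_unique)
qed

lemma kin_ge0: "continuous_on {0..1} D ==> 0 <= kin D"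
 unfolding kin_def by (auto intro!: integral_nonneg integrable_continuous_real continuous_intros)

lemma jlen_le_act:
 assumes "C1 X D" "T > 0" shows "jlen G X D <= kin D / T + T * pot G X"
proof -
 have "sqrt (kin D / T * (T * pot G X)) <= (kin D / T + T * pot G X) / 2"
  using arith_geo_mean_sqrt[of "kin D / T" "T * pot G X"] assms kin_ge0[OF C1_contD[OF assms(1)]]
   pot_ge[OF C1_cont[OF assms(1)]] Hpos by simp
 then show ?thesis using assms by (simp add: jlen_def)
qed

text \<open>The time for which the AM-GM inequality in \<open>jlen_le_act\<close> is an equality.
  Run in this time, the path satisfies the energy law on average:
  \<open>kin D = T^2 * pot G X\<close>.\<close>

definition Topt :: "(real => 'a) => (real => 'a) => real" where
 "Topt X D = sqrt (kin D / pot G X)"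

lemma Topt:
 assumes "C1 X D" "X 0 ~= X 1"
 shows "Topt X D > 0" "jlen G X D = kin D / Topt X D + Topt X D * pot G X"
  "Topt X D <= jlen G X D / (2 * H)" "norm (X 1 - X 0) / sqrt (2 * B) <= Topt X D"
  "kin D = (Topt X D)^2 * pot G X"
proof -
 have p: "0 < pot G X" using pot_ge[OF C1_cont[OF assms(1)]] Hpos by simp
 have "0 < (norm (X 1 - X 0))^2 / 2" using assms(2) by simp
 then have k: "0 < kin D" using kin_pos[OF assms(1)] by linarith
 show T: "Topt X D > 0" using p k by (simp add: Topt_def)
 show e: "kin D = (Topt X D)^2 * pot G X" using p k by (simp add: Topt_def)
 have j: "jlen G X D = 2 * (Topt X D * pot G X)"
 proof -
  have "kin D * pot G X = (Topt X D * pot G X)^2" using e by (simp add: power2_eq_square)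
  then show ?thesis using T p by (simp add: jlen_def)
 qed
 show "jlen G X D = kin D / Topt X D + Topt X D * pot G X"
  using j e T by (simp add: power2_eq_square)
 have "Topt X D * H <= Topt X D * pot G X"
  using T pot_ge[OF C1_cont[OF assms(1)]] by simp
 then show "Topt X D <= jlen G X D / (2 * H)" using j Hpos by (simp add: field_simps)
 have B: "B > 0" using p pot_le[OF C1_cont[OF assms(1)]] by simp
 have "(norm (X 1 - X 0))^2 / (2 * B) <= kin D / pot G X"
  using kin_pos[OF assms(1)] k p pot_le[OF C1_cont[OF assms(1)]]
   frac_le[of "kin D" "(norm (X 1 - X 0))^2 / 2" "pot G X" B] by (simp add: field_simps)
 then have "sqrt ((norm (X 1 - X 0))^2 / (2 * B)) <= Topt X D"
  unfolding Topt_def by (rule real_sqrt_le_mono)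
 then show "norm (X 1 - X 0) / sqrt (2 * B) <= Topt X D"
  by (simp add: real_sqrt_divide)
qed

definition F1 :: "(real => 'a) => real => 'a" where "F1 X t = integral {0..t} (%s. g (X s))"
definition F2 :: "(real => 'a) => real => 'a" where "F2 X t = integral {0..t} (F1 X)"
text \<open>The solution of the linear boundary problem x'' = \<open>T^2 *\<^sub>R g (X t)\<close>
  with the ends of \<open>X\<close>. The difference \<open>Ph T X - X\<close> is \<open>T\<close>
  times the negative gradient, with respect to the inner product of the velocities, of the action
  with constant lapse \<open>T\<close>; its zeros are the solutions of the equation of
  motion.\<close>

definition Ph :: "real => (real => 'a) => real => 'a" where
 "Ph T X t = X 0 + t *\<^sub>R (X 1 - X 0 - T^2 *\<^sub>R F2 X 1) + T^2 *\<^sub>R F2 X t"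
definition dPh :: "real => (real => 'a) => real => 'a" where
 "dPh T X t = (X 1 - X 0 - T^2 *\<^sub>R F2 X 1) + T^2 *\<^sub>R F1 X t"

lemma F1_der: "continuous_on {0..1} X ==> t \<in> {0..1} ==>
 (F1 X hvd g (X t)) (at t within {0..1})"
 unfolding F1_def[abs_def] by (rule integral_has_vector_derivative[OF g_comp_cont])

lemma F2_der: assumes "continuous_on {0..1} X" "t \<in> {0..1}"
 shows "(F2 X hvd F1 X t) (at t within {0..1})"
proof -
 have "continuous_on {0..1} (F1 X)"
  by (rule continuous_on_vector_derivative[OF F1_der[OF assms(1)]])
 then show ?thesis
  unfolding F2_def[abs_def] by (rule integral_has_vector_derivative[OF _ assms(2)])
qed

lemma Ph_der: "continuous_on {0..1} X ==> t \<in> {0..1} ==>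
 (Ph T X hvd dPh T X t) (at t within {0..1})"
 unfolding Ph_def[abs_def] dPh_def
 by (auto intro!: derivative_eq_intros F2_der)

lemma dPh_der: "continuous_on {0..1} X ==> t \<in> {0..1} ==>
 (dPh T X hvd T^2 *\<^sub>R g (X t)) (at t within {0..1})"
 unfolding dPh_def[abs_def]
 by (auto intro!: derivative_eq_intros F1_der)

lemma Ph_C1: "continuous_on {0..1} X ==> C1 (Ph T X) (dPh T X)"
 unfolding C1_def using Ph_der continuous_on_vector_derivative[OF dPh_der] by blast

lemma Ph_ends[simp]: "Ph T X 0 = X 0" "Ph T X 1 = X 1"
 by (auto simp: Ph_def F2_def)

lemma fam_Ph:
 assumes f: "fam U X D" and T: "continuous_on U T"
 shows "fam U (%v. Ph (T v) (X v)) (%v. dPh (T v) (X v))"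
proof -
 have cX: "continuous_on (U \<times> {0..1}) (%z. X (fst z) (snd z))" using f by (simp add: fam_def)
 have c1: "continuous_on (U \<times> {0..1}) (%z. F1 (X (fst z)) (snd z))"
  unfolding F1_def by (rule continuous_on_integral_upto[where f="%v s. g (X v s)"]) (rule g_comp_cont[OF cX])
 have c2: "continuous_on (U \<times> {0..1}) (%z. F2 (X (fst z)) (snd z))"
  unfolding F2_def by (rule continuous_on_integral_upto[where f="%v. F1 (X v)"]) (rule c1)
 have end_cont: "continuous_on (U \<times> {0..1::real}) (%z. h (fst z) e)"
  if "continuous_on (U \<times> {0..1}) (%z. h (fst z) (snd z))" "e \<in> {0..1}" for h :: "'b => real => 'a" and e
 proof -
  have "continuous_on (U \<times> {0..1}) (%z::'b \<times> real. h (fst (fst z, e)) (snd (fst z, e)))"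
   by (rule continuous_on_compose2[OF that(1)]) (use that(2) in \<open>auto intro!: continuous_intros\<close>)
  then show ?thesis by simp
 qed
 have cT: "continuous_on (U \<times> {0..1::real}) (%z. T (fst z))"
  by (rule continuous_on_compose2[OF T continuous_on_fst[OF continuous_on_id]]) auto
 show ?thesis
  unfolding fam_def
 proof (intro conjI ballI)
  show "continuous_on (U \<times> {0..1}) (%z. Ph (T (fst z)) (X (fst z)) (snd z))"
   unfolding Ph_def by (intro continuous_intros c1 c2 end_cont[OF cX] end_cont[OF c2] cT) auto
  show "continuous_on (U \<times> {0..1}) (%z. dPh (T (fst z)) (X (fst z)) (snd z))"
   unfolding dPh_def by (intro continuous_intros c1 c2 end_cont[OF cX] end_cont[OF c2] cT) auto
 next
  fix v t assume "v \<in> U" "t \<in> {0..1::real}"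
  then show "(Ph (T v) (X v) hvd dPh (T v) (X v) t) (at t within {0..1})"
   using Ph_der C1_cont fam_C1[OF f] by blast
 qed
qed

lemma Topt_cont:
 assumes f: "fam U X D"
 shows "continuous_on U (%v. Topt (X v) (D v))"
proof -
 have cX: "continuous_on (U \<times> {0..1}) (%z. X (fst z) (snd z))"
 and cD: "continuous_on (U \<times> {0..1}) (%z. D (fst z) (snd z))" using f by (auto simp: fam_def)
 have "continuous_on U (%v. integral (cbox 0 1) (%t. G (X v t)))"
  using G_comp_cont[OF cX] by (intro integral_continuous_on_param) (simp add: case_prod_beta)
 moreover have "continuous_on U (%v. integral (cbox 0 1) (%t. (norm (D v t))^2))"
  using cD by (intro integral_continuous_on_param) (auto simp: case_prod_beta intro!: continuous_intros)
 moreover have "pot G (X v) ~= 0" if "v \<in> U" for v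
  using pot_ge[OF C1_cont[OF fam_C1[OF f that]]] Hpos by linarith
 ultimately show ?thesis
  unfolding Topt_def kin_def pot_def
  by (auto intro!: continuous_intros simp: pot_def)
qed

text \<open>With the time frozen at \<open>Topt X D\<close>, the action lies above
  \<open>jlen\<close> everywhere and touches it at \<open>X\<close>, so whatever the action loses is
  lost by \<open>jlen\<close> too. Along \<open>W\<close> the first order term is minus the square
  norm of \<open>WD\<close> over \<open>T\<close>; the condition on \<open>\<beta>\<close> lets the
  second order terms eat at most half of it.\<close>

lemma descent:
 assumes c: "C1 X D" and ne: "X 0 ~= X 1" and T: "T = Topt X D"
  and b: "0 <= \<beta>" "\<beta> * (1 + 2 * T^2 * \<Lambda>) <= 1"
 defines "W \<equiv> %t. Ph T X t - X t" and "WD \<equiv> %t. dPh T X t - D t"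
 shows "jlen G (%t. X t + \<beta> *\<^sub>R W t) (%t. D t + \<beta> *\<^sub>R WD t)
  <= jlen G X D - \<beta> / (2 * T) * integral {0..1} (%t. (norm (WD t))^2)"
  "t \<in> {0..1} ==> (norm (W t))^2 <= integral {0..1} (%t. (norm (WD t))^2)"
  "C1 (%t. X t + \<beta> *\<^sub>R W t) (%t. D t + \<beta> *\<^sub>R WD t)" "W 0 = 0" "W 1 = 0"
proof -
 define I where "I = integral {0..1} (%t. (norm (WD t))^2)"
 have Tp: "T > 0" using Topt(1)[OF c ne] T by simp
 have cX: "continuous_on {0..1} X" and cD: "continuous_on {0..1} D"
  using C1_cont[OF c] C1_contD[OF c] .
 note P = Ph_C1[OF cX, of T]
 have cP: "continuous_on {0..1} (Ph T X)" and cdP: "continuous_on {0..1} (dPh T X)"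
  using C1_cont[OF P] C1_contD[OF P] .
 have W: "C1 W WD"
  using c P unfolding C1_def W_def WD_def by (auto intro!: continuous_intros derivative_eq_intros)
 have cW: "continuous_on {0..1} W" and cWD: "continuous_on {0..1} WD"
  using C1_cont[OF W] C1_contD[OF W] .
 show W0: "W 0 = 0" and W1: "W 1 = 0" by (auto simp: W_def)
 show Y: "C1 (%t. X t + \<beta> *\<^sub>R W t) (%t. D t + \<beta> *\<^sub>R WD t)"
  using c W cW cWD unfolding C1_def by (auto intro!: continuous_intros derivative_eq_intros)
 show sup: "(norm (W t))^2 <= integral {0..1} (%t. (norm (WD t))^2)" if t: "t \<in> {0..1}" for t
 proof -
  have "(norm (W t))^2 = (norm (integral {0..t} WD))^2"
   using C1_increment[OF W, of 0 t] t W0 by (simp add: integral_unique)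
  also have "... <= (t - 0) * integral {0..t} (%t. (norm (WD t))^2)"
   using t cWD by (intro integral_cauchy_schwarz) (auto elim: continuous_on_subset)
  also have "... <= 1 * integral {0..1} (%t. (norm (WD t))^2)"
   using t cWD by (intro mult_mono integral_subset_le integrable_continuous_real continuous_intros
     integral_nonneg) (auto elim: continuous_on_subset)
  finally show ?thesis by simp
 qed
 have IW: "integral {0..1} (%t. (norm (W t))^2) <= I"
 proof -
  have "integral {0..1} (%t. (norm (W t))^2) <= integral {0..1::real} (%_. I)"
   by (rule integral_le) (use sup cW in \<open>auto simp: I_def intro!: integrable_continuous_real continuous_intros\<close>)
  then show ?thesis by simp
 qed
 have I0: "0 <= I" unfolding I_def
  using cWD by (auto intro!: integral_nonneg integrable_continuous_real continuous_intros)
 have k: "kin (%t. D t + \<beta> *\<^sub>R WD t) = kin D + \<beta> * integral {0..1} (%t. D t \<bullet> WD t) + \<beta>^2 / 2 * I"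
 proof -
  have "((%t. (norm (D t))^2 + (2 * \<beta>) * (D t \<bullet> WD t) + \<beta>^2 * (norm (WD t))^2) has_integral
   (integral {0..1} (%t. (norm (D t))^2) + (2 * \<beta>) * integral {0..1} (%t. D t \<bullet> WD t) + \<beta>^2 * I)) {0..1}"
   unfolding I_def
   by (intro has_integral_add has_integral_mult_right integrable_integral integrable_continuous_real continuous_intros cD cWD)
  also have "(%t. (norm (D t))^2 + (2 * \<beta>) * (D t \<bullet> WD t) + \<beta>^2 * (norm (WD t))^2) = (%t. (norm (D t + \<beta> *\<^sub>R WD t))^2)"
   unfolding power2_norm_eq_inner
   by (auto simp: fun_eq_iff algebra_simps inner_commute power2_eq_square inner_add_left inner_add_right)
  finally show ?thesis by (simp add: kin_def integral_unique)
 qed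
 have p: "pot G (%t. X t + \<beta> *\<^sub>R W t) <= pot G X + \<beta> * integral {0..1} (%t. g (X t) \<bullet> W t) + \<Lambda> * \<beta>^2 * I"
 proof -
  have "pot G (%t. X t + \<beta> *\<^sub>R W t) <= integral {0..1} (%t. G (X t) + \<beta> * (g (X t) \<bullet> W t) + \<Lambda> * \<beta>^2 * (norm (W t))^2)"
   unfolding pot_def
  proof (rule integral_le)
   show "(%t. G (X t + \<beta> *\<^sub>R W t)) integrable_on {0..1}"
    by (intro integrable_continuous_real G_comp_cont continuous_intros cX cW)
   show "(%t. G (X t) + \<beta> * (g (X t) \<bullet> W t) + \<Lambda> * \<beta>^2 * (norm (W t))^2) integrable_on {0..1}"
    by (intro integrable_continuous_real G_comp_cont g_comp_cont continuous_intros cX cW)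
   show "G (X t + \<beta> *\<^sub>R W t) <= G (X t) + \<beta> * (g (X t) \<bullet> W t) + \<Lambda> * \<beta>^2 * (norm (W t))^2" for t
    using G_taylor[of "X t + \<beta> *\<^sub>R W t" "X t"] by (simp add: power_mult_distrib)
  qed
  also have "... = pot G X + \<beta> * integral {0..1} (%t. g (X t) \<bullet> W t) + \<Lambda> * \<beta>^2 * integral {0..1} (%t. (norm (W t))^2)"
   unfolding pot_def
   by (rule integral_unique, intro has_integral_add has_integral_mult_right integrable_integral
     integrable_continuous_real G_comp_cont g_comp_cont continuous_intros cX cW)
  also have "... <= pot G X + \<beta> * integral {0..1} (%t. g (X t) \<bullet> W t) + \<Lambda> * \<beta>^2 * I"
   using IW Lam0 by (intro add_left_mono mult_left_mono) auto
  finally show ?thesis .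
 qed
 have parts: "integral {0..1} (%t. T^2 * (g (X t) \<bullet> W t)) + integral {0..1} (%t. dPh T X t \<bullet> WD t) = 0"
 proof -
  have "((%t. T^2 * (g (X t) \<bullet> W t) + dPh T X t \<bullet> WD t) has_integral (dPh T X 1 \<bullet> W 1 - dPh T X 0 \<bullet> W 0)) {0..1}"
  proof (rule fundamental_theorem_of_calculus)
   fix t :: real assume t: "t \<in> {0..1}"
   show "((%t. dPh T X t \<bullet> W t) hvd T^2 * (g (X t) \<bullet> W t) + dPh T X t \<bullet> WD t) (at t within {0..1})"
    using bounded_bilinear.has_vector_derivative[OF bounded_bilinear_inner dPh_der[OF cX t, of T] C1_deriv[OF W t]]
    by (simp add: add.commute)
  qed auto
  moreover have "((%t. T^2 * (g (X t) \<bullet> W t) + dPh T X t \<bullet> WD t) has_integral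
   (integral {0..1} (%t. T^2 * (g (X t) \<bullet> W t)) + integral {0..1} (%t. dPh T X t \<bullet> WD t))) {0..1}"
   by (intro has_integral_add integrable_integral
     integrable_continuous_real g_comp_cont continuous_intros cX cW cWD cdP)
  ultimately have "dPh T X 1 \<bullet> W 1 - dPh T X 0 \<bullet> W 0 =
    integral {0..1} (%t. T^2 * (g (X t) \<bullet> W t)) + integral {0..1} (%t. dPh T X t \<bullet> WD t)"
   by (rule has_integral_unique)
  then show ?thesis using W0 W1 by simp
 qed
 have "integral {0..1} (%t. dPh T X t \<bullet> WD t) - integral {0..1} (%t. D t \<bullet> WD t) = I"
 proof -
  have "integral {0..1} (%t. dPh T X t \<bullet> WD t) - integral {0..1} (%t. D t \<bullet> WD t) =
   integral {0..1} (%t. dPh T X t \<bullet> WD t - D t \<bullet> WD t)"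
   by (intro integral_diff[symmetric] integrable_continuous_real continuous_intros cdP cD cWD)
  also have "(%t. dPh T X t \<bullet> WD t - D t \<bullet> WD t) = (%t. (norm (WD t))^2)"
   unfolding power2_norm_eq_inner by (simp add: WD_def inner_diff_left)
  finally show ?thesis by (simp add: I_def)
 qed
 then have key: "integral {0..1} (%t. D t \<bullet> WD t) + T^2 * integral {0..1} (%t. g (X t) \<bullet> W t) = - I"
  using parts by simp
 have "jlen G (%t. X t + \<beta> *\<^sub>R W t) (%t. D t + \<beta> *\<^sub>R WD t)
  <= kin (%t. D t + \<beta> *\<^sub>R WD t) / T + T * pot G (%t. X t + \<beta> *\<^sub>R W t)"
  by (rule jlen_le_act[OF Y Tp])
 also have "... <= (kin D + \<beta> * integral {0..1} (%t. D t \<bullet> WD t) + \<beta>^2 / 2 * I) / T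
   + T * (pot G X + \<beta> * integral {0..1} (%t. g (X t) \<bullet> W t) + \<Lambda> * \<beta>^2 * I)"
  using p Tp unfolding k by (intro add_left_mono mult_left_mono) auto
 also have "... = (kin D / T + T * pot G X) + (\<beta> / T) * (integral {0..1} (%t. D t \<bullet> WD t) + T^2 * integral {0..1} (%t. g (X t) \<bullet> W t))
   + \<beta> / (2 * T) * (\<beta> * (1 + 2 * T^2 * \<Lambda>)) * I"
  using Tp by (simp add: field_simps power2_eq_square)
 also have "... = jlen G X D - (\<beta> / T) * I + \<beta> / (2 * T) * (\<beta> * (1 + 2 * T^2 * \<Lambda>)) * I"
  unfolding key using Topt(2)[OF c ne] T by simp
 also have "... <= jlen G X D - (\<beta> / T) * I + \<beta> / (2 * T) * 1 * I"
  using b Tp I0 by (intro add_left_mono mult_right_mono mult_left_mono) auto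
 also have "... = jlen G X D - \<beta> / (2 * T) * I"
  using Tp by (simp add: field_simps)
 finally show "jlen G (%t. X t + \<beta> *\<^sub>R W t) (%t. D t + \<beta> *\<^sub>R WD t)
  <= jlen G X D - \<beta> / (2 * T) * integral {0..1} (%t. (norm (WD t))^2)"
  by (simp add: I_def)
qed

end

section \<open>Limits of almost critical paths and minimax\<close>

definition solves :: "('a::euclidean_space => 'a) => real set => (real => 'a) => (real => 'a) => bool" where
 "solves g I y v \<longleftrightarrow> (\<forall>t\<in>I. (y hvd v t) (at t within I) &
  (v hvd g (y t)) (at t within I))"

context soft
begin

definition orbit :: "real => (real => 'a) => (real => 'a) => bool" where
 "orbit T y v \<longleftrightarrow> solves g {0..T} y v & (\<forall>t\<in>{0..T}. (norm (v t))^2 / 2 = G (y t))"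

text \<open>The energy is constant along a fixed point of \<open>Ph\<close>, and the balance of
  \<open>kin\<close> and \<open>pot\<close> says that its mean vanishes. Hence it vanishes at every
  time, and dividing the time by \<open>T\<close> gives an orbit.\<close>

lemma crit_orbit:
 assumes x: "!!t. t \<in> {0..1} ==> x t = Ph T x t" and cx: "continuous_on {0..1} x"
  and T: "T > 0" "kin (dPh T x) = T^2 * pot G x"
 shows "\<exists>y v. orbit T y v & y 0 = x 0 & y T = x 1 &
  integral {0..T} (%t. (norm (v t))^2) = jlen G x (dPh T x)"
proof -
 define xd where "xd = dPh T x"
 have dx: "(x hvd xd t) (at t within {0..1})" if "t \<in> {0..1}" for t
  unfolding xd_def using Ph_der[OF cx that, of T] x that
  by (rule_tac has_vector_derivative_transform[of t "{0..1}" x "Ph T x"]) auto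
 have dxd: "(xd hvd T^2 *\<^sub>R g (x t)) (at t within {0..1})" if "t \<in> {0..1}" for t
  unfolding xd_def by (rule dPh_der[OF cx that])
 have cxd: "continuous_on {0..1} xd"
  by (rule continuous_on_vector_derivative[OF dxd])
 define e where "e = (%t. (xd t \<bullet> xd t) / 2 - T^2 * G (x t))"
 have de: "(e hvd 0) (at t within {0..1})" if t: "t \<in> {0..1}" for t
 proof -
  have 1: "((%t. xd t \<bullet> xd t) hvd (2 * T^2) * (xd t \<bullet> g (x t))) (at t within {0..1})"
   using bounded_bilinear.has_vector_derivative[OF bounded_bilinear_inner dxd[OF t] dxd[OF t]]
   by (simp add: inner_commute mult.assoc)
  have 2: "((%t. G (x t)) hvd g (x t) \<bullet> xd t) (at t within {0..1})"
   using has_derivative_compose[OF dx[OF t, unfolded has_vector_derivative_def] Gder]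
   by (simp add: has_vector_derivative_def)
  have "((%t. (1/2) * (xd t \<bullet> xd t) - T^2 * G (x t)) has_vector_derivative
   (1/2) * ((2 * T^2) * (xd t \<bullet> g (x t))) - T^2 * (g (x t) \<bullet> xd t)) (at t within {0..1})"
   by (intro has_vector_derivative_diff has_vector_derivative_mult_right 1 2)
  then show ?thesis by (simp add: e_def inner_commute)
 qed
 have "\<exists>C. \<forall>t\<in>{0..1}. e t = C"
  using has_vector_derivative_zero_constant[of "{0..1::real}" e] de by blast
 then obtain C where C: "!!t. t \<in> {0..1} ==> e t = C" by blast
 have "integral {0..1} e = kin xd - T^2 * pot G x"
 proof -
  have "((%t. (1/2) * (norm (xd t))^2 - T^2 * G (x t)) has_integral
   ((1/2) * integral {0..1} (%t. (norm (xd t))^2) - T^2 * integral {0..1} (%t. G (x t)))) {0..1}"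
   by (intro has_integral_diff has_integral_mult_right integrable_integral integrable_continuous_real
     continuous_intros G_comp_cont cx cxd)
  then show ?thesis by (simp add: e_def kin_def pot_def power2_norm_eq_inner integral_unique)
 qed
 moreover have "integral {0..1} e = integral {0..1::real} (%_. C)"
  by (rule integral_cong) (rule C)
 ultimately have "C = 0" using T by (simp add: xd_def)
 then have en: "(norm (xd t))^2 / 2 = T^2 * G (x t)" if "t \<in> {0..1}" for t
  using C[OF that] by (simp add: e_def power2_norm_eq_inner)
 define y v where "y = (%t. x (t / T))" and "v = (%t. (1/T) *\<^sub>R xd (t / T))"
 have im: "(%t. t / T) ` {0..T} \<subseteq> {0..1}" using T by auto
 have sc: "((%t. f (t / T)) hvd (1/T) *\<^sub>R f') (at t within {0..T})"
  if "t \<in> {0..T}" and f: "(f hvd f') (at (t / T) within {0..1})" for f f' t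
 proof -
  have "((%t. t / T) hvd 1/T) (at t within {0..T})"
   using T by (auto intro!: derivative_eq_intros simp: has_real_derivative_iff_has_vector_derivative[symmetric])
  moreover have "(f hvd f') (at (t / T) within (%t. t / T) ` {0..T})"
   using f im by (rule has_vector_derivative_within_subset)
  ultimately show ?thesis
   using vector_diff_chain_within[of "%t. t / T" "1/T" t "{0..T}" f f'] by (simp add: o_def)
 qed
 have "solves g {0..T} y v"
  unfolding solves_def
 proof (intro ballI conjI)
  fix t assume t: "t \<in> {0..T}"
  then have t': "t / T \<in> {0..1}" using im by blast
  show "(y hvd v t) (at t within {0..T})"
   unfolding y_def v_def by (rule sc[OF t dx[OF t']])
  have "((%t. (1/T) *\<^sub>R xd (t / T)) hvd (1/T) *\<^sub>R (1/T) *\<^sub>R T^2 *\<^sub>R g (x (t / T))) (at t within {0..T})"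
   by (rule bounded_linear.has_vector_derivative[OF bounded_linear_scaleR_right sc[OF t dxd[OF t']]])
  then show "(v hvd g (y t)) (at t within {0..T})"
   using T by (simp add: y_def v_def power2_eq_square)
 qed
 moreover have "(norm (v t))^2 / 2 = G (y t)" if "t \<in> {0..T}" for t
  using en[of "t / T"] that im T by (auto simp: v_def y_def power_mult_distrib divide_simps)
 moreover have "integral {0..T} (%t. (norm (v t))^2) = jlen G x xd"
 proof -
  have "((%t. (1/T) *\<^sub>R (norm (xd (t / T)))^2) has_integral (integral {0/T..T/T} (%t. (norm (xd t))^2))) {0..T}"
   using T im by (intro has_integral_substitution[where c=0 and d=1])
    (auto intro!: derivative_eq_intros continuous_intros cxd)
  then have "((%t. (1/T) * ((1/T) *\<^sub>R (norm (xd (t / T)))^2)) has_integral (1/T) * (2 * kin xd)) {0..T}"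
   using T by (intro has_integral_mult_right) (simp add: kin_def)
  moreover have "(%t. (1/T) * ((1/T) *\<^sub>R (norm (xd (t / T)))^2)) = (%t. (norm (v t))^2)"
   using T by (auto simp: v_def power_mult_distrib power2_eq_square)
  ultimately have 1: "integral {0..T} (%t. (norm (v t))^2) = 2 * kin xd / T"
   by (simp add: integral_unique)
  have "kin xd * pot G x = (kin xd / T)^2"
   using T by (simp add: xd_def power2_eq_square)
  then have "jlen G x xd = 2 * (kin xd / T)"
   using T kin_ge0[OF cxd] by (simp add: jlen_def)
  then show ?thesis using 1 by simp
 qed
 ultimately show ?thesis
  using T by (intro exI[of _ y] exI[of _ v]) (auto simp: orbit_def y_def xd_def)
qed

lemma F1_bound: "continuous_on {0..1} X ==> t \<in> {0..1} ==> norm (F1 X t) <= \<Gamma>"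
proof -
 assume a: "continuous_on {0..1} X" "t \<in> {0..1}"
 have "norm (F1 X t) <= \<Gamma> * (t - 0)"
  unfolding F1_def using a gB
  by (intro integral_bound g_comp_cont) (auto elim: continuous_on_subset)
 also have "... <= \<Gamma>" using a order_trans[OF norm_ge_zero gB[of 0]] by (auto simp: mult_left_le)
 finally show ?thesis .
qed

lemma F1_cont: "continuous_on {0..1} X ==> continuous_on {0..1} (F1 X)"
 by (rule continuous_on_vector_derivative[OF F1_der])

lemma F2_bound: "continuous_on {0..1} X ==> t \<in> {0..1} ==> norm (F2 X t) <= \<Gamma>"
proof -
 assume a: "continuous_on {0..1} X" "t \<in> {0..1}"
 have "norm (F2 X t) <= \<Gamma> * (t - 0)"
  unfolding F2_def using a F1_bound[OF a(1)] F1_cont[OF a(1)]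
  by (intro integral_bound) (auto elim: continuous_on_subset)
 also have "... <= \<Gamma>" using a order_trans[OF norm_ge_zero gB[of 0]] by (auto simp: mult_left_le)
 finally show ?thesis .
qed

lemma g_lim: "X ----> l ==> (%n. g (X n)) ----> g l"
 using continuous_on_tendsto_compose[OF g_cont[of UNIV]] by fastforce

lemma G_lim: "X ----> l ==> (%n. G (X n)) ----> G l"
 using continuous_on_tendsto_compose[OF G_cont[of UNIV]] by fastforce

text \<open>A Palais-Smale condition: paths of bounded cost whose gradient tends to zero converge,
  along a subsequence, to an orbit of the limiting cost.\<close>

lemma crit_limit:
 assumes C: "!!n. C1 (X n) (D n)" and e: "!!n. X n 0 = p" "!!n. X n 1 = q" and pq: "p ~= q"
  and crit: "(%n. integral {0..1} (%t. (norm (dPh (Topt (X n) (D n)) (X n) t - D n t))^2)) ----> 0"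
  and lim: "(%n. jlen G (X n) (D n)) ----> c"
 shows "\<exists>T>0. \<exists>y v. orbit T y v & y 0 = p & y T = q & integral {0..T} (%t. (norm (v t))^2) = c"
proof -
 define T where "T = (%n. Topt (X n) (D n))"
 define P Q where "P = (%n. Ph (T n) (X n))" and "Q = (%n. dPh (T n) (X n))"
 have cX: "continuous_on {0..1} (X n)" and cD: "continuous_on {0..1} (D n)" for n
  using C1_cont[OF C] C1_contD[OF C] .
 obtain L where L: "!!n. jlen G (X n) (D n) <= L"
  using Bseq_bdd_above[OF convergent_imp_Bseq[OF convergentI[OF lim]]] by (auto simp: bdd_above_def)
 define Tm \<tau> where "Tm = L / (2 * H)" and "\<tau> = norm (q - p) / sqrt (2 * B)"
 have B: "B > 0" using Gpos GB less_le_trans by blast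
 have ne: "X n 0 ~= X n 1" for n using e pq by simp
 have Tl: "T n <= Tm" "\<tau> <= T n" "T n > 0" for n
 proof -
  show "T n <= Tm" using Topt(3)[OF C ne, of n] L[of n] Hpos unfolding T_def Tm_def
   by (meson divide_right_mono dual_order.trans less_imp_le mult_pos_pos zero_less_numeral)
  show "\<tau> <= T n" "T n > 0" using Topt(1,4)[OF C ne, of n] e unfolding T_def \<tau>_def by auto
 qed
 have \<tau>: "\<tau> > 0" using pq B by (simp add: \<tau>_def)
 have G0: "\<Gamma> \<ge> 0" using order_trans[OF norm_ge_zero gB[of 0]] .
 define M where "M = norm (q - p) + 2 * Tm^2 * \<Gamma>"
 have T2: "(T n)^2 <= Tm^2" for n using Tl[of n] by (intro power_mono) auto
 have QM: "norm (Q n t) <= M" if "t \<in> {0..1}" for n t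
 proof -
  have "norm (Q n t) <= norm (q - p) + (T n)^2 * norm (F2 (X n) 1) + (T n)^2 * norm (F1 (X n) t)"
   unfolding Q_def dPh_def e
   using norm_triangle_ineq[of "q - p - (T n)^2 *\<^sub>R F2 (X n) 1" "(T n)^2 *\<^sub>R F1 (X n) t"]
    norm_triangle_ineq4[of "q - p" "(T n)^2 *\<^sub>R F2 (X n) 1"] by simp
  also have "... <= norm (q - p) + Tm^2 * \<Gamma> + Tm^2 * \<Gamma>"
   using T2 F1_bound[OF cX that] F2_bound[OF cX, of 1] by (intro add_mono mult_mono order_refl) auto
  finally show ?thesis by (simp add: M_def algebra_simps)
 qed
 have CP: "C1 (P n) (Q n)" for n unfolding P_def Q_def by (rule Ph_C1[OF cX])
 have Lip: "norm (P n s - P n t) <= M * norm (s - t)" if "s \<in> {0..1}" "t \<in> {0..1}" for n s t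
 proof (rule differentiable_bound[of "{0..1}" "P n" "%t h. h *\<^sub>R Q n t"])
  show "(P n has_derivative (%h. h *\<^sub>R Q n x)) (at x within {0..1})" if "x \<in> {0..1}" for x
   using C1_deriv[OF CP that] by (simp add: has_vector_derivative_def)
  show "onorm (%h. h *\<^sub>R Q n x) <= M" if "x \<in> {0..1}" for x
   using QM[OF that, of n] order_trans[OF norm_ge_zero QM[OF that, of n]]
   by (intro onorm_le) (auto simp: mult.commute[of M] intro: mult_left_mono)
 qed (use that in auto)
 have M0: "M \<ge> 0" using G0 by (simp add: M_def)
 have PB: "norm (P n t) <= norm p + M" if "t \<in> {0..1}" for n t
 proof -
  have "norm (P n t) <= norm (P n 0) + norm (P n t - P n 0)" by (rule norm_triangle_sub)
  also have "... <= norm p + M * norm (t - 0)" using Lip[OF that, of 0 n] by (simp add: P_def e)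
  also have "... <= norm p + M" using that M0 by (auto intro!: mult_left_le)
  finally show ?thesis .
 qed
 \<comment> \<open>Compactness is applied to the images under \<open>Ph\<close>, whose velocities
   are bounded by \<open>M\<close>; the paths \<open>X n\<close> themselves are only controlled
   through integrals, and follow because their distance to \<open>P n\<close> tends to zero.\<close>
 obtain x k1 where x: "continuous_on {0..1} x" "strict_mono (k1::nat => nat)"
  and k1: "!!\<epsilon>. 0 < \<epsilon> ==> \<exists>N. \<forall>n t. n \<ge> N & t \<in> {0..1} --> norm (P (k1 n) t - x t) < \<epsilon>"
 proof (rule Arzela_Ascoli[of "{0..1::real}" P "norm p + M"])
  fix s \<epsilon> :: real assume s: "s \<in> {0..1}" "0 < \<epsilon>"
  show "\<exists>d>0. \<forall>n t. t \<in> {0..1} & norm (s - t) < d --> norm (P n s - P n t) < \<epsilon>"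
  proof (intro exI[of _ "\<epsilon> / (M + 1)"] conjI allI impI)
   show "0 < \<epsilon> / (M + 1)" using s M0 by simp
   fix n t assume t: "t \<in> {0..1} & norm (s - t) < \<epsilon> / (M + 1)"
   have "norm (P n s - P n t) <= M * norm (s - t)" using Lip s t by blast
   also have "... <= (M + 1) * norm (s - t)" by (simp add: mult_right_mono)
   also have "... < \<epsilon>" using t M0 by (simp add: pos_less_divide_eq mult.commute)
   finally show "norm (P n s - P n t) < \<epsilon>" .
  qed
 qed (use PB in auto)
 obtain T' k2 where k2: "strict_mono (k2::nat => nat)" "(T \<circ> k1 \<circ> k2) ----> T'" "T' \<in> {\<tau>..Tm}"
  using compact_Icc[of \<tau> Tm, unfolded compact_def, rule_format, of "T \<circ> k1"] Tl by (auto simp: o_assoc)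
 define k where "k = k1 \<circ> k2"
 have k: "strict_mono k" unfolding k_def using x(2) k2(1) by (rule strict_mono_o)
 have Tk: "(%n. T (k n)) ----> T'" using k2(2) by (simp add: k_def o_def)
 have sub: "(%n. f (k n)) ----> l" if "f ----> l" for f :: "nat => real" and l
  using LIMSEQ_subseq_LIMSEQ[OF that k] by (simp add: o_def)
 have Pk: "(%n. P (k n) t) ----> x t" if t: "t \<in> {0..1}" for t
 proof -
  have "(%n. P (k1 n) t) ----> x t"
   by (rule LIMSEQ_I) (use k1 t in blast)
  from LIMSEQ_subseq_LIMSEQ[OF this k2(1)] show ?thesis by (simp add: k_def o_def)
 qed
 define I where "I = (%n. integral {0..1} (%t. (norm (Q n t - D n t))^2))"
 have I: "I ----> 0" using crit by (simp add: I_def Q_def T_def)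
 have W: "(norm (P n t - X n t))^2 <= I n" if "t \<in> {0..1}" for n t
  using descent(2)[OF C ne refl, of 0 n t] that by (simp add: I_def P_def Q_def T_def)
 have Xk: "(%n. X (k n) t) ----> x t" if t: "t \<in> {0..1}" for t
 proof -
  have "(%n. (norm (P (k n) t - X (k n) t))^2) ----> 0"
   by (rule tendsto_sandwich[OF _ _ tendsto_const sub[OF I]]) (use W t in auto)
  then have "(%n. sqrt ((norm (P (k n) t - X (k n) t))^2)) ----> sqrt 0"
   by (rule tendsto_real_sqrt)
  then have "(%n. P (k n) t - X (k n) t) ----> 0" by (simp add: tendsto_norm_zero_iff)
  from tendsto_diff[OF Pk[OF t] this] show ?thesis by simp
 qed
 have F1k: "(%n. F1 (X (k n)) t) ----> F1 x t" if "t \<in> {0..1}" for t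
  unfolding F1_def using that
  by (intro dominated_convergence(2)[where h="%_. \<Gamma>"] integrable_continuous_real g_comp_cont gB g_lim Xk)
   (auto intro: continuous_on_subset[OF cX])
 have F2k: "(%n. F2 (X (k n)) t) ----> F2 x t" if "t \<in> {0..1}" for t
  unfolding F2_def using that
  by (intro dominated_convergence(2)[where h="%_. \<Gamma>"] integrable_continuous_real F1_bound[OF cX] F1k)
   (auto intro: continuous_on_subset[OF F1_cont[OF cX]])
 have x01: "x 0 = p" "x 1 = q"
  using LIMSEQ_unique[OF Xk[of 0]] LIMSEQ_unique[OF Xk[of 1]] e by auto
 have Qk: "(%n. Q (k n) t) ----> dPh T' x t" if "t \<in> {0..1}" for t
  unfolding Q_def dPh_def e x01
  by (intro tendsto_intros Tk F1k F2k that) auto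
 have "(%n. P (k n) t) ----> Ph T' x t" if "t \<in> {0..1}" for t
  unfolding P_def Ph_def e x01
  by (intro tendsto_intros Tk F2k that) auto
 then have xPh: "x t = Ph T' x t" if "t \<in> {0..1}" for t
  using LIMSEQ_unique[OF Pk] that by blast
 have cQ: "continuous_on {0..1} (Q n)" for n using C1_contD[OF CP] .
 have kQ: "(%n. kin (Q (k n))) ----> kin (dPh T' x)"
  unfolding kin_def
  by (intro tendsto_divide tendsto_const dominated_convergence(2)[where h="%_. M^2"] integrable_continuous_real
    continuous_intros cQ Qk tendsto_power tendsto_norm) (use QM in \<open>auto intro!: power_mono\<close>)
 \<comment> \<open>The velocities \<open>D n\<close> approach \<open>Q n\<close> only in square
   mean, so their kinetic energies are compared with those of \<open>Q n\<close>, which converge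
   boundedly.\<close>
 have kD: "(%n. kin (D (k n))) ----> kin (dPh T' x)"
 proof -
  have "\<bar>kin (D n) - kin (Q n)\<bar> <= M * sqrt (I n) + I n / 2" for n
  proof -
   define J where "J = integral {0..1} (%t. norm (Q n t - D n t))"
   have "(norm J)^2 <= (1 - 0) * integral {0..1} (%t. (norm (norm (Q n t - D n t)))^2)"
    unfolding J_def by (rule integral_cauchy_schwarz) (auto intro!: continuous_intros cQ cD)
   then have J: "J <= sqrt (I n)" by (simp add: I_def real_le_rsqrt)
   have "((%t. (norm (D n t))^2 - (norm (Q n t))^2) has_integral (2 * kin (D n) - 2 * kin (Q n))) {0..1}"
    unfolding kin_def
    by (simp, intro has_integral_diff integrable_integral integrable_continuous_real continuous_intros cQ cD)
   then have "2 * kin (D n) - 2 * kin (Q n) = integral {0..1} (%t. (norm (D n t))^2 - (norm (Q n t))^2)"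
    by (simp add: integral_unique)
   then have "\<bar>2 * kin (D n) - 2 * kin (Q n)\<bar> = norm (integral {0..1} (%t. (norm (D n t))^2 - (norm (Q n t))^2))"
    by simp
   also have "... <= integral {0..1} (%t. (2 * M) * norm (Q n t - D n t) + (norm (Q n t - D n t))^2)"
   proof (rule integral_norm_bound_integral)
    fix t :: real assume t: "t \<in> {0..1}"
    have "(norm (D n t))^2 - (norm (Q n t))^2 = (norm (Q n t - D n t))^2 - 2 * (Q n t \<bullet> (Q n t - D n t))"
     unfolding power2_norm_eq_inner by (simp add: algebra_simps inner_commute)
    moreover have "\<bar>Q n t \<bullet> (Q n t - D n t)\<bar> <= M * norm (Q n t - D n t)"
     using Cauchy_Schwarz_ineq2[of "Q n t" "Q n t - D n t"] QM[OF t, of n]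
     by (meson mult_right_mono norm_ge_zero order_trans)
    ultimately show "norm ((norm (D n t))^2 - (norm (Q n t))^2) <= (2 * M) * norm (Q n t - D n t) + (norm (Q n t - D n t))^2"
     using zero_le_power2[of "norm (Q n t - D n t)"] unfolding real_norm_def abs_le_iff mult.assoc by linarith
   qed (intro integrable_continuous_real continuous_intros cQ cD)+
   also have "... = (2 * M) * J + I n"
    unfolding J_def I_def
    by (rule integral_unique, intro has_integral_add has_integral_mult_right integrable_integral
     integrable_continuous_real continuous_intros cQ cD)
   also have "... <= (2 * M) * sqrt (I n) + I n"
    using J M0 by (intro add_mono mult_left_mono) auto
   finally show ?thesis by simp
  qed
  then have b: "norm (kin (D (k n)) - kin (Q (k n))) <= M * sqrt (I (k n)) + I (k n) / 2" for n
   by simp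
  have "(%n. M * sqrt (I (k n)) + I (k n) / 2) ----> M * sqrt 0 + 0 / 2"
   by (intro tendsto_intros sub[OF I]) simp
  then have "(%n. kin (D (k n)) - kin (Q (k n))) ----> 0"
   by (intro Lim_null_comparison[OF always_eventually[OF allI[OF b]]]) simp
  from tendsto_add[OF this kQ] show ?thesis by simp
 qed
 have B0: "\<bar>G x\<bar> <= B" for x using GB[of x] Gpos[of x] by simp
 have pk: "(%n. pot G (X (k n))) ----> pot G x"
  unfolding pot_def
  by (intro dominated_convergence(2)[where h="%_. B"] integrable_continuous_real G_comp_cont cX G_lim Xk)
   (use B0 in auto)
 have "(%n. jlen G (X (k n)) (D (k n))) ----> jlen G x (dPh T' x)"
  unfolding jlen_def by (intro tendsto_intros kD pk)
 then have c: "c = jlen G x (dPh T' x)" using LIMSEQ_unique[OF sub[OF lim]] by blast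
 have T'0: "T' > 0" using k2(3) \<tau> by auto
 \<comment> \<open>The balance that defines \<open>Topt\<close> holds along the sequence and passes
   to the limit; it is what fixes the energy of the limit orbit.\<close>
 have "(%n. (T (k n))^2 * pot G (X (k n))) ----> T'^2 * pot G x"
  by (intro tendsto_intros Tk pk)
 moreover have "(T n)^2 * pot G (X n) = kin (D n)" for n
  using Topt(5)[OF C ne, of n] by (simp add: T_def)
 ultimately have "kin (dPh T' x) = T'^2 * pot G x"
  using LIMSEQ_unique[OF kD] by simp
 from crit_orbit[OF xPh x(1) T'0 this] show ?thesis
  using T'0 c x01 by metis
qed

section \<open>Descent step and minimax principle\<close>

definition stepX :: "real => (real => 'a) => (real => 'a) => real => 'a" where
 "stepX \<beta> X D t = X t + \<beta> *\<^sub>R (Ph (Topt X D) X t - X t)"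
definition stepD :: "real => (real => 'a) => (real => 'a) => real => 'a" where
 "stepD \<beta> X D t = D t + \<beta> *\<^sub>R (dPh (Topt X D) X t - D t)"

text \<open>\<open>L / (2 * H)\<close> bounds \<open>Topt\<close> on all paths of cost at most
  \<open>L\<close>. One step size therefore serves a whole sublevel set, the step depends
  continuously on the path, and no cut-off is needed.\<close>

definition stepsize :: "real => real" where "stepsize L = 1 / (1 + 2 * (L / (2 * H))^2 * \<Lambda>)"

lemma stepsize: "0 < stepsize L" "stepsize L <= 1"
 using Lam0 by (auto simp: stepsize_def add_pos_nonneg)

lemma fam_step: assumes "fam U X D" shows "fam U (%v. stepX \<beta> (X v) (D v)) (%v. stepD \<beta> (X v) (D v))"
 using fam_Ph[OF assms Topt_cont[OF assms]] assms unfolding fam_def stepX_def[abs_def] stepD_def[abs_def]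
 by (auto intro!: continuous_intros derivative_eq_intros)

lemma step_desc:
 assumes "C1 X D" "X 0 ~= X 1" "jlen G X D <= L" "0 <= \<beta>" "\<beta> <= stepsize L"
 shows "jlen G (stepX \<beta> X D) (stepD \<beta> X D) <= jlen G X D"
  "\<beta> * integral {0..1} (%t. (norm (dPh (Topt X D) X t - D t))^2) <=
   (L / H) * (jlen G X D - jlen G (stepX \<beta> X D) (stepD \<beta> X D))"
  "stepX \<beta> X D 0 = X 0" "stepX \<beta> X D 1 = X 1"
proof -
 define T where "T = Topt X D"
 define I where "I = integral {0..1} (%t. (norm (dPh T X t - D t))^2)"
 have T0: "T > 0" using Topt(1)[OF assms(1,2)] by (simp add: T_def)
 have T1: "T <= L / (2 * H)" using Topt(3)[OF assms(1,2)] assms(3) Hpos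
  by (simp add: T_def field_simps)
 have "1 + 2 * T^2 * \<Lambda> <= 1 + 2 * (L / (2 * H))^2 * \<Lambda>"
  using T0 T1 Lam0 by (intro add_mono mult_mono power_mono) auto
 then have "\<beta> * (1 + 2 * T^2 * \<Lambda>) <= stepsize L * (1 + 2 * (L / (2 * H))^2 * \<Lambda>)"
  using assms(4,5) Lam0 by (intro mult_mono) auto
 also have "... = 1" using stepsize(1)[of L] by (simp add: stepsize_def)
 finally have b: "\<beta> * (1 + 2 * T^2 * \<Lambda>) <= 1" .
 have d: "jlen G (stepX \<beta> X D) (stepD \<beta> X D) <= jlen G X D - \<beta> / (2 * T) * I"
  using descent(1)[OF assms(1,2) T_def assms(4) b]
  by (simp add: stepX_def[abs_def] stepD_def[abs_def] I_def T_def)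
 have I0: "0 <= I" unfolding I_def
  using C1_contD[OF Ph_C1[OF C1_cont[OF assms(1)]]] C1_contD[OF assms(1)]
  by (auto intro!: integral_nonneg integrable_continuous_real continuous_intros)
 then have "0 <= \<beta> / (2 * T) * I" using T0 assms(4) by simp
 then show m: "jlen G (stepX \<beta> X D) (stepD \<beta> X D) <= jlen G X D" using d by linarith
 have "\<beta> * I <= (2 * T) * (jlen G X D - jlen G (stepX \<beta> X D) (stepD \<beta> X D))"
  using d T0 by (simp add: field_simps)
 also have "... <= (L / H) * (jlen G X D - jlen G (stepX \<beta> X D) (stepD \<beta> X D))"
  using T1 m by (intro mult_right_mono) auto
 finally show "\<beta> * integral {0..1} (%t. (norm (dPh (Topt X D) X t - D t))^2) <=
   (L / H) * (jlen G X D - jlen G (stepX \<beta> X D) (stepD \<beta> X D))"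
  by (simp add: I_def T_def)
 show "stepX \<beta> X D 0 = X 0" "stepX \<beta> X D 1 = X 1" by (auto simp: stepX_def)
qed

text \<open>Closure of \<open>K\<close> under the descent step replaces a deformation lemma. A
  family within \<open>\<epsilon>\<close> of the infimum still has, after one step, a path above
  \<open>c - \<epsilon>\<close>. That path was below \<open>c + \<epsilon>\<close> before the step,
  so it lost at most \<open>2 * \<epsilon>\<close>, and its gradient is small.\<close>

theorem minimax:
 fixes K :: "(('p::topological_space => real => 'a) \<times> ('p => real => 'a)) set"
 assumes U: "U ~= {}" and K: "K ~= {}" and pq: "p ~= q"
  and f: "!!X D. (X, D) \<in> K ==> fam U X D"
  and e: "!!X D v. (X, D) \<in> K ==> v \<in> U ==> X v 0 = p & X v 1 = q & jlen G (X v) (D v) <= L"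
  and cl: "!!X D. (X, D) \<in> K ==>
   (%v. stepX (stepsize L) (X v) (D v), %v. stepD (stepsize L) (X v) (D v)) \<in> K"
 defines "c \<equiv> INF z\<in>K. SUP v\<in>U. jlen G (fst z v) (snd z v)"
 shows "\<exists>T>0. \<exists>y v. orbit T y v & y 0 = p & y T = q & integral {0..T} (%t. (norm (v t))^2) = c"
proof -
 define lev where "lev = (%z. SUP v\<in>U. jlen G (fst z v) (snd z v))"
 define \<beta> where "\<beta> = stepsize L"
 have b0: "\<beta> > 0" using stepsize by (simp add: \<beta>_def)
 have bd: "bdd_above ((%v. jlen G (fst z v) (snd z v)) ` U)" if "z \<in> K" for z
  using e[of "fst z" "snd z"] that by (auto intro!: bdd_aboveI2[where M=L])
 have j0: "0 <= jlen G (fst z v) (snd z v)" if "z \<in> K" "v \<in> U" for z v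
 proof -
  have "(fst z, snd z) \<in> K" using that by simp
  from jlen_ge[OF fam_C1[OF f[OF this] that(2)]] show ?thesis
   by (rule order_trans[rotated]) (use Hpos in simp)
 qed
 have lev: "jlen G (fst z v) (snd z v) <= lev z" if "z \<in> K" "v \<in> U" for z v
  unfolding lev_def by (rule cSUP_upper[OF that(2) bd[OF that(1)]])
 have l0: "0 <= lev z" if "z \<in> K" for z
 proof -
  obtain v where "v \<in> U" using U by blast
  then show ?thesis using lev[OF that] j0[OF that] order_trans by blast
 qed
 have bb: "bdd_below (lev ` K)" using l0 by (auto intro!: bdd_belowI2)
 have c: "c <= lev z" if "z \<in> K" for z
  unfolding c_def lev_def[symmetric] using bb that by (rule cINF_lower)
 define Pr where "Pr = (%n z v. z \<in> K & v \<in> U & \<bar>jlen G (fst z v) (snd z v) - c\<bar> <= 1 / real (Suc n) &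
  \<beta> * integral {0..1} (%t. (norm (dPh (Topt (fst z v) (snd z v)) (fst z v) t - snd z v t))^2) <= (L / H) * (2 / real (Suc n)))"
 have "\<exists>z v. Pr n z v" for n
 proof -
  define \<epsilon> where "\<epsilon> = 1 / real (Suc n)"
  have "\<epsilon> > 0" by (simp add: \<epsilon>_def)
  then obtain z where z: "z \<in> K" "lev z < c + \<epsilon>"
   using cINF_less_iff[OF K bb, of "c + \<epsilon>"] unfolding c_def lev_def by auto
  obtain X D where zz: "z = (X, D)" by (cases z)
  define z' where "z' = (%v. stepX \<beta> (X v) (D v), %v. stepD \<beta> (X v) (D v))"
  have z': "z' \<in> K" using cl z(1) by (simp add: z'_def zz \<beta>_def)
  have "c - \<epsilon> < lev z'" using c[OF z'] \<open>\<epsilon> > 0\<close> by linarith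
  \<comment> \<open>The parameter is selected on the family after the step; the almost critical path
    is the one with this parameter before it.\<close>
  then obtain v where v: "v \<in> U" "c - \<epsilon> < jlen G (fst z' v) (snd z' v)"
   unfolding lev_def using less_cSUP_iff[OF U bd[OF z']] by auto
  have zK: "(X, D) \<in> K" using z zz by simp
  have C: "C1 (X v) (D v)" using fam_C1[OF f[OF zK] v(1)] .
  have ne: "X v 0 ~= X v 1" and jL: "jlen G (X v) (D v) <= L" using e[OF zK v(1)] pq by auto
  have b: "0 <= \<beta>" "\<beta> <= stepsize L" using b0 by (auto simp: \<beta>_def)
  note s = step_desc[OF C ne jL b]
  have u: "jlen G (X v) (D v) < c + \<epsilon>" using lev[OF z(1) v(1)] z(2) zz by simp
  have l: "c - \<epsilon> < jlen G (stepX \<beta> (X v) (D v)) (stepD \<beta> (X v) (D v))" using v(2) by (simp add: z'_def)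
  have "0 <= L" using jL j0[OF zK v(1)] by simp
  have "\<beta> * integral {0..1} (%t. (norm (dPh (Topt (X v) (D v)) (X v) t - D v t))^2) <= (L / H) * (2 * \<epsilon>)"
   using u l Hpos \<open>0 <= L\<close> by (intro order_trans[OF s(2)] mult_left_mono) auto
  moreover have "\<bar>jlen G (X v) (D v) - c\<bar> <= \<epsilon>" using u l s(1) by linarith
  ultimately show ?thesis using z(1) v(1) zz by (intro exI[of _ z] exI[of _ v]) (auto simp: \<epsilon>_def Pr_def)
 qed
 then obtain Z V where ZV: "!!n. Pr n (Z n) (V n)" by metis
 have Z: "!!n. Z n \<in> K" and V: "!!n. V n \<in> U"
  and a: "!!n. \<bar>jlen G (fst (Z n) (V n)) (snd (Z n) (V n)) - c\<bar> <= 1 / real (Suc n)"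
  and b: "!!n. \<beta> * integral {0..1} (%t. (norm (dPh (Topt (fst (Z n) (V n)) (snd (Z n) (V n))) (fst (Z n) (V n)) t - snd (Z n) (V n) t))^2) <= (L / H) * (2 / real (Suc n))"
  using ZV unfolding Pr_def by blast+
 define X D where "X = (%n. fst (Z n) (V n))" and "D = (%n. snd (Z n) (V n))"
 have ZK: "(fst (Z n), snd (Z n)) \<in> K" for n using Z by simp
 have C: "C1 (X n) (D n)" for n unfolding X_def D_def by (rule fam_C1[OF f[OF ZK] V])
 have e1: "X n 0 = p" "X n 1 = q" for n using e[OF ZK V] by (auto simp: X_def)
 have r0: "(%n. 1 / real (Suc n)) ----> 0" using LIMSEQ_inverse_real_of_nat by (simp add: inverse_eq_divide)
 have "(%n. jlen G (X n) (D n) - c) ----> 0"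
  by (rule Lim_null_comparison[OF always_eventually r0]) (use a in \<open>auto simp: X_def D_def\<close>)
 then have lim: "(%n. jlen G (X n) (D n)) ----> c" by (simp add: LIM_zero_cancel)
 have "(%n. (L / H * 2 / \<beta>) * (1 / real (Suc n))) ----> (L / H * 2 / \<beta>) * 0"
  by (intro tendsto_intros r0)
 then have r1: "(%n. (L / H * 2 / \<beta>) * (1 / real (Suc n))) ----> 0" by simp
 have "(%n. integral {0..1} (%t. (norm (dPh (Topt (X n) (D n)) (X n) t - D n t))^2)) ----> 0"
 proof (rule tendsto_sandwich[OF always_eventually always_eventually tendsto_const r1]; intro allI)
  fix n
  show "0 <= integral {0..1} (%t. (norm (dPh (Topt (X n) (D n)) (X n) t - D n t))^2)"
   using C1_contD[OF Ph_C1[OF C1_cont[OF C[of n]]]] C1_contD[OF C[of n]]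
   by (auto intro!: integral_nonneg integrable_continuous_real continuous_intros)
  show "integral {0..1} (%t. (norm (dPh (Topt (X n) (D n)) (X n) t - D n t))^2) <= (L / H * 2 / \<beta>) * (1 / real (Suc n))"
  proof -
   have "x <= (L / H * 2 / \<beta>) * r" if "\<beta> * x <= (L / H) * (2 * r)" for x r :: real
    using that b0 Hpos by (simp add: field_simps)
   note r = this
   show ?thesis unfolding X_def D_def by (rule r) (use b[of n] in simp)
  qed
 qed
 from crit_limit[OF C e1 pq this lim] show ?thesis .
qed

end

section \<open>Change of parameter and concatenation of families\<close>

lemma increasing_inverse:
 fixes f f' :: "real => real"
 assumes ab: "a <= b"
  and d: "!!t. t \<in> {a..b} ==> (f hrd f' t) (at t within {a..b})"
  and pos: "!!t. t \<in> {a..b} ==> 0 < f' t"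
 obtains h where "!!t. t \<in> {a..b} ==> h (f t) = t" "!!s. s \<in> {f a..f b} ==> h s \<in> {a..b} & f (h s) = s"
  "!!s. s \<in> {f a..f b} ==> (h hrd (1 / f' (h s))) (at s within {f a..f b})"
proof -
 have c: "continuous_on {a..b} f" using d by (rule DERIV_continuous_on)
 have mono: "f s < f t" if "s \<in> {a..b}" "t \<in> {a..b}" "s < t" for s t
 proof -
  have "continuous_on {s..t} f" by (rule continuous_on_subset[OF c]) (use that in auto)
  moreover have "\<exists>y. (f hrd y) (at x) & 0 < y" if "s < x" "x < t" for x
  proof -
   have "x \<in> interior {a..b}" "x \<in> {a..b}" using that \<open>s \<in> {a..b}\<close> \<open>t \<in> {a..b}\<close> by auto
   then show ?thesis using d[of x] pos[of x] at_within_interior[of x "{a..b}"]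
    by (intro exI[of _ "f' x"]) simp
  qed
  ultimately show ?thesis by (intro DERIV_pos_imp_increasing_open[OF that(3)]) auto
 qed
 have inj: "inj_on f {a..b}"
  by (rule linorder_inj_onI) (use mono in fastforce)+
 have im: "f ` {a..b} = {f a..f b}"
 proof
  show "f ` {a..b} \<subseteq> {f a..f b}"
   using mono ab by (force simp: less_le)
  show "{f a..f b} \<subseteq> f ` {a..b}"
   using IVT'[of f a _ b] ab c by fastforce
 qed
 define h where "h = inv_into {a..b} f"
 have h1: "h (f t) = t" if "t \<in> {a..b}" for t using inj that by (simp add: h_def)
 have h2: "h s \<in> {a..b} & f (h s) = s" if "s \<in> {f a..f b}" for s
  using that im inv_into_into[of s f "{a..b}"] f_inv_into_f[of s f "{a..b}"] by (simp add: h_def)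
 have ch: "continuous_on {f a..f b} h"
  unfolding im[symmetric] using c h1 by (intro continuous_on_inv) auto
 have "(h hrd (1 / f' (h s))) (at s within {f a..f b})" if s: "s \<in> {f a..f b}" for s
 proof -
  define x where "x = h s"
  have x: "x \<in> {a..b}" "f x = s" using h2[OF s] by (auto simp: x_def)
  have "((%y. (f y - f x) / (y - x)) \<longlongrightarrow> f' x) (at x within {a..b})"
   using d[OF x(1)] by (simp add: has_field_derivative_iff)
  moreover have "filterlim h (at x within {a..b}) (at s within {f a..f b})"
   unfolding filterlim_at
  proof
   show "(h \<longlongrightarrow> x) (at s within {f a..f b})"
    using ch s by (simp add: continuous_on x_def)
   show "\<forall>\<^sub>F y in at s within {f a..f b}. h y \<in> {a..b} & h y ~= x"
    unfolding eventually_at_filter using h2 x(2) by (auto intro!: always_eventually)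
  qed
  ultimately have "((%y. (f (h y) - f x) / (h y - x)) \<longlongrightarrow> f' x) (at s within {f a..f b})"
   by (rule filterlim_compose)
  then have "((%y. inverse ((f (h y) - f x) / (h y - x))) \<longlongrightarrow> inverse (f' x)) (at s within {f a..f b})"
   by (rule tendsto_inverse) (use pos[OF x(1)] in simp)
  moreover have "\<forall>\<^sub>F y in at s within {f a..f b}. inverse ((f (h y) - f x) / (h y - x)) = (h y - h s) / (y - s)"
   unfolding eventually_at_filter using h2 x by (auto intro!: always_eventually simp: x_def)
  ultimately have "((%y. (h y - h s) / (y - s)) \<longlongrightarrow> inverse (f' x)) (at s within {f a..f b})"
   using tendsto_cong by force
  then show ?thesis by (simp add: has_field_derivative_iff x_def inverse_eq_divide)
 qed
 then show ?thesis using that[of h] h1 h2 by blast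
qed

lemma fam_compose:
 assumes f: "fam U X D" and th: "continuous_on {0..1} \<theta>'" "!!t. t \<in> {0..1} ==> \<theta> t \<in> {0..1}"
  "!!t. t \<in> {0..1} ==> (\<theta> hrd \<theta>' t) (at t within {0..1})"
 shows "fam U (%v t. X v (\<theta> t)) (%v t. \<theta>' t *\<^sub>R D v (\<theta> t))"
proof -
 have c: "continuous_on {0..1} \<theta>" using th(3) by (rule DERIV_continuous_on)
 have c2: "continuous_on (U \<times> {0..1}) (%z. \<theta> (snd z))" "continuous_on (U \<times> {0..1}) (%z. \<theta>' (snd z))"
  by (auto intro!: continuous_on_compose2[OF c] continuous_on_compose2[OF th(1)] continuous_intros)
 have c3: "continuous_on (U \<times> {0..1}) (%z. Y (fst z) (\<theta> (snd z)))"
  if "continuous_on (U \<times> {0..1}) (%z. Y (fst z) (snd z))" for Y :: "'a => real => 'b"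
 proof -
  have "continuous_on (U \<times> {0..1}) (%z. Y (fst (fst z, \<theta> (snd z))) (snd (fst z, \<theta> (snd z))))"
   by (rule continuous_on_compose2[OF that]) (use th(2) in \<open>auto intro!: continuous_intros c2\<close>)
  then show ?thesis by simp
 qed
 have im: "\<theta> ` {0..1} \<subseteq> {0..1}" using th(2) by blast
 show ?thesis
  unfolding fam_def
 proof (intro conjI ballI)
  fix v t assume v: "v \<in> U" and t: "t \<in> {0..1::real}"
  have "(X v hvd D v (\<theta> t)) (at (\<theta> t) within \<theta> ` {0..1})"
   using C1_deriv[OF fam_C1[OF f v] th(2)[OF t]] im has_vector_derivative_within_subset by blast
  from vector_diff_chain_within[OF th(3)[OF t, unfolded has_real_derivative_iff_has_vector_derivative] this]
  show "((%t. X v (\<theta> t)) hvd \<theta>' t *\<^sub>R D v (\<theta> t)) (at t within {0..1})"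
   by (simp add: o_def)
 qed (use f c2 c3 in \<open>auto simp: fam_def intro!: continuous_intros\<close>)
qed

text \<open>A cubic clock with zero speed at 0 and 1. Pieces run by it meet with velocity zero, so a
  concatenation is differentiable whatever the velocities at the junction.\<close>

definition sm :: "real => real" where "sm u = 3 * u^2 - 2 * u^3"
definition dsm :: "real => real" where "dsm u = 6 * u - 6 * u^2"

lemma sm_der: "(sm hrd dsm u) (at u within S)"
 unfolding sm_def[abs_def] dsm_def by (auto intro!: derivative_eq_intros simp: power2_eq_square)

lemma sm_01: "u \<in> {0..1} ==> sm u \<in> {0..1}" "u \<in> {0..1} ==> 0 <= dsm u"
proof -
 assume u: "u \<in> {0..1}"
 have "sm u = u^2 * (3 - 2 * u)" "1 - sm u = (1 - u)^2 * (1 + 2 * u)" "dsm u = 6 * (u * (1 - u))"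
  by (auto simp: sm_def dsm_def power2_eq_square power3_eq_cube algebra_simps)
 moreover have "0 <= u^2 * (3 - 2 * u)" "0 <= (1 - u)^2 * (1 + 2 * u)" "0 <= 6 * (u * (1 - u))"
  using u by auto
 ultimately show "sm u \<in> {0..1}" "0 <= dsm u" by auto
qed

lemma sm_ends[simp]: "sm 0 = 0" "sm 1 = 1" "dsm 0 = 0" "dsm 1 = 0"
 by (auto simp: sm_def dsm_def)

lemma sm_cont: "continuous_on S sm" "continuous_on S dsm"
 unfolding sm_def[abs_def] dsm_def[abs_def] by (auto intro!: continuous_intros)

definition cat :: "(real => 'b) => (real => 'b) => real => 'b" where
 "cat X Y u = (if u <= 1/2 then X (sm (2 * u)) else Y (sm (2 * u - 1)))"
definition catD :: "(real => 'b::real_vector) => (real => 'b) => real => 'b" where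
 "catD X Y u = (if u <= 1/2 then (2 * dsm (2 * u)) *\<^sub>R X (sm (2 * u)) else (2 * dsm (2 * u - 1)) *\<^sub>R Y (sm (2 * u - 1)))"

lemma cat_ends[simp]: "cat X Y 0 = X 0" "cat X Y 1 = Y 1" by (auto simp: cat_def)

lemma half_eq: "b * 2 = (1::real) ==> b = 1/2" by simp

lemma cat_cont:
 fixes X Y :: "'p::topological_space => real => 'b::topological_space"
 assumes X: "continuous_on (U \<times> {0..1}) (%z. X (fst z) (snd z))"
  and Y: "continuous_on (U \<times> {0..1}) (%z. Y (fst z) (snd z))"
  and m: "!!v. v \<in> U ==> X v 1 = Y v 0"
 shows "continuous_on (U \<times> {0..1}) (%z. cat (X (fst z)) (Y (fst z)) (snd z))"
 unfolding cat_def
proof (rule continuous_on_cases_le)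
 have 1: "continuous_on {t \<in> U \<times> {0..1}. snd t <= 1 / 2} (%z. X (fst (fst z, sm (2 * snd z))) (snd (fst z, sm (2 * snd z))))"
  by (rule continuous_on_compose2[OF X])
   (auto intro!: continuous_intros continuous_on_compose2[OF sm_cont(1)[of UNIV]] sm_01(1)[simplified])
 then show "continuous_on {t \<in> U \<times> {0..1}. snd t <= 1 / 2} (%z. X (fst z) (sm (2 * snd z)))" by simp
 have 2: "continuous_on {t \<in> U \<times> {0..1}. 1/2 <= snd t} (%z. Y (fst (fst z, sm (2 * snd z - 1))) (snd (fst z, sm (2 * snd z - 1))))"
  by (rule continuous_on_compose2[OF Y])
   (auto intro!: continuous_intros continuous_on_compose2[OF sm_cont(1)[of UNIV]] sm_01(1)[simplified])
 then show "continuous_on {t \<in> U \<times> {0..1}. 1/2 <= snd t} (%z. Y (fst z) (sm (2 * snd z - 1)))" by simp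
qed (use m in \<open>auto intro!: continuous_intros dest!: half_eq\<close>)

lemma fam_cat:
 assumes X: "fam U X1 D1" and Y: "fam U X2 D2" and m: "!!v. v \<in> U ==> X1 v 1 = X2 v 0"
 shows "fam U (%v. cat (X1 v) (X2 v)) (%v. catD (D1 v) (D2 v))"
 unfolding fam_def
proof (intro conjI ballI)
 show "continuous_on (U \<times> {0..1}) (%z. cat (X1 (fst z)) (X2 (fst z)) (snd z))"
  by (rule cat_cont) (use X Y m in \<open>auto simp: fam_def\<close>)
 show "continuous_on (U \<times> {0..1}) (%z. catD (D1 (fst z)) (D2 (fst z)) (snd z))"
  unfolding catD_def
 proof (rule continuous_on_cases_le)
  have "continuous_on {t \<in> U \<times> {0..1}. snd t <= 1 / 2} (%z. D1 (fst (fst z, sm (2 * snd z))) (snd (fst z, sm (2 * snd z))))"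
   by (rule continuous_on_compose2[where f="%z. (fst z, sm (2 * snd z))" and t="U \<times> {0..1}"])
   (use X in \<open>auto simp: fam_def intro!: continuous_intros continuous_on_compose2[OF sm_cont(1)[of UNIV]] sm_01(1)[simplified]\<close>)
  then show "continuous_on {t \<in> U \<times> {0..1}. snd t <= 1 / 2} (%z. (2 * dsm (2 * snd z)) *\<^sub>R D1 (fst z) (sm (2 * snd z)))"
   by (auto intro!: continuous_intros continuous_on_compose2[OF sm_cont(2)[of UNIV]])
  have "continuous_on {t \<in> U \<times> {0..1}. 1/2 <= snd t} (%z. D2 (fst (fst z, sm (2 * snd z - 1))) (snd (fst z, sm (2 * snd z - 1))))"
   by (rule continuous_on_compose2[where f="%z. (fst z, sm (2 * snd z - 1))" and t="U \<times> {0..1}"])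
   (use Y in \<open>auto simp: fam_def intro!: continuous_intros continuous_on_compose2[OF sm_cont(1)[of UNIV]] sm_01(1)[simplified]\<close>)
  then show "continuous_on {t \<in> U \<times> {0..1}. 1/2 <= snd t} (%z. (2 * dsm (2 * snd z - 1)) *\<^sub>R D2 (fst z) (sm (2 * snd z - 1)))"
   by (auto intro!: continuous_intros continuous_on_compose2[OF sm_cont(2)[of UNIV]])
 qed (auto intro!: continuous_intros dest!: half_eq)
next
 fix v t assume v: "v \<in> U" and t: "t \<in> {0..1::real}"
 have ch: "((%u. Z (sm (2 * u - a))) hvd (2 * dsm (2 * s - a)) *\<^sub>R E (sm (2 * s - a))) (at s within {a/2..a/2+1/2})"
  if "C1 Z E" "s \<in> {a/2..a/2+1/2}" for Z E :: "real => 'b" and s a :: real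
 proof -
  have "((%u. sm (2 * u - a)) hvd (2 * dsm (2 * s - a))) (at s within {a/2..a/2+1/2})"
   unfolding has_real_derivative_iff_has_vector_derivative[symmetric]
   by (rule DERIV_chain'[OF _ sm_der, THEN DERIV_cong]) (auto intro!: derivative_eq_intros)
  moreover have "(Z hvd E (sm (2 * s - a))) (at (sm (2 * s - a)) within (%u. sm (2 * u - a)) ` {a/2..a/2+1/2})"
   by (rule has_vector_derivative_within_subset[OF C1_deriv[OF that(1)]])
   (use that sm_01(1)[of "2 * s - a"] in \<open>auto intro!: sm_01(1)[simplified]\<close>)
  ultimately show ?thesis
   using vector_diff_chain_within[of "%u. sm (2 * u - a)" _ s "{a/2..a/2+1/2}" Z] by (fastforce simp: o_def)
 qed
 have "((%u. if u \<in> {0..1/2} then X1 v (sm (2 * u)) else X2 v (sm (2 * u - 1))) has_vector_derivative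
  (if t \<in> {0..1/2} then (2 * dsm (2 * t)) *\<^sub>R D1 v (sm (2 * t)) else (2 * dsm (2 * t - 1)) *\<^sub>R D2 v (sm (2 * t - 1)))) (at t within {0..1})"
 proof (rule has_vector_derivative_If_within_closures[where T="{1/2..1}"])
  show "{0..1} = {0..1/2} \<union> {1/2..1::real}" by auto
  have i: "{0..1/2} \<union> closure {0..1/2} \<inter> closure {1/2..1} = {0..1/2::real}"
   "{1/2..1} \<union> closure {0..1/2} \<inter> closure {1/2..1} = {1/2..1::real}" by auto
  show "((%u. X1 v (sm (2 * u))) hvd (2 * dsm (2 * t)) *\<^sub>R D1 v (sm (2 * t)))
   (at t within {0..1/2} \<union> closure {0..1/2} \<inter> closure {1/2..1})"
   if "t \<in> {0..1/2} \<union> closure {0..1/2} \<inter> closure {1/2..1}"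
   using ch[OF fam_C1[OF X v], of t 0] that unfolding i by simp
  show "((%u. X2 v (sm (2 * u - 1))) hvd (2 * dsm (2 * t - 1)) *\<^sub>R D2 v (sm (2 * t - 1)))
   (at t within {1/2..1} \<union> closure {0..1/2} \<inter> closure {1/2..1})"
   if "t \<in> {1/2..1} \<union> closure {0..1/2} \<inter> closure {1/2..1}"
   using ch[OF fam_C1[OF Y v], of t 1] that unfolding i by simp
 qed (use t m[OF v] in \<open>auto dest!: half_eq\<close>)
 then have "(cat (X1 v) (X2 v) has_vector_derivative
  (if t \<in> {0..1/2} then (2 * dsm (2 * t)) *\<^sub>R D1 v (sm (2 * t)) else (2 * dsm (2 * t - 1)) *\<^sub>R D2 v (sm (2 * t - 1)))) (at t within {0..1})"
  by (rule has_vector_derivative_transform[OF t, rotated]) (auto simp: cat_def)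
 then show "(cat (X1 v) (X2 v) hvd catD (D1 v) (D2 v) t) (at t within {0..1})"
  using t by (simp add: catD_def)
qed

text \<open>The clock \<open>sm\<close> stands still at the junction, and so would the joined lapse;
  \<open>\<epsilon>\<close> keeps it positive.\<close>

definition catN :: "real => (real => real) => (real => real) => real => real" where
 "catN \<epsilon> N1 N2 u = catD N1 N2 u + \<epsilon>"

context soft
begin

lemma lact_cont:
 assumes "continuous_on {0..1} X" "continuous_on {0..1} D" "continuous_on {0..1} N" "!!t. t \<in> {0..1} ==> 0 < N t"
 shows "continuous_on {0..1} (%t. (norm (D t))^2 / (2 * N t) + N t * G (X t))"
 using assms(4) by (auto intro!: continuous_intros assms G_comp_cont) (metis less_irrefl atLeastAtMost_iff)

text \<open>Running a path so that its lapse becomes constant turns \<open>lact\<close> into the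
  action with that constant lapse, which lies above \<open>jlen\<close>. As \<open>N\<close> does
  not depend on the member of the family, one change of parameter serves all members and the family
  stays continuous.\<close>

lemma reparam:
 assumes f: "fam U X D" and N: "continuous_on {0..1} N" "!!t. t \<in> {0..1} ==> 0 < N t"
 obtains \<theta> \<theta>' where "continuous_on {0..1} \<theta>" "!!t. t \<in> {0..1} ==> \<theta> t \<in> {0..1}" "\<theta> 0 = 0" "\<theta> 1 = 1"
  "fam U (%v t. X v (\<theta> t)) (%v t. \<theta>' t *\<^sub>R D v (\<theta> t))"
  "!!v. v \<in> U ==> jlen G (%t. X v (\<theta> t)) (%t. \<theta>' t *\<^sub>R D v (\<theta> t)) <= lact G N (X v) (D v)"
proof -
 define T where "T = integral {0..1} N"
 define \<phi> where "\<phi> = (%u. integral {0..u} N / T)"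
 obtain n0 where n0: "0 < n0" "!!t. t \<in> {0..1} ==> n0 <= N t"
  using continuous_attains_inf[of "{0..1::real}" N] N by (metis atLeastAtMost_iff compact_Icc empty_iff order_refl zero_le_one)
 have T: "T > 0"
 proof -
  have "integral {0..1::real} (%_. n0) <= T"
   unfolding T_def by (rule integral_le) (use n0 integrable_continuous_real[OF N(1)] in auto)
  then show ?thesis using n0 by simp
 qed
 have d: "(\<phi> hrd N t / T) (at t within {0..1})" if "t \<in> {0..1}" for t
  unfolding \<phi>_def using integral_has_real_derivative[OF N(1) that] by (rule DERIV_cdivide)
 have p01: "\<phi> 0 = 0" "\<phi> 1 = 1" using T by (auto simp: \<phi>_def T_def)
 obtain \<theta> where th: "!!t. t \<in> {0..1} ==> \<theta> (\<phi> t) = t" "!!s. s \<in> {0..1} ==> \<theta> s \<in> {0..1} & \<phi> (\<theta> s) = s"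
  and thd: "!!s. s \<in> {0..1} ==> (\<theta> hrd (1 / (N (\<theta> s) / T))) (at s within {0..1})"
  by (rule increasing_inverse[of 0 1 \<phi> "%t. N t / T"]) (use d N(2) T in \<open>auto simp: p01\<close>)
 define \<theta>' where "\<theta>' = (%s. T / N (\<theta> s))"
 have th01: "\<theta> 0 = 0" "\<theta> 1 = 1" using th(1)[of 0] th(1)[of 1] p01 by auto
 have thd': "(\<theta> hrd \<theta>' s) (at s within {0..1})" if "s \<in> {0..1}" for s
  using thd[OF that] by (simp add: \<theta>'_def)
 have cth: "continuous_on {0..1} \<theta>" using thd' by (rule DERIV_continuous_on)
 have cN: "continuous_on {0..1} (%s. N (\<theta> s))"
  by (rule continuous_on_compose2[OF N(1) cth]) (use th in auto)
 have N0: "N (\<theta> s) ~= 0" if "s \<in> {0..1}" for s using N(2)[of "\<theta> s"] th(2)[OF that] by auto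
 have cth': "continuous_on {0..1} \<theta>'"
  unfolding \<theta>'_def using N0 by (intro continuous_intros cN) auto
 note F = fam_compose[OF f cth' _ thd']
 have sub: "integral {0..1} (%s. \<theta>' s * h (\<theta> s)) = integral {0..1} h" if "continuous_on {0..1} h" for h :: "real => real"
 proof -
  have "((%s. \<theta>' s *\<^sub>R h (\<theta> s)) has_integral integral {\<theta> 0..\<theta> 1} h) {0..1}"
   by (rule has_integral_substitution[where c=0 and d=1]) (use th thd' that th01 in auto)
  then show ?thesis by (simp add: th01 integral_unique)
 qed
 have "jlen G (%t. X v (\<theta> t)) (%t. \<theta>' t *\<^sub>R D v (\<theta> t)) <= lact G N (X v) (D v)" if v: "v \<in> U" for v
 proof -
  note C = fam_C1[OF F v] and C0 = fam_C1[OF f v]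
  have C: "C1 (%t. X v (\<theta> t)) (%t. \<theta>' t *\<^sub>R D v (\<theta> t))" by (rule C) (use th in auto)
  have cX: "continuous_on {0..1} (X v)" and cD: "continuous_on {0..1} (D v)"
   using C1_cont[OF C0] C1_contD[OF C0] .
  have ne: "\<forall>t\<in>{0..1}. N t ~= 0" using N(2) by force
  have ch: "continuous_on {0..1} (%u. (T / N u) * (norm (D v u))^2)" "continuous_on {0..1} (%u. N u / T * G (X v u))"
   using ne T by (auto intro!: continuous_intros N(1) cD G_comp_cont cX)
  have "kin (%t. \<theta>' t *\<^sub>R D v (\<theta> t)) = integral {0..1} (%s. \<theta>' s * ((T / N (\<theta> s)) * (norm (D v (\<theta> s)))^2)) / 2"
   unfolding kin_def using T by (simp add: \<theta>'_def power_mult_distrib power2_eq_square mult.assoc mult.left_commute)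
  also have "... = integral {0..1} (%u. (T / N u) * (norm (D v u))^2) / 2"
   using sub[OF ch(1)] by simp
  finally have k: "kin (%t. \<theta>' t *\<^sub>R D v (\<theta> t)) = integral {0..1} (%u. (T / N u) * (norm (D v u))^2) / 2" .
  have "pot G (%t. X v (\<theta> t)) = integral {0..1} (%s. \<theta>' s * (N (\<theta> s) / T * G (X v (\<theta> s))))"
   unfolding pot_def by (rule integral_cong) (use N0 T in \<open>auto simp: \<theta>'_def\<close>)
  also have "... = integral {0..1} (%u. N u / T * G (X v u))" by (rule sub[OF ch(2)])
  finally have p: "pot G (%t. X v (\<theta> t)) = integral {0..1} (%u. N u / T * G (X v u))" .
  have "jlen G (%t. X v (\<theta> t)) (%t. \<theta>' t *\<^sub>R D v (\<theta> t)) <= kin (%t. \<theta>' t *\<^sub>R D v (\<theta> t)) / T + T * pot G (%t. X v (\<theta> t))"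
   by (rule jlen_le_act[OF C T])
  also have "... = (1/(2*T)) * integral {0..1} (%u. (T / N u) * (norm (D v u))^2) + T * integral {0..1} (%u. N u / T * G (X v u))"
   by (simp add: k p)
  also have "... = integral {0..1} (%u. (1/(2*T)) * ((T / N u) * (norm (D v u))^2) + T * (N u / T * G (X v u)))"
   by (rule integral_unique[symmetric], intro has_integral_add has_integral_mult_right integrable_integral
     integrable_continuous_real ch)
  also have "... = lact G N (X v) (D v)"
   unfolding lact_def using T by (intro integral_cong) (auto simp: field_simps)
  finally show ?thesis .
 qed
 moreover have "fam U (%v t. X v (\<theta> t)) (%v t. \<theta>' t *\<^sub>R D v (\<theta> t))" by (rule F) (use th in auto)
 ultimately show ?thesis using that[of \<theta> \<theta>'] cth th th01 by blast
qed

lemma catN: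
 assumes "continuous_on {0..1} N1" "continuous_on {0..1} N2" "!!t. t \<in> {0..1} ==> 0 < N1 t"
  "!!t. t \<in> {0..1} ==> 0 < N2 t" "0 < \<epsilon>"
 shows "continuous_on {0..1} (catN \<epsilon> N1 N2)" "!!t. t \<in> {0..1} ==> 0 < catN \<epsilon> N1 N2 t"
proof -
 have "continuous_on {0..1} (catD N1 N2)"
  unfolding catD_def
 proof (rule continuous_on_cases_le)
  show "continuous_on {t \<in> {0..1}. t <= 1 / 2} (%u. (2 * dsm (2 * u)) *\<^sub>R N1 (sm (2 * u)))"
   by (auto intro!: continuous_intros continuous_on_compose2[OF sm_cont(2)[of UNIV]]
    continuous_on_compose2[OF assms(1)] continuous_on_compose2[OF sm_cont(1)[of UNIV]] sm_01(1)[simplified])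
  show "continuous_on {t \<in> {0..1}. 1 / 2 <= t} (%u. (2 * dsm (2 * u - 1)) *\<^sub>R N2 (sm (2 * u - 1)))"
   by (auto intro!: continuous_intros continuous_on_compose2[OF sm_cont(2)[of UNIV]]
    continuous_on_compose2[OF assms(2)] continuous_on_compose2[OF sm_cont(1)[of UNIV]] sm_01(1)[simplified])
 qed (auto intro!: continuous_intros dest!: half_eq)
 then show "continuous_on {0..1} (catN \<epsilon> N1 N2)"
  unfolding catN_def[abs_def] by (intro continuous_intros)
 fix t :: real assume t: "t \<in> {0..1}"
 have "0 <= dsm (2 * t) * N1 (sm (2 * t))" if "t <= 1/2"
  using assms(3)[OF sm_01(1), of "2 * t"] sm_01(2)[of "2 * t"] t that by auto
 moreover have "0 <= dsm (2 * t - 1) * N2 (sm (2 * t - 1))" if "\<not> t <= 1/2"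
  using assms(4)[OF sm_01(1), of "2 * t - 1"] sm_01(2)[of "2 * t - 1"] t that by auto
 ultimately show "0 < catN \<epsilon> N1 N2 t" using assms(5) by (auto simp: catN_def catD_def)
qed

text \<open>Enlarging the lapse by \<open>\<epsilon>\<close> can only lower the kinetic term and
  adds at most \<open>\<epsilon> * B\<close> to the other. Where the clock stands still the velocity
  vanishes as well, so the quotient is harmless there.\<close>

lemma lact_cat:
 assumes C: "C1 X1 D1" "C1 X2 D2" "X1 1 = X2 0" and N1: "continuous_on {0..1} N1" "!!t. t \<in> {0..1} ==> 0 < N1 t"
  and N2: "continuous_on {0..1} N2" "!!t. t \<in> {0..1} ==> 0 < N2 t" and e: "0 < \<epsilon>"
 shows "lact G (catN \<epsilon> N1 N2) (cat X1 X2) (catD D1 D2) <= lact G N1 X1 D1 + lact G N2 X2 D2 + \<epsilon> * B"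
proof -
 define F where "F = (%t. (norm (catD D1 D2 t))^2 / (2 * catN \<epsilon> N1 N2 t) + catN \<epsilon> N1 N2 t * G (cat X1 X2 t))"
 have cC: "C1 (cat X1 X2) (catD D1 D2)"
  using fam_C1[OF fam_cat[OF C1_fam[OF C(1)] C1_fam[OF C(2)], of "{0::real}"], of 0] C(3) by simp
 note N = catN[OF N1(1) N2(1) N1(2) N2(2) e]
 have cF: "continuous_on {0..1} F" unfolding F_def
  by (rule lact_cont[OF C1_cont[OF cC] C1_contD[OF cC] N])
 have piece: "integral {a/2..a/2+1/2} F <= lact G M Z E + \<epsilon> * B / 2"
  if Z: "C1 Z E" and M: "continuous_on {0..1} M" "!!t. t \<in> {0..1} ==> 0 < M t" and a: "0 <= a" "a <= 1"
  and F: "!!u. u \<in> {a/2..a/2+1/2} ==> F u = (norm ((2 * dsm (2 * u - a)) *\<^sub>R E (sm (2 * u - a))))^2 / (2 * (2 * dsm (2 * u - a) * M (sm (2 * u - a)) + \<epsilon>))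
    + (2 * dsm (2 * u - a) * M (sm (2 * u - a)) + \<epsilon>) * G (Z (sm (2 * u - a)))" for a Z E M
 proof -
  define h where "h = (%w. (norm (E w))^2 / (2 * M w) + M w * G (Z w))"
  have ch: "continuous_on {0..1} h" unfolding h_def
   by (rule lact_cont[OF C1_cont[OF Z] C1_contD[OF Z] M])
  have "((%u. (2 * dsm (2 * u - a)) *\<^sub>R h (sm (2 * u - a))) has_integral integral {sm (2 * (a/2) - a)..sm (2 * (a/2+1/2) - a)} h) {a/2..a/2+1/2}"
  proof (rule has_integral_substitution[where c=0 and d=1, OF _ _ _ ch])
   show "(%u. sm (2 * u - a)) ` {a/2..a/2+1/2} \<subseteq> {0..1}" by (auto intro!: sm_01(1)[simplified])
   show "((%u. sm (2 * u - a)) hrd (2 * dsm (2 * x - a))) (at x within {a/2..a/2+1/2})" for x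
    by (rule DERIV_chain'[OF _ sm_der, THEN DERIV_cong]) (auto intro!: derivative_eq_intros)
  qed auto
  then have i: "((%u. (2 * dsm (2 * u - a)) * h (sm (2 * u - a))) has_integral lact G M Z E) {a/2..a/2+1/2}"
   by (simp add: h_def lact_def)
  have "((%_. \<epsilon> * B) has_integral (\<epsilon> * B / 2)) {a/2..a/2+1/2}"
   using has_integral_const_real[of "\<epsilon> * B" "a/2" "a/2+1/2"] by simp
  from has_integral_add[OF i this]
  have i2: "((%u. (2 * dsm (2 * u - a)) * h (sm (2 * u - a)) + \<epsilon> * B) has_integral (lact G M Z E + \<epsilon> * B / 2)) {a/2..a/2+1/2}" .
  have iF: "(F has_integral integral {a/2..a/2+1/2} F) {a/2..a/2+1/2}"
   by (intro integrable_integral integrable_continuous_real continuous_on_subset[OF cF]) (use a in auto)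
  show ?thesis
  proof (rule has_integral_le[OF iF i2])
   fix u assume u: "u \<in> {a/2..a/2+1/2}"
   define s k where "s = sm (2 * u - a)" and "k = 2 * dsm (2 * u - a)"
   have s: "s \<in> {0..1}" and k: "0 <= k" unfolding s_def k_def using u
    by (auto intro!: sm_01(1)[simplified] sm_01(2))
   have Ms: "0 < M s" by (rule M(2)[OF s])
   have "(norm (k *\<^sub>R E s))^2 / (2 * (k * M s + \<epsilon>)) <= k * ((norm (E s))^2 / (2 * M s))"
   proof (cases "k = 0")
    case False
    then have "(norm (k *\<^sub>R E s))^2 / (2 * (k * M s + \<epsilon>)) <= (norm (k *\<^sub>R E s))^2 / (2 * (k * M s))"
     using k Ms e by (intro divide_left_mono) (auto intro!: mult_pos_pos add_pos_pos)
    also have "... = k * ((norm (E s))^2 / (2 * M s))"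
     using False Ms by (simp add: power_mult_distrib field_simps power2_eq_square)
    finally show ?thesis .
   qed simp
   moreover have "\<epsilon> * G (Z s) <= \<epsilon> * B" using e GB by simp
   ultimately show "F u <= 2 * dsm (2 * u - a) * h (sm (2 * u - a)) + \<epsilon> * B"
    unfolding F[OF u] h_def s_def[symmetric] k_def[symmetric] by (simp add: algebra_simps)
  qed
 qed
 have "integral {0/2..0/2+1/2} F <= lact G N1 X1 D1 + \<epsilon> * B / 2"
  by (rule piece[OF C(1) N1]) (auto simp: F_def catD_def catN_def cat_def)
 moreover have "integral {1/2..1/2+1/2} F <= lact G N2 X2 D2 + \<epsilon> * B / 2"
  by (rule piece[OF C(2) N2]) (use C(3) in \<open>auto simp: F_def catD_def catN_def cat_def dest!: half_eq\<close>)
 moreover have "integral {0..1/2} F + integral {1/2..1} F = integral {0..1} F"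
  by (rule Henstock_Kurzweil_Integration.integral_combine) (auto intro: integrable_continuous_real cF)
 ultimately show ?thesis by (simp add: lact_def F_def)
qed

end

section \<open>The Jacobi distance\<close>

definition jac :: "('a => real) => 'a::euclidean_space => 'a => real" where
 "jac G p q = Inf {jlen G X D |X D. C1 X D & X 0 = p & X 1 = q}"

lemma C1_line: "C1 (%t. p + t *\<^sub>R (q - p)) (%_. q - p)"
 unfolding C1_def by (auto intro!: derivative_eq_intros)

lemma C1_reverse:
 assumes "C1 X D" shows "C1 (%t. X (1 - t)) (%t. - D (1 - t))"
 unfolding C1_def
proof (intro conjI ballI)
 show "continuous_on {0..1} (%t. - D (1 - t))"
  by (intro continuous_intros continuous_on_compose2[OF C1_contD[OF assms]]) auto
 fix t :: real assume t: "t \<in> {0..1}"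
 have "((%t. 1 - t) hvd - 1) (at t within {0..1})"
  by (auto intro!: derivative_eq_intros)
 moreover have "(X hvd D (1 - t)) (at (1 - t) within (%t. 1 - t) ` {0..1})"
  by (rule has_vector_derivative_within_subset[OF C1_deriv[OF assms]]) (use t in auto)
 ultimately show "((%t. X (1 - t)) hvd - D (1 - t)) (at t within {0..1})"
  using vector_diff_chain_within[of "%t. 1 - t" "- 1" t "{0..1}" X "D (1 - t)"] by (simp add: o_def)
qed

lemma integral_reverse01:
 assumes "continuous_on {0..1} (f :: real => real)"
 shows "integral {0..1} (%t. f (1 - t)) = integral {0..1} f"
proof -
 have "integral {-1..0} (f \<circ> (%x. x + 1)) = integral {0..1} f"
  using integral_shift[of "-1" 1 0 f] assms by simp
 moreover have "integral {-1..-0} (%x. f (1 - (- x))) = integral {0..1} (%t. f (1 - t))"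
  using Henstock_Kurzweil_Integration.integral_reflect_real[of 1 0 "%t. f (1 - t)"] by simp
 ultimately show ?thesis by (simp add: o_def add.commute)
qed

context soft
begin

lemma jlen_nonneg: "C1 X D ==> 0 <= jlen G X D"
 using kin_ge0[OF C1_contD] pot_ge[OF C1_cont] Hpos by (fastforce simp: jlen_def)

lemma jac_bdd: "bdd_below {jlen G X D |X D. C1 X D & X 0 = p & X 1 = q}"
 by (rule bdd_belowI[of _ 0]) (use jlen_nonneg in auto)

lemma jac_ne: "{jlen G X D |X D. C1 X D & X 0 = p & X 1 = q} ~= {}"
proof -
 have "jlen G (%t. p + t *\<^sub>R (q - p)) (%_. q - p) \<in> {jlen G X D |X D. C1 X D & X 0 = p & X 1 = q}"
  unfolding mem_Collect_eq
  by (intro exI[of _ "%t. p + t *\<^sub>R (q - p)"] exI[of _ "%_. q - p"]) (simp add: C1_line)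
 then show ?thesis by blast
qed

lemma jac_le: "C1 X D ==> X 0 = p ==> X 1 = q ==> jac G p q <= jlen G X D"
 unfolding jac_def by (rule cInf_lower[OF _ jac_bdd]) blast

lemma jac_ge: "sqrt (2 * H) * norm (q - p) <= jac G p q"
 unfolding jac_def by (rule cInf_greatest[OF jac_ne]) (use jlen_ge in auto)

lemma jac_nonneg: "0 <= jac G p q"
 by (rule order_trans[OF _ jac_ge]) (use Hpos in simp)

lemma jac_near:
 assumes "jac G p q < r"
 obtains X D where "C1 X D" "X 0 = p" "X 1 = q" "jlen G X D < r"
 using assms cInf_less_iff[OF jac_ne jac_bdd] unfolding jac_def by blast

lemma jac_le_lact:
 assumes "C1 X D" "continuous_on {0..1} N" "!!t. t \<in> {0..1} ==> 0 < N t"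
 shows "jac G (X 0) (X 1) <= lact G N X D"
proof -
 obtain \<theta> \<theta>' where t: "\<theta> 0 = 0" "\<theta> 1 = 1"
  "fam {0::real} (%v t. X (\<theta> t)) (%v t. \<theta>' t *\<^sub>R D (\<theta> t))"
  "jlen G (%t. X (\<theta> t)) (%t. \<theta>' t *\<^sub>R D (\<theta> t)) <= lact G N X D"
  by (rule reparam[OF C1_fam[OF assms(1), of "{0::real}"] assms(2,3)]) auto
 have "jac G (X 0) (X 1) <= jlen G (%t. X (\<theta> t)) (%t. \<theta>' t *\<^sub>R D (\<theta> t))"
  by (rule jac_le[OF fam_C1[OF t(3)]]) (use t in auto)
 then show ?thesis using t by linarith
qed

text \<open>The optimal time attains \<open>jlen\<close> exactly, except for a path at rest, whose
  optimal time would be zero; it is given a short positive time instead.\<close>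

lemma lact_near:
 assumes "C1 X D" "0 < \<epsilon>"
 obtains T where "T > 0" "lact G (%_. T) X D < jlen G X D + \<epsilon>"
proof (cases "X 0 = X 1 & kin D = 0")
 case False
 have p: "0 < pot G X" using pot_ge[OF C1_cont[OF assms(1)]] Hpos by simp
 have k: "0 < kin D"
 proof (cases "X 0 = X 1")
  case True then show ?thesis using False kin_ge0[OF C1_contD[OF assms(1)]] by simp
 next
  case F: False
  then have "0 < (norm (X 1 - X 0))^2 / 2" by simp
  then show ?thesis using kin_pos[OF assms(1)] by linarith
 qed
 define T where "T = sqrt (kin D / pot G X)"
 have T: "T > 0" using p k by (simp add: T_def)
 have e: "kin D = T^2 * pot G X" using p k by (simp add: T_def)
 have "kin D * pot G X = (T * pot G X)^2" using e by (simp add: power2_eq_square)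
 then have "jlen G X D = 2 * (T * pot G X)" using T p by (simp add: jlen_def)
 then have "lact G (%_. T) X D = jlen G X D"
  using lact_const[OF assms(1) T] e T by (simp add: power2_eq_square)
 then show ?thesis using that[OF T] assms(2) by simp
next
 case True
 have p: "0 < pot G X" using pot_ge[OF C1_cont[OF assms(1)]] Hpos by simp
 define T where "T = \<epsilon> / 2 / pot G X"
 have T: "T > 0" using p assms(2) by (simp add: T_def)
 have "lact G (%_. T) X D = \<epsilon> / 2"
  using lact_const[OF assms(1) T] True p by (simp add: T_def)
 then show ?thesis using that[OF T] assms(2) jlen_nonneg[OF assms(1)] by simp
qed

lemma jac_near_T:
 assumes "jac G p q < r"
 obtains X D T where "C1 X D" "X 0 = p" "X 1 = q" "T > 0" "lact G (%_. T) X D < r"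
proof -
 obtain X D where X: "C1 X D" "X 0 = p" "X 1 = q" "jlen G X D < r" using jac_near[OF assms] .
 obtain T where "T > 0" "lact G (%_. T) X D < jlen G X D + (r - jlen G X D)"
  using lact_near[OF X(1), of "r - jlen G X D"] X(4) by auto
 then show ?thesis using that X by auto
qed

text \<open>\<open>jlen\<close> is not additive, since two pieces may have different optimal times.
  The concatenation is therefore estimated with a lapse that changes from piece to piece, and
  reparametrised at the end.\<close>

lemma jac_triangle: "jac G p r <= jac G p q + jac G q r"
proof (rule field_le_epsilon)
 fix e :: real assume e: "0 < e"
 have B: "B > 0" using Gpos GB less_le_trans by blast
 obtain X D T where X: "C1 X D" "X 0 = p" "X 1 = q" "T > 0" "lact G (%_. T) X D < jac G p q + e / 4"
  using jac_near_T[of p q "jac G p q + e / 4"] e by auto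
 obtain Y E S where Y: "C1 Y E" "Y 0 = q" "Y 1 = r" "S > 0" "lact G (%_. S) Y E < jac G q r + e / 4"
  using jac_near_T[of q r "jac G q r + e / 4"] e by auto
 define d where "d = e / (4 * B)"
 have d: "d > 0" "d * B = e / 4" using e B by (auto simp: d_def)
 have c: "C1 (cat X Y) (catD D E)"
  using fam_C1[OF fam_cat[OF C1_fam[OF X(1)] C1_fam[OF Y(1)], of "{0::real}"], of 0] X Y by simp
 have N: "continuous_on {0..1} (catN d (%_. T) (%_. S))" "!!t. t \<in> {0..1} ==> 0 < catN d (%_. T) (%_. S) t"
  using catN[of "%_. T" "%_. S" d] X Y d by auto
 have "jac G (cat X Y 0) (cat X Y 1) <= lact G (catN d (%_. T) (%_. S)) (cat X Y) (catD D E)"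
  by (rule jac_le_lact[OF c N])
 also have "... <= lact G (%_. T) X D + lact G (%_. S) Y E + d * B"
  by (rule lact_cat) (use X Y d in auto)
 finally show "jac G p r <= jac G p q + jac G q r + e" using X Y d e by simp
qed

lemma jac_refl: "jac G p p = 0"
proof -
 have "jac G p p <= jlen G (%t. p + t *\<^sub>R (p - p)) (%_. p - p)"
  by (rule jac_le[OF C1_line]) auto
 then show ?thesis using jac_nonneg[of p p] by (simp add: jlen_def kin_def)
qed

lemma jac_sym_le: "jac G q p <= jac G p q"
proof (rule field_le_epsilon)
 fix e :: real assume e: "0 < e"
 obtain X D where X: "C1 X D" "X 0 = p" "X 1 = q" "jlen G X D < jac G p q + e"
  using jac_near[of p q "jac G p q + e"] e by auto
 have "jlen G (%t. X (1 - t)) (%t. - D (1 - t)) = jlen G X D"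
  using integral_reverse01[of "%t. (norm (D t))^2"] integral_reverse01[of "%t. G (X t)"]
   G_comp_cont[OF C1_cont[OF X(1)]] C1_contD[OF X(1)]
  by (simp add: jlen_def kin_def pot_def continuous_intros)
 then show "jac G q p <= jac G p q + e"
  using jac_le[OF C1_reverse[OF X(1)], of q p] X by simp
qed

lemma jac_sym: "jac G q p = jac G p q"
 using jac_sym_le antisym by blast

lemma jac_le_act:
 assumes st: "s <= t" and T: "T > 0"
  and y: "!!u. u \<in> {s..t} ==> (y hvd v u) (at u within {s..t})"
  and v: "continuous_on {s..t} v"
 shows "jac G (y s) (y t) <= integral {s..t} (%u. (norm (v u))^2 / (2 * T) + T * G (y u))"
proof (cases "s = t")
 case True then show ?thesis by (simp add: jac_refl)
next
 case False
 define L where "L = t - s"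
 have L: "L > 0" using False st by (simp add: L_def)
 define a where "a = (%u. s + u * L)"
 have a: "a u \<in> {s..t}" if "u \<in> {0..1}" for u
 proof -
  have "u * L <= 1 * L" "0 <= u * L" using that L by (auto intro!: mult_right_mono)
  moreover have "s + L = t" by (simp add: L_def)
  ultimately show ?thesis unfolding a_def by simp
 qed
 have a01: "a 0 = s" "a 1 = t" by (auto simp: a_def L_def)
 have ad: "(a hrd L) (at u within S)" for u S
  unfolding a_def by (auto intro!: derivative_eq_intros)
 have ca: "continuous_on {0..1} a" by (rule DERIV_continuous_on[OF ad])
 have cy: "continuous_on {s..t} y" by (rule continuous_on_vector_derivative[OF y])
 define X D where "X = (%u. y (a u))" and "D = (%u. L *\<^sub>R v (a u))"
 have C: "C1 X D"
  unfolding C1_def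
 proof (intro conjI ballI)
  show "continuous_on {0..1} D" unfolding D_def
   by (intro continuous_intros continuous_on_compose2[OF v ca]) (use a in auto)
  fix u :: real assume u: "u \<in> {0..1}"
  have "(y hvd v (a u)) (at (a u) within a ` {0..1})"
   by (rule has_vector_derivative_within_subset[OF y[OF a[OF u]]]) (use a in auto)
  from vector_diff_chain_within[OF ad[unfolded has_real_derivative_iff_has_vector_derivative] this]
  show "(X hvd D u) (at u within {0..1})" by (simp add: X_def D_def o_def)
 qed
 define h where "h = (%u. (norm (v u))^2 / (2 * T) + T * G (y u))"
 have ch: "continuous_on {s..t} h" unfolding h_def using T
  by (intro continuous_intros v G_comp_cont cy) auto
 have "((%u. L *\<^sub>R h (a u)) has_integral integral {a 0..a 1} h) {0..1}"
  by (rule has_integral_substitution[where c=s and d=t, OF _ _ _ ch ad]) (use a a01 st in auto)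
 then have "integral {0..1} (%u. L * h (a u)) = integral {s..t} h"
  unfolding real_scaleR_def a01 by (rule integral_unique)
 then have "integral {s..t} h = integral {0..1} (%u. L * h (a u))" by simp
 also have "... = lact G (%_. L * T) X D"
  unfolding lact_def using L T
  by (intro integral_cong) (auto simp: h_def X_def D_def power_mult_distrib power2_eq_square algebra_simps)
 finally have "lact G (%_. L * T) X D = integral {s..t} h" by simp
 moreover have "jac G (X 0) (X 1) <= lact G (%_. L * T) X D"
  by (rule jac_le_lact[OF C]) (use L T in auto)
 ultimately show ?thesis by (simp add: X_def a01 h_def)
qed

text \<open>Both pieces are run with the optimal time scale of the whole path; the action with that
  common scale is additive and equals \<open>jlen\<close> on the whole.\<close>

lemma jac_split:
 assumes "C1 X D" "X 0 ~= X 1" "t \<in> {0..1}"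
 shows "jac G (X 0) (X t) + jac G (X t) (X 1) <= jlen G X D"
proof -
 define T where "T = Topt X D"
 have T: "T > 0" using Topt(1)[OF assms(1,2)] by (simp add: T_def)
 define h where "h = (%u. (norm (D u))^2 / (2 * T) + T * G (X u))"
 have ch: "continuous_on {0..1} h" unfolding h_def using T
  by (intro continuous_intros C1_contD[OF assms(1)] G_comp_cont C1_cont[OF assms(1)]) auto
 have "jac G (X 0) (X t) <= integral {0..t} h" unfolding h_def
  by (rule jac_le_act[OF _ T has_vector_derivative_within_subset[OF C1_deriv[OF assms(1)]]
    continuous_on_subset[OF C1_contD[OF assms(1)]]]) (use assms(3) in auto)
 moreover have "jac G (X t) (X 1) <= integral {t..1} h" unfolding h_def
  by (rule jac_le_act[OF _ T has_vector_derivative_within_subset[OF C1_deriv[OF assms(1)]]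
    continuous_on_subset[OF C1_contD[OF assms(1)]]]) (use assms(3) in auto)
 moreover have "integral {0..t} h + integral {t..1} h = integral {0..1} h"
  by (rule Henstock_Kurzweil_Integration.integral_combine) (use assms in \<open>auto intro: integrable_continuous_real ch\<close>)
 moreover have "integral {0..1} h = jlen G X D"
  using lact_const[OF assms(1) T] Topt(2)[OF assms(1,2)] by (simp add: h_def lact_def T_def)
 ultimately show ?thesis by linarith
qed

lemma orbit_contD: "orbit T y v ==> continuous_on {0..T} v" "orbit T y v ==> continuous_on {0..T} y"
proof -
 assume o: "orbit T y v"
 show "continuous_on {0..T} v"
  by (rule continuous_on_vector_derivative[where f'="%t. g (y t)"]) (use o in \<open>auto simp: orbit_def solves_def\<close>)
 show "continuous_on {0..T} y"
  by (rule continuous_on_vector_derivative[where f'=v]) (use o in \<open>auto simp: orbit_def solves_def\<close>)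
qed

text \<open>On an orbit the two halves of the integrand with unit lapse agree, so the action is the
  integral of the squared speed. This is the form in which costs of orbits are measured from here
  on.\<close>

lemma jac_orbit_le:
 assumes o: "orbit T y v" and st: "0 <= s" "s <= t" "t <= T"
 shows "jac G (y s) (y t) <= integral {s..t} (%u. (norm (v u))^2)"
proof -
 have "jac G (y s) (y t) <= integral {s..t} (%u. (norm (v u))^2 / (2 * 1) + 1 * G (y u))"
 proof (rule jac_le_act)
  show "(y hvd v u) (at u within {s..t})" if "u \<in> {s..t}" for u
   by (rule has_vector_derivative_within_subset[of _ _ _ "{0..T}"])
   (use o st that in \<open>auto simp: orbit_def solves_def\<close>)
  show "continuous_on {s..t} v" by (rule continuous_on_subset[OF orbit_contD(1)[OF o]]) (use st in auto)
 qed (use st in auto)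
 also have "... = integral {s..t} (%u. (norm (v u))^2)"
  by (rule integral_cong) (use o st in \<open>auto simp: orbit_def\<close>)
 finally show ?thesis .
qed

lemma orbit_act_split:
 assumes "orbit T y v" "0 <= s" "s <= t" "t <= u" "u <= T"
 shows "integral {s..t} (%u. (norm (v u))^2) + integral {t..u} (%u. (norm (v u))^2) = integral {s..u} (%u. (norm (v u))^2)"
 by (rule Henstock_Kurzweil_Integration.integral_combine)
 (use assms orbit_contD(1)[OF assms(1)] in \<open>auto intro!: integrable_continuous_real continuous_intros elim: continuous_on_subset\<close>)

lemma orbit_act_ge:
 assumes "orbit T y v" "0 <= s" "s <= t" "t <= T"
 shows "2 * H * (t - s) <= integral {s..t} (%u. (norm (v u))^2)"
proof -
 have "integral {s..t} (%_. 2 * H) <= integral {s..t} (%u. (norm (v u))^2)"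
 proof (rule integral_le)
  show "(%u. (norm (v u))^2) integrable_on {s..t}"
   using assms orbit_contD(1)[OF assms(1)] by (auto intro!: integrable_continuous_real continuous_intros elim: continuous_on_subset)
  show "2 * H <= (norm (v u))^2" if "u \<in> {s..t}" for u
  proof -
   have "(norm (v u))^2 / 2 = G (y u)" using assms that by (auto simp: orbit_def)
   then show ?thesis using GH[of "y u"] by simp
  qed
 qed auto
 then show ?thesis using assms by (simp add: mult.commute algebra_simps)
qed

text \<open>The minimax principle over a one-point parameter space is a minimisation.\<close>

lemma minimizer:
 assumes pq: "p ~= q"
 shows "\<exists>T>0. \<exists>y v. orbit T y v & y 0 = p & y T = q & integral {0..T} (%t. (norm (v t))^2) = jac G p q"
proof -
 define L where "L = jac G p q + 1"
 define K where "K = {(%_::real. X, %_::real. D) |X D. C1 X D & X 0 = p & X 1 = q & jlen G X D <= L}"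
 obtain X0 D0 where X0: "C1 X0 D0" "X0 0 = p" "X0 1 = q" "jlen G X0 D0 < L"
  using jac_near[of p q L] by (auto simp: L_def)
 have K0: "(%_. X0, %_. D0) \<in> K" unfolding K_def mem_Collect_eq
  by (intro exI[of _ X0] exI[of _ D0]) (use X0 in auto)
 have "\<exists>T>0. \<exists>y v. orbit T y v & y 0 = p & y T = q & integral {0..T} (%t. (norm (v t))^2) =
  (INF z\<in>K. SUP v\<in>{0::real}. jlen G (fst z v) (snd z v))"
 proof (rule minimax[where L=L])
  show "K ~= {}" using K0 by blast
  show "fam {0} X D" if "(X, D) \<in> K" for X D using that C1_fam by (auto simp: K_def)
  fix X D assume XD: "(X, D) \<in> K"
  show "X v 0 = p & X v 1 = q & jlen G (X v) (D v) <= L" for v using XD by (auto simp: K_def)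
  obtain X1 D1 where 1: "X = (%_. X1)" "D = (%_. D1)" "C1 X1 D1" "X1 0 = p" "X1 1 = q" "jlen G X1 D1 <= L"
   using XD by (auto simp: K_def)
  have "C1 (stepX (stepsize L) X1 D1) (stepD (stepsize L) X1 D1)"
   using fam_C1[OF fam_step[OF C1_fam[OF 1(3), of "{0::real}"]], of 0] by simp
  moreover have "jlen G (stepX (stepsize L) X1 D1) (stepD (stepsize L) X1 D1) <= L"
   by (rule order_trans[OF step_desc(1)[OF 1(3) _ 1(6)] 1(6)]) (use 1 pq stepsize[of L] in auto)
  ultimately show "(%v. stepX (stepsize L) (X v) (D v), %v. stepD (stepsize L) (X v) (D v)) \<in> K"
   unfolding K_def mem_Collect_eq 1(1,2)
   by (intro exI[of _ "stepX (stepsize L) X1 D1"] exI[of _ "stepD (stepsize L) X1 D1"]) (use 1 in \<open>auto simp: stepX_def\<close>)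
 qed (use pq in auto)
 moreover have "(INF z\<in>K. SUP v\<in>{0::real}. jlen G (fst z v) (snd z v)) = jac G p q"
 proof (rule antisym)
  have bb: "bdd_below ((%z. jlen G (fst z 0) (snd z 0)) ` K)"
   by (rule bdd_belowI2[of _ 0]) (auto simp: K_def jlen_nonneg)
  show "(INF z\<in>K. SUP v\<in>{0::real}. jlen G (fst z v) (snd z v)) <= jac G p q"
  proof (rule field_le_epsilon)
   fix e :: real assume "0 < e"
   then obtain X D where X: "C1 X D" "X 0 = p" "X 1 = q" "jlen G X D < jac G p q + min e 1"
    using jac_near[of p q "jac G p q + min e 1"] by auto
   then have "(%_. X, %_. D) \<in> K" unfolding K_def mem_Collect_eq L_def
    by (intro exI[of _ X] exI[of _ D]) auto
   from cINF_lower[OF bb this] X show "(INF z\<in>K. SUP v\<in>{0::real}. jlen G (fst z v) (snd z v)) <= jac G p q + e"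
    by simp
  qed
  show "jac G p q <= (INF z\<in>K. SUP v\<in>{0::real}. jlen G (fst z v) (snd z v))"
   by (rule cINF_greatest) (use K0 jac_le in \<open>auto simp: K_def\<close>)
 qed
 ultimately show ?thesis by simp
qed

end

section \<open>Essential loops of paths\<close>

definition circ :: "real ^ 3 => (real ^ 3) set" where
 "circ E = {v \<in> sphere 0 1. v \<bullet> E = 0}"

text \<open>The unit sphere as suspension of a circle: \<open>v\<close> is the longitude,
  \<open>2 * t - 1\<close> the height over the equator.\<close>

definition sphpt :: "real ^ 3 => real ^ 3 => real => real ^ 3" where
 "sphpt E v t = (2 * t - 1) *\<^sub>R E + sqrt (1 - (2 * t - 1)^2) *\<^sub>R v"

text \<open>At the two poles every longitude qualifies and the choice is arbitrary. This does no
  harm, because the paths of a family share their ends.\<close>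

definition lon :: "real ^ 3 => real ^ 3 => real ^ 3" where
 "lon E z = (SOME v. v \<in> circ E & sphpt E v ((1 + z \<bullet> E) / 2) = z)"

definition sphmap :: "real ^ 3 => (real ^ 3 => real => 'b) => real ^ 3 => 'b" where
 "sphmap E X z = X (lon E z) ((1 + z \<bullet> E) / 2)"

text \<open>A circle of paths with common ends, read as a map of the 2-sphere, is not null-homotopic
  in the complement of \<open>c\<close>. Homotopies may move the common ends as long as these avoid
  \<open>c\<close>; that is used when paths are prolonged.\<close>

definition ess :: "real ^ 3 => real ^ 3 => (real ^ 3 => real => real ^ 3) => bool" where
 "ess E c X \<longleftrightarrow> \<not> (\<exists>a. homotopic_with_canon (%_. True) (sphere 0 1) (- {c}) (sphmap E X) (%_. a))"

lemma circ_ne: "circ E ~= {}"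
proof -
 obtain y where "y ~= 0" "orthogonal E y"
  using orthogonal_to_vector_exists[of E] by auto
 then have "y /\<^sub>R norm y \<in> circ E" by (simp add: circ_def orthogonal_def inner_commute)
 then show ?thesis by blast
qed

lemma compact_circ: "compact (circ E)"
proof -
 have "circ E = sphere 0 1 \<inter> {v. v \<bullet> E = 0}" by (auto simp: circ_def)
 moreover have "closed {v. v \<bullet> E = 0}" by (intro closed_Collect_eq continuous_intros)
 ultimately show ?thesis by (simp add: compact_Int_closed)
qed

lemma sphpt:
 assumes "norm E = 1" "v \<in> circ E" "t \<in> {0..1}"
 shows "sphpt E v t \<in> sphere 0 1" "(1 + sphpt E v t \<bullet> E) / 2 = t"
proof -
 have E: "E \<bullet> E = 1" "v \<bullet> E = 0" "v \<bullet> v = 1" using assms by (auto simp: circ_def norm_eq_1)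
 have "(2 * t - 1)^2 <= 1" using assms(3) by (auto simp: abs_le_square_iff[of _ 1, simplified, symmetric] abs_le_iff)
 then have "sphpt E v t \<bullet> sphpt E v t = 1"
  using E by (simp add: sphpt_def inner_add_left inner_add_right inner_commute power2_eq_square[symmetric])
 then show "sphpt E v t \<in> sphere 0 1" by (simp add: norm_eq_1)
 show "(1 + sphpt E v t \<bullet> E) / 2 = t" using E by (simp add: sphpt_def inner_add_left)
qed

lemma lon:
 assumes E: "norm E = 1" and z: "z \<in> sphere 0 1"
 shows "lon E z \<in> circ E" "sphpt E (lon E z) ((1 + z \<bullet> E) / 2) = z" "(1 + z \<bullet> E) / 2 \<in> {0..1}"
proof -
 have EE: "E \<bullet> E = 1" "z \<bullet> z = 1" using E z by (auto simp: norm_eq_1)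
 have b: "\<bar>z \<bullet> E\<bar> <= 1" using Cauchy_Schwarz_ineq2[of z E] E z by simp
 then show "(1 + z \<bullet> E) / 2 \<in> {0..1}" by auto
 define w where "w = z - (z \<bullet> E) *\<^sub>R E"
 have wE: "w \<bullet> E = 0" using EE by (simp add: w_def inner_diff_left)
 have "w \<bullet> w = 1 - (z \<bullet> E)^2"
  using EE by (simp add: w_def inner_diff_left inner_diff_right inner_commute power2_eq_square)
 then have nw: "norm w = sqrt (1 - (z \<bullet> E)^2)" by (simp add: norm_eq_sqrt_inner)
 have h2: "2 * ((1 + z \<bullet> E) / 2) - 1 = z \<bullet> E" by (simp add: field_simps)
 have sp: "sphpt E v ((1 + z \<bullet> E) / 2) = (z \<bullet> E) *\<^sub>R E + sqrt (1 - (z \<bullet> E)^2) *\<^sub>R v" for v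
  unfolding sphpt_def h2 ..
 have "\<exists>v. v \<in> circ E & sphpt E v ((1 + z \<bullet> E) / 2) = z"
 proof (cases "w = 0")
  case True
  obtain v where v: "v \<in> circ E" using circ_ne by blast
  have "z = (z \<bullet> E) *\<^sub>R E" using True by (simp add: w_def)
  moreover have "sqrt (1 - (z \<bullet> E)^2) = 0" using nw True by simp
  ultimately show ?thesis using v unfolding sp by (intro exI[of _ v]) simp
 next
  case False
  have "w /\<^sub>R norm w \<in> circ E" using False wE by (simp add: circ_def)
  moreover have "(z \<bullet> E) *\<^sub>R E + sqrt (1 - (z \<bullet> E)^2) *\<^sub>R (w /\<^sub>R norm w) = z"
   unfolding nw[symmetric] using False by (simp add: w_def)
  ultimately show ?thesis unfolding sp by blast
 qed
 from someI_ex[OF this] show "lon E z \<in> circ E" "sphpt E (lon E z) ((1 + z \<bullet> E) / 2) = z"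
  by (simp_all add: lon_def)
qed

lemma sphmap_sphpt:
 assumes E: "norm E = 1" and v: "v \<in> circ E" and t: "t \<in> {0..1}"
  and ends: "!!v. v \<in> circ E ==> X v 0 = a" "!!v. v \<in> circ E ==> X v 1 = b"
 shows "sphmap E X (sphpt E v t) = X v t"
proof -
 define w where "w = lon E (sphpt E v t)"
 have w: "w \<in> circ E" "sphpt E w t = sphpt E v t"
  using lon[OF E sphpt(1)[OF E v t]] unfolding w_def sphpt(2)[OF E v t] by auto
 have "X w t = X v t"
 proof (cases "t = 0 \<or> t = 1")
  case True then show ?thesis using ends v w by auto
 next
  case False
  have "1 - (2 * t - 1)^2 = 4 * (t * (1 - t))" by (simp add: power2_eq_square algebra_simps)
  moreover have "0 < t * (1 - t)" using False t by auto
  ultimately have "0 < 1 - (2 * t - 1)^2" by linarith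
  then have "0 < sqrt (1 - (2 * t - 1)^2)" by (rule real_sqrt_gt_zero)
  then show ?thesis using w(2) by (simp add: sphpt_def)
 qed
 then show ?thesis unfolding sphmap_def sphpt(2)[OF E v t] w_def .
qed

text \<open>\<open>lon\<close> is discontinuous at the poles, so continuity is obtained from the
  quotient map of the suspension: the preimage of a closed set is the image of a compact
  set.\<close>

lemma sphmap_homotopy_cont:
 fixes X :: "real => real ^ 3 => real => real ^ 3"
 assumes E: "norm E = 1"
  and c: "continuous_on ({0..1} \<times> circ E \<times> {0..1}) (%z. X (fst z) (fst (snd z)) (snd (snd z)))"
  and ends: "!!l v. l \<in> {0..1} ==> v \<in> circ E ==> X l v 0 = a l" "!!l v. l \<in> {0..1} ==> v \<in> circ E ==> X l v 1 = b l"
 shows "continuous_on ({0..1} \<times> sphere 0 1) (%z. sphmap E (X (fst z)) (snd z))"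
proof (subst continuous_on_closed_vimage, intro closed_Times closed_atLeastAtMost closed_sphere, intro allI impI)
 fix B :: "(real ^ 3) set" assume B: "closed B"
 let ?S = "{0..1::real} \<times> circ E \<times> {0..1::real}"
 let ?f = "%z. X (fst z) (fst (snd z)) (snd (snd z))"
 let ?q = "%z::real \<times> (real ^ 3) \<times> real. (fst z, sphpt E (fst (snd z)) (snd (snd z)))"
 have cS: "compact ?S" by (intro compact_Times compact_circ compact_Icc)
 have "closed (?f -` B \<inter> ?S)"
  using c B compact_imp_closed[OF cS] by (auto simp: continuous_on_closed_vimage)
 then have "compact (?S \<inter> (?f -` B \<inter> ?S))" by (rule compact_Int_closed[OF cS])
 then have "compact (?f -` B \<inter> ?S)" by (simp add: Int_absorb1)
 moreover have "continuous_on (?f -` B \<inter> ?S) ?q"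
  unfolding sphpt_def by (intro continuous_intros)
 ultimately have "compact (?q ` (?f -` B \<inter> ?S))" by (rule compact_continuous_image[rotated])
 moreover have "?q ` (?f -` B \<inter> ?S) = (%z. sphmap E (X (fst z)) (snd z)) -` B \<inter> {0..1} \<times> sphere 0 1"
 proof (intro set_eqI iffI)
  fix y assume "y \<in> ?q ` (?f -` B \<inter> ?S)"
  then obtain l v t where y: "y = (l, sphpt E v t)" "l \<in> {0..1}" "v \<in> circ E" "t \<in> {0..1}" "X l v t \<in> B"
   by auto
  then show "y \<in> (%z. sphmap E (X (fst z)) (snd z)) -` B \<inter> {0..1} \<times> sphere 0 1"
   using sphmap_sphpt[OF E y(3,4), of "X l" "a l" "b l"] ends sphpt(1)[OF E y(3,4)] by auto
 next
  fix y assume y: "y \<in> (%z. sphmap E (X (fst z)) (snd z)) -` B \<inter> {0..1} \<times> sphere 0 1"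
  then have z: "snd y \<in> sphere 0 1" and l: "fst y \<in> {0..1}" by auto
  have "?q (fst y, lon E (snd y), (1 + snd y \<bullet> E) / 2) = y" using lon(2)[OF E z] by simp
  moreover have "(fst y, lon E (snd y), (1 + snd y \<bullet> E) / 2) \<in> ?f -` B \<inter> ?S"
   using lon[OF E z] l y by (auto simp: sphmap_def)
  ultimately show "y \<in> ?q ` (?f -` B \<inter> ?S)" by (rule image_eqI[OF sym])
 qed
 ultimately show "closed ((%z. sphmap E (X (fst z)) (snd z)) -` B \<inter> {0..1} \<times> sphere 0 1)"
  by (simp add: compact_imp_closed)
qed

lemma sphmap_homotopic:
 fixes X :: "real => real ^ 3 => real => real ^ 3"
 assumes E: "norm E = 1"
  and c: "continuous_on ({0..1} \<times> circ E \<times> {0..1}) (%z. X (fst z) (fst (snd z)) (snd (snd z)))"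
  and ends: "!!l v. l \<in> {0..1} ==> v \<in> circ E ==> X l v 0 = a l" "!!l v. l \<in> {0..1} ==> v \<in> circ E ==> X l v 1 = b l"
  and av: "!!l v t. l \<in> {0..1} ==> v \<in> circ E ==> t \<in> {0..1} ==> X l v t ~= p"
 shows "homotopic_with_canon (%_. True) (sphere 0 1) (- {p}) (sphmap E (X 0)) (sphmap E (X 1))"
proof -
 let ?h = "%z. sphmap E (X (fst z)) (snd z)"
 have 1: "continuous_on ({0..1} \<times> sphere 0 1) ?h" by (rule sphmap_homotopy_cont[OF E c ends])
 have 2: "?h z \<in> - {p}" if "z \<in> {0..1} \<times> sphere 0 1" for z
 proof -
  have z: "fst z \<in> {0..1}" "snd z \<in> sphere 0 1" using that by auto
  show ?thesis using av[OF z(1) lon(1)[OF E z(2)] lon(3)[OF E z(2)]] by (simp add: sphmap_def)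
 qed
 have "continuous_map (prod_topology (top_of_set {0..1}) (top_of_set (sphere 0 1))) (top_of_set (- {p})) ?h"
  unfolding prod_topology_subtopology_eu continuous_map_subtopology_eu using 1 2 by blast
 then show ?thesis
  unfolding homotopic_with_def by (intro exI[of _ ?h]) simp
qed

lemma ess_homotopic:
 fixes X :: "real => real ^ 3 => real => real ^ 3"
 assumes "norm E = 1"
  and "continuous_on ({0..1} \<times> circ E \<times> {0..1}) (%z. X (fst z) (fst (snd z)) (snd (snd z)))"
  and "!!l v. l \<in> {0..1} ==> v \<in> circ E ==> X l v 0 = a l" "!!l v. l \<in> {0..1} ==> v \<in> circ E ==> X l v 1 = b l"
  and "!!l v t. l \<in> {0..1} ==> v \<in> circ E ==> t \<in> {0..1} ==> X l v t ~= p"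
 shows "ess E p (X 0) \<longleftrightarrow> ess E p (X 1)"
proof -
 note h = sphmap_homotopic[OF assms]
 have "homotopic_with_canon (%_. True) (sphere 0 1) (- {p}) (sphmap E (X 0)) (%_. q) \<longleftrightarrow>
    homotopic_with_canon (%_. True) (sphere 0 1) (- {p}) (sphmap E (X 1)) (%_. q)" for q
  using homotopic_with_trans[OF homotopic_with_symD[OF h]] homotopic_with_trans[OF h] by blast
 then show ?thesis by (simp add: ess_def)
qed

text \<open>The complement of the ray is star-shaped about \<open>p + e\<close>: a family that
  misses the ray shrinks along segments to that point without meeting \<open>p\<close>.\<close>

lemma ess_hits_ray:
 assumes E: "norm E = 1" and c: "continuous_on (circ E \<times> {0..1}) (%z. X (fst z) (snd z))"
  and ends: "!!v. v \<in> circ E ==> X v 0 = a" "!!v. v \<in> circ E ==> X v 1 = b"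
  and e: "e ~= 0" and es: "ess E p X"
 shows "\<exists>v\<in>circ E. \<exists>t\<in>{0..1}. \<exists>s\<ge>0. X v t = p - s *\<^sub>R e"
proof (rule ccontr)
 assume n: "\<not> ?thesis"
 define Y where "Y = (%l v t. (1 - l) *\<^sub>R X v t + l *\<^sub>R (p + e))"
 have cY: "continuous_on ({0..1} \<times> circ E \<times> {0..1}) (%z. Y (fst z) (fst (snd z)) (snd (snd z)))"
  unfolding Y_def
  by (intro continuous_intros continuous_on_compose2[OF c, of _ snd]) auto
 have av: "Y l v t ~= p" if l: "l \<in> {0..1}" and v: "v \<in> circ E" "t \<in> {0..1}" for l v t
 proof
  assume eq: "Y l v t = p"
  show False
  proof (cases "l = 1")
   case True then show ?thesis using eq e by (simp add: Y_def)
  next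
   case False
   then have l1: "1 - l > 0" using l by auto
   have "(1 - l) *\<^sub>R (p - (l / (1 - l)) *\<^sub>R e) = (1 - l) *\<^sub>R p - l *\<^sub>R e"
    using l1 unfolding scaleR_diff_right by simp
   also have "... = (1 - l) *\<^sub>R X v t"
    using eq by (simp add: Y_def algebra_simps)
   finally have "(1 - l) *\<^sub>R X v t = (1 - l) *\<^sub>R (p - (l / (1 - l)) *\<^sub>R e)" by (rule sym)
   then have "X v t = p - (l / (1 - l)) *\<^sub>R e" using l1 by (metis less_irrefl scaleR_cancel_left)
   moreover have "l / (1 - l) \<ge> 0" using l l1 by auto
   ultimately show False using n v by blast
  qed
 qed
 have "homotopic_with_canon (%_. True) (sphere 0 1) (- {p}) (sphmap E (Y 0)) (sphmap E (Y 1))"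
  by (rule sphmap_homotopic[OF E cY, where a="%l. (1 - l) *\<^sub>R a + l *\<^sub>R (p + e)" and b="%l. (1 - l) *\<^sub>R b + l *\<^sub>R (p + e)"])
   (use ends av in \<open>auto simp: Y_def\<close>)
 moreover have "Y 0 = X" "sphmap E (Y 1) = (%_. p + e)" by (auto simp: Y_def sphmap_def fun_eq_iff)
 ultimately show False using es by (auto simp: ess_def)
qed

text \<open>The straight homotopy to the standard sphere around \<open>p\<close> never meets
  \<open>p\<close>: off the middle the heights along \<open>E\<close> have the same sign, and in the
  middle both points lie on the same side along \<open>v\<close>. The standard sphere is essential
  because a sphere is not contractible.\<close>

lemma ess_base:
 assumes E: "norm E = 1" and c: "continuous_on (circ E \<times> {0..1}) (%z. X (fst z) (snd z))"
  and ends: "!!v. v \<in> circ E ==> X v 0 = a" "!!v. v \<in> circ E ==> X v 1 = b"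
  and av: "!!v t. v \<in> circ E ==> t \<in> {0..1} ==> X v t ~= p"
  and lo: "!!v t. v \<in> circ E ==> t \<in> {0..1/2} ==> (X v t - p) \<bullet> E <= 0"
  and hi: "!!v t. v \<in> circ E ==> t \<in> {1/2..1} ==> (X v t - p) \<bullet> E \<ge> 0"
  and mid: "!!v. v \<in> circ E ==> \<exists>r>0. X v (1/2) = p + r *\<^sub>R v"
 shows "ess E p X"
 unfolding ess_def
proof
 assume "\<exists>q. homotopic_with_canon (%_. True) (sphere 0 1) (- {p}) (sphmap E X) (%_. q)"
 then obtain q where q: "homotopic_with_canon (%_. True) (sphere 0 1) (- {p}) (sphmap E X) (%_. q)" by blast
 define Y where "Y = (%l v t. (1 - l) *\<^sub>R X v t + l *\<^sub>R (p + sphpt E v t))"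
 have cY: "continuous_on ({0..1} \<times> circ E \<times> {0..1}) (%z. Y (fst z) (fst (snd z)) (snd (snd z)))"
  unfolding Y_def sphpt_def
  by (intro continuous_intros continuous_on_compose2[OF c, of _ snd]) auto
 have avY: "Y l v t ~= p" if l: "l \<in> {0..1}" and v: "v \<in> circ E" and t: "t \<in> {0..1}" for l v t
 proof
  assume "Y l v t = p"
  then have eq: "(1 - l) *\<^sub>R (X v t - p) + l *\<^sub>R sphpt E v t = 0"
   by (simp add: Y_def algebra_simps)
  have sE: "sphpt E v t \<bullet> E = 2 * t - 1" using sphpt(2)[OF E v t] by simp
  have d: "(1 - l) * ((X v t - p) \<bullet> E) + l * (2 * t - 1) = 0"
   using arg_cong[OF eq, of "%x. x \<bullet> E"] sE by (simp add: inner_add_left)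
  show False
  proof (cases "l = 0 \<or> t = 1/2")
   case False
   then have l0: "l > 0" using l by auto
   show False
   proof (cases "t < 1/2")
    case True
    then have "(1 - l) * ((X v t - p) \<bullet> E) <= 0" "l * (2 * t - 1) < 0"
     using lo[OF v, of t] l t l0 by (auto intro!: mult_nonneg_nonpos mult_pos_neg)
    then show False using d by linarith
   next
    case F: False
    then have "(1 - l) * ((X v t - p) \<bullet> E) \<ge> 0" "l * (2 * t - 1) > 0"
     using hi[OF v, of t] l t l0 False by (auto intro!: mult_nonneg_nonneg mult_pos_pos)
    then show False using d by linarith
   qed
  next
   case True
   then show False
   proof
    assume "l = 0" then show False using eq av[OF v t] by simp
   next
    assume th: "t = 1/2"
    obtain r where r: "r > 0" "X v t = p + r *\<^sub>R v" using mid[OF v] th by auto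
    have "sphpt E v t = v" by (simp add: sphpt_def th)
    then have "((1 - l) * r + l) *\<^sub>R v = 0" using eq r by (simp add: algebra_simps)
    moreover have "(1 - l) * r + l > 0"
    proof (cases "l = 0")
     case False then show ?thesis using l r by (intro add_nonneg_pos) auto
    qed (use r in simp)
    moreover have "v ~= 0" using v by (auto simp: circ_def)
    ultimately show False by simp
   qed
  qed
 qed
 have h0: "homotopic_with_canon (%_. True) (sphere 0 1) (- {p}) (sphmap E (Y 0)) (sphmap E (Y 1))"
  by (rule sphmap_homotopic[OF E cY, where a="%l. (1 - l) *\<^sub>R a + l *\<^sub>R (p - E)" and b="%l. (1 - l) *\<^sub>R b + l *\<^sub>R (p + E)"])
   (use ends avY in \<open>auto simp: Y_def sphpt_def\<close>)
 have "Y 0 = X" by (simp add: Y_def)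
 with h0 q have "homotopic_with_canon (%_. True) (sphere 0 1) (- {p}) (sphmap E (Y 1)) (%_. q)"
  by (intro homotopic_with_trans[OF homotopic_with_symD[OF h0]]) simp
 then have h: "homotopic_with_canon (%_. True) (sphere 0 1) (- {p}) (%z. p + z) (%_. q)"
  by (rule homotopic_with_eq) (use lon[OF E] in \<open>auto simp: Y_def sphmap_def\<close>)
 \<comment> \<open>Radial projection from \<open>p\<close> would make the identity of the sphere
   null-homotopic.\<close>
 have "homotopic_with_canon (%_. True) (sphere 0 1) (sphere 0 1)
  ((%x. (x - p) /\<^sub>R norm (x - p)) \<circ> (%z. p + z)) ((%x. (x - p) /\<^sub>R norm (x - p)) \<circ> (%_. q))"
  by (rule homotopic_with_compose_continuous_left[OF h]) (auto intro!: continuous_intros)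
 then have "homotopic_with_canon (%_. True) (sphere 0 1) (sphere 0 1) id (%_. (q - p) /\<^sub>R norm (q - p))"
  by (rule homotopic_with_eq) auto
 then have "contractible (sphere (0::real ^ 3) 1)" by (auto simp: contractible_def)
 then show False by (simp add: contractible_sphere)
qed

lemma cont_compose_snd:
 assumes c: "continuous_on (U \<times> {0..1}) (%z. X (fst z) (snd z))"
  and h: "continuous_on ({0..1} \<times> {0..1}) (%z. h (fst z) (snd z))"
  and h1: "!!l t. l \<in> {0..1} ==> t \<in> {0..1} ==> h l t \<in> {0..1::real}"
 shows "continuous_on ({0..1::real} \<times> U \<times> {0..1::real}) (%z. X (fst (snd z)) (h (fst z) (snd (snd z))))"
proof -
 have ch: "continuous_on ({0..1::real} \<times> U \<times> {0..1::real}) (%z. h (fst z) (snd (snd z)))"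
  using continuous_on_compose2[OF h, of "{0..1::real} \<times> U \<times> {0..1::real}" "%z. (fst z, snd (snd z))"]
  by (force intro!: continuous_intros)
 have "continuous_on ({0..1::real} \<times> U \<times> {0..1::real})
  (%z. X (fst (fst (snd z), h (fst z) (snd (snd z)))) (snd (fst (snd z), h (fst z) (snd (snd z)))))"
  by (rule continuous_on_compose2[OF c]) (use h1 in \<open>auto intro!: continuous_intros ch\<close>)
 then show ?thesis by simp
qed

lemma ess_reparam:
 assumes E: "norm E = 1" and c: "continuous_on (circ E \<times> {0..1}) (%z. X (fst z) (snd z))"
  and ends: "!!v. v \<in> circ E ==> X v 0 = a" "!!v. v \<in> circ E ==> X v 1 = b"
  and av: "!!v t. v \<in> circ E ==> t \<in> {0..1} ==> X v t ~= p"
  and th: "continuous_on {0..1} \<theta>" "!!t. t \<in> {0..1} ==> \<theta> t \<in> {0..1}" "\<theta> 0 = 0" "\<theta> 1 = 1"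
 shows "ess E p (%v t. X v (\<theta> t)) \<longleftrightarrow> ess E p X"
proof -
 define Y where "Y = (%l v t. X v ((1 - l) * \<theta> t + l * t))"
 have m: "(1 - l) * \<theta> t + l * t \<in> {0..1}" if "l \<in> {0..1}" "t \<in> {0..1}" for l t
  using convexD_alt[of "{0..1::real}" "\<theta> t" t l] th(2) that by auto
 have "ess E p (Y 0) \<longleftrightarrow> ess E p (Y 1)"
 proof (rule ess_homotopic[OF E, where a="%_. a" and b="%_. b"])
  show "continuous_on ({0..1} \<times> circ E \<times> {0..1}) (%z. Y (fst z) (fst (snd z)) (snd (snd z)))"
   unfolding Y_def by (rule cont_compose_snd[OF c])
   (use m in \<open>auto intro!: continuous_intros continuous_on_compose2[OF th(1)]\<close>)
 qed (use av m th ends in \<open>auto simp: Y_def\<close>)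
 then show ?thesis by (simp add: Y_def)
qed

text \<open>Homotopy that lets the starting point travel along \<open>Z\<close> to its end. When it
  arrives, only the second half of the concatenation is left, which is \<open>X v\<close> run by the
  clock \<open>sm\<close>.\<close>

lemma ess_cat_front:
 assumes E: "norm E = 1" and c: "continuous_on (circ E \<times> {0..1}) (%z. X (fst z) (snd z))"
  and ends: "!!v. v \<in> circ E ==> X v 0 = a" "!!v. v \<in> circ E ==> X v 1 = b"
  and av: "!!v t. v \<in> circ E ==> t \<in> {0..1} ==> X v t ~= p"
  and Z: "continuous_on {0..1} Z" "Z 1 = a" "!!t. t \<in> {0..1} ==> Z t ~= p"
  and es: "ess E p X"
 shows "ess E p (%v. cat Z (X v))"
proof -
 define Y where "Y = (%l v t. cat Z (X v) (l / 2 + t * (1 - l / 2)))"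
 have m: "l / 2 + t * (1 - l / 2) \<in> {0..1}" if "l \<in> {0..1}" "t \<in> {0..1}" for l t :: real
  using convexD_alt[of "{0..1::real}" "1" t "1 - l/2"] that by (auto simp: algebra_simps)
 have cZ: "continuous_on (circ E \<times> {0..1}) (%z. Z (snd z))"
  by (rule continuous_on_compose2[OF Z(1)]) (auto intro!: continuous_intros)
 have cc: "continuous_on (circ E \<times> {0..1}) (%z. cat Z (X (fst z)) (snd z))"
  by (rule cat_cont[where X="%_. Z", OF cZ c]) (use Z ends in auto)
 have "ess E p (Y 0) \<longleftrightarrow> ess E p (Y 1)"
 proof (rule ess_homotopic[OF E, where a="%l. Z (sm l)" and b="%_. b"])
  show "continuous_on ({0..1} \<times> circ E \<times> {0..1}) (%z. Y (fst z) (fst (snd z)) (snd (snd z)))"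
   unfolding Y_def by (rule cont_compose_snd[OF cc]) (use m in \<open>auto intro!: continuous_intros\<close>)
  show "Y l v t ~= p" if "l \<in> {0..1}" "v \<in> circ E" "t \<in> {0..1}" for l v t
  proof -
   have "cat Z (X v) u ~= p" if "u \<in> {0..1}" for u
    using that Z(3)[OF sm_01(1), of "2 * u"] av[OF \<open>v \<in> circ E\<close> sm_01(1), of "2 * u - 1"] by (auto simp: cat_def)
   from this[OF m[OF that(1,3)]] show ?thesis by (simp add: Y_def)
  qed
 qed (use ends in \<open>auto simp: Y_def cat_def\<close>)
 moreover have "ess E p (Y 1) \<longleftrightarrow> ess E p (%v t. X v (sm t))"
 proof -
  have "sphmap E (Y 1) z = sphmap E (%v t. X v (sm t)) z" if "z \<in> sphere 0 1" for z
  proof -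
   have "Y 1 v t = X v (sm t)" if "v \<in> circ E" "t \<in> {0..1}" for v t
    using that Z ends by (cases "t = 0") (auto simp: Y_def cat_def)
   then show ?thesis using lon[OF E that] by (simp add: sphmap_def)
  qed
  then have "homotopic_with_canon (%_. True) (sphere 0 1) (- {p}) (sphmap E (Y 1)) (%_. q) \<longleftrightarrow>
   homotopic_with_canon (%_. True) (sphere 0 1) (- {p}) (sphmap E (%v t. X v (sm t))) (%_. q)" for q
   by (auto elim!: homotopic_with_eq)
  then show ?thesis by (simp add: ess_def)
 qed
 moreover have "ess E p (%v t. X v (sm t)) \<longleftrightarrow> ess E p X"
  by (rule ess_reparam[OF E c ends av]) (use sm_cont sm_01 in auto)
 moreover have "Y 0 = (%v. cat Z (X v))" by (auto simp: Y_def)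
 ultimately show ?thesis using es by simp
qed

lemma ess_cat_back:
 assumes E: "norm E = 1" and c: "continuous_on (circ E \<times> {0..1}) (%z. X (fst z) (snd z))"
  and ends: "!!v. v \<in> circ E ==> X v 0 = a" "!!v. v \<in> circ E ==> X v 1 = b"
  and av: "!!v t. v \<in> circ E ==> t \<in> {0..1} ==> X v t ~= p"
  and Z: "continuous_on {0..1} Z" "Z 0 = b" "!!t. t \<in> {0..1} ==> Z t ~= p"
  and es: "ess E p X"
 shows "ess E p (%v. cat (X v) Z)"
proof -
 define Y where "Y = (%l v t. cat (X v) Z (t * (1 - l / 2)))"
 have m: "t * (1 - l / 2) \<in> {0..1}" if "l \<in> {0..1}" "t \<in> {0..1}" for l t :: real
  using that mult_le_one[of t "1 - l/2"] by auto
 have cZ: "continuous_on (circ E \<times> {0..1}) (%z. Z (snd z))"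
  by (rule continuous_on_compose2[OF Z(1)]) (auto intro!: continuous_intros)
 have cc: "continuous_on (circ E \<times> {0..1}) (%z. cat (X (fst z)) Z (snd z))"
  by (rule cat_cont[where Y="%_. Z", OF c cZ]) (use Z ends in auto)
 have "ess E p (Y 0) \<longleftrightarrow> ess E p (Y 1)"
 proof (rule ess_homotopic[OF E, where a="%_. a" and b="%l. Z (sm (1 - l))"])
  show "continuous_on ({0..1} \<times> circ E \<times> {0..1}) (%z. Y (fst z) (fst (snd z)) (snd (snd z)))"
   unfolding Y_def by (rule cont_compose_snd[OF cc]) (use m in \<open>auto intro!: continuous_intros\<close>)
  show "Y l v 1 = Z (sm (1 - l))" if "l \<in> {0..1}" "v \<in> circ E" for l v
   using that Z ends by (cases "l = 1") (auto simp: Y_def cat_def)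
  show "Y l v t ~= p" if "l \<in> {0..1}" "v \<in> circ E" "t \<in> {0..1}" for l v t
  proof -
   have "cat (X v) Z u ~= p" if "u \<in> {0..1}" for u
    using that Z(3)[OF sm_01(1), of "2 * u - 1"] av[OF \<open>v \<in> circ E\<close> sm_01(1), of "2 * u"] by (auto simp: cat_def)
   from this[OF m[OF that(1,3)]] show ?thesis by (simp add: Y_def)
  qed
 qed (use ends in \<open>auto simp: Y_def cat_def\<close>)
 moreover have "ess E p (Y 1) \<longleftrightarrow> ess E p (%v t. X v (sm t))"
 proof -
  have "Y 1 v t = X v (sm t)" if "t \<in> {0..1}" for v t
   using that by (auto simp: Y_def cat_def)
  then have "sphmap E (Y 1) z = sphmap E (%v t. X v (sm t)) z" if "z \<in> sphere 0 1" for z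
   using lon(3)[OF E that] unfolding sphmap_def by blast
  then have "homotopic_with_canon (%_. True) (sphere 0 1) (- {p}) (sphmap E (Y 1)) (%_. q) \<longleftrightarrow>
   homotopic_with_canon (%_. True) (sphere 0 1) (- {p}) (sphmap E (%v t. X v (sm t))) (%_. q)" for q
   by (auto elim!: homotopic_with_eq)
  then show ?thesis by (simp add: ess_def)
 qed
 moreover have "ess E p (%v t. X v (sm t)) \<longleftrightarrow> ess E p X"
  by (rule ess_reparam[OF E c ends av]) (use sm_cont sm_01 in auto)
 moreover have "Y 0 = (%v. cat (X v) Z)" by (auto simp: Y_def)
 ultimately show ?thesis using es by simp
qed

text \<open>A subsolution of the eikonal equation grows along a path by at most the cost of the
  path. This is the source of the lower bound near a centre, which the straight-line estimate
  \<open>jac_ge\<close> is too weak to give.\<close>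

lemma (in soft) jac_calibration:
 assumes d: "!!x. (\<phi> has_derivative (%h. \<psi> x \<bullet> h)) (at x)" and n: "!!x. (norm (\<psi> x))^2 <= 2 * G x"
 shows "\<phi> q - \<phi> p <= jac G p q"
 unfolding jac_def
proof (rule cInf_greatest[OF jac_ne])
 fix r assume "r \<in> {jlen G X D |X D. C1 X D & X 0 = p & X 1 = q}"
 then obtain X D where r: "r = jlen G X D" and X: "C1 X D" "X 0 = p" "X 1 = q" by blast
 show "\<phi> q - \<phi> p <= r"
 proof (cases "p = q")
  case True then show ?thesis using jlen_nonneg[OF X(1)] r by simp
 next
  case False
  define T where "T = Topt X D"
  have ne: "X 0 ~= X 1" using X False by simp
  have T: "T > 0" using Topt(1)[OF X(1) ne] by (simp add: T_def)
  have "((%t. \<psi> (X t) \<bullet> D t) has_integral (\<phi> (X 1) - \<phi> (X 0))) {0..1}"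
  proof (rule fundamental_theorem_of_calculus)
   fix t :: real assume t: "t \<in> {0..1}"
   show "((%t. \<phi> (X t)) hvd \<psi> (X t) \<bullet> D t) (at t within {0..1})"
    using has_derivative_compose[OF C1_deriv[OF X(1) t, unfolded has_vector_derivative_def] d]
    by (simp add: has_vector_derivative_def)
  qed simp
  moreover have "((%t. (norm (D t))^2 / (2 * T) + T * G (X t)) has_integral lact G (%_. T) X D) {0..1}"
   unfolding lact_def by (intro integrable_integral integrable_continuous_real lact_cont[OF C1_cont[OF X(1)] C1_contD[OF X(1)]])
    (use T in auto)
  moreover have "\<psi> (X t) \<bullet> D t <= (norm (D t))^2 / (2 * T) + T * G (X t)" for t
  proof -
   have "0 <= (norm (D t - T *\<^sub>R \<psi> (X t)))^2 / (2 * T)" using T by simp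
   also have "... = (norm (D t))^2 / (2 * T) - \<psi> (X t) \<bullet> D t + T * (norm (\<psi> (X t)))^2 / 2"
    using T unfolding power2_norm_eq_inner by (simp add: algebra_simps inner_commute add_divide_distrib diff_divide_distrib)
   also have "... <= (norm (D t))^2 / (2 * T) - \<psi> (X t) \<bullet> D t + T * G (X t)"
    using n[of "X t"] T by (simp add: mult_left_mono)
   finally show ?thesis by simp
  qed
  ultimately have "\<phi> (X 1) - \<phi> (X 0) <= lact G (%_. T) X D"
   by (rule has_integral_le)
  also have "... = r" using lact_const[OF X(1) T] Topt(2)[OF X(1) ne] by (simp add: r T_def)
  finally show ?thesis using X by simp
 qed
qed

text \<open>The class of essential families below \<open>M\<close> is preserved by descent: letting
  the step size grow from zero gives a homotopy whose paths all stay below \<open>M\<close>, and by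
  \<open>av\<close> no such path meets \<open>c\<close>. The bound \<open>l\<close> holds for every
  member of the class, since one of its paths crosses the ray and splits there.\<close>

theorem loop_orbit:
 fixes G :: "real ^ 3 => real"
 assumes s: "soft G g H \<Lambda> \<Gamma> B" and E: "norm E = 1" and ab: "a ~= b"
  and av: "!!X D t. C1 X D ==> X 0 = a ==> X 1 = b ==> jlen G X D <= M ==> t \<in> {0..1} ==> X t ~= c"
  and X0: "fam (circ E) X0 D0" "!!v. v \<in> circ E ==> X0 v 0 = a & X0 v 1 = b & jlen G (X0 v) (D0 v) <= M"
   "ess E c X0"
  and e: "e ~= 0" and lb: "!!s. 0 <= s ==> l <= jac G a (c - s *\<^sub>R e) + jac G (c - s *\<^sub>R e) b"
 shows "\<exists>T>0. \<exists>y v. soft.orbit G g T y v & y 0 = a & y T = b &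
  l <= integral {0..T} (%t. (norm (v t))^2) & integral {0..T} (%t. (norm (v t))^2) <= M"
proof -
 interpret soft G g H \<Lambda> \<Gamma> B by (rule s)
 define K where "K = {(X, D). fam (circ E) X D & (\<forall>v\<in>circ E. X v 0 = a & X v 1 = b & jlen G (X v) (D v) <= M) & ess E c X}"
 have K0: "(X0, D0) \<in> K" using X0 by (simp add: K_def)
 define lev where "lev = (%z. SUP v\<in>circ E. jlen G (fst z v) (snd z v))"
 have "\<exists>T>0. \<exists>y v. orbit T y v & y 0 = a & y T = b & integral {0..T} (%t. (norm (v t))^2) = (INF z\<in>K. SUP v\<in>circ E. jlen G (fst z v) (snd z v))"
 proof (rule minimax[where L=M])
  show "K ~= {}" using K0 by blast
  show "circ E ~= {}" by (rule circ_ne)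
  fix X D assume "(X, D) \<in> K"
  then have f: "fam (circ E) X D" and en: "!!v. v \<in> circ E ==> X v 0 = a & X v 1 = b & jlen G (X v) (D v) <= M"
   and es: "ess E c X" by (auto simp: K_def)
  show "fam (circ E) X D" by (rule f)
  show "X v 0 = a & X v 1 = b & jlen G (X v) (D v) <= M" if "v \<in> circ E" for v by (rule en[OF that])
  define \<beta> where "\<beta> = stepsize M"
  have st: "C1 (stepX (l * \<beta>) (X v) (D v)) (stepD (l * \<beta>) (X v) (D v))"
   "jlen G (stepX (l * \<beta>) (X v) (D v)) (stepD (l * \<beta>) (X v) (D v)) <= M"
   "stepX (l * \<beta>) (X v) (D v) 0 = a" "stepX (l * \<beta>) (X v) (D v) 1 = b"
   if "l \<in> {0..1}" "v \<in> circ E" for l v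
  proof -
   show "C1 (stepX (l * \<beta>) (X v) (D v)) (stepD (l * \<beta>) (X v) (D v))" using fam_C1[OF fam_step[OF f] that(2)] .
   have b: "0 <= l * \<beta>" "l * \<beta> <= stepsize M"
    using that stepsize[of M] by (auto simp: \<beta>_def mult_le_cancel_right1)
   have ne: "X v 0 ~= X v 1" "jlen G (X v) (D v) <= M" using en[OF that(2)] ab by auto
   note sd = step_desc[OF fam_C1[OF f that(2)] ne b]
   show "jlen G (stepX (l * \<beta>) (X v) (D v)) (stepD (l * \<beta>) (X v) (D v)) <= M" using sd(1) ne by linarith
   show "stepX (l * \<beta>) (X v) (D v) 0 = a" "stepX (l * \<beta>) (X v) (D v) 1 = b" using sd(3,4) en[OF that(2)] by auto
  qed
  have "ess E c (%v. stepX (0 * \<beta>) (X v) (D v)) \<longleftrightarrow> ess E c (%v. stepX (1 * \<beta>) (X v) (D v))"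
  proof (rule ess_homotopic[OF E, where X="%l v. stepX (l * \<beta>) (X v) (D v)" and a="%_. a" and b="%_. b"])
   have c1: "continuous_on (circ E \<times> {0..1}) (%z. X (fst z) (snd z))" using f by (simp add: fam_def)
   have c2: "continuous_on (circ E \<times> {0..1}) (%z. Ph (Topt (X (fst z)) (D (fst z))) (X (fst z)) (snd z))"
    using fam_Ph[OF f Topt_cont[OF f]] by (simp add: fam_def)
   have c3: "continuous_on ({0..1::real} \<times> circ E \<times> {0..1}) (%z. X (fst (snd z)) (snd (snd z)))"
    "continuous_on ({0..1::real} \<times> circ E \<times> {0..1}) (%z. Ph (Topt (X (fst (snd z))) (D (fst (snd z)))) (X (fst (snd z))) (snd (snd z)))"
    by (rule continuous_on_compose2[OF c1 continuous_on_snd[OF continuous_on_id]], auto)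
     (rule continuous_on_compose2[OF c2 continuous_on_snd[OF continuous_on_id]], auto)
   show "continuous_on ({0..1} \<times> circ E \<times> {0..1}) (%z. stepX (fst z * \<beta>) (X (fst (snd z))) (D (fst (snd z))) (snd (snd z)))"
    unfolding stepX_def by (intro continuous_intros c3)
  qed (use st av in blast)+
  moreover have "stepX 0 (X v) (D v) = X v" for v by (simp add: stepX_def fun_eq_iff)
  ultimately have "ess E c (%v. stepX \<beta> (X v) (D v))" using es by simp
  then show "(%v. stepX (stepsize M) (X v) (D v), %v. stepD (stepsize M) (X v) (D v)) \<in> K"
   using fam_step[OF f] st[of 1] by (simp add: K_def \<beta>_def)
 qed (rule ab)
 moreover have bd: "bdd_above ((%v. jlen G (fst z v) (snd z v)) ` circ E)" if "z \<in> K" for z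
  using that by (intro bdd_aboveI2[where M=M]) (auto simp: K_def)
 have "lev z \<ge> l" if z: "z \<in> K" for z
 proof -
  obtain X D where zz: "z = (X, D)" by (cases z)
  have f: "fam (circ E) X D" and en: "!!v. v \<in> circ E ==> X v 0 = a & X v 1 = b & jlen G (X v) (D v) <= M"
   and es: "ess E c X" using z zz by (auto simp: K_def)
  have cX: "continuous_on (circ E \<times> {0..1}) (%z. X (fst z) (snd z))" using f by (simp add: fam_def)
  obtain v t s where v: "v \<in> circ E" "t \<in> {0..1}" "0 <= s" "X v t = c - s *\<^sub>R e"
   using ess_hits_ray[OF E cX _ _ e es, of a b] en by blast
  have "l <= jac G (X v 0) (X v t) + jac G (X v t) (X v 1)"
   using lb[OF v(3)] v en[OF v(1)] by simp
  also have "... <= jlen G (X v) (D v)"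
   by (rule jac_split[OF fam_C1[OF f v(1)]]) (use en[OF v(1)] ab v in auto)
  also have "... <= lev z" unfolding lev_def zz fst_conv snd_conv
   using cSUP_upper[OF v(1) bd[OF z]] by (simp add: zz)
  finally show ?thesis .
 qed
 then have "l <= (INF z\<in>K. lev z)" using K0 by (intro cINF_greatest) auto
 moreover have "(INF z\<in>K. lev z) <= lev (X0, D0)"
  using \<open>!!z. z \<in> K ==> l <= lev z\<close> K0 by (intro cINF_lower bdd_belowI2) auto
 moreover have "lev (X0, D0) <= M" unfolding lev_def
  using X0(2) circ_ne by (intro cSUP_least) auto
 ultimately show ?thesis unfolding lev_def by fastforce
qed

section \<open>Zero energy arcs around a centre\<close>

locale arcs =
 fixes \<alpha> \<mu> s :: real and c w1 w2 :: "real ^ 3"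
 assumes al: "1 <= \<alpha>" "\<alpha> < 2" and mu: "0 < \<mu>" and s: "0 < s"
  and w: "norm w1 = 1" "norm w2 = 1" "w1 ~= w2"
begin

text \<open>For the potential \<open>\<mu>^2 / (2 r\<^sup>\<alpha>)\<close> and energy zero the map \<open>z \<mapsto> z\<^sup>\<kappa>\<close> turns orbits in a plane through \<open>c\<close> into straight
 lines: \<open>rho\<close>, \<open>th\<close> parametrise such a line, and \<open>kk v\<close> turns the arc so that it meets the directions \<open>v\<close> and \<open>w1\<close> or \<open>w2\<close>.
 Twice \<open>cost h\<close> bounds the action of the loop; \<open>Y0 < 1\<close> makes it smaller than the cost \<open>2 (\<mu> / \<kappa>) s\<^sup>\<kappa>\<close> of a collision.\<close>

definition "\<kappa> = 1 - \<alpha> / 2"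
definition "hw = norm (w2 - w1) / 2"
definition "E = (w2 - w1) /\<^sub>R norm (w2 - w1)"
definition "\<phi>h = arccos (- sqrt (1 - hw^2))"
definition "Y0 = sin (\<kappa> * \<phi>h)"
definition "C = cos (\<kappa> * \<phi>h)"
definition "Q y = C^2 + (Y0 * y)^2"
definition "rho y = s * Q y powr (1 / (2 * \<kappa>))"
definition "th y = arctan (Y0 * y / C) / \<kappa>"
definition "drho y = rho y * (Y0^2 * y) / (\<kappa> * Q y)"
definition "dth y = Y0 * C / (\<kappa> * Q y)"
definition "kk v = arccos (v \<bullet> w1) / \<phi>h"
definition "nn w v = (w - (v \<bullet> w) *\<^sub>R v) /\<^sub>R sqrt (1 - (v \<bullet> w)^2)"
definition "half w v y = c + rho y *\<^sub>R (cos (kk v * th y) *\<^sub>R v + sin (kk v * th y) *\<^sub>R nn w v)"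
definition "dhalf w v y = drho y *\<^sub>R (cos (kk v * th y) *\<^sub>R v + sin (kk v * th y) *\<^sub>R nn w v) +
 (rho y * (kk v * dth y)) *\<^sub>R (cos (kk v * th y) *\<^sub>R nn w v - sin (kk v * th y) *\<^sub>R v)"
definition "lap y = rho y powr \<alpha> * s powr \<kappa> * Y0 / (\<kappa> * \<mu>)"
definition "cost h = (\<mu> / \<kappa>) * s powr \<kappa> * Y0 + h * (s powr \<alpha> * s powr \<kappa> * Y0 / (\<kappa> * \<mu>))"

lemma kap: "0 < \<kappa>" "\<kappa> <= 1/2" using al by (auto simp: \<kappa>_def)

lemma chi: "0 < hw" "hw <= 1" "sqrt (1 - hw^2) < 1" "0 <= 1 - hw^2"
proof -
 show c0: "0 < hw" using w by (simp add: hw_def)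
 show c1: "hw <= 1" using norm_triangle_ineq4[of w2 w1] w by (simp add: hw_def)
 then show "0 <= 1 - hw^2" using c0 by (simp add: abs_square_le_1)
 show "sqrt (1 - hw^2) < 1" using c0 by simp
qed

text \<open>\<open>\<phi>h\<close> is the largest angle that a direction orthogonal to
  \<open>E\<close> can make with \<open>w1\<close> or \<open>w2\<close>. It stays below pi because
  \<open>w1\<close> and \<open>w2\<close> are distinct and so have nonzero components along
  \<open>E\<close>.\<close>

lemma phih: "0 < \<phi>h" "\<phi>h < pi" "pi / 2 <= \<phi>h"
proof -
 have b: "- 1 < - sqrt (1 - hw^2)" "- sqrt (1 - hw^2) <= 0" using chi by auto
 show "\<phi>h < pi" unfolding \<phi>h_def using arccos_less_mono[of "- sqrt (1 - hw^2)" "- 1"] b by simp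
 show p: "pi / 2 <= \<phi>h" unfolding \<phi>h_def using arccos_le_mono[of "0" "- sqrt (1 - hw^2)"] b by simp
 then show "0 < \<phi>h" using pi_gt_zero by linarith
qed

text \<open>Here \<open>\<alpha> >= 1\<close> enters, as \<open>\<kappa> <= 1/2\<close>. After the
  map \<open>z powr \<kappa>\<close> the arc of largest turning spans the angle
  \<open>2 * \<kappa> * \<phi>h\<close>; a straight line that misses the origin can do so only below
  pi.\<close>

lemma ang: "0 < \<kappa> * \<phi>h" "\<kappa> * \<phi>h < pi / 2"
proof -
 show "0 < \<kappa> * \<phi>h" using kap phih by simp
 have "\<kappa> * \<phi>h <= 1/2 * \<phi>h" using kap phih by (intro mult_right_mono) auto
 then show "\<kappa> * \<phi>h < pi / 2" using phih(2) by linarith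
qed

lemma CY: "0 < C" "0 < Y0" "Y0 < 1" "C^2 + Y0^2 = 1"
proof -
 show C: "0 < C" unfolding C_def using ang by (intro cos_gt_zero_pi) auto
 show Y: "0 < Y0" unfolding Y0_def using ang by (intro sin_gt_zero) auto
 show 1: "C^2 + Y0^2 = 1" by (simp add: C_def Y0_def)
 then show "Y0 < 1" using C Y by (smt (verit, best) power2_less_imp_less one_power2 zero_less_power)
qed

lemma Qpos: "0 < Q y" using CY by (simp add: Q_def add_pos_nonneg)

lemma Q_le: "y \<in> {0..1} ==> Q y <= 1"
proof -
 assume y: "y \<in> {0..1}"
 have "(Y0 * y)^2 <= (Y0 * 1)^2" using y CY by (intro power_mono mult_left_mono) auto
 then show ?thesis using CY(4) by (simp add: Q_def)
qed

lemma rho: "0 < rho y" "y \<in> {0..1} ==> rho y <= s" "rho 1 = s"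
proof -
 show "0 < rho y" unfolding rho_def using s Qpos[of y] by (intro mult_pos_pos) auto
 show "rho y <= s" if "y \<in> {0..1}"
  unfolding rho_def using s Q_le[OF that] Qpos[of y] kap by (intro mult_left_le powr_le1) auto
 show "rho 1 = s" using CY by (simp add: rho_def Q_def)
qed

lemma rho_powr: "rho y powr (2 * \<kappa>) = s powr (2 * \<kappa>) * Q y"
 using s Qpos[of y] kap by (simp add: rho_def powr_mult powr_powr)

lemma th: "y \<in> {0..1} ==> 0 <= th y & th y <= \<phi>h" "th 0 = 0" "th 1 = \<phi>h"
proof -
 have "arctan (Y0 / C) = \<kappa> * \<phi>h"
  using arctan_tan[of "\<kappa> * \<phi>h"] ang by (simp add: Y0_def C_def tan_def)
 then show t1: "th 1 = \<phi>h" using kap by (simp add: th_def)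
 show "th 0 = 0" by (simp add: th_def)
 assume y: "y \<in> {0..1}"
 have "0 <= Y0 * y / C" "Y0 * y / C <= Y0 * 1 / C" using y CY by (auto intro!: divide_right_mono mult_left_mono)
 then have "0 <= arctan (Y0 * y / C)" "arctan (Y0 * y / C) <= arctan (Y0 * 1 / C)"
  by (auto simp: arctan_monotone')
 then have "0 <= th y" "th y <= th 1" unfolding th_def using kap by (auto intro: divide_right_mono)
 then show "0 <= th y & th y <= \<phi>h" using t1 by simp
qed

lemma drho: "(rho hrd drho y) (at y within S)"
proof -
 have "((%y. s * Q y powr (1 / (2 * \<kappa>))) has_real_derivative
  s * ((1 / (2 * \<kappa>)) * Q y powr (1 / (2 * \<kappa>) - 1) * (2 * (Y0^2 * y)))) (at y within S)"
  unfolding Q_def using Qpos[of y, unfolded Q_def]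
  by (auto intro!: derivative_eq_intros simp: power2_eq_square)
 moreover have "s * ((1 / (2 * \<kappa>)) * Q y powr (1 / (2 * \<kappa>) - 1) * (2 * (Y0^2 * y))) = drho y"
 proof -
  have "Q y powr (1 / (2 * \<kappa>) - 1) = Q y powr (1 / (2 * \<kappa>)) / Q y"
   using powr_diff[of "Q y" "1 / (2 * \<kappa>)" 1] Qpos[of y] by simp
  then show ?thesis using kap by (simp add: drho_def rho_def)
 qed
 ultimately show ?thesis by (simp add: rho_def[abs_def])
qed

lemma dth: "(th hrd dth y) (at y within S)"
proof -
 have "((%y. Y0 * y / C) hrd Y0 / C) (at y within S)"
  using CY(1) by (auto intro!: derivative_eq_intros)
 from DERIV_cdivide[OF DERIV_chain2[OF DERIV_arctan this], of \<kappa>]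
 have "((%y. arctan (Y0 * y / C) / \<kappa>) hrd (inverse (1 + (Y0 * y / C)^2) * (Y0 / C)) / \<kappa>) (at y within S)" .
 moreover have "(inverse (1 + (Y0 * y / C)^2) * (Y0 / C)) / \<kappa> = dth y"
 proof -
  have "1 + (Y0 * y / C)^2 = Q y / C^2" using CY by (simp add: Q_def field_simps)
  then show ?thesis using CY kap Qpos[of y] by (simp add: dth_def power2_eq_square mult.commute)
 qed
 ultimately show ?thesis by (simp add: th_def[abs_def])
qed

lemma wE: "w1 \<bullet> E = - hw" "w2 \<bullet> E = hw" "norm E = 1"
proof -
 have i: "w1 \<bullet> w1 = 1" "w2 \<bullet> w2 = 1" using w by (auto simp: norm_eq_1)
 have "(norm (w2 - w1))^2 = 2 - 2 * (w1 \<bullet> w2)"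
  unfolding power2_norm_eq_inner using i by (simp add: inner_diff_left inner_diff_right inner_commute)
 then have "w1 \<bullet> w2 = 1 - (norm (w2 - w1))^2 / 2" by linarith
 moreover have "norm (w2 - w1) ~= 0" using w by simp
 ultimately show "w1 \<bullet> E = - hw" "w2 \<bullet> E = hw" using i
  by (auto simp: E_def hw_def inner_diff_right inner_commute field_simps power2_eq_square)
 show "norm E = 1" using w by (simp add: E_def)
qed

lemma circ_w:
 assumes v: "v \<in> circ E"
 shows "v \<bullet> w1 = v \<bullet> w2" "(v \<bullet> w1)^2 <= 1 - hw^2" "norm v = 1"
proof -
 have vE: "v \<bullet> E = 0" and nv: "v \<bullet> v = 1" using v by (auto simp: circ_def norm_eq_1)
 show "norm v = 1" using v by (simp add: circ_def)
 have "norm (w2 - w1) ~= 0" using w by simp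
 then show "v \<bullet> w1 = v \<bullet> w2" using vE by (simp add: E_def inner_diff_right)
 define z where "z = w1 + hw *\<^sub>R E"
 have EE: "E \<bullet> E = 1" "w1 \<bullet> w1 = 1" using wE w by (auto simp: norm_eq_1)
 have "v \<bullet> w1 = v \<bullet> z" using vE by (simp add: z_def inner_add_right)
 then have "(v \<bullet> w1)^2 <= (v \<bullet> v) * (z \<bullet> z)" using Cauchy_Schwarz_ineq[of v z] by simp
 also have "z \<bullet> z = 1 - hw^2"
  using EE wE by (simp add: z_def inner_add_left inner_add_right inner_commute power2_eq_square algebra_simps)
 finally show "(v \<bullet> w1)^2 <= 1 - hw^2" using nv by simp
qed

text \<open>The factor shrinks the angle of the extremal arc to the one actually needed for
  \<open>v\<close>. Being at most 1 it never raises the speed.\<close>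

lemma kk:
 assumes v: "v \<in> circ E"
 shows "0 <= kk v" "kk v <= 1" "kk v * \<phi>h = arccos (v \<bullet> w1)"
  "y \<in> {0..1} ==> 0 <= kk v * th y & kk v * th y <= pi"
proof -
 have b: "\<bar>v \<bullet> w1\<bar> <= sqrt (1 - hw^2)" using circ_w(2)[OF v] by (simp add: real_le_rsqrt)
 then have b1: "\<bar>v \<bullet> w1\<bar> <= 1" using chi by linarith
 have a: "0 <= arccos (v \<bullet> w1)" "arccos (v \<bullet> w1) <= \<phi>h"
 proof -
  show "0 <= arccos (v \<bullet> w1)" using b1 by (intro arccos_lbound) auto
  show "arccos (v \<bullet> w1) <= \<phi>h" unfolding \<phi>h_def by (rule arccos_le_arccos) (use b b1 chi in linarith)+
 qed
 show k0: "0 <= kk v" and k1: "kk v <= 1" using a phih by (auto simp: kk_def)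
 show "kk v * \<phi>h = arccos (v \<bullet> w1)" using phih by (simp add: kk_def)
 assume y: "y \<in> {0..1}"
 have "kk v * th y <= 1 * th y" using th(1)[OF y] k1 by (intro mult_right_mono) auto
 then show "0 <= kk v * th y & kk v * th y <= pi" using th(1)[OF y] k0 phih by auto
qed

lemma nn:
 assumes v: "v \<in> circ E" and ww: "ww = w1 \<or> ww = w2"
 shows "0 < 1 - (v \<bullet> ww)^2" "nn ww v \<bullet> v = 0" "norm (nn ww v) = 1"
  "cos (arccos (v \<bullet> w1)) *\<^sub>R v + sin (arccos (v \<bullet> w1)) *\<^sub>R nn ww v = ww" "nn ww v \<bullet> E = (ww \<bullet> E) / sqrt (1 - (v \<bullet> ww)^2)"
proof -
 note cw = circ_w[OF v]
 have vw: "v \<bullet> ww = v \<bullet> w1" using ww cw by auto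
 have "0 < hw^2" using chi by simp
 then show p: "0 < 1 - (v \<bullet> ww)^2" using cw(2) unfolding vw by linarith
 define d where "d = sqrt (1 - (v \<bullet> ww)^2)"
 have d: "d > 0" "d^2 = 1 - (v \<bullet> ww)^2" using p by (auto simp: d_def)
 have i: "v \<bullet> v = 1" "ww \<bullet> ww = 1" "v \<bullet> E = 0" using v ww w by (auto simp: circ_def norm_eq_1)
 show "nn ww v \<bullet> v = 0" using i by (simp add: nn_def inner_diff_left inner_diff_right inner_commute)
 have "(ww - (v \<bullet> ww) *\<^sub>R v) \<bullet> (ww - (v \<bullet> ww) *\<^sub>R v) = d^2"
  using i d by (simp add: inner_diff_left inner_diff_right inner_commute power2_eq_square)
 then have "norm (ww - (v \<bullet> ww) *\<^sub>R v) = sqrt (d^2)" by (simp only: norm_eq_sqrt_inner)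
 then have "norm (ww - (v \<bullet> ww) *\<^sub>R v) = d" using d(1) by simp
 then show "norm (nn ww v) = 1" using d by (simp add: nn_def d_def[symmetric])
 have a1: "\<bar>v \<bullet> w1\<bar> <= 1" using p vw by (simp add: abs_square_le_1[symmetric])
 then have "cos (arccos (v \<bullet> w1)) = v \<bullet> ww" "sin (arccos (v \<bullet> w1)) = d"
  using vw by (auto simp: d_def sin_arccos_abs)
 then show "cos (arccos (v \<bullet> w1)) *\<^sub>R v + sin (arccos (v \<bullet> w1)) *\<^sub>R nn ww v = ww"
  using d by (simp add: nn_def d_def[symmetric])
 show "nn ww v \<bullet> E = (ww \<bullet> E) / sqrt (1 - (v \<bullet> ww)^2)"
  using i by (simp add: nn_def inner_diff_left divide_inverse mult.commute)
qed

text \<open>For the speed bound, \<open>kk v\<close> is replaced by 1. The extremal arc is the image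
  of a straight line, so the squares of radial and angular speed add up to a multiple of
  \<open>(rho y)^2 / Q y\<close>; by \<open>rho_powr\<close> and
  \<open>2 - 2 * \<kappa> = \<alpha>\<close> this is a constant times
  \<open>rho y powr \<alpha>\<close>.\<close>

lemma half:
 assumes v: "v \<in> circ E" and ww: "ww = w1 \<or> ww = w2"
 shows "half ww v 1 = c + s *\<^sub>R ww" "half ww v 0 = c + rho 0 *\<^sub>R v" "norm (half ww v y - c) = rho y"
  "(norm (dhalf ww v y))^2 <= rho y powr \<alpha> * s powr (2 * \<kappa>) * Y0^2 / \<kappa>^2"
proof -
 note n = nn[OF v ww]
 have i: "v \<bullet> v = 1" "nn ww v \<bullet> nn ww v = 1" "nn ww v \<bullet> v = 0" "v \<bullet> nn ww v = 0"
  using n circ_w(3)[OF v] by (auto simp: norm_eq_1 inner_commute)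
 show "half ww v 1 = c + s *\<^sub>R ww"
  unfolding half_def th kk(3)[OF v] n(4) rho by simp
 show "half ww v 0 = c + rho 0 *\<^sub>R v" by (simp add: half_def th)
 define x z where "x = cos (kk v * th y) *\<^sub>R v + sin (kk v * th y) *\<^sub>R nn ww v"
  and "z = cos (kk v * th y) *\<^sub>R nn ww v - sin (kk v * th y) *\<^sub>R v"
 have xz: "x \<bullet> x = 1" "z \<bullet> z = 1" "x \<bullet> z = 0" "z \<bullet> x = 0"
  unfolding x_def z_def using i
  by (auto simp: inner_add_left inner_add_right inner_diff_left inner_diff_right power2_eq_square[symmetric])
 have "norm x = 1" using xz by (simp add: norm_eq_1)
 then show "norm (half ww v y - c) = rho y"
  using rho(1)[of y] unfolding half_def x_def[symmetric] by simp
 have "(norm (dhalf ww v y))^2 = (drho y)^2 + (rho y * (kk v * dth y))^2"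
  unfolding dhalf_def x_def[symmetric] z_def[symmetric] power2_norm_eq_inner
  using xz by (simp add: inner_add_left inner_add_right power2_eq_square)
 also have "... <= (drho y)^2 + (rho y * (1 * dth y))^2"
 proof -
  have "0 <= dth y" using CY kap Qpos[of y] by (simp add: dth_def)
  then have "(rho y * (kk v * dth y))^2 <= (rho y * (1 * dth y))^2"
   using kk(1,2)[OF v] rho(1)[of y] by (intro power_mono mult_left_mono mult_right_mono) auto
  then show ?thesis by simp
 qed
 also have "... = (rho y)^2 * Y0^2 * Q y / (\<kappa>^2 * (Q y)^2)"
 proof -
  have "(rho y * (Y0^2 * y))^2 + (rho y * (Y0 * C))^2 = (rho y)^2 * Y0^2 * Q y"
   by (simp add: Q_def algebra_simps power_mult_distrib power2_eq_square)
  then have "((rho y * (Y0^2 * y))^2 + (rho y * (Y0 * C))^2) / (\<kappa> * Q y)^2 = (rho y)^2 * Y0^2 * Q y / (\<kappa> * Q y)^2" by simp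
  then show ?thesis by (simp add: drho_def dth_def power_divide add_divide_distrib power_mult_distrib)
 qed
 also have "... = (rho y)^2 / Q y * Y0^2 / \<kappa>^2" using Qpos[of y] kap by (simp add: field_simps power2_eq_square)
 also have "(rho y)^2 / Q y = rho y powr \<alpha> * s powr (2 * \<kappa>)"
 proof -
  have "(rho y)^2 = rho y powr \<alpha> * rho y powr (2 * \<kappa>)"
   using rho(1)[of y] by (simp add: \<kappa>_def powr_add[symmetric] powr_numeral)
  then show ?thesis using Qpos[of y] by (simp add: rho_powr)
 qed
 finally show "(norm (dhalf ww v y))^2 <= rho y powr \<alpha> * s powr (2 * \<kappa>) * Y0^2 / \<kappa>^2" .
qed

lemma half_side:
 assumes v: "v \<in> circ E" and y: "y \<in> {0..1}"
 shows "(half w1 v y - c) \<bullet> E <= 0" "0 <= (half w2 v y - c) \<bullet> E"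
proof -
 have sn: "0 <= sin (kk v * th y)" using kk(4)[OF v y] by (intro sin_ge_zero) auto
 have vE: "v \<bullet> E = 0" using v by (simp add: circ_def)
 have h: "(half ww v y - c) \<bullet> E = rho y * (sin (kk v * th y) * (nn ww v \<bullet> E))" for ww
  using vE by (simp add: half_def inner_add_left)
 have "nn w1 v \<bullet> E <= 0" "0 <= nn w2 v \<bullet> E"
  unfolding nn(5)[OF v disjI1[OF refl]] nn(5)[OF v disjI2[OF refl]] wE
  using chi nn(1)[OF v, of w1] nn(1)[OF v, of w2] by (auto intro!: divide_nonpos_nonneg divide_nonneg_nonneg)
 then show "(half w1 v y - c) \<bullet> E <= 0" "0 <= (half w2 v y - c) \<bullet> E"
  unfolding h using sn rho(1)[of y] by (auto intro!: mult_nonneg_nonpos mult_nonneg_nonneg)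
qed

lemma fam_half:
 assumes ww: "ww = w1 \<or> ww = w2"
 shows "fam (circ E) (half ww) (dhalf ww)"
 unfolding fam_def
proof (intro conjI ballI)
 have crho: "continuous_on A rho" for A using drho by (rule DERIV_continuous_on)
 have cth: "continuous_on A th" for A using dth by (rule DERIV_continuous_on)
 have Q0: "Q y ~= 0" for y using Qpos[of y] by simp
 have cQ: "continuous_on A Q" for A unfolding Q_def[abs_def] by (intro continuous_intros)
 have cdrho: "continuous_on A drho" for A unfolding drho_def[abs_def]
  using kap Q0 by (intro continuous_intros crho cQ) auto
 have cdth: "continuous_on A dth" for A unfolding dth_def[abs_def]
  using kap Q0 by (intro continuous_intros cQ) auto
 have k1: "\<bar>v \<bullet> w1\<bar> <= 1" if "v \<in> circ E" for v
  using nn(1)[OF that, of w1] by (simp add: abs_square_le_1[symmetric])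
 have ckk: "continuous_on (circ E) kk" unfolding kk_def[abs_def]
  using k1 phih by (intro continuous_intros) (auto simp: abs_le_iff)
 have cnn: "continuous_on (circ E) (nn ww)" unfolding nn_def[abs_def]
  using nn(1)[OF _ ww] by (intro continuous_intros) force+
 note cf = continuous_on_compose2[OF _ continuous_on_fst[OF continuous_on_id], of "circ E" _ "circ E \<times> {0..1::real}"]
 note cs = continuous_on_compose2[OF _ continuous_on_snd[OF continuous_on_id], of "{0..1::real}" _ "circ E \<times> {0..1::real}"]
 have c1: "continuous_on (circ E \<times> {0..1::real}) (%z. kk (fst z))" "continuous_on (circ E \<times> {0..1::real}) (%z. nn ww (fst z))"
  by (rule cf, use ckk cnn in auto)+
 have c2: "continuous_on (circ E \<times> {0..1::real}) (%z. rho (snd z))" "continuous_on (circ E \<times> {0..1::real}) (%z. th (snd z))"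
  "continuous_on (circ E \<times> {0..1::real}) (%z. drho (snd z))" "continuous_on (circ E \<times> {0..1::real}) (%z. dth (snd z))"
  by (rule cs, use crho cth cdrho cdth in auto)+
 show "continuous_on (circ E \<times> {0..1}) (%z. half ww (fst z) (snd z))"
  unfolding half_def by (intro continuous_intros c1 c2)
 show "continuous_on (circ E \<times> {0..1}) (%z. dhalf ww (fst z) (snd z))"
  unfolding dhalf_def by (intro continuous_intros c1 c2)
 fix v t
 have cs: "((%y. cos (kk v * th y)) hrd - sin (kk v * th t) * (kk v * dth t)) (at t within {0..1})"
  "((%y. sin (kk v * th y)) hrd cos (kk v * th t) * (kk v * dth t)) (at t within {0..1})"
  by (auto intro!: derivative_eq_intros dth)
 note d = has_vector_derivative_add[OF has_vector_derivative_const[of c]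
  has_vector_derivative_scaleR[OF drho has_vector_derivative_add[OF
   has_vector_derivative_scaleR[OF cs(1) has_vector_derivative_const[of v]]
   has_vector_derivative_scaleR[OF cs(2) has_vector_derivative_const[of "nn ww v"]]]]]
 show "(half ww v hvd dhalf ww v t) (at t within {0..1})"
  unfolding half_def[abs_def] dhalf_def
  by (rule has_vector_derivative_eq_rhs[OF d]) (simp add: algebra_simps)
qed

lemma lap: "0 < lap y" "continuous_on A lap"
proof -
 show "0 < lap y" using rho(1)[of y] s CY kap mu by (simp add: lap_def)
 have crho: "continuous_on A rho" using drho by (rule DERIV_continuous_on)
 show "continuous_on A lap" unfolding lap_def[abs_def]
  using rho(1) kap mu by (intro continuous_intros crho) (auto simp: less_imp_neq[symmetric])
qed

text \<open>The lapse \<open>lap\<close> balances the two terms: the kinetic part and the singular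
  part of the potential are each at most half of
  \<open>(\<mu> / \<kappa>) * s powr \<kappa> * Y0\<close>, at every parameter. The regular part
  \<open>h\<close> only adds a higher order term in \<open>s\<close>.\<close>

lemma half_act:
 assumes so: "soft G g H \<Lambda> \<Gamma> B" and v: "v \<in> circ E" and ww: "ww = w1 \<or> ww = w2"
  and G: "!!x. x ~= c ==> norm (x - c) <= s ==> G x <= h + \<mu>^2 / 2 * norm (x - c) powr (- \<alpha>)" and h: "0 <= h"
 shows "lact G lap (half ww v) (dhalf ww v) <= cost h"
proof -
 interpret soft G g H \<Lambda> \<Gamma> B by (rule so)
 note C1h = fam_C1[OF fam_half[OF ww] v]
 have "lact G lap (half ww v) (dhalf ww v) <= integral {0..1::real} (%_. cost h)"
  unfolding lact_def
 proof (rule integral_le)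
  show "(%t. (norm (dhalf ww v t))^2 / (2 * lap t) + lap t * G (half ww v t)) integrable_on {0..1}"
   by (intro integrable_continuous_real lact_cont C1_cont[OF C1h] C1_contD[OF C1h] lap)
  fix y :: real assume y: "y \<in> {0..1}"
  define K where "K = s powr \<kappa> * Y0 / (\<kappa> * \<mu>)"
  have K: "0 < K" using s CY kap mu by (simp add: K_def)
  have R: "0 < rho y powr \<alpha>" using rho(1)[of y] by simp
  have L: "lap y = rho y powr \<alpha> * K" by (simp add: lap_def K_def)
  have "(norm (dhalf ww v y))^2 / (2 * lap y) <= (rho y powr \<alpha> * s powr (2 * \<kappa>) * Y0^2 / \<kappa>^2) / (2 * lap y)"
   using half(4)[OF v ww] lap(1)[of y] by (intro divide_right_mono) auto
  also have "... = (\<mu> / \<kappa>) * s powr \<kappa> * Y0 / 2"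
  proof -
   have "s powr (2 * \<kappa>) = s powr \<kappa> * s powr \<kappa>" by (simp add: powr_add[symmetric])
   then show ?thesis unfolding L K_def using R CY kap mu s by (simp add: field_simps power2_eq_square)
  qed
  finally have 1: "(norm (dhalf ww v y))^2 / (2 * lap y) <= (\<mu> / \<kappa>) * s powr \<kappa> * Y0 / 2" .
  have nh: "norm (half ww v y - c) = rho y" by (rule half(3)[OF v ww])
  then have "half ww v y ~= c" using rho(1)[of y] by auto
  then have "G (half ww v y) <= h + \<mu>^2 / 2 * rho y powr (- \<alpha>)"
   using G[of "half ww v y"] nh rho(2)[OF y] by simp
  then have "lap y * G (half ww v y) <= lap y * (h + \<mu>^2 / 2 * rho y powr (- \<alpha>))"
   using lap(1)[of y] by simp
  also have "... = h * lap y + K * \<mu>^2 / 2"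
   using R unfolding L by (simp add: powr_minus field_simps)
  also have "... <= h * (s powr \<alpha> * K) + K * \<mu>^2 / 2"
   using h K rho(1)[of y] rho(2)[OF y] al unfolding L by (intro add_mono mult_left_mono mult_right_mono powr_mono2) auto
  also have "K * \<mu>^2 / 2 = (\<mu> / \<kappa>) * s powr \<kappa> * Y0 / 2"
   using mu by (simp add: K_def power2_eq_square)
  finally show "(norm (dhalf ww v y))^2 / (2 * lap y) + lap y * G (half ww v y) <= cost h"
   using 1 unfolding cost_def K_def by (simp add: field_simps)
 qed (rule integrable_const_ivl)
 then show ?thesis by simp
qed

end

section \<open>Families of paths that sweep around a centre\<close>

lemma onto_01:
 assumes "continuous_on {0..1} \<theta>" "\<theta> 0 = 0" "\<theta> 1 = 1" "t \<in> {0..1::real}"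
 obtains x where "x \<in> {0..1::real}" "\<theta> x = t"
 using IVT'[of \<theta> 0 t 1] assms by fastforce

lemma cat_left: "x \<in> {0..1} ==> cat X Y (x / 2) = X (sm x)"
 by (simp add: cat_def)

lemma cat_right: "X 1 = Y 0 ==> x \<in> {0..1} ==> cat X Y (1/2 + x / 2) = Y (sm x)"
 by (cases "x = 0") (auto simp: cat_def algebra_simps)

context arcs
begin

text \<open>Two half arcs, the first one reversed, are joined in the middle and prolonged by almost
  minimal paths to \<open>a\<close> and \<open>b\<close>. All joints are made with lapses, and a
  single change of parameter at the end turns the total into \<open>jlen\<close>.\<close>

theorem gain:
 assumes so: "soft G g H \<Lambda> \<Gamma> B" and h: "0 <= h"
  and G: "!!x. x ~= c ==> norm (x - c) <= s ==> G x <= h + \<mu>^2 / 2 * norm (x - c) powr (- \<alpha>)"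
  and lt: "jac G a (c + s *\<^sub>R w1) + jac G (c + s *\<^sub>R w2) b + 2 * cost h < M"
  and av: "!!X D t. C1 X D ==> X 0 = a ==> X 1 = b ==> jlen G X D <= M ==> t \<in> {0..1} ==> X t ~= c"
 shows "\<exists>X D. fam (circ E) X D & (\<forall>v\<in>circ E. X v 0 = a & X v 1 = b & jlen G (X v) (D v) <= M) & ess E c X"
proof -
 interpret soft G g H \<Lambda> \<Gamma> B by (rule so)
 define p q where "p = c + s *\<^sub>R w1" and "q = c + s *\<^sub>R w2"
 define \<epsilon> where "\<epsilon> = M - (jac G a p + jac G q b + 2 * cost h)"
 have e: "\<epsilon> > 0" using lt by (simp add: \<epsilon>_def p_def q_def)
 have B: "B > 0" using Gpos GB less_le_trans by blast
 \<comment> \<open>The slack \<open>\<epsilon>\<close> pays for five items of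
   \<open>\<epsilon> / 8\<close>: the two almost minimal prolongations and the three joints.\<close>
 define d where "d = \<epsilon> / (8 * B)"
 have d: "d > 0" "d * B = \<epsilon> / 8" using e B by (auto simp: d_def)
 obtain Z DZ T where Z: "C1 Z DZ" "Z 0 = a" "Z 1 = p" "T > 0" "lact G (%_. T) Z DZ < jac G a p + \<epsilon> / 8"
  using jac_near_T[of a p "jac G a p + \<epsilon> / 8"] e by auto
 obtain W DW S where W: "C1 W DW" "W 0 = q" "W 1 = b" "S > 0" "lact G (%_. S) W DW < jac G q b + \<epsilon> / 8"
  using jac_near_T[of q b "jac G q b + \<epsilon> / 8"] e by auto
 define A1 where "A1 = (%v t. half w1 v (1 - t))"
 define D1 where "D1 = (%v t. (-1) *\<^sub>R dhalf w1 v (1 - t))"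
 have f1: "fam (circ E) A1 D1" unfolding A1_def D1_def
  by (rule fam_compose[OF fam_half, of w1 "%_. -1" "%t. 1 - t"]) (auto intro!: derivative_eq_intros)
 have f2: "fam (circ E) (half w2) (dhalf w2)" by (rule fam_half) simp
 have a1: "lact G (%t. lap (1 - t)) (A1 v) (D1 v) <= cost h" if v: "v \<in> circ E" for v
 proof -
  note C = fam_C1[OF fam_half v, of w1]
  have "lact G (%t. lap (1 - t)) (A1 v) (D1 v) = lact G lap (half w1 v) (dhalf w1 v)"
   unfolding lact_def A1_def D1_def
   using integral_reverse01[OF lact_cont[OF C1_cont[OF C] C1_contD[OF C] lap(2) lap(1)]] by simp
  then show ?thesis using half_act[OF so v _ G h, of w1] by simp
 qed
 have a2: "lact G lap (half w2 v) (dhalf w2 v) <= cost h" if v: "v \<in> circ E" for v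
  using half_act[OF so v _ G h, of w2] by simp
 have j1: "A1 v 1 = half w2 v 0" "A1 v 0 = p" "half w2 v 1 = q" if "v \<in> circ E" for v
  using half(1,2)[OF that] by (auto simp: A1_def p_def q_def)
 define F1 where "F1 = (%v. cat (A1 v) (half w2 v))"
 define N1 where "N1 = catN d (%t. lap (1 - t)) lap"
 have l1: "continuous_on {0..1} (%t. lap (1 - t))"
  by (intro continuous_on_compose2[OF lap(2)[of UNIV]] continuous_intros) auto
 have fF1: "fam (circ E) F1 (%v. catD (D1 v) (dhalf w2 v))"
  unfolding F1_def by (rule fam_cat[OF f1 f2 j1(1)])
 have N1: "continuous_on {0..1} N1" "!!t. t \<in> {0..1} ==> 0 < N1 t"
  unfolding N1_def by (rule catN; use l1 lap d in auto)+
 have aF1: "lact G N1 (F1 v) (catD (D1 v) (dhalf w2 v)) <= 2 * cost h + d * B" if v: "v \<in> circ E" for v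
  using lact_cat[OF fam_C1[OF f1 v] fam_C1[OF f2 v] j1(1)[OF v] l1 lap(1) lap(2) lap(1) d(1)] a1[OF v] a2[OF v]
  by (simp add: F1_def N1_def)
 have eF1: "F1 v 0 = p" "F1 v 1 = q" if "v \<in> circ E" for v using j1[OF that] by (auto simp: F1_def)
 define F2 where "F2 = (%v. cat Z (F1 v))"
 define N2 where "N2 = catN d (%_. T) N1"
 have fF2: "fam (circ E) F2 (%v. catD DZ (catD (D1 v) (dhalf w2 v)))"
  unfolding F2_def by (rule fam_cat[OF C1_fam[OF Z(1)] fF1]) (use Z eF1 in auto)
 have N2: "continuous_on {0..1} N2" "!!t. t \<in> {0..1} ==> 0 < N2 t"
  unfolding N2_def by (rule catN; use N1 Z d in auto)+
 have aF2: "lact G N2 (F2 v) (catD DZ (catD (D1 v) (dhalf w2 v))) <= jac G a p + \<epsilon> / 8 + 2 * cost h + 2 * (d * B)" if v: "v \<in> circ E" for v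
 proof -
  have "lact G N2 (F2 v) (catD DZ (catD (D1 v) (dhalf w2 v))) <= lact G (%_. T) Z DZ + lact G N1 (F1 v) (catD (D1 v) (dhalf w2 v)) + d * B"
   unfolding F2_def N2_def by (rule lact_cat[OF Z(1) fam_C1[OF fF1 v]]) (use Z eF1[OF v] N1 d in auto)
  then show ?thesis using Z(5) aF1[OF v] by linarith
 qed
 have eF2: "F2 v 0 = a" "F2 v 1 = q" if "v \<in> circ E" for v using eF1[OF that] Z by (auto simp: F2_def)
 define F3 where "F3 = (%v. cat (F2 v) W)"
 define D3 where "D3 = (%v. catD (catD DZ (catD (D1 v) (dhalf w2 v))) DW)"
 define N3 where "N3 = catN d N2 (%_. S)"
 have fF3: "fam (circ E) F3 D3"
  unfolding F3_def D3_def by (rule fam_cat[OF fF2 C1_fam[OF W(1)]]) (use W eF2 in auto)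
 have N3: "continuous_on {0..1} N3" "!!t. t \<in> {0..1} ==> 0 < N3 t"
  unfolding N3_def by (rule catN; use N2 W d in auto)+
 have aF3: "lact G N3 (F3 v) (D3 v) <= M" if v: "v \<in> circ E" for v
 proof -
  have "lact G N3 (F3 v) (D3 v) <= lact G N2 (F2 v) (catD DZ (catD (D1 v) (dhalf w2 v))) + lact G (%_. S) W DW + d * B"
   unfolding F3_def N3_def D3_def by (rule lact_cat[OF fam_C1[OF fF2 v] W(1)]) (use W eF2[OF v] N2 d in auto)
  then have "lact G N3 (F3 v) (D3 v) <= jac G a p + jac G q b + 2 * cost h + 2 * (\<epsilon> / 8) + 3 * (d * B)"
   using W(5) aF2[OF v] by linarith
  moreover have "jac G a p + jac G q b + 2 * cost h = M - \<epsilon>" by (simp add: \<epsilon>_def)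
  ultimately show ?thesis using d(2) e by linarith
 qed
 have eF3: "F3 v 0 = a" "F3 v 1 = b" if "v \<in> circ E" for v using eF2[OF that] W by (auto simp: F3_def)
 obtain \<theta> \<theta>' where th: "continuous_on {0..1} \<theta>" "!!t. t \<in> {0..1} ==> \<theta> t \<in> {0..1}" "\<theta> 0 = 0" "\<theta> 1 = 1"
  and R: "fam (circ E) (%v t. F3 v (\<theta> t)) (%v t. \<theta>' t *\<^sub>R D3 v (\<theta> t))"
  and Rj: "!!v. v \<in> circ E ==> jlen G (%t. F3 v (\<theta> t)) (%t. \<theta>' t *\<^sub>R D3 v (\<theta> t)) <= lact G N3 (F3 v) (D3 v)"
  by (rule reparam[OF fF3 N3]) auto
 \<comment> \<open>Costing at most \<open>M\<close>, the finished paths miss \<open>c\<close> by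
   hypothesis. Read back through the changes of parameter, this shows that the prolongations
   \<open>Z\<close> and \<open>W\<close> miss \<open>c\<close> too, which is needed to keep the
   family essential.\<close>
 have av3: "F3 v t ~= c" if v: "v \<in> circ E" and t: "t \<in> {0..1}" for v t
 proof -
  obtain x where "x \<in> {0..1}" "\<theta> x = t" using onto_01[OF th(1,3,4) t] .
  then show ?thesis
   using av[OF fam_C1[OF R v]] eF3[OF v] th Rj[OF v] aF3[OF v] by fastforce
 qed
 obtain v0 where v0: "v0 \<in> circ E" using circ_ne by blast
 note cs = sm_cont(1)[of "{0..1}"]
 have av2: "F2 v t ~= c" if v: "v \<in> circ E" and t: "t \<in> {0..1}" for v t
 proof -
  obtain x where x: "x \<in> {0..1}" "sm x = t" using onto_01[OF cs _ _ t] by auto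
  then show ?thesis using av3[OF v, of "x / 2"] cat_left[OF x(1), of "F2 v" W] by (simp add: F3_def)
 qed
 have avZ: "Z t ~= c" if t: "t \<in> {0..1}" for t
 proof -
  obtain x where x: "x \<in> {0..1}" "sm x = t" using onto_01[OF cs _ _ t] by auto
  then show ?thesis using av2[OF v0, of "x / 2"] cat_left[OF x(1), of Z "F1 v0"] by (simp add: F2_def)
 qed
 have avW: "W t ~= c" if t: "t \<in> {0..1}" for t
 proof -
  obtain x where x: "x \<in> {0..1}" "sm x = t" using onto_01[OF cs _ _ t] by auto
  have "F2 v0 1 = W 0" using eF2[OF v0] W by simp
  then show ?thesis using av3[OF v0, of "1/2 + x / 2"] cat_right[OF _ x(1), of "F2 v0" W] x by (simp add: F3_def)
 qed
 have s01: "t \<in> {0..1/2} ==> 1 - sm (2 * t) \<in> {0..1}" "t \<in> {1/2..1} ==> sm (2 * t - 1) \<in> {0..1}" for t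
  using sm_01(1)[of "2 * t"] sm_01(1)[of "2 * t - 1"] by auto
 have F1a: "F1 v t = half w1 v (1 - sm (2 * t))" if "t \<in> {0..1/2}" for v t
  using that by (simp add: F1_def cat_def A1_def)
 have F1b: "F1 v t = half w2 v (sm (2 * t - 1))" if "v \<in> circ E" "t \<in> {1/2..1}" for v t
  using that j1(1)[OF that(1)] by (cases "t = 1/2") (auto simp: F1_def cat_def dest!: half_eq)
 have cF: "continuous_on (circ E \<times> {0..1}) (%z. F1 (fst z) (snd z))"
  "continuous_on (circ E \<times> {0..1}) (%z. F2 (fst z) (snd z))" "continuous_on (circ E \<times> {0..1}) (%z. F3 (fst z) (snd z))"
  using fF1 fF2 fF3 by (auto simp: fam_def)
 have av1: "F1 v t ~= c" if v: "v \<in> circ E" and t: "t \<in> {0..1}" for v t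
 proof -
  have "half ww v y ~= c" if "ww = w1 \<or> ww = w2" for ww y
   using half(3)[OF v that, of y] rho(1)[of y] by auto
  then show ?thesis using F1a[of t v] F1b[OF v, of t] t by (cases "t <= 1/2") auto
 qed
 have es1: "ess E c F1"
 proof (rule ess_base[OF wE(3) cF(1)])
  show "(F1 v t - c) \<bullet> E <= 0" if "v \<in> circ E" "t \<in> {0..1/2}" for v t
   unfolding F1a[OF that(2)] by (rule half_side(1)[OF that(1) s01(1)[OF that(2)]])
  show "0 <= (F1 v t - c) \<bullet> E" if "v \<in> circ E" "t \<in> {1/2..1}" for v t
   unfolding F1b[OF that] by (rule half_side(2)[OF that(1) s01(2)[OF that(2)]])
  show "\<exists>r>0. F1 v (1/2) = c + r *\<^sub>R v" if "v \<in> circ E" for v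
   using F1a[of "1/2" v] half(2)[OF that, of w1] rho(1)[of 0] by auto
 qed (use eF1 av1 in auto)
 have es2: "ess E c F2" unfolding F2_def
  by (rule ess_cat_front[OF wE(3) cF(1) eF1 av1 C1_cont[OF Z(1)] _ avZ es1]) (use Z in auto)
 have es3: "ess E c F3" unfolding F3_def
  by (rule ess_cat_back[OF wE(3) cF(2) eF2 av2 C1_cont[OF W(1)] _ avW es2]) (use W in auto)
 have "ess E c (%v t. F3 v (\<theta> t))"
  using ess_reparam[OF wE(3) cF(3) eF3 av3 th] es3 by simp
 moreover have "\<forall>v\<in>circ E. F3 v (\<theta> 0) = a & F3 v (\<theta> 1) = b & jlen G (%t. F3 v (\<theta> t)) (%t. \<theta>' t *\<^sub>R D3 v (\<theta> t)) <= M"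
  using eF3 th Rj aF3 order_trans by fastforce
 ultimately show ?thesis using R
  by (intro exI[of _ "%v t. F3 v (\<theta> t)"] exI[of _ "%v t. \<theta>' t *\<^sub>R D3 v (\<theta> t)"]) auto
qed

end

section \<open>The regularised centres\<close>

locale ncentre =
 fixes N :: nat and c :: "nat => real ^ 3" and m :: "nat => real" and \<alpha> H :: real
 assumes al: "1 <= \<alpha>" "\<alpha> < 2" and mpos: "!!i. i \<in> {1..N} ==> 0 < m i" and H0: "0 < H"
begin

definition Vd :: "real => real ^ 3 => real" where
 "Vd \<delta> x = (\<Sum>i = 1..N. m i / \<alpha> * ((norm (x - c i))^2 + \<delta>^2) powr (- (\<alpha> / 2)))"
definition Fd :: "real => real ^ 3 => real ^ 3" where
 "Fd \<delta> x = (\<Sum>i = 1..N. (- m i * ((norm (x - c i))^2 + \<delta>^2) powr (- (\<alpha> / 2) - 1)) *\<^sub>R (x - c i))"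
definition Gd :: "real => real ^ 3 => real" where "Gd \<delta> x = H + Vd \<delta> x"
definition M where "M = (\<Sum>i = 1..N. m i)"
definition C0 where "C0 = (\<Sum>i = 1..N. norm (c i))"
definition \<kappa> where "\<kappa> = 1 - \<alpha> / 2"
text \<open>Normalised so that the singular part of the potential is
  \<open>(mu i)^2 / 2 * r powr (- \<alpha>)\<close>; a radial fall from distance \<open>r\<close> at
  energy zero then costs \<open>(mu i / \<kappa>) * r powr \<kappa>\<close>.\<close>

definition mu where "mu i = sqrt (2 * m i / \<alpha>)"
definition K where "K = (\<Sum>i = 1..N. mu i * (2 / \<kappa>))"
text \<open>Modulus of continuity of the Jacobi distance, independent of \<open>\<delta>\<close>:
  the first term is the cost of straight motion at speed \<open>sqrt (2 * H)\<close>, the second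
  bounds the extra cost of passing through centres.\<close>

definition modu where "modu l = sqrt (2 * H) * l + K * l powr \<kappa>"

lemma kap: "0 < \<kappa>" "\<kappa> <= 1/2" using al by (auto simp: \<kappa>_def)

lemma M0: "0 <= M" and C00: "0 <= C0" and K0: "0 <= K"
proof -
 have m: "0 <= m i" if "i \<in> {1..N}" for i using mpos[OF that] by simp
 show "0 <= M" "0 <= C0" "0 <= K"
  unfolding M_def C0_def K_def mu_def using m kap al
  by (intro sum_nonneg mult_nonneg_nonneg divide_nonneg_nonneg real_sqrt_ge_zero; simp)+
qed

lemma c_le: "i \<in> {1..N} ==> norm (c i) <= C0"
 unfolding C0_def by (rule member_le_sum) auto

lemma Vd_nonneg: "0 <= Vd \<delta> x"
 unfolding Vd_def using mpos al by (intro sum_nonneg mult_nonneg_nonneg) (auto simp: less_imp_le)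

lemma Gd_ge: "H <= Gd \<delta> x" using Vd_nonneg by (simp add: Gd_def)

lemma Gd_ge1:
 assumes "i \<in> {1..N}" shows "H + m i / \<alpha> * ((norm (x - c i))^2 + \<delta>^2) powr (- (\<alpha> / 2)) <= Gd \<delta> x"
proof -
 have "m i / \<alpha> * ((norm (x - c i))^2 + \<delta>^2) powr (- (\<alpha> / 2)) <= Vd \<delta> x"
  unfolding Vd_def by (rule member_le_sum[OF assms]) (use mpos al in \<open>auto simp: less_imp_le\<close>)
 then show ?thesis by (simp add: Gd_def)
qed

lemma plummer_der:
 fixes a :: "real ^ 3"
 assumes "0 < (norm (x - a))^2 + \<delta>^2"
 shows "((%x. ((norm (x - a))^2 + \<delta>^2) powr p) has_derivative
  (%h. p * ((norm (x - a))^2 + \<delta>^2) powr (p - 1) * (2 * ((x - a) \<bullet> h)))) (at x)"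
proof -
 have "((%x. (norm (x - a))^2 + \<delta>^2) has_derivative (%h. 2 * ((x - a) \<bullet> h))) (at x)"
  unfolding power2_norm_eq_inner by (auto intro!: derivative_eq_intros simp: inner_commute)
 from has_derivative_compose[OF this, of "%u. u powr p" "%h. p * ((norm (x - a))^2 + \<delta>^2) powr (p - 1) * h"]
 show ?thesis using has_real_derivative_powr[OF assms, of p] by (simp add: has_field_derivative_def)
qed

lemma Gd_der: assumes "\<delta> ~= 0" shows "(Gd \<delta> has_derivative (%h. Fd \<delta> x \<bullet> h)) (at x)"
proof -
 have p: "0 < (norm (x - c i))^2 + \<delta>^2" for i using assms by (simp add: add_nonneg_pos)
 have "((%x. H + (\<Sum>i = 1..N. m i / \<alpha> * ((norm (x - c i))^2 + \<delta>^2) powr (- (\<alpha> / 2)))) has_derivative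
  (%h. 0 + (\<Sum>i = 1..N. m i / \<alpha> * (- (\<alpha> / 2) * ((norm (x - c i))^2 + \<delta>^2) powr (- (\<alpha> / 2) - 1) * (2 * ((x - c i) \<bullet> h)))))) (at x)"
  by (intro has_derivative_add has_derivative_const has_derivative_sum has_derivative_mult_right plummer_der[OF p])
 moreover have "0 + (\<Sum>i = 1..N. m i / \<alpha> * (- (\<alpha> / 2) * ((norm (x - c i))^2 + \<delta>^2) powr (- (\<alpha> / 2) - 1) * (2 * ((x - c i) \<bullet> h)))) = Fd \<delta> x \<bullet> h" for h
  using al unfolding Fd_def inner_sum_left add_0 by (intro sum.cong) auto
 ultimately show ?thesis by (simp add: Gd_def[abs_def] Vd_def)
qed

lemma plummer_le:
 fixes d :: real
 assumes "0 < b" "b <= d" "0 <= p" shows "d powr (- p) <= b powr (- p)"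
 using assms by (intro powr_mono2') auto

lemma Fd_term_bound:
 assumes "0 < r" "r <= norm (x - a)"
 shows "norm (((norm (x - a))^2 + \<delta>^2) powr (- (\<alpha> / 2) - 1) *\<^sub>R (x - a :: real ^ 3)) <= r powr (- \<alpha> - 1)"
proof -
 define n where "n = norm (x - a)"
 have n: "0 < n" "r <= n" using assms by (auto simp: n_def)
 have "(n^2 + \<delta>^2) powr (- (\<alpha> / 2 + 1)) <= (n^2) powr (- (\<alpha> / 2 + 1))"
  using n al by (intro plummer_le) auto
 also have "... = n powr (- \<alpha> - 2)"
 proof -
  have "n^2 = n powr 2" using n by (simp add: powr_numeral)
  then show ?thesis by (simp add: powr_powr)
 qed
 finally have "(n^2 + \<delta>^2) powr (- (\<alpha> / 2) - 1) * n <= n powr (- \<alpha> - 2) * n powr 1"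
  using n by (auto intro!: mult_right_mono)
 also have "... = n powr (- (\<alpha> + 1))" by (simp only: powr_add[symmetric]) (simp add: algebra_simps)
 also have "... <= r powr (- (\<alpha> + 1))" using n assms al by (intro plummer_le) auto
 finally show ?thesis by (simp add: n_def)
qed

lemma Fd_bound:
 assumes "0 < r" "!!i. i \<in> {1..N} ==> r <= norm (x - c i)"
 shows "norm (Fd \<delta> x) <= M * r powr (- \<alpha> - 1)"
proof -
 have "norm (Fd \<delta> x) <= (\<Sum>i = 1..N. m i * r powr (- \<alpha> - 1))"
  unfolding Fd_def
 proof (rule sum_norm_le)
  fix i assume i: "i \<in> {1..N}"
  have "norm ((- m i * ((norm (x - c i))^2 + \<delta>^2) powr (- (\<alpha> / 2) - 1)) *\<^sub>R (x - c i)) =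
   m i * norm (((norm (x - c i))^2 + \<delta>^2) powr (- (\<alpha> / 2) - 1) *\<^sub>R (x - c i))"
   using mpos[OF i] by simp
  also have "... <= m i * r powr (- \<alpha> - 1)"
   using mpos[OF i] Fd_term_bound[OF assms(1) assms(2)[OF i]] by (intro mult_left_mono) auto
  finally show "norm ((- m i * ((norm (x - c i))^2 + \<delta>^2) powr (- (\<alpha> / 2) - 1)) *\<^sub>R (x - c i)) <= m i * r powr (- \<alpha> - 1)" .
 qed
 then show ?thesis by (simp add: M_def sum_distrib_right)
qed

lemma Vd_bound:
 assumes "0 < r" "!!i. i \<in> {1..N} ==> r <= norm (x - c i)"
 shows "Vd \<delta> x <= M * r powr (- \<alpha>)"
proof -
 have "Vd \<delta> x <= (\<Sum>i = 1..N. m i * r powr (- \<alpha>))"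
  unfolding Vd_def
 proof (rule sum_mono)
  fix i assume i: "i \<in> {1..N}"
  have "((norm (x - c i))^2 + \<delta>^2) powr (- (\<alpha> / 2)) <= (r^2) powr (- (\<alpha> / 2))"
  proof (rule plummer_le)
   have "r^2 <= (norm (x - c i))^2" using assms i by (intro power_mono) auto
   then show "r^2 <= (norm (x - c i))^2 + \<delta>^2" by (simp add: add_increasing2)
  qed (use assms al in auto)
  also have "... = r powr (- \<alpha>)"
  proof -
   have "r^2 = r powr 2" using assms by (simp add: powr_numeral)
   then show ?thesis by (simp add: powr_powr)
  qed
  finally have "m i / \<alpha> * ((norm (x - c i))^2 + \<delta>^2) powr (- (\<alpha> / 2)) <= m i / \<alpha> * r powr (- \<alpha>)"
   using mpos[OF i] al by (intro mult_left_mono) auto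
  also have "... <= m i * r powr (- \<alpha>)"
  proof -
   have "m i / \<alpha> <= m i / 1" using mpos[OF i] al by (intro divide_left_mono) auto
   then show ?thesis by (intro mult_right_mono) auto
  qed
  finally show "m i / \<alpha> * ((norm (x - c i))^2 + \<delta>^2) powr (- (\<alpha> / 2)) <= m i * r powr (- \<alpha>)" .
 qed
 then show ?thesis by (simp add: M_def sum_distrib_right)
qed

lemma Vd_Fd_lim:
 assumes "d ----> \<delta>" "X ----> x" "x \<notin> c ` {1..N}"
 shows "(%n. Vd (d n) (X n)) ----> Vd \<delta> x" "(%n. Fd (d n) (X n)) ----> Fd \<delta> x"
proof -
 have p: "(norm (x - c i))^2 + \<delta>^2 ~= 0" if "i \<in> {1..N}" for i
  using assms(3) that by (metis add_pos_nonneg image_eqI less_irrefl right_minus_eq zero_le_power2 zero_less_norm_iff zero_less_power)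
 show "(%n. Vd (d n) (X n)) ----> Vd \<delta> x"
  unfolding Vd_def by (intro tendsto_sum tendsto_mult tendsto_const tendsto_powr tendsto_add tendsto_power tendsto_norm tendsto_diff assms p)
 show "(%n. Fd (d n) (X n)) ----> Fd \<delta> x"
  unfolding Fd_def by (intro tendsto_sum tendsto_mult tendsto_scaleR tendsto_const tendsto_powr tendsto_add tendsto_power tendsto_norm tendsto_diff assms p)
qed

lemma plummer_lip:
 fixes a :: "real ^ 3"
 assumes d: "\<delta> ~= 0"
 defines "f \<equiv> %x. ((norm (x - a))^2 + \<delta>^2) powr (- (\<alpha> / 2) - 1) *\<^sub>R (x - a)"
 shows "norm (f x - f y) <= ((3 + \<alpha>) * (\<delta>^2) powr (- (\<alpha> / 2) - 1)) * norm (x - y)" "norm (f x) <= (\<delta>^2) powr (- (\<alpha> / 2 + 1/2))"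
proof -
 define q where "q = \<alpha> / 2 + 1"
 define u where "u = (%x. (norm (x - a))^2 + \<delta>^2)"
 have q: "q > 0" "- (\<alpha> / 2) - 1 = - q" using al by (auto simp: q_def)
 have u: "0 < \<delta>^2" "0 < u x" "\<delta>^2 <= u x" "(norm (x - a))^2 <= u x" for x using d by (auto simp: u_def add_nonneg_pos)
 have f: "f = (%x. u x powr (- q) *\<^sub>R (x - a))" by (simp add: f_def u_def q)
 have der: "(f has_derivative (%h. u x powr (- q) *\<^sub>R h + (- q * u x powr (- q - 1) * (2 * ((x - a) \<bullet> h))) *\<^sub>R (x - a))) (at x within UNIV)" for x
  unfolding f u_def
  by (rule has_derivative_eq_rhs[OF has_derivative_scaleR[OF plummer_der has_derivative_diff[OF has_derivative_ident has_derivative_const]]])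
   (use u(2)[of x] in \<open>auto simp: u_def\<close>)
 have on: "onorm (%h. u x powr (- q) *\<^sub>R h + (- q * u x powr (- q - 1) * (2 * ((x - a) \<bullet> h))) *\<^sub>R (x - a)) <= (3 + \<alpha>) * (\<delta>^2) powr (- q)" for x
 proof (rule onorm_le)
  fix h
  have "norm ((- q * u x powr (- q - 1) * (2 * ((x - a) \<bullet> h))) *\<^sub>R (x - a)) = (2 * q * u x powr (- q - 1)) * (\<bar>(x - a) \<bullet> h\<bar> * norm (x - a))"
   using q by (simp add: abs_mult)
  also have "... <= (2 * q * u x powr (- q - 1)) * ((norm (x - a) * norm h) * norm (x - a))"
   using q Cauchy_Schwarz_ineq2[of "x - a" h] by (intro mult_left_mono mult_right_mono) auto
  also have "... = (2 * q * u x powr (- q - 1)) * ((norm (x - a))^2 * norm h)" by (simp add: power2_eq_square)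
  also have "... <= (2 * q * u x powr (- q - 1)) * (u x * norm h)"
   using q u(4)[of x] by (intro mult_left_mono mult_right_mono) auto
  also have "... = 2 * q * (u x powr (- q - 1) * u x powr 1) * norm h" using u(2)[of x] by simp
  also have "u x powr (- q - 1) * u x powr 1 = u x powr (- q)" by (simp only: powr_add[symmetric]) simp
  finally have 1: "norm ((- q * u x powr (- q - 1) * (2 * ((x - a) \<bullet> h))) *\<^sub>R (x - a)) <= 2 * q * u x powr (- q) * norm h" .
  have "norm (u x powr (- q) *\<^sub>R h + (- q * u x powr (- q - 1) * (2 * ((x - a) \<bullet> h))) *\<^sub>R (x - a)) <= (1 + 2 * q) * u x powr (- q) * norm h"
   using norm_triangle_ineq[of "u x powr (- q) *\<^sub>R h" "(- q * u x powr (- q - 1) * (2 * ((x - a) \<bullet> h))) *\<^sub>R (x - a)"] 1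
   by (simp add: algebra_simps)
  also have "... <= (3 + \<alpha>) * (\<delta>^2) powr (- q) * norm h"
   using u q al by (intro mult_right_mono mult_mono plummer_le) (auto simp: q_def)
  finally show "norm (u x powr (- q) *\<^sub>R h + (- q * u x powr (- q - 1) * (2 * ((x - a) \<bullet> h))) *\<^sub>R (x - a)) <= (3 + \<alpha>) * (\<delta>^2) powr (- q) * norm h" .
 qed
 show "norm (f x - f y) <= ((3 + \<alpha>) * (\<delta>^2) powr (- (\<alpha> / 2) - 1)) * norm (x - y)"
  unfolding q(2) by (rule differentiable_bound[OF convex_UNIV der on]) auto
 have "norm (f x) = u x powr (- q) * norm (x - a)" by (simp add: f)
 also have "... <= u x powr (- q) * u x powr (1/2)"
  using u(2,4)[of x] by (intro mult_left_mono) (auto simp: powr_half_sqrt real_le_rsqrt)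
 also have "... = u x powr (- (\<alpha> / 2 + 1/2))" by (simp only: powr_add[symmetric]) (simp add: q_def algebra_simps)
 also have "... <= (\<delta>^2) powr (- (\<alpha> / 2 + 1/2))" using u al by (intro plummer_le) auto
 finally show "norm (f x) <= (\<delta>^2) powr (- (\<alpha> / 2 + 1/2))" .
qed

text \<open>The constants blow up as \<open>\<delta>\<close> tends to zero. They only serve to
  produce orbits for a fixed \<open>\<delta>\<close>; no limit argument refers to them.\<close>

lemma soft_Gd:
 assumes d: "\<delta> ~= 0" shows "\<exists>\<Lambda> \<Gamma> B. soft (Gd \<delta>) (Fd \<delta>) H \<Lambda> \<Gamma> B"
proof -
 define f where "f = (%a x. ((norm (x - a))^2 + \<delta>^2) powr (- (\<alpha> / 2) - 1) *\<^sub>R (x - a :: real ^ 3))"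
 have F: "Fd \<delta> x = (\<Sum>i = 1..N. (- m i) *\<^sub>R f (c i) x)" for x by (simp add: Fd_def f_def)
 note L = plummer_lip[OF d, folded f_def]
 have "norm (Fd \<delta> x - Fd \<delta> y) <= (M * ((3 + \<alpha>) * (\<delta>^2) powr (- (\<alpha> / 2) - 1))) * norm (x - y)" for x y
 proof -
  have "Fd \<delta> x - Fd \<delta> y = (\<Sum>i = 1..N. (- m i) *\<^sub>R (f (c i) x - f (c i) y))"
   unfolding F by (simp add: sum_subtractf[symmetric] scaleR_diff_right)
  also have "norm ... <= (\<Sum>i = 1..N. m i * (((3 + \<alpha>) * (\<delta>^2) powr (- (\<alpha> / 2) - 1)) * norm (x - y)))"
  proof (rule sum_norm_le)
   fix i assume i: "i \<in> {1..N}"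
   have "norm ((- m i) *\<^sub>R (f (c i) x - f (c i) y)) = m i * norm (f (c i) x - f (c i) y)" using mpos[OF i] by simp
   also have "... <= m i * (((3 + \<alpha>) * (\<delta>^2) powr (- (\<alpha> / 2) - 1)) * norm (x - y))"
    unfolding f_def by (rule mult_left_mono[OF plummer_lip(1)[OF d]]) (use mpos[OF i] in simp)
   finally show "norm ((- m i) *\<^sub>R (f (c i) x - f (c i) y)) <= m i * (((3 + \<alpha>) * (\<delta>^2) powr (- (\<alpha> / 2) - 1)) * norm (x - y))" .
  qed
  finally show ?thesis by (simp add: M_def sum_distrib_right mult.assoc)
 qed
 moreover have "norm (Fd \<delta> x) <= M * (\<delta>^2) powr (- (\<alpha> / 2 + 1/2))" for x
 proof -
  have "norm (Fd \<delta> x) <= (\<Sum>i = 1..N. m i * (\<delta>^2) powr (- (\<alpha> / 2 + 1/2)))"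
   unfolding F using mpos L(2) by (intro sum_norm_le) (auto intro!: mult_left_mono simp: f_def less_imp_le)
  then show ?thesis by (simp add: M_def sum_distrib_right)
 qed
 moreover have "Gd \<delta> x <= H + (\<Sum>i = 1..N. m i / \<alpha> * (\<delta>^2) powr (- (\<alpha> / 2)))" for x
  unfolding Gd_def Vd_def using d mpos al
  by (intro add_left_mono sum_mono mult_left_mono plummer_le) (auto simp: less_imp_le)
 ultimately show ?thesis
  using H0 Gd_ge Gd_der[OF d] unfolding soft_def by blast
qed

section \<open>Bounds for the Jacobi distance, uniform in the softening\<close>

lemma sing_int:
 assumes t: "\<tau> \<in> {0..1}"
 shows "((%t. \<bar>t - \<tau>\<bar> powr (\<kappa> - 1)) has_integral (((1 - \<tau>) powr \<kappa> + \<tau> powr \<kappa>) / \<kappa>)) {0..1}"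
proof -
 define A where "A = (%t. (max (t - \<tau>) 0 powr \<kappa> - max (\<tau> - t) 0 powr \<kappa>) / \<kappa>)"
 have "((%t. \<bar>t - \<tau>\<bar> powr (\<kappa> - 1)) has_integral (A 1 - A 0)) {0..1}"
 proof (rule fundamental_theorem_of_calculus_interior_strong[of "{\<tau>}"])
  show "continuous_on {0..1} A"
   unfolding A_def using kap by (intro continuous_intros continuous_on_powr') auto
  fix t assume t: "t \<in> {0<..<1} - {\<tau>}"
  show "(A hvd \<bar>t - \<tau>\<bar> powr (\<kappa> - 1)) (at t)"
  proof (cases "\<tau> < t")
   case True
   have "((%t. (t - \<tau>) powr \<kappa> / \<kappa>) hrd (t - \<tau>) powr (\<kappa> - 1)) (at t)"
    using True kap by (auto intro!: derivative_eq_intros)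
   then have "((%t. (t - \<tau>) powr \<kappa> / \<kappa>) hvd \<bar>t - \<tau>\<bar> powr (\<kappa> - 1)) (at t)"
    using True by (simp add: has_real_derivative_iff_has_vector_derivative)
   then show ?thesis
    by (rule has_vector_derivative_transform_within_open[of _ _ _ "{\<tau><..}"]) (use True in \<open>auto simp: A_def\<close>)
  next
   case False
   then have F: "t < \<tau>" using t by auto
   have "((%t. - ((\<tau> - t) powr \<kappa>) / \<kappa>) hrd (\<tau> - t) powr (\<kappa> - 1)) (at t)"
    using F kap by (auto intro!: derivative_eq_intros)
   then have "((%t. - ((\<tau> - t) powr \<kappa>) / \<kappa>) hvd \<bar>t - \<tau>\<bar> powr (\<kappa> - 1)) (at t)"
    using F by (simp add: has_real_derivative_iff_has_vector_derivative)
   then show ?thesis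
    by (rule has_vector_derivative_transform_within_open[of _ _ _ "{..<\<tau>}"]) (use F in \<open>auto simp: A_def\<close>)
  qed
 qed auto
 moreover have "A 1 - A 0 = ((1 - \<tau>) powr \<kappa> + \<tau> powr \<kappa>) / \<kappa>"
  using t by (auto simp: A_def max_def diff_divide_distrib add_divide_distrib)
 ultimately show ?thesis by simp
qed

lemma sqrt_sum_le: "finite S ==> 0 <= a ==> (!!i. i \<in> S ==> 0 <= b i) ==> sqrt (a + sum b S) <= sqrt a + (\<Sum>i\<in>S. sqrt (b i))"
proof (induction S rule: finite_induct)
 case (insert x S)
 have "sqrt (a + sum b (insert x S)) = sqrt ((a + sum b S) + b x)" using insert by (simp add: add.commute add.left_commute)
 also have "... <= sqrt (a + sum b S) + sqrt (b x)"
  using insert by (intro sqrt_add_le_add_sqrt add_nonneg_nonneg sum_nonneg) auto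
 finally show ?case using insert by auto
qed simp

text \<open>The segment is a competitor. By subadditivity of the root each centre contributes
  separately, and its contribution is largest when the centre lies on the segment; there it is an
  integrable singularity because \<open>\<alpha> / 2 < 1\<close>.\<close>

lemma jac_le_modu:
 assumes d: "\<delta> ~= 0" shows "jac (Gd \<delta>) p q <= modu (norm (q - p))"
proof (cases "p = q")
 case True
 obtain \<Lambda> \<Gamma> B where "soft (Gd \<delta>) (Fd \<delta>) H \<Lambda> \<Gamma> B" using soft_Gd[OF d] by blast
 then show ?thesis using True by (simp add: soft.jac_refl modu_def)
next
 case False
 obtain \<Lambda> \<Gamma> B where so: "soft (Gd \<delta>) (Fd \<delta>) H \<Lambda> \<Gamma> B" using soft_Gd[OF d] by blast
 interpret soft "Gd \<delta>" "Fd \<delta>" H \<Lambda> \<Gamma> B by (rule so)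
 define l where "l = norm (q - p)"
 have l: "l > 0" using False by (simp add: l_def)
 define X where "X = (%t. p + t *\<^sub>R (q - p))"
 have C: "C1 X (%_. q - p)" unfolding X_def by (rule C1_line)
 have cX: "continuous_on {0..1} X" by (rule C1_cont[OF C])
 have G2: "0 < sqrt (2 * Gd \<delta> x)" for x using Gpos[of x] by simp
 \<comment> \<open>This lapse makes the energy balance exact at each point, so that the action
   becomes the genuine Jacobi length of the segment.\<close>
 define n where "n = (%t. l / sqrt (2 * Gd \<delta> (X t)))"
 have n: "continuous_on {0..1} n" "0 < n t" for t
  unfolding n_def using l G2 by (auto intro!: continuous_intros G_comp_cont cX divide_pos_pos less_imp_neq[symmetric])
 have "jac (Gd \<delta>) (X 0) (X 1) <= lact (Gd \<delta>) n X (%_. q - p)"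
  by (rule jac_le_lact[OF C n(1)]) (use n in auto)
 also have "... = integral {0..1} (%t. l * sqrt (2 * Gd \<delta> (X t)))"
  unfolding lact_def
 proof (rule integral_cong)
  fix t
  define w where "w = sqrt (2 * Gd \<delta> (X t))"
  have w: "w > 0" "Gd \<delta> (X t) = w * w / 2" using G2[of "X t"] Gpos[of "X t"] by (auto simp: w_def)
  show "(norm (q - p))^2 / (2 * n t) + n t * Gd \<delta> (X t) = l * sqrt (2 * Gd \<delta> (X t))"
   unfolding n_def w_def[symmetric] l_def[symmetric] w(2) using w(1) l by (simp add: power2_eq_square)
 qed
 also have "... <= sqrt (2 * H) * l + (\<Sum>i = 1..N. mu i * (2 / \<kappa>)) * l powr \<kappa>"
 proof -
  define b where "b = (%i t. ((norm (X t - c i))^2 + \<delta>^2) powr (- (\<alpha> / 4)))"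
  have "\<exists>J\<tau>. \<exists>h. (h has_integral J\<tau>) {0..1} & J\<tau> <= l powr (\<kappa> - 1) * (2 / \<kappa>) & (\<forall>t\<in>{0..1}. b i t <= h t)" for i
  proof -
   define S where "S = closed_segment p q"
   have S: "convex S" "closed S" "S ~= {}" by (auto simp: S_def)
   \<comment> \<open>The obtuse angle at the nearest point of the segment bounds the distance to the
     centre below by the distance to that point, whose parameter is \<open>\<tau>\<close>.\<close>
   define z where "z = closest_point S (c i)"
   have zS: "z \<in> S" using S by (simp add: z_def closest_point_in_set)
   then obtain \<tau> where tau: "\<tau> \<in> {0..1}" "z = X \<tau>"
    by (auto simp: S_def closed_segment_def X_def algebra_simps)
   have far: "l * \<bar>t - \<tau>\<bar> <= norm (X t - c i)" if "t \<in> {0..1}" for t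
   proof -
    have XS: "X t \<in> S" using that by (auto simp: S_def closed_segment_def X_def algebra_simps intro!: exI[of _ t])
    have "(c i - z) \<bullet> (X t - z) <= 0"
     using closest_point_dot[OF S(1,2) XS, of "c i"] by (simp add: z_def)
    moreover have "X t - c i = (X t - z) - (c i - z)" by simp
    then have "(norm (X t - c i))^2 = (norm (X t - z))^2 + (norm (c i - z))^2 - 2 * ((c i - z) \<bullet> (X t - z))"
     unfolding power2_norm_eq_inner by (simp add: inner_diff_left inner_diff_right inner_commute)
    ultimately have "(norm (X t - z))^2 <= (norm (X t - c i))^2" by (smt (verit) zero_le_power2)
    then have "norm (X t - z) <= norm (X t - c i)" by (rule power2_le_imp_le) simp
    moreover have "X t - z = (t - \<tau>) *\<^sub>R (q - p)" by (simp add: tau X_def algebra_simps)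
    ultimately show ?thesis by (simp add: l_def mult.commute)
   qed
   \<comment> \<open>The value at \<open>\<tau>\<close> has to be set by hand: there the power would
     be \<open>0 powr (\<kappa> - 1) = 0\<close> and could not majorise \<open>b i \<tau>\<close>.
     One point does not change the integral.\<close>
   define h where "h = (%t. if t = \<tau> then b i \<tau> else l powr (\<kappa> - 1) * \<bar>t - \<tau>\<bar> powr (\<kappa> - 1))"
   have "(h has_integral (l powr (\<kappa> - 1) * (((1 - \<tau>) powr \<kappa> + \<tau> powr \<kappa>) / \<kappa>))) {0..1}"
    by (rule has_integral_spike_finite[OF _ _ has_integral_mult_right[OF sing_int[OF tau(1)]], of "{\<tau>}"]) (auto simp: h_def)
   moreover have "(1 - \<tau>) powr \<kappa> <= 1" "\<tau> powr \<kappa> <= 1" using tau kap by (auto intro!: powr_le1)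
   then have "l powr (\<kappa> - 1) * (((1 - \<tau>) powr \<kappa> + \<tau> powr \<kappa>) / \<kappa>) <= l powr (\<kappa> - 1) * (2 / \<kappa>)"
    using kap by (intro mult_left_mono divide_right_mono) auto
   moreover have "b i t <= h t" if "t \<in> {0..1}" for t
   proof (cases "t = \<tau>")
    case False
    have "0 < l * \<bar>t - \<tau>\<bar>" using False l by simp
    then have "((norm (X t - c i))^2 + \<delta>^2) powr (- (\<alpha> / 4)) <= ((l * \<bar>t - \<tau>\<bar>)^2) powr (- (\<alpha> / 4))"
     using far[OF that] al by (intro plummer_le) (auto intro: add_increasing2 power_mono)
    also have "... = (l * \<bar>t - \<tau>\<bar>) powr (\<kappa> - 1)"
    proof -
     have "(l * \<bar>t - \<tau>\<bar>)^2 = (l * \<bar>t - \<tau>\<bar>) powr 2" using \<open>0 < l * \<bar>t - \<tau>\<bar>\<close> by (simp add: powr_numeral)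
     then show ?thesis by (simp add: powr_powr \<kappa>_def)
    qed
    also have "... = h t" using False l by (simp add: h_def powr_mult)
    finally show ?thesis by (simp add: b_def)
   qed (simp add: h_def)
   ultimately show ?thesis by blast
  qed
  then obtain J h where J: "!!i. (h i has_integral J i) {0..1}" "!!i. J i <= l powr (\<kappa> - 1) * (2 / \<kappa>)"
   and h: "!!i t. t \<in> {0..1} ==> b i t <= h i t" by metis
  have mu: "0 <= mu i" if "i \<in> {1..N}" for i using mpos[OF that] al by (simp add: mu_def)
  have "integral {0..1} (%t. l * sqrt (2 * Gd \<delta> (X t))) <= l * (sqrt (2 * H) + (\<Sum>i = 1..N. mu i * J i))"
  proof (rule has_integral_le)
   show "((%t. l * sqrt (2 * Gd \<delta> (X t))) has_integral integral {0..1} (%t. l * sqrt (2 * Gd \<delta> (X t)))) {0..1}"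
    by (intro integrable_integral integrable_continuous_real continuous_intros G_comp_cont cX)
   have "((%t. sqrt (2 * H)) has_integral sqrt (2 * H)) {0..1::real}"
    using has_integral_const_real[of "sqrt (2 * H)" 0 1] by simp
   then show "((%t. l * (sqrt (2 * H) + (\<Sum>i = 1..N. mu i * h i t))) has_integral l * (sqrt (2 * H) + (\<Sum>i = 1..N. mu i * J i))) {0..1}"
    by (intro has_integral_mult_right has_integral_add has_integral_sum J) auto
   fix t :: real assume t: "t \<in> {0..1}"
   have "sqrt (2 * Gd \<delta> (X t)) = sqrt (2 * H + (\<Sum>i = 1..N. 2 * (m i / \<alpha> * ((norm (X t - c i))^2 + \<delta>^2) powr (- (\<alpha> / 2)))))"
    by (simp add: Gd_def Vd_def sum_distrib_left)
   also have "... <= sqrt (2 * H) + (\<Sum>i = 1..N. sqrt (2 * (m i / \<alpha> * ((norm (X t - c i))^2 + \<delta>^2) powr (- (\<alpha> / 2)))))"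
    using mpos al H0 by (intro sqrt_sum_le) (auto simp: less_imp_le)
   also have "(\<Sum>i = 1..N. sqrt (2 * (m i / \<alpha> * ((norm (X t - c i))^2 + \<delta>^2) powr (- (\<alpha> / 2))))) = (\<Sum>i = 1..N. mu i * b i t)"
   proof (rule sum.cong[OF refl])
    fix i
    define u where "u = (norm (X t - c i))^2 + \<delta>^2"
    have u: "u > 0" using d by (simp add: u_def add_nonneg_pos)
    have "sqrt (u powr (- (\<alpha> / 2))) = u powr (- (\<alpha> / 4))"
     using u by (simp add: powr_half_sqrt[symmetric] powr_powr)
    then show "sqrt (2 * (m i / \<alpha> * ((norm (X t - c i))^2 + \<delta>^2) powr (- (\<alpha> / 2)))) = mu i * b i t"
     unfolding b_def mu_def u_def[symmetric] by (metis real_sqrt_mult times_divide_eq_right mult.assoc)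
   qed
   also have "... <= (\<Sum>i = 1..N. mu i * h i t)" using mu h[OF t] by (intro sum_mono mult_left_mono) auto
   finally show "l * sqrt (2 * Gd \<delta> (X t)) <= l * (sqrt (2 * H) + (\<Sum>i = 1..N. mu i * h i t))"
    using l by simp
  qed
  also have "... <= l * (sqrt (2 * H) + (\<Sum>i = 1..N. mu i * (l powr (\<kappa> - 1) * (2 / \<kappa>))))"
   using l mu J(2) by (intro mult_left_mono add_left_mono sum_mono) auto
  also have "(\<Sum>i = 1..N. mu i * (l powr (\<kappa> - 1) * (2 / \<kappa>))) = (\<Sum>i = 1..N. mu i * (2 / \<kappa>)) * l powr (\<kappa> - 1)"
   unfolding sum_distrib_right by (rule sum.cong) auto
  also have "l * (sqrt (2 * H) + (\<Sum>i = 1..N. mu i * (2 / \<kappa>)) * l powr (\<kappa> - 1)) = sqrt (2 * H) * l + (\<Sum>i = 1..N. mu i * (2 / \<kappa>)) * (l powr (\<kappa> - 1) * l powr 1)"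
   using l by (simp add: algebra_simps)
  also have "l powr (\<kappa> - 1) * l powr 1 = l powr \<kappa>" by (simp only: powr_add[symmetric]) simp
  finally show ?thesis .
 qed
 finally show ?thesis by (simp add: X_def modu_def K_def l_def)
qed

text \<open>Calibration by the softened cost of a radial fall at energy zero. Its gradient is at
  most \<open>sqrt (2 * Gd \<delta> x)\<close>, as the other centres and \<open>H\<close> only
  increase \<open>Gd\<close>.\<close>

lemma jac_radial:
 assumes d: "\<delta> ~= 0" and i: "i \<in> {1..N}"
 shows "(mu i / \<kappa>) * (((norm (q - c i))^2 + \<delta>^2) powr (\<kappa> / 2) - ((norm (p - c i))^2 + \<delta>^2) powr (\<kappa> / 2)) <= jac (Gd \<delta>) p q"
proof -
 obtain \<Lambda> \<Gamma> B where so: "soft (Gd \<delta>) (Fd \<delta>) H \<Lambda> \<Gamma> B" using soft_Gd[OF d] by blast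
 interpret soft "Gd \<delta>" "Fd \<delta>" H \<Lambda> \<Gamma> B by (rule so)
 define u where "u = (%x. (norm (x - c i))^2 + \<delta>^2)"
 have u: "0 < u x" "(norm (x - c i))^2 <= u x" for x using d by (auto simp: u_def add_nonneg_pos)
 have mi: "0 < m i" using mpos[OF i] .
 have mu: "(mu i)^2 = 2 * m i / \<alpha>" using mi al by (simp add: mu_def)
 define \<phi> where "\<phi> = (%x. (mu i / \<kappa>) * u x powr (\<kappa> / 2))"
 define \<psi> where "\<psi> = (%x. (mu i * u x powr (\<kappa> / 2 - 1)) *\<^sub>R (x - c i))"
 have "\<phi> q - \<phi> p <= jac (Gd \<delta>) p q"
 proof (rule jac_calibration)
  fix x
  have "(\<phi> has_derivative (%h. (mu i / \<kappa>) * (\<kappa> / 2 * u x powr (\<kappa> / 2 - 1) * (2 * ((x - c i) \<bullet> h))))) (at x)"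
   unfolding \<phi>_def u_def by (intro has_derivative_mult_right plummer_der) (use u(1)[of x] in \<open>simp add: u_def\<close>)
  moreover have "(mu i / \<kappa>) * (\<kappa> / 2 * u x powr (\<kappa> / 2 - 1) * (2 * ((x - c i) \<bullet> h))) = \<psi> x \<bullet> h" for h
   using kap by (simp add: \<psi>_def)
  ultimately show "(\<phi> has_derivative (%h. \<psi> x \<bullet> h)) (at x)" by simp
  have "(norm (\<psi> x))^2 = (mu i)^2 * (u x powr (\<kappa> / 2 - 1))^2 * (norm (x - c i))^2"
   by (simp add: \<psi>_def power_mult_distrib)
  also have "... <= (mu i)^2 * (u x powr (\<kappa> / 2 - 1))^2 * u x" using u(2) by (intro mult_left_mono) auto
  also have "(u x powr (\<kappa> / 2 - 1))^2 = u x powr (\<kappa> - 2)"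
   using u(1)[of x] by (simp add: power2_eq_square powr_add[symmetric])
  also have "(mu i)^2 * u x powr (\<kappa> - 2) * u x = (2 * m i / \<alpha>) * (u x powr (\<kappa> - 2) * u x powr 1)"
   using u(1)[of x] by (simp add: mu)
  also have "u x powr (\<kappa> - 2) * u x powr 1 = u x powr (- (\<alpha> / 2))"
   by (simp only: powr_add[symmetric]) (simp add: \<kappa>_def)
  also have "2 * m i / \<alpha> * u x powr (- (\<alpha> / 2)) <= 2 * Gd \<delta> x"
   using Gd_ge1[OF i, of x \<delta>] H0 by (simp add: u_def)
  finally show "(norm (\<psi> x))^2 <= 2 * Gd \<delta> x" .
 qed
 then show ?thesis by (simp add: \<phi>_def u_def right_diff_distrib)
qed

text \<open>Beyond \<open>2 * C0\<close> every centre is at least half as far away as the origin;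
  the summand 2 makes that distance at least 1, so that powers with exponent \<open>\<alpha>\<close>
  are bounded by those with exponent 1; the last summand makes the virial
  \<open>x \<bullet> Fd \<delta> x\<close> at most \<open>H\<close> in size.\<close>

definition \<rho>1 where "\<rho>1 = 2 * C0 + 2 + 4 * M / H"

lemma far:
 assumes "\<rho>1 <= norm x"
 shows "norm (Fd \<delta> x) <= 4 * M / (norm x)^2" "Vd \<delta> x <= 2 * M / norm x" "\<bar>x \<bullet> Fd \<delta> x\<bar> <= H"
  "x \<notin> c ` {1..N}"
proof -
 have MH: "0 <= 4 * M / H" using M0 H0 by simp
 have x: "2 <= norm x" "2 * C0 <= norm x" "4 * M / H <= norm x" using assms C00 MH by (auto simp: \<rho>1_def)
 define r where "r = norm x / 2"
 have r: "1 <= r" using x by (simp add: r_def)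
 have ri: "r <= norm (x - c i)" if "i \<in> {1..N}" for i
  using norm_triangle_ineq2[of x "c i"] c_le[OF that] x by (simp add: r_def)
 show "x \<notin> c ` {1..N}" using ri r by force
 have "norm (Fd \<delta> x) <= M * r powr (- \<alpha> - 1)" by (rule Fd_bound) (use r ri in auto)
 also have "... <= M * r powr (- 2)" using r al M0 by (intro mult_left_mono powr_mono) auto
 also have "... = 4 * M / (norm x)^2" using r by (simp add: powr_minus powr_numeral r_def power_divide field_simps)
 finally show F: "norm (Fd \<delta> x) <= 4 * M / (norm x)^2" .
 have "Vd \<delta> x <= M * r powr (- \<alpha>)" by (rule Vd_bound) (use r ri in auto)
 also have "... <= M * r powr (- 1)" using r al M0 by (intro mult_left_mono powr_mono) auto
 also have "... = 2 * M / norm x" using r by (simp add: powr_minus_divide r_def)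
 finally show "Vd \<delta> x <= 2 * M / norm x" .
 have "\<bar>x \<bullet> Fd \<delta> x\<bar> <= norm x * norm (Fd \<delta> x)" by (rule Cauchy_Schwarz_ineq2)
 also have "... <= norm x * (4 * M / (norm x)^2)" using F by (intro mult_left_mono) auto
 also have "... = 4 * M / norm x" using x by (simp add: power2_eq_square)
 also have "... <= H"
 proof -
  have "4 * M <= norm x * H" using x(3) H0 by (simp add: pos_divide_le_eq)
  moreover have "0 < norm x" using x by linarith
  ultimately show ?thesis by (simp add: pos_divide_le_eq mult.commute)
 qed
 finally show "\<bar>x \<bullet> Fd \<delta> x\<bar> <= H" .
qed

end

section \<open>Limits of solutions and escape\<close>

text \<open>Only positions and forces are known to converge. The initial velocity is an affine
  function of the two end positions and a double integral of the force, hence converges as well, and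
  then so do all velocities.\<close>

lemma solutions_limit:
 fixes y v f :: "nat => real => 'a::euclidean_space"
 assumes ab: "a < b"
  and dy: "!!n t. t \<in> {a..b} ==> (y n hvd v n t) (at t within {a..b})"
  and dv: "!!n t. t \<in> {a..b} ==> (v n hvd f n t) (at t within {a..b})"
  and cf: "!!n. continuous_on {a..b} (f n)" and C: "!!n t. t \<in> {a..b} ==> norm (f n t) <= C"
  and ly: "!!t. t \<in> {a..b} ==> (%n. y n t) ----> y0 t" and lf: "!!t. t \<in> {a..b} ==> (%n. f n t) ----> f0 t"
  and cf0: "continuous_on {a..b} f0"
 obtains v0 where "!!t. t \<in> {a..b} ==> (%n. v n t) ----> v0 t"
  "!!t. t \<in> {a..b} ==> (y0 hvd v0 t) (at t within {a..b})"
  "!!t. t \<in> {a..b} ==> (v0 hvd f0 t) (at t within {a..b})"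
proof -
 define F where "F = (%h t. integral {a..t} h :: 'a)"
 have F_eq: "F h t = integral {a..t} h" for h t by (simp add: F_def)
 have int: "(h has_integral (p t - p a)) {a..t}"
  if "t \<in> {a..b}" "!!s. s \<in> {a..b} ==> (p hvd h s) (at s within {a..b})" for p h :: "real => 'a" and t
  by (rule fundamental_theorem_of_calculus) (use that in \<open>auto intro: has_vector_derivative_within_subset[OF that(2)]\<close>)
 have dF: "(F h hvd h t) (at t within {a..b})" if "continuous_on {a..b} h" "t \<in> {a..b}" for h t
  unfolding F_def by (rule integral_has_vector_derivative[OF that])
 have cF: "continuous_on {a..b} (F h)" if "continuous_on {a..b} h" for h
  by (rule continuous_on_vector_derivative[OF dF[OF that]])
 have vF: "v n t = v n a + F (f n) t" if "t \<in> {a..b}" for n t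
  using integral_unique[OF int[OF that dv]] by (simp add: F_def)
 have yF: "y n t = y n a + (t - a) *\<^sub>R v n a + F (F (f n)) t" if t: "t \<in> {a..b}" for n t
 proof -
  have 1: "((%s. v n a + F (f n) s) has_integral ((t - a) *\<^sub>R v n a + F (F (f n)) t)) {a..t}"
  proof (rule has_integral_add)
   show "((%s. v n a) has_integral (t - a) *\<^sub>R v n a) {a..t}"
    using has_integral_const_real[of "v n a" a t] t by simp
   have "continuous_on {a..t} (F (f n))" by (rule continuous_on_subset[OF cF[OF cf]]) (use t in auto)
   then show "(F (f n) has_integral F (F (f n)) t) {a..t}"
    unfolding F_eq[of "F (f n)" t] by (intro integrable_integral integrable_continuous_real)
  qed
  have 2: "(v n has_integral ((t - a) *\<^sub>R v n a + F (F (f n)) t)) {a..t}"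
   by (rule has_integral_eq[OF vF[symmetric] 1]) (use t in auto)
  have "y n t - y n a = (t - a) *\<^sub>R v n a + F (F (f n)) t"
   by (rule has_integral_unique[OF int[OF t dy] 2])
  then show ?thesis by (simp add: algebra_simps)
 qed
 have FC: "norm (F (f n) t) <= C * (b - a)" if t: "t \<in> {a..b}" for n t
 proof -
  have C0: "0 <= C" by (rule order_trans[OF norm_ge_zero C[OF t]])
  have "norm (F (f n) t) <= C * (t - a)"
   unfolding F_def by (rule integral_bound[OF _ continuous_on_subset[OF cf]]) (use t C in auto)
  also have "... <= C * (b - a)" using t C0 by (intro mult_left_mono) auto
  finally show ?thesis .
 qed
 have lF: "(%n. F (f n) t) ----> F f0 t" if t: "t \<in> {a..b}" for t
  unfolding F_def by (rule dominated_convergence(2)[where h="%_. C", OF integrable_continuous_real[OF continuous_on_subset[OF cf]]])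
   (use t C lf in auto)
 have lFF: "(%n. F (F (f n)) t) ----> F (F f0) t" if t: "t \<in> {a..b}" for t
  unfolding F_eq[of "F h" for h] by (rule dominated_convergence(2)[where h="%_. C * (b - a)", OF integrable_continuous_real[OF continuous_on_subset[OF cF[OF cf]]]])
   (use t FC lF in auto)
 have b: "b \<in> {a..b}" "a \<in> {a..b}" using ab by auto
 define va where "va = (1 / (b - a)) *\<^sub>R (y0 b - y0 a - F (F f0) b)"
 have "(%n. (1 / (b - a)) *\<^sub>R (y n b - y n a - F (F (f n)) b)) ----> va"
  unfolding va_def by (intro tendsto_intros ly lFF b)
 moreover have "(1 / (b - a)) *\<^sub>R (y n b - y n a - F (F (f n)) b) = v n a" for n
  using yF[OF b(1), of n] ab by simp
 ultimately have lva: "(%n. v n a) ----> va" by simp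
 define v0 where "v0 = (%t. va + F f0 t)"
 have lv: "(%n. v n t) ----> v0 t" if t: "t \<in> {a..b}" for t
  unfolding vF[OF t] v0_def by (intro tendsto_intros lva lF t)
 have "(%n. y n t) ----> y0 a + (t - a) *\<^sub>R va + F (F f0) t" if t: "t \<in> {a..b}" for t
  unfolding yF[OF t] by (intro tendsto_intros lva lFF t ly b)
 then have y0: "y0 t = y0 a + (t - a) *\<^sub>R va + F (F f0) t" if t: "t \<in> {a..b}" for t
  using LIMSEQ_unique[OF ly[OF t]] t by blast
 show ?thesis
 proof (rule that[of v0])
  fix t assume t: "t \<in> {a..b}"
  show "(%n. v n t) ----> v0 t" by (rule lv[OF t])
  show "(v0 hvd f0 t) (at t within {a..b})"
   unfolding v0_def by (auto intro!: derivative_eq_intros dF[OF cf0 t])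
  have "((%t. y0 a + (t - a) *\<^sub>R va + F (F f0) t) hvd v0 t) (at t within {a..b})"
   unfolding v0_def by (auto intro!: derivative_eq_intros dF[OF cF[OF cf0] t])
  then show "(y0 hvd v0 t) (at t within {a..b})"
   by (rule has_vector_derivative_transform[OF t, rotated]) (rule y0)
 qed
qed

text \<open>Arzela-Ascoli on each interval and a diagonal sequence. The hypothesis is a Hoelder
  condition of exponent 1/2, which is all that a bound on the action gives: near a centre the speeds
  are not bounded uniformly in \<open>\<delta>\<close>.\<close>

lemma equicontinuous_limit:
 fixes y :: "nat => real => 'a::euclidean_space"
 assumes eq: "!!k::nat. \<exists>C. \<forall>n. \<forall>s\<in>{- real k..real k}. \<forall>t\<in>{- real k..real k}. (norm (y n s - y n t))^2 <= C * \<bar>s - t\<bar>"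
  and bd: "!!n. norm (y n 0) <= Y"
 obtains r y0 where "strict_mono (r :: nat => nat)"
  "!!(k::nat) e. 0 < e ==> \<exists>n0. \<forall>n\<ge>n0. \<forall>t\<in>{- real k..real k}. norm (y (r n) t - y0 t) < e"
  "!!t. (%n. y (r n) t) ----> y0 t" "continuous_on UNIV y0"
proof -
 define P where "P = (%(k::nat) (z :: nat => real => 'a). \<exists>g. continuous_on {- real k..real k} g &
  (\<forall>e>0. \<exists>n0. \<forall>n\<ge>n0. \<forall>t\<in>{- real k..real k}. norm (z n t - g t) < e))"
 have AA: "\<exists>s. strict_mono (s :: nat => nat) & P k ((y \<circ> r) \<circ> s)" for k and r :: "nat => nat"
 proof -
  let ?S = "{- real k..real k}"
  obtain C' where C': "!!n s t. s \<in> ?S ==> t \<in> ?S ==> (norm (y n s - y n t))^2 <= C' * \<bar>s - t\<bar>"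
   using eq[of k] by blast
  define C where "C = max C' 1"
  have C: "(norm (y n s - y n t))^2 <= C * \<bar>s - t\<bar>" "1 <= C" if "s \<in> ?S" "t \<in> ?S" for n s t
  proof -
   have "C' * \<bar>s - t\<bar> <= C * \<bar>s - t\<bar>" by (intro mult_right_mono) (auto simp: C_def)
   then show "(norm (y n s - y n t))^2 <= C * \<bar>s - t\<bar>" using C'[OF that, of n] by linarith
  qed (simp add: C_def)
  have C1: "1 <= C" by (simp add: C_def)
  obtain g s where g: "continuous_on ?S g" "strict_mono (s :: nat => nat)"
   and lim: "!!e. 0 < e ==> \<exists>N. \<forall>n t. n \<ge> N & t \<in> ?S --> norm (y (r (s n)) t - g t) < e"
  proof (rule Arzela_Ascoli[of ?S "%n. y (r n)" "Y + (C * real k + 1)"])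
   fix n x assume x: "x \<in> ?S"
   have "(norm (y (r n) x - y (r n) 0))^2 <= C * \<bar>x - 0\<bar>" using C(1)[OF x, of 0 "r n"] by simp
   also have "... <= C * real k" using x C1 by (intro mult_left_mono) auto
   also have "C * real k <= (C * real k + 1)^2"
   proof -
    have "u <= (u + 1)^2" if "0 <= u" for u :: real using that by (simp add: power2_eq_square algebra_simps)
    then show ?thesis using C1 by simp
   qed
   finally have "(norm (y (r n) x - y (r n) 0))^2 <= (C * real k + 1)^2" .
   then have "norm (y (r n) x - y (r n) 0) <= C * real k + 1"
    by (rule power2_le_imp_le) (use C1 in simp)
   then show "norm (y (r n) x) <= Y + (C * real k + 1)"
    using norm_triangle_sub[of "y (r n) x" "y (r n) 0"] bd[of "r n"] by linarith
  next
   fix x e :: real assume x: "x \<in> ?S" "0 < e"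
   show "\<exists>d>0. \<forall>n u. u \<in> ?S & norm (x - u) < d --> norm (y (r n) x - y (r n) u) < e"
   proof (intro exI[of _ "e^2 / C"] conjI allI impI)
    show "0 < e^2 / C" using x C1 by simp
    fix n u assume u: "u \<in> ?S & norm (x - u) < e^2 / C"
    have "(norm (y (r n) x - y (r n) u))^2 <= C * \<bar>x - u\<bar>" using C(1) x u by blast
    also have "... < e^2" using u C1 by (simp add: pos_less_divide_eq mult.commute)
    finally show "norm (y (r n) x - y (r n) u) < e" using x by (simp add: power_less_imp_less_base)
   qed
  qed auto
  have "\<exists>n0. \<forall>n\<ge>n0. \<forall>t\<in>?S. norm (y (r (s n)) t - g t) < e" if "0 < e" for e
   using lim[OF that] by blast
  then show ?thesis unfolding P_def using g by (intro exI[of _ s] conjI exI[of _ g]) (auto simp: o_def)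
 qed
 obtain r where r: "strict_mono (r :: nat => nat)" "!!k. P k (y \<circ> (id \<circ> r))"
 proof (rule subsequence_diagonalization_lemma[of "%k r. P k (y \<circ> r)" id])
  show "\<exists>s. strict_mono (s :: nat => nat) & P k (y \<circ> (r \<circ> s))" for k r using AA by (simp add: o_assoc)
  fix i n0 and r k1 k2 :: "nat => nat" assume P: "P i (y \<circ> (r \<circ> k1))" and k: "!!j. n0 <= j ==> \<exists>j'\<ge>j. k2 j = k1 j'"
  obtain g where g: "continuous_on {- real i..real i} g"
   "!!e. e > 0 ==> \<exists>n0. \<forall>n\<ge>n0. \<forall>t\<in>{- real i..real i}. norm ((y \<circ> (r \<circ> k1)) n t - g t) < e"
   using P by (auto simp: P_def)
  have "\<exists>n1. \<forall>n\<ge>n1. \<forall>t\<in>{- real i..real i}. norm ((y \<circ> (r \<circ> k2)) n t - g t) < e" if "e > 0" for e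
  proof -
   obtain n1 where n1: "\<forall>n\<ge>n1. \<forall>t\<in>{- real i..real i}. norm ((y \<circ> (r \<circ> k1)) n t - g t) < e" using g(2)[OF \<open>e > 0\<close>] by blast
   have "norm ((y \<circ> (r \<circ> k2)) n t - g t) < e" if "n \<ge> max n0 n1" "t \<in> {- real i..real i}" for n t
   proof -
    obtain j' where "j' \<ge> n" "k2 n = k1 j'" using k[of n] \<open>n \<ge> max n0 n1\<close> by auto
    then show ?thesis using n1[rule_format, of j' t] that by (simp add: o_def)
   qed
   then show ?thesis by blast
  qed
  then show "P i (y \<circ> (r \<circ> k2))" unfolding P_def using g(1) by blast
 qed (rule that, assumption+)
 have "\<exists>g. continuous_on {- real k..real k} g & (\<forall>e>0. \<exists>n0. \<forall>n\<ge>n0. \<forall>t\<in>{- real k..real k}. norm (y (r n) t - g t) < e)" for k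
  using r(2)[of k] by (simp add: P_def o_def)
 then obtain g where g: "!!k. continuous_on {- real k..real k} (g k)"
  "!!k e. e > 0 ==> \<exists>n0. \<forall>n\<ge>n0. \<forall>t\<in>{- real k..real k}. norm (y (r n) t - g k t) < e" by metis
 have lim: "(%n. y (r n) t) ----> g k t" if "t \<in> {- real k..real k}" for k t
  by (rule LIMSEQ_I) (use g(2)[of _ k] that in blast)
 define y0 where "y0 = (%t. lim (%n. y (r n) t))"
 have gy: "y0 t = g k t" if "t \<in> {- real k..real k}" for k t
  unfolding y0_def by (rule limI[OF lim[OF that]])
 have ex: "\<exists>k::nat. t \<in> {- real k<..<real k}" for t :: real
 proof -
  obtain k :: nat where "\<bar>t\<bar> < real k" using reals_Archimedean2 by blast
  then show ?thesis by (intro exI[of _ k]) auto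
 qed
 show ?thesis
 proof (rule that[OF r(1), of y0])
  show "\<exists>n0. \<forall>n\<ge>n0. \<forall>t\<in>{- real k..real k}. norm (y (r n) t - y0 t) < e" if "0 < e" for k e
   using g(2)[OF that, of k] gy[of _ k] by simp
  show "(%n. y (r n) t) ----> y0 t" for t
  proof -
   obtain k :: nat where "t \<in> {- real k<..<real k}" using ex by blast
   then have "t \<in> {- real k..real k}" by auto
   then show ?thesis using lim gy by metis
  qed
  show "continuous_on UNIV y0"
  proof (subst continuous_on_eq_continuous_at, simp, intro ballI)
   fix t :: real
   obtain k :: nat where k: "t \<in> {- real k<..<real k}" using ex by blast
   have "continuous_on {- real k<..<real k} (g k)" by (rule continuous_on_subset[OF g(1)]) auto
   then have "continuous_on {- real k<..<real k} y0" by (rule continuous_on_eq) (use gy[of _ k] in auto)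
   then show "isCont y0 t" using k by (simp add: continuous_on_eq_continuous_at)
  qed
 qed
qed

text \<open>With \<open>f\<close> zero this is also the monotonicity criterion for a function whose
  one-sided derivative is nonnegative, and it is used in both ways.\<close>

lemma derivative_bound:
 fixes f :: "real => 'a::real_normed_vector"
 assumes ab: "a <= b"
  and f: "!!t. t \<in> {a..b} ==> (f hvd f' t) (at t within {a..b})"
  and p: "!!t. t \<in> {a..b} ==> (\<phi> hrd \<phi>' t) (at t within {a..b})"
  and le: "!!t. t \<in> {a..b} ==> norm (f' t) <= \<phi>' t"
 shows "norm (f b - f a) <= \<phi> b - \<phi> a"
proof (cases "a = b")
 case False
 show ?thesis
 proof (rule differentiable_bound_general)
  show "a < b" using False ab by simp
  show "continuous_on {a..b} f" by (rule continuous_on_vector_derivative[OF f])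
  show "continuous_on {a..b} \<phi>" by (rule DERIV_continuous_on[OF p])
  fix x assume x: "a < x" "x < b"
  have i: "at x within {a..b} = at x" by (rule at_within_Icc_at[OF x])
  show "(f hvd f' x) (at x)" using f[of x] x by (simp add: i)
  show "(\<phi> hvd \<phi>' x) (at x)"
   using p[of x] x by (simp add: i has_real_derivative_iff_has_vector_derivative)
  show "norm (f' x) <= \<phi>' x" using le[of x] x by simp
 qed
qed simp

section \<open>Convexity and escape\<close>

lemma second_order_lower:
 fixes w w' w'' :: "real => real"
 assumes ab: "a <= b"
  and d1: "!!t. t \<in> {a..b} ==> (w hrd w' t) (at t within {a..b})"
  and d2: "!!t. t \<in> {a..b} ==> (w' hrd w'' t) (at t within {a..b})"
  and h: "!!t. t \<in> {a..b} ==> 2 * h <= w'' t"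
 shows "w' a + 2 * h * (b - a) <= w' b" "w a + w' a * (b - a) + h * (b - a)^2 <= w b"
proof -
 have 1: "w' a + 2 * h * (t - a) <= w' t" if t: "t \<in> {a..b}" for t
 proof -
  have "norm ((0::real) - 0) <= (w' t - 2 * h * t) - (w' a - 2 * h * a)"
  proof (rule derivative_bound[where f="%_. 0" and f'="%_. 0" and \<phi>="%t. w' t - 2 * h * t" and \<phi>'="%t. w'' t - 2 * h"])
   fix s assume s: "s \<in> {a..t}"
   have "(w' hrd w'' s) (at s within {a..t})"
    by (rule has_field_derivative_subset[OF d2]) (use s t in auto)
   then show "((%t. w' t - 2 * h * t) hrd w'' s - 2 * h) (at s within {a..t})"
    by (auto intro!: derivative_eq_intros)
   show "norm (0::real) <= w'' s - 2 * h" using h[of s] s t by simp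
  qed (use t in auto)
  then show ?thesis by (simp add: algebra_simps)
 qed
 show "w' a + 2 * h * (b - a) <= w' b" using 1[of b] ab by simp
 have "norm ((0::real) - 0) <= (w b - w' a * (b - a) - h * (b - a)^2) - (w a - w' a * (a - a) - h * (a - a)^2)"
 proof (rule derivative_bound[where f="%_. 0" and f'="%_. 0" and \<phi>="%t. w t - w' a * (t - a) - h * (t - a)^2" and \<phi>'="%t. w' t - w' a - 2 * h * (t - a)"])
  fix s assume s: "s \<in> {a..b}"
  show "((%t. w t - w' a * (t - a) - h * (t - a)^2) hrd w' s - w' a - 2 * h * (s - a)) (at s within {a..b})"
   using d1[OF s] by (auto intro!: derivative_eq_intros)
  show "norm (0::real) <= w' s - w' a - 2 * h * (s - a)" using 1[OF s] by simp
 qed (use ab in auto)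
 then show "w a + w' a * (b - a) + h * (b - a)^2 <= w b" by (simp add: algebra_simps)
qed

text \<open>Convexity is known only while \<open>w\<close> is at least \<open>R\<close>, hence a
  continuation argument at the first time \<open>s\<close> where \<open>w\<close> would drop
  below.\<close>

lemma convex_escape:
 fixes w w' w'' :: "real => real"
 assumes ab: "a <= b" and hp: "0 < h"
  and d1: "!!t. t \<in> {a..b} ==> (w hrd w' t) (at t within {a..b})"
  and d2: "!!t. t \<in> {a..b} ==> (w' hrd w'' t) (at t within {a..b})"
  and h: "!!t. t \<in> {a..b} ==> R <= w t ==> 2 * h <= w'' t"
  and R: "R <= w a" and w'0: "0 <= w' a"
 shows "R <= w b" "w a + h * (b - a)^2 <= w b"
proof -
 have cw: "continuous_on {a..b} w" by (rule DERIV_continuous_on[OF d1])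
 have all: "R <= w t" if tb: "t \<in> {a..b}" for t
 proof (rule ccontr)
  assume n: "\<not> R <= w t"
  define Z where "Z = {u \<in> {a..b}. w u < R}"
  define s where "s = Inf Z"
  have tZ: "t \<in> Z" using n tb by (simp add: Z_def)
  have bb: "bdd_below Z" by (rule bdd_belowI[of _ a]) (auto simp: Z_def)
  have sa: "a <= s" unfolding s_def by (rule cInf_greatest) (use tZ in \<open>auto simp: Z_def\<close>)
  have st: "s <= t" unfolding s_def by (rule cInf_lower[OF tZ bb])
  have sb: "s \<in> {a..b}" using sa st tb by auto
  have bef: "R <= w u" if "u \<in> {a..<s}" for u
  proof (rule ccontr)
   assume "\<not> R <= w u"
   then have "u \<in> Z" using that sb by (auto simp: Z_def)
   then show False using cInf_lower[OF _ bb, of u] that by (auto simp: s_def)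
  qed
  have ws: "R <= w s"
  proof (cases "s = a")
   case False
   then have "a < s" using sa by simp
   have "continuous_on {a..s} w" by (rule continuous_on_subset[OF cw]) (use sb in auto)
   then have "closed ({a..s} \<inter> w -` {R..})" by (intro continuous_closed_preimage) auto
   moreover have "{a..<s} \<subseteq> {a..s} \<inter> w -` {R..}" using bef by auto
   ultimately have "closure {a..<s} \<subseteq> {a..s} \<inter> w -` {R..}" by (rule closure_minimal[rotated])
   moreover have "s \<in> closure {a..<s}" using \<open>a < s\<close> by simp
   ultimately show ?thesis by blast
  qed (use R in simp)
  have R2: "2 * h <= w'' u" if "u \<in> {a..s}" for u
   using h[of u] bef[of u] ws that sb by (cases "u = s") auto
  have w's: "0 <= w' s"
  proof -
   have "w' a + 2 * h * (s - a) <= w' s"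
    by (rule second_order_lower(1)[of a s w w' w'' h])
     (use sa sb R2 in \<open>auto intro: has_field_derivative_subset[OF d1] has_field_derivative_subset[OF d2]\<close>)
   moreover have "0 <= 2 * h * (s - a)" using hp sa by simp
   ultimately show ?thesis using w'0 by linarith
  qed
  have slt: "s < t" using st ws n by (cases "s = t") auto
  \<comment> \<open>Nonnegative slope and positive second derivative at \<open>s\<close> force
    \<open>w\<close> to be nondecreasing for a while after \<open>s\<close>, so \<open>s\<close>
    cannot be the infimum of the times with \<open>w < R\<close>.\<close>
  have pos: "0 < w'' s" using h[OF sb ws] hp by linarith
  have "(w' hrd w'' s) (at s within {a..b})" by (rule d2[OF sb])
  then obtain d where d: "0 < d" "!!e. e > 0 ==> s + e \<in> {a..b} ==> e < d ==> w' s < w' (s + e)"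
   using has_real_derivative_pos_inc_right[OF _ pos] by blast
  define r where "r = min (s + d / 2) t"
  have r: "s < r" "r <= t" "r < s + d" using d(1) slt by (auto simp: r_def)
  have inc: "w s <= w u" if u: "u \<in> {s..r}" for u
  proof -
   have "norm ((0::real) - 0) <= w u - w s"
   proof (rule derivative_bound[where f="%_. 0" and f'="%_. 0" and \<phi>=w and \<phi>'=w'])
    fix x assume x: "x \<in> {s..u}"
    show "(w hrd w' x) (at x within {s..u})"
     by (rule has_field_derivative_subset[OF d1]) (use x u r sb tb in auto)
    show "norm (0::real) <= w' x"
     using d(2)[of "x - s"] w's x u r sb tb by (cases "x = s") auto
   qed (use u in auto)
   then show ?thesis by simp
  qed
  have "r <= s" unfolding s_def
  proof (rule cInf_greatest)
   show "Z ~= {}" using tZ by blast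
   fix x assume x: "x \<in> Z"
   show "r <= x"
   proof (rule ccontr)
    assume "\<not> r <= x"
    then show False using inc[of x] ws x cInf_lower[OF x bb] by (auto simp: s_def Z_def)
   qed
  qed
  then show False using r by simp
 qed
 show "R <= w b" using all ab by simp
 have "w a + w' a * (b - a) + h * (b - a)^2 <= w b"
  by (rule second_order_lower(2)[OF ab d1 d2]) (use h all in auto)
 moreover have "0 <= w' a * (b - a)" using w'0 ab by simp
 ultimately show "w a + h * (b - a)^2 <= w b" by linarith
qed

text \<open>If the velocity converges, so does the mean velocity \<open>Y t /\<^sub>R t\<close>,
  with the same limit; normalising removes the factor \<open>t\<close>.\<close>

lemma direction_of_velocity:
 fixes Y V :: "real => 'a::real_normed_vector"
 assumes d: "!!t. \<tau> < t ==> (Y hvd V t) (at t)"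
  and V: "(V \<longlongrightarrow> w) at_top" and w: "w ~= 0"
 shows "((%t. Y t /\<^sub>R norm (Y t)) \<longlongrightarrow> w /\<^sub>R norm w) at_top"
proof -
 have lim: "((%t. Y t /\<^sub>R t) \<longlongrightarrow> w) at_top"
 proof (rule tendstoI)
  fix e :: real assume e: "0 < e"
  obtain t0 where t0: "!!t. t0 <= t ==> norm (V t - w) < e / 2"
   using tendstoD[OF V, of "e / 2"] e by (auto simp: eventually_at_top_linorder dist_norm)
  define t1 where "t1 = max t0 (max (\<tau> + 1) 1)"
  have t1: "t0 <= t1" "\<tau> < t1" "1 <= t1" by (auto simp: t1_def)
  define K where "K = norm (Y t1 - t1 *\<^sub>R w)"
  have b: "norm ((Y t - t *\<^sub>R w) - (Y t1 - t1 *\<^sub>R w)) <= (e / 2) * t - (e / 2) * t1" if t: "t1 <= t" for t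
  proof (rule derivative_bound[OF t, where f="%t. Y t - t *\<^sub>R w" and f'="%t. V t - w" and \<phi>="%t. (e / 2) * t" and \<phi>'="%_. e / 2"])
   fix s assume s: "s \<in> {t1..t}"
   have "(Y hvd V s) (at s within {t1..t})"
    by (rule has_vector_derivative_at_within[OF d]) (use s t1 in auto)
   then show "((%t. Y t - t *\<^sub>R w) hvd V s - w) (at s within {t1..t})"
    by (auto intro!: derivative_eq_intros)
   show "norm (V s - w) <= e / 2" using t0[of s] s t1 by simp
  qed (auto intro!: derivative_eq_intros)
  have "\<forall>\<^sub>F t in at_top. max t1 (4 * (K + 1) / e) <= t" by (rule eventually_ge_at_top)
  then show "\<forall>\<^sub>F t in at_top. dist (Y t /\<^sub>R t) w < e"
  proof eventually_elim
   case (elim t)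
   then have t: "t1 <= t" "4 * (K + 1) / e <= t" "0 < t" using t1 by auto
   have K0: "0 <= K" by (simp add: K_def)
   have "norm (Y t - t *\<^sub>R w) <= K + norm ((Y t - t *\<^sub>R w) - (Y t1 - t1 *\<^sub>R w))"
    unfolding K_def by (rule norm_triangle_sub)
   also have "... <= K + ((e / 2) * t - (e / 2) * t1)" using b[OF t(1)] by simp
   also have "... < e * t"
   proof -
    have "4 * (K + 1) <= e * t" using t(2) e by (simp add: pos_divide_le_eq mult.commute)
    moreover have "0 <= (e / 2) * t1" using e t1 by simp
    ultimately show ?thesis using K0 e t(3) by (simp add: field_simps)
   qed
   finally have "norm (Y t - t *\<^sub>R w) < e * t" .
   moreover have "Y t /\<^sub>R t - w = (1 / t) *\<^sub>R (Y t - t *\<^sub>R w)" using t(3) by (simp add: scaleR_diff_right divide_inverse)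
   ultimately show ?case using t(3) by (simp add: dist_norm pos_divide_less_eq)
  qed
 qed
 have "((%t. (Y t /\<^sub>R t) /\<^sub>R norm (Y t /\<^sub>R t)) \<longlongrightarrow> w /\<^sub>R norm w) at_top"
  by (rule tendsto_scaleR[OF tendsto_inverse[OF tendsto_norm[OF lim]] lim]) (use w in simp)
 moreover have "\<forall>\<^sub>F t in at_top. (Y t /\<^sub>R t) /\<^sub>R norm (Y t /\<^sub>R t) = Y t /\<^sub>R norm (Y t)"
  using eventually_gt_at_top[of "0::real"] by eventually_elim (simp add: divide_simps)
 ultimately show ?thesis by (rule Lim_transform_eventually)
qed

section \<open>Orbits outside a large ball\<close>

context ncentre
begin

definition orb :: "real => real => (real => real ^ 3) => (real => real ^ 3) => bool" where
 "orb \<delta> T y v \<longleftrightarrow> solves (Fd \<delta>) {0..T} y v & (\<forall>t\<in>{0..T}. (norm (v t))^2 / 2 = Gd \<delta> (y t))"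

lemma orb_orbit: assumes "\<delta> ~= 0" shows "soft.orbit (Gd \<delta>) (Fd \<delta>) T y v \<longleftrightarrow> orb \<delta> T y v"
proof -
 obtain \<Lambda> \<Gamma> B where so: "soft (Gd \<delta>) (Fd \<delta>) H \<Lambda> \<Gamma> B" using soft_Gd[OF assms] by blast
 show ?thesis by (simp add: orb_def soft.orbit_def[OF so])
qed

lemma orb_der:
 assumes "orb \<delta> T y v" "t \<in> {0..T}"
 shows "(y hvd v t) (at t within {0..T})" "(v hvd Fd \<delta> (y t)) (at t within {0..T})"
  "(norm (v t))^2 = 2 * H + 2 * Vd \<delta> (y t)" "sqrt (2 * H) <= norm (v t)"
proof -
 show "(y hvd v t) (at t within {0..T})" "(v hvd Fd \<delta> (y t)) (at t within {0..T})"
  using assms by (auto simp: orb_def solves_def)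
 have "(norm (v t))^2 / 2 = Gd \<delta> (y t)" using assms by (simp add: orb_def)
 then show e: "(norm (v t))^2 = 2 * H + 2 * Vd \<delta> (y t)" by (simp add: Gd_def)
 have "2 * H <= (norm (v t))^2" using e Vd_nonneg[of \<delta> "y t"] by simp
 then show "sqrt (2 * H) <= norm (v t)" by (simp add: real_le_lsqrt)
qed

lemma orb_cont: "orb \<delta> T y v ==> continuous_on {0..T} y" "orb \<delta> T y v ==> continuous_on {0..T} v"
 by (rule continuous_on_vector_derivative[OF orb_der(1)], assumption+)
  (rule continuous_on_vector_derivative[OF orb_der(2)], assumption+)

lemma orb_reverse:
 assumes o: "orb \<delta> T y v" shows "orb \<delta> T (%t. y (T - t)) (%t. - v (T - t))"
proof -
 have ch: "((%t. f (T - t)) hvd - f') (at t within {0..T})"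
  if "t \<in> {0..T}" "(f hvd f') (at (T - t) within {0..T})" for f :: "real => real ^ 3" and f' t
 proof -
  have "((%t. T - t) hvd - 1) (at t within {0..T})"
   by (auto intro!: derivative_eq_intros)
  moreover have "(f hvd f') (at (T - t) within (%t. T - t) ` {0..T})"
   by (rule has_vector_derivative_within_subset[OF that(2)]) auto
  ultimately show ?thesis
   using vector_diff_chain_within[of "%t. T - t" "- 1" t "{0..T}" f f'] by (simp add: o_def)
 qed
 show ?thesis
  unfolding orb_def solves_def
 proof (intro conjI ballI)
  fix t assume t: "t \<in> {0..T}"
  then have t': "T - t \<in> {0..T}" by auto
  show "((%t. y (T - t)) hvd - v (T - t)) (at t within {0..T})"
   by (rule ch[OF t orb_der(1)[OF o t']])
  have "((%t. - v (T - t)) hvd - (- Fd \<delta> (y (T - t)))) (at t within {0..T})"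
   by (intro has_vector_derivative_minus ch[OF t orb_der(2)[OF o t']])
  then show "((%t. - v (T - t)) hvd Fd \<delta> (y (T - t))) (at t within {0..T})" by simp
  show "(norm (- v (T - t)))^2 / 2 = Gd \<delta> (y (T - t))" using o t' by (simp add: orb_def)
 qed
qed

definition act :: "(real => real ^ 3) => real => real => real" where
 "act v s t = integral {s..t} (%u. (norm (v u))^2)"

lemma orb_act:
 assumes d: "\<delta> ~= 0" and o: "orb \<delta> T y v" and st: "0 <= s" "s <= t" "t <= T"
 shows "jac (Gd \<delta>) (y s) (y t) <= act v s t" "2 * H * (t - s) <= act v s t"
  "(norm (y t - y s))^2 <= (t - s) * act v s t" "0 <= act v s t"
proof -
 obtain \<Lambda> \<Gamma> B where so: "soft (Gd \<delta>) (Fd \<delta>) H \<Lambda> \<Gamma> B" using soft_Gd[OF d] by blast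
 interpret soft "Gd \<delta>" "Fd \<delta>" H \<Lambda> \<Gamma> B by (rule so)
 have o': "orbit T y v" using o d by (simp add: orb_orbit)
 show "jac (Gd \<delta>) (y s) (y t) <= act v s t" "2 * H * (t - s) <= act v s t"
  unfolding act_def using jac_orbit_le[OF o' st] orbit_act_ge[OF o' st] .
 then show "0 <= act v s t" using H0 st by (smt (verit) mult_nonneg_nonneg)
 have "(v has_integral (y t - y s)) {s..t}"
  by (rule fundamental_theorem_of_calculus[OF st(2)])
   (rule has_vector_derivative_within_subset[OF orb_der(1)[OF o]], use st in auto)
 then have "y t - y s = integral {s..t} v" by (simp add: integral_unique)
 then show "(norm (y t - y s))^2 <= (t - s) * act v s t"
  unfolding act_def using integral_cauchy_schwarz[OF st(2) continuous_on_subset[OF orb_cont(2)[OF o]]] st by auto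
qed

lemma orb_act_split:
 assumes d: "\<delta> ~= 0" and o: "orb \<delta> T y v" and st: "0 <= s" "s <= t" "t <= u" "u <= T"
 shows "act v s t + act v t u = act v s u"
proof -
 obtain \<Lambda> \<Gamma> B where so: "soft (Gd \<delta>) (Fd \<delta>) H \<Lambda> \<Gamma> B" using soft_Gd[OF d] by blast
 show ?thesis unfolding act_def
  by (rule soft.orbit_act_split[OF so _ st]) (use o d in \<open>simp add: orb_orbit\<close>)
qed

lemma rho1: "2 <= \<rho>1" using C00 M0 H0 by (simp add: \<rho>1_def)

lemma orb_norm_der:
 assumes o: "orb \<delta> T y v" and t: "t \<in> {0..T}"
 shows "((%t. (norm (y t - a))^2) hrd 2 * ((y t - a) \<bullet> v t)) (at t within {0..T})"
  "((%t. 2 * ((y t - a) \<bullet> v t)) hrd 2 * ((norm (v t))^2 + (y t - a) \<bullet> Fd \<delta> (y t))) (at t within {0..T})"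
proof -
 have d: "((%t. y t - a) hvd v t) (at t within {0..T})"
  using orb_der(1)[OF o t] by (auto intro!: derivative_eq_intros)
 show "((%t. (norm (y t - a))^2) hrd 2 * ((y t - a) \<bullet> v t)) (at t within {0..T})"
  unfolding power2_norm_eq_inner has_real_derivative_iff_has_vector_derivative
  using bounded_bilinear.has_vector_derivative[OF bounded_bilinear_inner d d] by (simp add: inner_commute)
 have "((%t. (y t - a) \<bullet> v t) hvd (norm (v t))^2 + (y t - a) \<bullet> Fd \<delta> (y t)) (at t within {0..T})"
  using bounded_bilinear.has_vector_derivative[OF bounded_bilinear_inner d orb_der(2)[OF o t]]
  by (simp add: power2_norm_eq_inner add.commute)
 from has_vector_derivative_mult_right[OF this, of 2]
 show "((%t. 2 * ((y t - a) \<bullet> v t)) hrd 2 * ((norm (v t))^2 + (y t - a) \<bullet> Fd \<delta> (y t))) (at t within {0..T})"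
  by (simp add: has_real_derivative_iff_has_vector_derivative)
qed

text \<open>Lagrange-Jacobi identity: the second derivative of the squared distance is twice squared
  speed plus virial. Outside \<open>\<rho>1\<close> this is at least
  \<open>2 * (2 * H - H)\<close>.\<close>

lemma escape:
 assumes o: "orb \<delta> T y v" and t0: "0 <= t0" "t0 <= t" "t <= T" and r: "\<rho>1 <= norm (y t0)" and p: "0 <= y t0 \<bullet> v t0"
 shows "\<rho>1 <= norm (y t)" "(norm (y t0))^2 + H * (t - t0)^2 <= (norm (y t))^2"
proof -
 let ?w = "%t. (norm (y t - 0))^2" and ?w' = "%t. 2 * ((y t - 0) \<bullet> v t)"
  and ?w'' = "%t. 2 * ((norm (v t))^2 + (y t - 0) \<bullet> Fd \<delta> (y t))"
 have sT: "s \<in> {0..T}" "{t0..t} \<subseteq> {0..T}" if "s \<in> {t0..t}" for s using t0 that by auto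
 have d1: "(?w hrd ?w' s) (at s within {t0..t})" if s: "s \<in> {t0..t}" for s
  by (rule has_field_derivative_subset[OF orb_norm_der(1)[OF o sT(1)[OF s], of 0] sT(2)[OF s]])
 have d2: "(?w' hrd ?w'' s) (at s within {t0..t})" if s: "s \<in> {t0..t}" for s
  by (rule has_field_derivative_subset[OF orb_norm_der(2)[OF o sT(1)[OF s], of 0] sT(2)[OF s]])
 have h: "2 * H <= ?w'' s" if s: "s \<in> {t0..t}" and "\<rho>1^2 <= ?w s" for s
 proof -
  have "\<rho>1 <= norm (y s)" by (rule power2_le_imp_le) (use that(2) in simp_all)
  then show ?thesis
   using abs_le_D2[OF far(3)[of "y s" \<delta>]] orb_der(3)[OF o sT(1)[OF s]] Vd_nonneg[of \<delta> "y s"] by simp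
 qed
 have R: "\<rho>1^2 <= ?w t0" using r rho1 by (simp add: power_mono)
 have w0: "0 <= ?w' t0" using p by simp
 have ce: "\<rho>1^2 <= ?w t"
  by (rule convex_escape(1)[OF t0(2) H0 d1 d2 h R w0])
 have ce2: "?w t0 + H * (t - t0)^2 <= ?w t"
  by (rule convex_escape(2)[OF t0(2) H0 d1 d2 h R w0])
 show "(norm (y t0))^2 + H * (t - t0)^2 <= (norm (y t))^2" using ce2 by simp
 show "\<rho>1 <= norm (y t)" using power2_le_imp_le[of \<rho>1 "norm (y t)"] ce by (simp only: diff_0_right norm_ge_zero)
qed

text \<open>By \<open>escape\<close> the squared distance exceeds \<open>H * (s - t0)^2\<close>, so
  the force is dominated by a multiple of \<open>1 / (s - t0)^2\<close>, whose integral from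
  \<open>t\<close> on is bounded by a multiple of \<open>1 / (t - t0)\<close>.\<close>

lemma escape_velocity:
 assumes o: "orb \<delta> T y v" and t0: "0 <= t0" "t0 < t" "t <= t'" "t' <= T" and r: "\<rho>1 <= norm (y t0)" and p: "0 <= y t0 \<bullet> v t0"
 shows "norm (v t' - v t) <= 4 * M / (H * (t - t0))"
proof -
 have "norm (v t' - v t) <= (- (4 * M / H) / (t' - t0)) - (- (4 * M / H) / (t - t0))"
 proof (rule derivative_bound[OF t0(3), where f'="%s. Fd \<delta> (y s)" and \<phi>="%s. - (4 * M / H) / (s - t0)" and \<phi>'="%s. (4 * M / H) / (s - t0)^2"])
  fix s assume s: "s \<in> {t..t'}"
  have s0: "0 < s - t0" using s t0 by auto
  show "(v hvd Fd \<delta> (y s)) (at s within {t..t'})"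
   by (rule has_vector_derivative_within_subset[OF orb_der(2)[OF o]]) (use s t0 in auto)
  show "((%s. - (4 * M / H) / (s - t0)) hrd (4 * M / H) / (s - t0)^2) (at s within {t..t'})"
   using s0 H0 by (auto intro!: derivative_eq_intros simp: power2_eq_square)
  have e: "\<rho>1 <= norm (y s)" "(norm (y t0))^2 + H * (s - t0)^2 <= (norm (y s))^2"
   using escape[OF o t0(1) _ _ r p, of s] s t0 by auto
  have "norm (Fd \<delta> (y s)) <= 4 * M / (norm (y s))^2" by (rule far(1)[OF e(1)])
  also have "... <= 4 * M / (H * (s - t0)^2)"
  proof (rule divide_left_mono)
   show "H * (s - t0)^2 <= (norm (y s))^2" using e(2) zero_le_power2[of "norm (y t0)"] by linarith
   have "0 < H * (s - t0)^2" using s0 H0 by simp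
   moreover have "0 < (norm (y s))^2" using e(1) rho1 by (intro zero_less_power) linarith
   ultimately show "0 < (norm (y s))^2 * (H * (s - t0)^2)" by (rule mult_pos_pos[rotated])
  qed (use M0 in simp)
  finally show "norm (Fd \<delta> (y s)) <= (4 * M / H) / (s - t0)^2" by simp
 qed
 also have "... <= 4 * M / (H * (t - t0))"
 proof -
  have "0 <= (4 * M / H) / (t' - t0)" using M0 H0 t0 by simp
  then show ?thesis by simp
 qed
 finally show ?thesis .
qed

text \<open>The velocity hardly changes after \<open>t\<close>, so the prescribed end
  \<open>R *\<^sub>R \<xi>\<close> equals \<open>y t + (T - t) *\<^sub>R v t\<close> up to a small
  multiple of \<open>T - t\<close>. The factor 2 comes from replacing the unknown length
  \<open>R / (T - t)\<close> by the speed.\<close>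

lemma escape_direction:
 assumes o: "orb \<delta> T y v" and t0: "0 <= t0" "t0 < t" "t < T" and r: "\<rho>1 <= norm (y t0)" and p: "0 <= y t0 \<bullet> v t0"
  and e: "y T = R *\<^sub>R \<xi>" "norm \<xi> = 1" "0 <= R"
 shows "norm (v t - norm (v t) *\<^sub>R \<xi>) <= 2 * (4 * M / (H * (t - t0)) + norm (y t) / (T - t))"
proof -
 define \<epsilon> where "\<epsilon> = 4 * M / (H * (t - t0))"
 have "norm ((y T - T *\<^sub>R v t) - (y t - t *\<^sub>R v t)) <= \<epsilon> * T - \<epsilon> * t"
 proof (rule derivative_bound[where f="%s. y s - s *\<^sub>R v t" and f'="%s. v s - v t" and \<phi>="%s. \<epsilon> * s" and \<phi>'="%_. \<epsilon>"])
  fix s assume s: "s \<in> {t..T}"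
  have "(y hvd v s) (at s within {t..T})"
   by (rule has_vector_derivative_within_subset[OF orb_der(1)[OF o]]) (use s t0 in auto)
  then show "((%s. y s - s *\<^sub>R v t) hvd v s - v t) (at s within {t..T})"
   by (auto intro!: derivative_eq_intros)
  show "norm (v s - v t) <= \<epsilon>" unfolding \<epsilon>_def
   by (rule escape_velocity[OF o t0(1,2) _ _ r p]) (use s in auto)
 qed (use t0 in \<open>auto intro!: derivative_eq_intros\<close>)
 then have "norm (R *\<^sub>R \<xi> - y t - (T - t) *\<^sub>R v t) <= \<epsilon> * (T - t)"
  by (simp add: e algebra_simps)
 moreover have "(T - t) *\<^sub>R ((R / (T - t)) *\<^sub>R \<xi> - (1 / (T - t)) *\<^sub>R y t - v t) = R *\<^sub>R \<xi> - y t - (T - t) *\<^sub>R v t"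
  using t0 by (simp add: scaleR_diff_right)
 ultimately have "norm ((T - t) *\<^sub>R ((R / (T - t)) *\<^sub>R \<xi> - (1 / (T - t)) *\<^sub>R y t - v t)) <= \<epsilon> * (T - t)"
  by simp
 then have "(T - t) * norm ((R / (T - t)) *\<^sub>R \<xi> - (1 / (T - t)) *\<^sub>R y t - v t) <= \<epsilon> * (T - t)"
  using t0 unfolding norm_scaleR by simp
 then have 1: "norm ((R / (T - t)) *\<^sub>R \<xi> - (1 / (T - t)) *\<^sub>R y t - v t) <= \<epsilon>"
  using t0 by (simp add: mult.commute)
 define \<mu> where "\<mu> = R / (T - t)"
 have mu: "0 <= \<mu>" using e t0 by (simp add: \<mu>_def)
 have 2: "norm (\<mu> *\<^sub>R \<xi> - v t) <= \<epsilon> + norm (y t) / (T - t)"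
  using norm_triangle_ineq[of "(\<mu> *\<^sub>R \<xi> - (1 / (T - t)) *\<^sub>R y t - v t)" "(1 / (T - t)) *\<^sub>R y t"] 1 t0
  by (simp add: \<mu>_def)
 have "\<bar>\<mu> - norm (v t)\<bar> = \<bar>norm (\<mu> *\<^sub>R \<xi>) - norm (v t)\<bar>" using e mu by simp
 also have "... <= norm (\<mu> *\<^sub>R \<xi> - v t)" by (rule norm_triangle_ineq3)
 finally have 3: "\<bar>\<mu> - norm (v t)\<bar> <= \<epsilon> + norm (y t) / (T - t)" using 2 by linarith
 have "v t - norm (v t) *\<^sub>R \<xi> = (\<mu> - norm (v t)) *\<^sub>R \<xi> - (\<mu> *\<^sub>R \<xi> - v t)"
  by (simp add: algebra_simps)
 then have "norm (v t - norm (v t) *\<^sub>R \<xi>) <= norm ((\<mu> - norm (v t)) *\<^sub>R \<xi>) + norm (\<mu> *\<^sub>R \<xi> - v t)"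
  by (simp only: norm_triangle_ineq4)
 then show ?thesis using 2 3 e by (simp add: \<epsilon>_def)
qed

text \<open>The bounds on direction and speed do not depend on \<open>n\<close>, and the
  contribution of the end point disappears as \<open>T n\<close> grows. The limit velocity therefore
  converges to \<open>sqrt (2 * H) *\<^sub>R \<xi>\<close>.\<close>

lemma asymptotics:
 fixes y v :: "nat => real => real ^ 3"
 assumes o: "!!n. orb (\<delta> n) (T n) (y n) (v n)" and t0: "!!n. 0 <= t0 n" "!!n. t0 n <= \<tau>"
  and r: "!!n. \<rho>1 <= norm (y n (t0 n))" and p: "!!n. 0 <= y n (t0 n) \<bullet> v n (t0 n)"
  and e: "!!n. y n (T n) = R n *\<^sub>R \<xi>" "norm \<xi> = 1" "!!n. 0 <= R n" and T: "filterlim T at_top sequentially"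
  and ly: "!!t. \<tau> < t ==> (%n. y n t) ----> Y t" and lv: "!!t. \<tau> < t ==> (%n. v n t) ----> V t"
  and d: "!!t. \<tau> < t ==> (Y hvd V t) (at t)"
 shows "((%t. Y t /\<^sub>R norm (Y t)) \<longlongrightarrow> \<xi>) at_top"
proof -
 have ev: "\<forall>\<^sub>F n in sequentially. t < T n" for t using T by (simp add: filterlim_at_top_dense)
 have dir: "norm (V t - norm (V t) *\<^sub>R \<xi>) <= 2 * (4 * M / (H * (t - \<tau>)))" if t: "\<tau> < t" for t
 proof (rule tendsto_le[OF sequentially_bot])
  show "(%n. norm (v n t - norm (v n t) *\<^sub>R \<xi>)) ----> norm (V t - norm (V t) *\<^sub>R \<xi>)"
   by (intro tendsto_intros lv t)
  have "filterlim (%n. - t + T n) at_top sequentially"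
   by (rule filterlim_tendsto_add_at_top[OF tendsto_const T])
  then have "(%n. norm (y n t) / (- t + T n)) ----> 0"
   by (intro real_tendsto_divide_at_top[OF tendsto_norm[OF ly[OF t]]])
  then have "(%n. 2 * (4 * M / (H * (t - \<tau>)) + norm (y n t) / (- t + T n))) ----> 2 * (4 * M / (H * (t - \<tau>)) + 0)"
   by (intro tendsto_intros)
  then show "(%n. 2 * (4 * M / (H * (t - \<tau>)) + norm (y n t) / (T n - t))) ----> 2 * (4 * M / (H * (t - \<tau>)))"
   by simp
  show "\<forall>\<^sub>F n in sequentially. norm (v n t - norm (v n t) *\<^sub>R \<xi>) <= 2 * (4 * M / (H * (t - \<tau>)) + norm (y n t) / (T n - t))"
   using ev[of t]
  proof eventually_elim
   case (elim n)
   have tn: "t0 n < t" using t0(2)[of n] t by linarith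
   have "norm (v n t - norm (v n t) *\<^sub>R \<xi>) <= 2 * (4 * M / (H * (t - t0 n)) + norm (y n t) / (T n - t))"
    by (rule escape_direction[OF o t0(1) tn elim r p e(1,2,3)])
   also have "... <= 2 * (4 * M / (H * (t - \<tau>)) + norm (y n t) / (T n - t))"
    using M0 H0 t t0(2)[of n] by (intro mult_left_mono add_right_mono divide_left_mono) (auto intro!: mult_pos_pos)
   finally show ?case .
  qed
 qed
 have sp: "sqrt (2 * H) <= norm (V t) & (norm (V t))^2 <= 2 * H + 4 * M / (sqrt H * (t - \<tau>))" if t: "\<tau> < t" for t
 proof
  show "sqrt (2 * H) <= norm (V t)"
  proof (rule tendsto_le[OF sequentially_bot tendsto_norm[OF lv[OF t]] tendsto_const])
   show "\<forall>\<^sub>F n in sequentially. sqrt (2 * H) <= norm (v n t)" using ev[of t]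
   proof eventually_elim
    case (elim n)
    have "t \<in> {0..T n}" using elim t t0[of n] by simp
    then show ?case by (rule orb_der(4)[OF o])
   qed
  qed
  show "(norm (V t))^2 <= 2 * H + 4 * M / (sqrt H * (t - \<tau>))"
  proof (rule tendsto_le[OF sequentially_bot tendsto_const tendsto_power[OF tendsto_norm[OF lv[OF t]]]])
   show "\<forall>\<^sub>F n in sequentially. (norm (v n t))^2 <= 2 * H + 4 * M / (sqrt H * (t - \<tau>))" using ev[of t]
   proof eventually_elim
    case (elim n)
    have tn: "t0 n <= t" using t0(2)[of n] t by linarith
    have tT: "t \<in> {0..T n}" using elim tn t0(1)[of n] by auto
    note es = escape[OF o t0(1) tn less_imp_le[OF elim] r p]
    have "(sqrt H * (t - \<tau>))^2 = H * (t - \<tau>)^2" using H0 by (simp add: power_mult_distrib)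
    also have "... <= H * (t - t0 n)^2" using H0 t t0(2)[of n] by (intro mult_left_mono power_mono) auto
    also have "... <= (norm (y n t))^2" using es(2) zero_le_power2[of "norm (y n (t0 n))"] by linarith
    finally have l: "sqrt H * (t - \<tau>) <= norm (y n t)" by (rule power2_le_imp_le) simp
    have l0: "0 < sqrt H * (t - \<tau>)" using H0 t by simp
    have "Vd (\<delta> n) (y n t) <= 2 * M / norm (y n t)" by (rule far(2)[OF es(1)])
    also have "... <= 2 * M / (sqrt H * (t - \<tau>))"
     using l l0 M0 by (intro divide_left_mono) (auto intro!: mult_pos_pos)
    finally show ?case using orb_der(3)[OF o tT] by simp
   qed
  qed
 qed
 have inv0: "((%t. k / (t - \<tau>)) \<longlongrightarrow> 0) at_top" for k :: real
 proof -
  have "filterlim (%t. - \<tau> + t) at_top at_top" by (rule filterlim_tendsto_add_at_top[OF tendsto_const filterlim_ident])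
  from real_tendsto_divide_at_top[OF tendsto_const this, of k] show ?thesis by simp
 qed
 have evt: "\<forall>\<^sub>F t in at_top. \<tau> < t" by (rule eventually_gt_at_top)
 have "((%t. (norm (V t))^2) \<longlongrightarrow> 2 * H) at_top"
 proof (rule tendsto_sandwich[OF _ _ tendsto_const])
  show "\<forall>\<^sub>F t in at_top. 2 * H <= (norm (V t))^2" using evt
  proof eventually_elim
   case (elim t)
   have "(sqrt (2 * H))^2 <= (norm (V t))^2" using sp[OF elim] H0 by (intro power_mono) auto
   then show ?case using H0 by simp
  qed
  show "\<forall>\<^sub>F t in at_top. (norm (V t))^2 <= 2 * H + (4 * M / sqrt H) / (t - \<tau>)"
   using evt by eventually_elim (use sp in simp)
  show "((%t. 2 * H + (4 * M / sqrt H) / (t - \<tau>)) \<longlongrightarrow> 2 * H) at_top"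
   using tendsto_add[OF tendsto_const[of "2 * H"] inv0[of "4 * M / sqrt H"]] by simp
 qed
 from tendsto_real_sqrt[OF this] have nV: "((%t. norm (V t)) \<longlongrightarrow> sqrt (2 * H)) at_top" by simp
 have "((%t. V t - norm (V t) *\<^sub>R \<xi>) \<longlongrightarrow> 0) at_top"
 proof (rule Lim_null_comparison[OF _ inv0[of "8 * M / H"]])
  show "\<forall>\<^sub>F t in at_top. norm (V t - norm (V t) *\<^sub>R \<xi>) <= 8 * M / H / (t - \<tau>)"
   using evt by eventually_elim (use dir in simp)
 qed
 from tendsto_add[OF this tendsto_scaleR[OF nV tendsto_const[of \<xi>]]]
 have "(V \<longlongrightarrow> sqrt (2 * H) *\<^sub>R \<xi>) at_top" by simp
 moreover have "sqrt (2 * H) *\<^sub>R \<xi> ~= 0" using e(2) H0 by auto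
 ultimately have "((%t. Y t /\<^sub>R norm (Y t)) \<longlongrightarrow> (sqrt (2 * H) *\<^sub>R \<xi>) /\<^sub>R norm (sqrt (2 * H) *\<^sub>R \<xi>)) at_top"
  by (rule direction_of_velocity[rotated]) (rule d)
 moreover have "(sqrt (2 * H) *\<^sub>R \<xi>) /\<^sub>R norm (sqrt (2 * H) *\<^sub>R \<xi>) = \<xi>" using e(2) H0 by simp
 ultimately show ?thesis by (simp only:)
qed

end

section \<open>Ejection from a centre\<close>

lemma norm_cross_le: "norm (cross3 a b) <= norm a * norm b"
proof (rule power2_le_imp_le)
 show "(norm (cross3 a b))^2 <= (norm a * norm b)^2"
  using norm_cross_dot[of a b] zero_le_power2[of "a \<bullet> b"] by linarith
qed simp

lemma bounded_bilinear_cross: "bounded_bilinear cross3"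
 using bilinear_cross by (simp add: bilinear_conv_bounded_bilinear)

lemma cross_cross_self: "cross3 (cross3 x v) x = (x \<bullet> x) *\<^sub>R v - (x \<bullet> v) *\<^sub>R x"
 using Lagrange[of x x v] by (subst cross_skew) simp

lemma norm_cross_diff:
 "norm (cross3 a b - cross3 a' b') <= norm (a - a') * norm b + norm a' * norm (b - b')"
proof -
 have "cross3 a b - cross3 a' b' = cross3 (a - a') b + cross3 a' (b - b')"
  by (simp add: Cross3.left_diff_distrib Cross3.right_diff_distrib)
 also have "norm ... <= norm (cross3 (a - a') b) + norm (cross3 a' (b - b'))" by (rule norm_triangle_ineq)
 finally show ?thesis using norm_cross_le[of "a - a'" b] norm_cross_le[of a' "b - b'"] by linarith
qed

text \<open>One singular centre at the origin; \<open>W\<close> collects \<open>H\<close> and the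
  potential of the others, \<open>g\<close> their force. Condition \<open>sB\<close> makes the
  virial of the singular part dominate inside the radius \<open>s0\<close>, so that the squared
  distance is convex along orbits.\<close>

locale ejection =
 fixes m \<alpha> B s0 :: real and W :: "real ^ 3 => real" and g :: "real ^ 3 => real ^ 3"
 assumes al: "1 <= \<alpha>" "\<alpha> < 2" and pos: "0 < m" "0 < B" "0 < s0" "s0 <= 1"
  and sB: "s0 * B < (2 / \<alpha> - 1) * m"
  and W: "!!x. norm x <= s0 ==> 0 <= W x" "!!x. norm x <= s0 ==> W x <= B"
  and g: "!!x. norm x <= s0 ==> norm (g x) <= B"
  and LW: "!!x y. norm x <= s0 ==> norm y <= s0 ==> \<bar>W x - W y\<bar> <= B * norm (x - y)"
  and Lg: "!!x y. norm x <= s0 ==> norm y <= s0 ==> norm (g x - g y) <= B * norm (x - y)"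
begin

definition F where "F x = - (m * norm x powr (- \<alpha> - 2)) *\<^sub>R x + g x"
text \<open>Lower bound for the radial speed: the energy gives at least
  \<open>2 * m / \<alpha>\<close> for the squared speed, and the bound on \<open>\<epsilon>\<close>
  in \<open>ej\<close> leaves at most \<open>m / \<alpha>\<close> for its angular part.\<close>

definition k where "k = sqrt (m / \<alpha>)"
definition b where "b = B / k"
definition U where "U x = m / \<alpha> * norm x powr (- \<alpha>) + W x"

definition ej :: "(real => real ^ 3) => (real => real ^ 3) => real => bool" where
 "ej x V \<epsilon> \<longleftrightarrow> 0 < \<epsilon> & B^2 * \<epsilon>^2 <= m / \<alpha> & x 0 = 0 & continuous_on {0..\<epsilon>} x &
  (\<forall>t\<in>{0<..<\<epsilon>}. x t ~= 0 & norm (x t) <= s0 & (x hvd V t) (at t) &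
    (V hvd F (x t)) (at t) & (norm (V t))^2 = 2 * U (x t))"

text \<open>The ejection orbit with the radius as independent variable: \<open>h\<close> is the
  time, \<open>q\<close> the radial speed, \<open>Y\<close> the direction, \<open>\<Lambda>\<close>
  the angular momentum. The singular central force has dropped out of the equations for
  \<open>Y\<close> and \<open>\<Lambda>\<close>, whose right-hand sides stay bounded at the
  collision.\<close>

definition rad where
 "rad s h q Y \<Lambda> \<longleftrightarrow> (\<forall>r\<in>{0<..<s}. 0 < h r & k * h r <= r & norm (Y r) = (1::real) &
  (h hrd (1 / q r)) (at r) & k <= q r & norm (\<Lambda> r) <= b * r^2 &
  (q r)^2 = 2 * (m / \<alpha> * r powr (- \<alpha>) + W (r *\<^sub>R Y r)) - (norm (\<Lambda> r))^2 / r^2 &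
  (Y hvd (1 / (r^2 * q r)) *\<^sub>R cross3 (\<Lambda> r) (Y r)) (at r) &
  (\<Lambda> hvd (r / q r) *\<^sub>R cross3 (Y r) (g (r *\<^sub>R Y r))) (at r))"

lemma kb: "0 < k" "0 < b" "k^2 = m / \<alpha>" using al pos by (auto simp: k_def b_def)

lemma powr_ge1: "0 < r ==> r <= s0 ==> 1 <= r powr (- \<alpha>)"
 using powr_mono2'[of "- \<alpha>" r 1] al pos by simp

context
 fixes x V \<epsilon> assumes e: "ej x V \<epsilon>"
begin

lemma ejD:
 assumes "t \<in> {0<..<\<epsilon>}"
 shows "x t ~= 0" "norm (x t) <= s0" "(x hvd V t) (at t)" "(V hvd F (x t)) (at t)"
  "(norm (V t))^2 = 2 * U (x t)" "0 < norm (x t)"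
 using e assms by (auto simp: ej_def)

lemma ej_w: assumes t: "t \<in> {0<..<\<epsilon>}"
 shows "((%t. x t \<bullet> x t) hrd 2 * (x t \<bullet> V t)) (at t)"
  "\<exists>D>0. ((%t. x t \<bullet> V t) hrd D) (at t)"
proof -
 note d = ejD[OF t]
 show "((%t. x t \<bullet> x t) hrd 2 * (x t \<bullet> V t)) (at t)"
  unfolding has_real_derivative_iff_has_vector_derivative
  using bounded_bilinear.has_vector_derivative[OF bounded_bilinear_inner d(3) d(3)] by (simp add: inner_commute)
 have D: "((%t. x t \<bullet> V t) hrd (x t \<bullet> F (x t) + V t \<bullet> V t)) (at t)"
  unfolding has_real_derivative_iff_has_vector_derivative
  by (rule bounded_bilinear.has_vector_derivative[OF bounded_bilinear_inner d(3) d(4)])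
 define n where "n = norm (x t)"
 have n: "0 < n" "n <= s0" using d by (auto simp: n_def)
 have xx: "x t \<bullet> x t = n powr 2" using n by (simp add: n_def dot_square_norm powr_numeral)
 have "x t \<bullet> F (x t) = - m * (n powr (- \<alpha> - 2) * n powr 2) + x t \<bullet> g (x t)"
  unfolding F_def inner_add_right inner_scaleR_right xx n_def[symmetric] by simp
 also have "n powr (- \<alpha> - 2) * n powr 2 = n powr (- \<alpha>)" by (simp only: powr_add[symmetric]) simp
 finally have F: "x t \<bullet> F (x t) = - m * n powr (- \<alpha>) + x t \<bullet> g (x t)" .
 have V: "V t \<bullet> V t = 2 * (m / \<alpha> * n powr (- \<alpha>) + W (x t))" using d(5) by (simp add: U_def n_def dot_square_norm)
 have "\<bar>x t \<bullet> g (x t)\<bar> <= n * B"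
  using Cauchy_Schwarz_ineq2[of "x t" "g (x t)"] mult_left_mono[OF g[OF d(2)], of n] by (simp add: n_def)
 also have "n * B <= s0 * B" using n pos by (intro mult_right_mono) auto
 finally have 1: "- (s0 * B) <= x t \<bullet> g (x t)" by linarith
 have "0 <= (2 / \<alpha> - 1) * m" using al pos by (simp add: field_simps)
 from mult_left_mono[OF powr_ge1[OF n] this] have 2: "(2 / \<alpha> - 1) * m <= (2 / \<alpha> - 1) * m * n powr (- \<alpha>)" by simp
 have "x t \<bullet> F (x t) + V t \<bullet> V t = (2 / \<alpha> - 1) * m * n powr (- \<alpha>) + x t \<bullet> g (x t) + 2 * W (x t)"
  unfolding F V by (simp add: algebra_simps)
 then have "0 < x t \<bullet> F (x t) + V t \<bullet> V t" using 1 2 sB W(1)[OF d(2)] by linarith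
 then show "\<exists>D>0. ((%t. x t \<bullet> V t) hrd D) (at t)" using D by blast
qed

lemma ej_small: assumes "0 < e'" shows "\<exists>d>0. \<forall>a\<in>{0<..<\<epsilon>}. a < d --> norm (x a) < e'"
proof -
 have "continuous_on {0..\<epsilon>} x" "x 0 = 0" "0 \<in> {0..\<epsilon>}" using e by (auto simp: ej_def)
 then obtain d where "d > 0" "!!a. a \<in> {0..\<epsilon>} ==> dist a 0 < d ==> dist (x a) (x 0) < e'"
  unfolding continuous_on_iff using assms by blast
 then show ?thesis using \<open>x 0 = 0\<close> by (intro exI[of _ d]) auto
qed

text \<open>\<open>x \<bullet> V\<close> increases. Were it not positive at \<open>t\<close>, it
  would be nonpositive at all earlier times, and the distance could not have grown from its value 0
  at the collision.\<close>

lemma ej_out: assumes t: "t \<in> {0<..<\<epsilon>}" shows "0 < x t \<bullet> V t"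
proof (rule ccontr)
 assume n: "\<not> 0 < x t \<bullet> V t"
 have neg: "x s \<bullet> V s <= 0" if s: "0 < s" "s <= t" for s
 proof (cases "s = t")
  case False
  have "x s \<bullet> V s < x t \<bullet> V t"
  proof (rule DERIV_pos_imp_increasing[of s t "%t. x t \<bullet> V t"])
   fix u assume "s <= u" "u <= t"
   then have "u \<in> {0<..<\<epsilon>}" using s t by auto
   from ej_w(2)[OF this] show "\<exists>y. ((%t. x t \<bullet> V t) hrd y) (at u) & 0 < y" by (metis (no_types))
  qed (use False s in simp)
  then show ?thesis using n by simp
 qed (use n in simp)
 obtain d where d: "0 < d" "!!a. a \<in> {0<..<\<epsilon>} ==> a < d ==> norm (x a) < norm (x t)"
  using ej_small[OF ejD(6)[OF t]] by blast
 define a where "a = min (d / 2) t"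
 have a: "0 < a" "a <= t" "a < d" using d t by (auto simp: a_def)
 have "x t \<bullet> x t <= x a \<bullet> x a"
 proof (rule DERIV_nonpos_imp_nonincreasing[OF a(2), of "%t. x t \<bullet> x t"])
  fix s assume "a <= s" "s <= t"
  then show "\<exists>y. ((%t. x t \<bullet> x t) hrd y) (at s) & y <= 0"
   using ej_w(1)[of s] neg[of s] a t by (intro exI[of _ "2 * (x s \<bullet> V s)"]) auto
 qed
 then have "norm (x t) <= norm (x a)" by (simp add: norm_le)
 then show False using d(2)[of a] a t by auto
qed

lemma ej_norm_der: assumes t: "t \<in> {0<..<\<epsilon>}"
 shows "((%t. norm (x t)) hrd (x t \<bullet> V t) / norm (x t)) (at t)"
proof -
 have p: "0 < x t \<bullet> x t" using ejD(1)[OF t] by simp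
 have aux: "(inverse a / 2) * (2 * b) = b / a" for a b :: real by (simp add: field_simps)
 have "((%t. sqrt (x t \<bullet> x t)) hrd (x t \<bullet> V t) / sqrt (x t \<bullet> x t)) (at t)"
  by (rule DERIV_cong[OF DERIV_chain2[where f=sqrt and g="%t. x t \<bullet> x t", OF DERIV_real_sqrt[OF p] ej_w(1)[OF t]] aux])
 then show ?thesis unfolding norm_eq_sqrt_inner .
qed

lemma ej_mono: assumes "0 < s" "s < t" "t < \<epsilon>" shows "norm (x s) < norm (x t)"
proof (rule DERIV_pos_imp_increasing[of s t "%t. norm (x t)", OF assms(2)])
 fix u assume "s <= u" "u <= t"
 then have u: "u \<in> {0<..<\<epsilon>}" using assms by auto
 show "\<exists>y. ((%t. norm (x t)) hrd y) (at u) & 0 < y"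
  by (rule exI[of _ "x u \<bullet> V u / norm (x u)"], rule conjI[OF ej_norm_der[OF u]]) (use ej_out[OF u] ejD(6)[OF u] in simp)
qed

lemma ej_L_der: assumes t: "t \<in> {0<..<\<epsilon>}"
 shows "((%t. cross3 (x t) (V t)) hvd cross3 (x t) (g (x t))) (at t)"
proof -
 have "((%t. cross3 (x t) (V t)) hvd (cross3 (x t) (F (x t)) + cross3 (V t) (V t))) (at t)"
  by (rule bounded_bilinear.has_vector_derivative[OF bounded_bilinear_cross ejD(3,4)[OF t]])
 moreover have "cross3 (x t) (F (x t)) + cross3 (V t) (V t) = cross3 (x t) (g (x t))"
  unfolding F_def cross_add_right cross_mult_right by simp
 ultimately show ?thesis by (simp only:)
qed

text \<open>The central part of the force exerts no torque. The angular momentum starts from zero,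
  because its square is at most of order \<open>norm (x a) powr (2 - \<alpha>)\<close> and
  \<open>\<alpha> < 2\<close>.\<close>

lemma ej_L: assumes t: "t \<in> {0<..<\<epsilon>}" shows "norm (cross3 (x t) (V t)) <= B * norm (x t) * t"
proof -
 let ?L = "%t. cross3 (x t) (V t)"
 have 1: "norm (?L t) <= B * norm (x t) * t + norm (?L a)" if a: "0 < a" "a < t" for a
 proof -
  have "norm (?L t - ?L a) <= (B * norm (x t)) * t - (B * norm (x t)) * a"
  proof (rule derivative_bound[where f' = "%t. cross3 (x t) (g (x t))" and \<phi>="%u. (B * norm (x t)) * u" and \<phi>'="%_. B * norm (x t)"])
   fix u assume u: "u \<in> {a..t}"
   then have u': "u \<in> {0<..<\<epsilon>}" using a t by auto
   show "(?L hvd cross3 (x u) (g (x u))) (at u within {a..t})"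
    by (rule has_vector_derivative_at_within[OF ej_L_der[OF u']])
   have "norm (x u) <= norm (x t)" using ej_mono[of u t] u a t by (cases "u = t") auto
   then have "norm (x u) * norm (g (x u)) <= norm (x t) * B" by (intro mult_mono g ejD(2)[OF u']) auto
   then show "norm (cross3 (x u) (g (x u))) <= B * norm (x t)"
    using norm_cross_le[of "x u" "g (x u)"] by (simp add: mult.commute)
  qed (use a in \<open>auto intro!: derivative_eq_intros\<close>)
  moreover have "0 <= B * norm (x t) * a" using pos a by simp
  ultimately show ?thesis using norm_triangle_ineq2[of "?L t" "?L a"] by linarith
 qed
 have 2: "(norm (?L a))^2 <= 2 * (m / \<alpha> * norm (x a) powr (2 - \<alpha>) + B * (norm (x a))^2)" if a: "a \<in> {0<..<\<epsilon>}" for a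
 proof -
  define n where "n = norm (x a)"
  have n: "0 < n" "n <= s0" using ejD[OF a] by (auto simp: n_def)
  have "(norm (?L a))^2 <= (norm (x a) * norm (V a))^2" by (intro power_mono norm_cross_le) simp
  also have "... = 2 * (m / \<alpha> * (n^2 * n powr (- \<alpha>)) + W (x a) * n^2)"
   unfolding power_mult_distrib ejD(5)[OF a] U_def n_def by (simp add: algebra_simps)
  also have "n^2 * n powr (- \<alpha>) = n powr (2 - \<alpha>)"
  proof -
   have "n^2 = n powr 2" using n by (simp add: powr_numeral)
   then show ?thesis by (simp add: powr_add[symmetric])
  qed
  finally show ?thesis unfolding n_def using mult_right_mono[OF W(2)[OF ejD(2)[OF a]], of "(norm (x a))^2"] by simp
 qed
 have ev: "\<forall>\<^sub>F a in at_right 0. 0 < a & a < t" using t by (auto simp: eventually_at_right_less eventually_at_right_field intro!: exI[of _ t])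
 have x0: "((%a. norm (x a)) \<longlongrightarrow> 0) (at_right 0)"
 proof (rule tendstoI)
  fix e' :: real assume "0 < e'"
  then obtain d where d: "0 < d" "\<forall>a\<in>{0<..<\<epsilon>}. a < d --> norm (x a) < e'" using ej_small by blast
  show "\<forall>\<^sub>F a in at_right 0. dist (norm (x a)) 0 < e'"
   using d t by (auto simp: eventually_at_right_field intro!: exI[of _ "min d t"])
 qed
 have "((%a. 2 * (m / \<alpha> * norm (x a) powr (2 - \<alpha>) + B * (norm (x a))^2)) \<longlongrightarrow> 2 * (m / \<alpha> * 0 + B * 0^2)) (at_right 0)"
 proof (intro tendsto_intros x0)
  show "((%a. norm (x a) powr (2 - \<alpha>)) \<longlongrightarrow> 0) (at_right 0)"
   by (rule tendsto_zero_powrI[OF x0 tendsto_const]) (use al in auto)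
 qed
 then have b0: "((%a. 2 * (m / \<alpha> * norm (x a) powr (2 - \<alpha>) + B * (norm (x a))^2)) \<longlongrightarrow> 0) (at_right 0)" by simp
 have "((%a. (norm (?L a))^2) \<longlongrightarrow> 0) (at_right 0)"
  by (rule tendsto_sandwich[OF _ _ tendsto_const b0]) (use ev 2 t in \<open>auto elim!: eventually_mono\<close>)
 from tendsto_real_sqrt[OF this] have L0: "((%a. norm (?L a)) \<longlongrightarrow> 0) (at_right 0)" by simp
 have "norm (?L t) <= B * norm (x t) * t + 0"
  by (rule tendsto_lowerbound[OF tendsto_add[OF tendsto_const L0]]) (use ev 1 in \<open>auto elim!: eventually_mono\<close>)
 then show ?thesis by simp
qed

lemma ej_q: assumes t: "t \<in> {0<..<\<epsilon>}"
 defines "q \<equiv> (x t \<bullet> V t) / norm (x t)"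
 shows "k <= q" "q^2 = 2 * U (x t) - (norm (cross3 (x t) (V t)))^2 / (norm (x t))^2"
proof -
 define n where "n = norm (x t)"
 have n: "0 < n" "n <= s0" using ejD[OF t] by (auto simp: n_def)
 let ?l = "norm (cross3 (x t) (V t))"
 have "(x t \<bullet> V t)^2 = n^2 * (2 * U (x t)) - ?l^2"
  using norm_cross_dot[of "x t" "V t"] ejD(5)[OF t] by (simp add: n_def power_mult_distrib)
 then show q: "q^2 = 2 * U (x t) - ?l^2 / (norm (x t))^2"
  using n by (simp add: q_def n_def[symmetric] power_divide diff_divide_distrib)
 have "?l^2 <= (B * n * t)^2" unfolding n_def by (intro power_mono ej_L t) simp
 then have "?l^2 / n^2 <= B^2 * t^2" using n by (simp add: pos_divide_le_eq power_mult_distrib mult_ac)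
 also have "... <= B^2 * \<epsilon>^2" using t by (intro mult_left_mono power_mono) auto
 also have "... <= m / \<alpha>" using e by (simp add: ej_def)
 finally have 1: "?l^2 / (norm (x t))^2 <= m / \<alpha>" by (simp add: n_def)
 have "m / \<alpha> * 1 <= m / \<alpha> * n powr (- \<alpha>)" using pos al by (intro mult_left_mono powr_ge1 n) auto
 then have "m / \<alpha> <= U (x t)" using W(1)[OF ejD(2)[OF t]] by (simp add: U_def n_def)
 then have "k^2 <= q^2" using q 1 kb(3) by linarith
 moreover have "0 <= q" using ej_out[OF t] n by (simp add: q_def n_def)
 ultimately show "k <= q" by (rule power2_le_imp_le)
qed

lemma ej_lin: assumes t: "t \<in> {0<..<\<epsilon>}" shows "k * t <= norm (x t)"
proof (rule ccontr)
 assume n: "\<not> k * t <= norm (x t)"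
 have kt: "k * (t - a) <= norm (x t)" if a: "0 < a" "a < t" for a
 proof -
  have "norm ((0::real) - 0) <= (norm (x t) - k * t) - (norm (x a) - k * a)"
  proof (rule derivative_bound[where f="%_. 0" and f'="%_. 0" and \<phi>="%t. norm (x t) - k * t" and \<phi>'="%t. (x t \<bullet> V t) / norm (x t) - k"])
   fix u assume u: "u \<in> {a..t}"
   then have u': "u \<in> {0<..<\<epsilon>}" using a t by auto
   show "((%t. norm (x t) - k * t) hrd x u \<bullet> V u / norm (x u) - k) (at u within {a..t})"
    by (rule has_field_derivative_at_within) (auto intro!: derivative_eq_intros ej_norm_der[OF u'])
   show "norm (0::real) <= x u \<bullet> V u / norm (x u) - k" using ej_q(1)[OF u'] by simp
  qed (use a in auto)
  then have "0 <= (norm (x t) - k * t) - (norm (x a) - k * a)" by simp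
  then show ?thesis using norm_ge_zero[of "x a"] unfolding right_diff_distrib by linarith
 qed
 define a where "a = (t - norm (x t) / k) / 2"
 have "norm (x t) / k < t" using n kb by (simp add: pos_divide_less_eq mult.commute)
 moreover have "0 < norm (x t) / k" using ejD(6)[OF t] kb by simp
 ultimately have "0 < a" "a < t" by (auto simp: a_def)
 from kt[OF this] show False using n kb by (simp add: a_def field_simps)
qed

lemma ej_y_der: assumes t: "t \<in> {0<..<\<epsilon>}"
 shows "((%t. (1 / norm (x t)) *\<^sub>R x t) has_vector_derivative
  (1 / (norm (x t))^2) *\<^sub>R cross3 (cross3 (x t) (V t)) ((1 / norm (x t)) *\<^sub>R x t)) (at t)"
proof -
 define n where "n = norm (x t)"
 have n: "0 < n" using ejD(6)[OF t] by (simp add: n_def)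
 have "((%t. 1 / norm (x t)) hrd - ((x t \<bullet> V t) / n) / n^2) (at t)"
  unfolding n_def using ejD(6)[OF t]
  by (auto intro!: derivative_eq_intros ej_norm_der[OF t] simp: power2_eq_square)
 from bounded_bilinear.has_vector_derivative[OF bounded_bilinear_scaleR this[unfolded has_real_derivative_iff_has_vector_derivative] ejD(3)[OF t]]
 have "((%t. (1 / norm (x t)) *\<^sub>R x t) has_vector_derivative
   (1 / n) *\<^sub>R V t + (- (x t \<bullet> V t / n) / n^2) *\<^sub>R x t) (at t)" by (simp add: n_def)
 moreover have "(1 / n^2) *\<^sub>R cross3 (cross3 (x t) (V t)) ((1 / n) *\<^sub>R x t) = (1 / n) *\<^sub>R V t + (- (x t \<bullet> V t / n) / n^2) *\<^sub>R x t"
  using n by (simp add: cross_mult_right cross_cross_self dot_square_norm n_def[symmetric] scaleR_diff_right power2_eq_square)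
 ultimately show ?thesis by (simp add: n_def)
qed

lemma ej_rad:
 obtains s h q Y \<Lambda> t1 where "0 < s" "s <= s0" "rad s h q Y \<Lambda>" "0 < t1"
  "!!t. t \<in> {0<..<t1} ==> norm (x t) \<in> {0<..<s} & h (norm (x t)) = t & x t = norm (x t) *\<^sub>R Y (norm (x t))"
proof -
 have e0: "0 < \<epsilon>" using e by (simp add: ej_def)
 \<comment> \<open>Taken inside the interval, so that the orbit is regular at \<open>t1\<close> and
   every radius below \<open>s\<close> is attained before it.\<close>
 define t1 where "t1 = \<epsilon> / 2"
 have t1: "0 < t1" "t1 < \<epsilon>" using e0 by (auto simp: t1_def)
 have in\<epsilon>: "t \<in> {0<..<\<epsilon>}" if "0 < t" "t <= t1" for t using that t1 by auto
 let ?R = "%t. norm (x t)"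
 define s where "s = ?R t1"
 have s: "0 < s" "s <= s0" using ejD[OF in\<epsilon>[of t1]] t1 by (auto simp: s_def)
 have inj: "inj_on ?R {0<..<t1}"
  by (rule linorder_inj_onI) (use ej_mono t1 in \<open>force simp: less_imp_neq\<close>)+
 define h where "h = inv_into {0<..<t1} ?R"
 have hR: "h (?R t) = t" if "t \<in> {0<..<t1}" for t unfolding h_def by (rule inv_into_f_f[OF inj that])
 have Rs: "?R t \<in> {0<..<s}" if "t \<in> {0<..<t1}" for t
  using that ej_mono[of t t1] t1 ejD(6)[of t] by (auto simp: s_def)
 have hr: "h r \<in> {0<..<t1} & ?R (h r) = r" if r: "r \<in> {0<..<s}" for r
 proof -
  have cx: "continuous_on {0..t1} x" using e t1 by (auto simp: ej_def intro: continuous_on_subset)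
  have "\<exists>t\<ge>0. t <= t1 & ?R t = r"
   by (rule IVT'[of ?R 0 r t1]) (use r e t1 in \<open>auto simp: s_def ej_def intro!: continuous_intros cx\<close>)
  then obtain t where t: "0 <= t" "t <= t1" "?R t = r" by blast
  have "t ~= 0" using t r e by (auto simp: ej_def)
  moreover have "t ~= t1" using t r by (auto simp: s_def)
  ultimately have "t \<in> {0<..<t1}" using t by auto
  then show ?thesis using hR[of t] t by auto
 qed
 have hd: "(h hrd 1 / ((x (h r) \<bullet> V (h r)) / r)) (at r)" if r: "r \<in> {0<..<s}" for r
 proof -
  define t where "t = h r"
  have t: "t \<in> {0<..<t1}" "?R t = r" using hr[OF r] by (auto simp: t_def)
  define a where "a = t / 2" define a' where "a' = (t + t1) / 2"
  have a: "0 < a" "a < t" "t < a'" "a' < t1" using t by (auto simp: a_def a'_def)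
  have sub: "u \<in> {0<..<t1} & u \<in> {0<..<\<epsilon>}" if "u \<in> {a..a'}" for u using that a t1 by auto
  \<comment> \<open>The inverse function lemma works on compact intervals, so it is applied around
    each time; the local inverse agrees with \<open>h\<close> by injectivity.\<close>
  obtain h' where h': "!!t. t \<in> {a..a'} ==> h' (?R t) = t" "!!s. s \<in> {?R a..?R a'} ==> h' s \<in> {a..a'} & ?R (h' s) = s"
   "!!s. s \<in> {?R a..?R a'} ==> (h' hrd (1 / (x (h' s) \<bullet> V (h' s) / ?R (h' s)))) (at s within {?R a..?R a'})"
  proof (rule increasing_inverse[of a a' ?R "%t. x t \<bullet> V t / ?R t"])
   fix t assume "t \<in> {a..a'}"
   from sub[OF this] have t: "t \<in> {0<..<\<epsilon>}" by simp
   show "(?R hrd x t \<bullet> V t / ?R t) (at t within {a..a'})"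
    by (rule has_field_derivative_at_within[OF ej_norm_der[OF t]])
   show "0 < x t \<bullet> V t / ?R t" using ej_out[OF t] ejD(6)[OF t] by simp
  qed (use a in auto)
  have aR: "?R a < r" "r < ?R a'" using ej_mono[of a t] ej_mono[of t a'] a t t1 by auto
  have eq: "h' u = h u" if "u \<in> {?R a..?R a'}" for u
   using h'(2)[OF that] sub hR by metis
  have "(h' hrd (1 / (x (h' r) \<bullet> V (h' r) / ?R (h' r)))) (at r within {?R a..?R a'})"
   by (rule h'(3)) (use aR in auto)
  moreover have "at r within {?R a..?R a'} = at r" by (rule at_within_Icc_at) (use aR in auto)
  ultimately have "(h' hrd (1 / (x t \<bullet> V t / r))) (at r)"
   using eq[of r] aR t by (simp add: t_def)
  then have "(h hrd (1 / (x t \<bullet> V t / r))) (at r)"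
   by (rule has_field_derivative_transform_within_open[of _ _ _ "{?R a<..<?R a'}"]) (use eq aR in auto)
  then show ?thesis by (simp add: t_def)
 qed
 define q where "q = (%r. (x (h r) \<bullet> V (h r)) / r)"
 define Y where "Y = (%r. (1 / norm (x (h r))) *\<^sub>R x (h r))"
 define \<Lambda> where "\<Lambda> = (%r. cross3 (x (h r)) (V (h r)))"
 have "rad s h q Y \<Lambda>"
  unfolding rad_def
 proof (intro ballI conjI)
  fix r assume r: "r \<in> {0<..<s}"
  have r0: "0 < r" using r by simp
  have t: "h r \<in> {0<..<\<epsilon>}" "?R (h r) = r" using hr[OF r] t1 by auto
  show "0 < h r" using t by simp
  show "k * h r <= r" using ej_lin[OF t(1)] t(2) by simp
  show "norm (Y r) = 1" using r0 t by (simp add: Y_def)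
  show hq: "(h hrd 1 / q r) (at r)" unfolding q_def by (rule hd[OF r])
  show kq: "k <= q r" using ej_q(1)[OF t(1)] t(2) by (simp add: q_def)
  have "norm (\<Lambda> r) <= B * r * h r" using ej_L[OF t(1)] t(2) by (simp add: \<Lambda>_def)
  also have "... <= B * r * (r / k)"
   using ej_lin[OF t(1)] t(2) pos r0 kb by (intro mult_left_mono) (auto simp: pos_le_divide_eq mult.commute)
  finally show "norm (\<Lambda> r) <= b * r^2" by (simp add: b_def power2_eq_square)
  have xY: "x (h r) = r *\<^sub>R Y r" using t r0 by (simp add: Y_def)
  show "(q r)^2 = 2 * (m / \<alpha> * r powr (- \<alpha>) + W (r *\<^sub>R Y r)) - (norm (\<Lambda> r))^2 / r^2"
   using ej_q(2)[OF t(1)] t(2) by (simp add: q_def U_def xY[symmetric] \<Lambda>_def)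
  have hv: "(h hvd 1 / q r) (at r)" using hq by (simp add: has_real_derivative_iff_has_vector_derivative)
  from vector_diff_chain_at[OF hv ej_y_der[OF t(1)]]
  show "(Y hvd (1 / (r^2 * q r)) *\<^sub>R cross3 (\<Lambda> r) (Y r)) (at r)"
   using t(2) by (simp add: Y_def[abs_def] o_def \<Lambda>_def cross_mult_right mult_ac)
  from vector_diff_chain_at[OF hv ej_L_der[OF t(1)]]
  have "(\<Lambda> hvd (1 / q r) *\<^sub>R cross3 (x (h r)) (g (x (h r)))) (at r)"
   by (simp add: \<Lambda>_def[abs_def] o_def)
  then show "(\<Lambda> hvd (r / q r) *\<^sub>R cross3 (Y r) (g (r *\<^sub>R Y r))) (at r)"
   by (simp add: xY cross_mult_left)
 qed
 then show ?thesis
 proof (rule that[OF s _ t1(1)])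
  fix t assume t: "t \<in> {0<..<t1}"
  then have "0 < norm (x t)" using ejD(6)[of t] t1 by auto
  then show "?R t \<in> {0<..<s} & h (?R t) = t & x t = ?R t *\<^sub>R Y (?R t)"
   using Rs[OF t] hR[OF t] by (simp add: Y_def)
 qed
qed

end

lemma radD:
 assumes "rad s h q Y \<Lambda>" "r \<in> {0<..<s}"
 shows "0 < h r" "k * h r <= r" "norm (Y r) = 1" "(h hrd (1 / q r)) (at r)" "k <= q r"
  "norm (\<Lambda> r) <= b * r^2" "(q r)^2 = 2 * (m / \<alpha> * r powr (- \<alpha>) + W (r *\<^sub>R Y r)) - (norm (\<Lambda> r))^2 / r^2"
  "(Y hvd (1 / (r^2 * q r)) *\<^sub>R cross3 (\<Lambda> r) (Y r)) (at r)"
  "(\<Lambda> hvd (r / q r) *\<^sub>R cross3 (Y r) (g (r *\<^sub>R Y r))) (at r)"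
  "0 < r" "0 < q r"
 using assms kb by (auto simp: rad_def intro: less_le_trans)

lemma rad_mono: "rad s h q Y \<Lambda> ==> s' <= s ==> rad s' h q Y \<Lambda>"
 by (auto simp: rad_def)

text \<open>The bound \<open>b * r^2\<close> on the angular momentum cancels the square in the
  denominator, so the direction is Lipschitz in the radius with constant \<open>b / k\<close> and
  has a limit at the collision.\<close>

lemma rad_limit:
 assumes R: "rad s h q Y \<Lambda>" and s: "0 < s"
 shows "\<exists>w. norm w = 1 & (Y \<longlongrightarrow> w) (at_right 0)"
proof -
 have lip: "norm (Y r - Y r') <= (b / k) * r - (b / k) * r'" if r: "0 < r'" "r' <= r" "r < s" for r r'
 proof (rule derivative_bound[OF r(2), where f'="%r. (1 / (r^2 * q r)) *\<^sub>R cross3 (\<Lambda> r) (Y r)" and \<phi>'="%_. b / k"])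
  fix u assume u: "u \<in> {r'..r}"
  then have u': "u \<in> {0<..<s}" using r by auto
  note D = radD[OF R u']
  show "(Y hvd (1 / (u^2 * q u)) *\<^sub>R cross3 (\<Lambda> u) (Y u)) (at u within {r'..r})"
   by (rule has_vector_derivative_at_within[OF D(8)])
  have "norm (cross3 (\<Lambda> u) (Y u)) <= b * u^2" using norm_cross_le[of "\<Lambda> u" "Y u"] D(3,6) by simp
  moreover have "b * u^2 <= (b / k) * (u^2 * q u)"
   using mult_left_mono[OF D(5), of "b * u^2 / k"] kb by simp
  ultimately have "norm (cross3 (\<Lambda> u) (Y u)) <= (b / k) * (u^2 * q u)" by linarith
  moreover have "0 < u^2 * q u" using D by simp
  ultimately show "norm ((1 / (u^2 * q u)) *\<^sub>R cross3 (\<Lambda> u) (Y u)) <= b / k"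
   using D by (simp add: pos_divide_le_eq abs_mult)
 qed (use kb in \<open>auto intro!: derivative_eq_intros\<close>)
 define r where "r = (%n. (s / 2) * inverse (real (Suc n)))"
 have r: "0 < r n" "r n < s" for n
 proof -
  have i: "0 < inverse (real (Suc n))" "inverse (real (Suc n)) <= 1" by (simp_all add: inverse_le_1_iff)
  show "0 < r n" unfolding r_def by (rule mult_pos_pos[OF _ i(1)]) (use s in simp)
  have "(s / 2) * inverse (real (Suc n)) <= (s / 2) * 1" using i(2) s by (intro mult_left_mono) auto
  then show "r n < s" unfolding r_def using s by linarith
 qed
 have r0: "r ----> 0" using tendsto_mult[OF tendsto_const[of "s / 2"] LIMSEQ_inverse_real_of_nat] unfolding r_def mult_zero_right .
 have "norm (Y (r n)) = 1" for n by (rule radD(3)[OF R]) (use r in simp)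
 then have sp: "\<forall>n. Y (r n) \<in> sphere 0 1" by simp
 obtain w \<sigma> where w: "w \<in> sphere 0 1" "strict_mono (\<sigma> :: nat => nat)" "((%n. Y (r n)) \<circ> \<sigma>) ----> w"
  by (rule seq_compactE[OF compact_imp_seq_compact[OF compact_sphere] sp])
 have bd: "norm (Y u - w) <= (b / k) * u" if u: "0 < u" "u < s" for u
 proof (rule tendsto_upperbound)
  show "(%n. norm (Y u - Y (r (\<sigma> n)))) ----> norm (Y u - w)"
   using w(3) by (intro tendsto_intros) (simp add: o_def)
  have "(%n. r (\<sigma> n)) ----> 0" using LIMSEQ_subseq_LIMSEQ[OF r0 w(2)] by (simp add: o_def)
  then have "\<forall>\<^sub>F n in sequentially. r (\<sigma> n) < u" by (rule order_tendstoD(2)) (rule u)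
  then show "\<forall>\<^sub>F n in sequentially. norm (Y u - Y (r (\<sigma> n))) <= (b / k) * u"
  proof eventually_elim
   case (elim n)
   then have "norm (Y u - Y (r (\<sigma> n))) <= (b / k) * u - (b / k) * r (\<sigma> n)" using lip[of "r (\<sigma> n)" u] r u by auto
   moreover have "0 <= (b / k) * r (\<sigma> n)" using r[of "\<sigma> n"] kb by simp
   ultimately show ?case by linarith
  qed
 qed simp
 have "(Y \<longlongrightarrow> w) (at_right 0)"
 proof (rule Lim_null[THEN iffD2], rule Lim_null_comparison)
  show "\<forall>\<^sub>F u in at_right 0. norm (Y u - w) <= (b / k) * u"
   using bd s by (auto simp: eventually_at_right_field intro!: exI[of _ s])
  show "((%u. (b / k) * u) \<longlongrightarrow> 0) (at_right 0)" by (use kb in \<open>auto intro!: tendsto_eq_intros\<close>)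
 qed
 then show ?thesis using w(1) by auto
qed

text \<open>Contraction in the weighted norm \<open>\<bar>Y\<bar> + \<bar>\<Lambda>\<bar> / r^2\<close>, where \<open>\<Lambda>\<close> is the angular momentum: it is halved on a short interval.\<close>

lemma rad_unique:
 assumes R1: "rad s h1 q1 Y1 \<Lambda>1" and R2: "rad s h2 q2 Y2 \<Lambda>2" and s: "0 < s" "s <= s0"
  and l: "(Y1 \<longlongrightarrow> w) (at_right 0)" "(Y2 \<longlongrightarrow> w) (at_right 0)"
 obtains s' where "0 < s'" "s' <= s" "!!r. r \<in> {0<..<s'} ==> h1 r = h2 r & Y1 r = Y2 r"
proof -
 define a where "a = (B + b) / k ^ 3"
 define K1 where "K1 = (1 + b) / k + b * a"
 define K2 where "K2 = 2 * B * K1 / k + B * a"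
 have a0: "0 < a" using kb pos by (simp add: a_def)
 have K1: "0 < K1" using kb pos a0 by (auto simp: K1_def intro!: add_pos_pos)
 then have K0: "0 < K1" "0 < K2" using kb pos a0 by (auto simp: K2_def intro!: add_pos_pos)
 define s' where "s' = min s (1 / (2 * (K1 + K2)))"
 have s': "0 < s'" "s' <= s" "s' <= 1 / (2 * (K1 + K2))" "s' <= 1" using s K0 pos by (auto simp: s'_def)
 have Ks: "K1 * r <= 1 / 2" "K2 * r <= 1 / 2" if "r \<in> {0<..<s'}" for r
 proof -
  have r: "0 < r" "r <= 1 / (2 * (K1 + K2))" using that s' by auto
  have "(K1 + K2) * r <= (K1 + K2) * (1 / (2 * (K1 + K2)))" by (rule mult_left_mono) (use r K0 in auto)
  also have "... = 1 / 2" using K0 by (simp add: field_simps)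
  finally have "K1 * r + K2 * r <= 1 / 2" by (simp add: algebra_simps)
  moreover have "0 <= K1 * r" "0 <= K2 * r" using K0 r by auto
  ultimately show "K1 * r <= 1 / 2" "K2 * r <= 1 / 2" by linarith+
 qed
 define D where "D = (%r. norm (Y1 r - Y2 r))"
 define E where "E = (%r. norm (\<Lambda>1 r - \<Lambda>2 r))"
 have D0: "(D \<longlongrightarrow> 0) (at_right 0)"
  using tendsto_norm[OF tendsto_diff[OF l]] by (simp add: D_def)
 have E0: "E r <= 2 * b * r^2" if r: "r \<in> {0<..<s}" for r
  using norm_triangle_ineq4[of "\<Lambda>1 r" "\<Lambda>2 r"] radD(6)[OF R1 r] radD(6)[OF R2 r] by (simp add: E_def)
 have qd: "\<bar>1 / q1 r - 1 / q2 r\<bar> <= a * r * n"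
  if r: "r \<in> {0<..<s'}" and n: "D r <= n" "E r <= n * r^2" for r n
 proof -
  have r': "r \<in> {0<..<s}" using r s' by auto
  note d1 = radD[OF R1 r'] and d2 = radD[OF R2 r']
  have r1: "0 < r" "r <= s0" "r <= 1" using r s s' by auto
  have n0: "0 <= n" using n(1) norm_ge_zero[of "Y1 r - Y2 r"] unfolding D_def by linarith
  define l1 where "l1 = norm (\<Lambda>1 r)" define l2 where "l2 = norm (\<Lambda>2 r)"
  have l12: "\<bar>l1^2 - l2^2\<bar> <= 2 * b * r^2 * (n * r^2)"
  proof -
   have "\<bar>l1^2 - l2^2\<bar> = (l1 + l2) * \<bar>l1 - l2\<bar>"
    by (simp add: power2_eq_square square_diff_square_factored abs_mult l1_def l2_def)
   also have "... <= (b * r^2 + b * r^2) * (n * r^2)"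
   proof (rule mult_mono)
    show "\<bar>l1 - l2\<bar> <= n * r^2" using norm_triangle_ineq3[of "\<Lambda>1 r" "\<Lambda>2 r"] n(2) by (simp add: E_def l1_def l2_def)
   qed (use d1(6) d2(6) kb in \<open>auto simp: l1_def l2_def intro!: add_mono\<close>)
   finally show ?thesis by simp
  qed
  have "\<bar>W (r *\<^sub>R Y1 r) - W (r *\<^sub>R Y2 r)\<bar> <= B * norm (r *\<^sub>R Y1 r - r *\<^sub>R Y2 r)"
   by (rule LW) (use r1 d1 d2 in auto)
  also have "norm (r *\<^sub>R Y1 r - r *\<^sub>R Y2 r) = r * D r" using r1 by (simp add: scaleR_diff_right[symmetric] D_def)
  also have "B * (r * D r) <= B * (r * n)" using n r1 pos by (intro mult_left_mono) auto
  finally have w: "\<bar>W (r *\<^sub>R Y1 r) - W (r *\<^sub>R Y2 r)\<bar> <= B * (r * n)" .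
  have "\<bar>(l1^2 - l2^2) / r^2\<bar> <= 2 * b * r^2 * n" using l12 r1 by (simp add: abs_divide pos_divide_le_eq mult_ac)
  also have "... <= 2 * b * r * n" using r1 kb n0 by (intro mult_right_mono mult_left_mono) (auto simp: power2_eq_square intro: mult_left_le_one_le)
  finally have "\<bar>(q1 r)^2 - (q2 r)^2\<bar> <= 2 * (B * (r * n)) + 2 * b * r * n"
   using w unfolding d1(7) d2(7) l1_def l2_def diff_divide_distrib by (simp add: abs_le_iff algebra_simps)
  also have "... = 2 * k ^ 3 * (a * r * n)" using kb by (simp add: a_def field_simps)
  finally have 1: "\<bar>(q1 r)^2 - (q2 r)^2\<bar> <= 2 * k ^ 3 * (a * r * n)" .
  define Q where "Q = q1 r * q2 r * (q1 r + q2 r)"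
  have "k * k * (k + k) <= Q" unfolding Q_def using d1(5) d2(5) kb by (intro mult_mono add_mono) auto
  then have Q: "2 * k ^ 3 <= Q" by (simp add: power3_eq_cube)
  have Q0: "0 < Q" by (rule less_le_trans[OF _ Q]) (use kb in simp)
  have "1 / q1 r - 1 / q2 r = - ((q1 r)^2 - (q2 r)^2) / Q"
  proof -
   have "- ((q1 r)^2 - (q2 r)^2) / Q = ((q2 r - q1 r) * (q1 r + q2 r)) / (q1 r * q2 r * (q1 r + q2 r))"
    by (simp add: Q_def algebra_simps power2_eq_square)
   also have "... = (q2 r - q1 r) / (q1 r * q2 r)" using d1(11) d2(11) by (intro mult_divide_mult_cancel_right) simp
   also have "... = 1 / q1 r - 1 / q2 r" using d1(11) d2(11) by (simp add: diff_divide_distrib)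
   finally show ?thesis by simp
  qed
  then have "\<bar>1 / q1 r - 1 / q2 r\<bar> = \<bar>(q1 r)^2 - (q2 r)^2\<bar> / Q" using Q0 by (simp only: abs_divide abs_minus_cancel abs_of_pos)
  also have "... <= a * r * n"
  proof -
   have "2 * k ^ 3 * (a * r * n) <= Q * (a * r * n)" using a0 r1 n0 by (intro mult_right_mono Q) auto
   then show ?thesis using 1 Q0 by (simp add: pos_divide_le_eq mult.commute)
  qed
  finally show ?thesis .
 qed
 have half: "\<forall>r\<in>{0<..<s'}. D r <= n / 2 & E r <= (n / 2) * r^2"
  if n: "\<forall>r\<in>{0<..<s'}. D r <= n & E r <= n * r^2" for n
 proof -
  have n0: "0 <= n"
  proof -
   have "s' / 2 \<in> {0<..<s'}" using s' by simp
   then have "norm (Y1 (s' / 2) - Y2 (s' / 2)) <= n" using n unfolding D_def by blast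
   then show ?thesis by (rule order_trans[OF norm_ge_zero])
  qed
  have DK: "D r <= K1 * n * r" if r: "r \<in> {0<..<s'}" for r
  proof -
   have 1: "D r <= K1 * n * r + D r'" if r': "0 < r'" "r' < r" for r'
   proof -
    have "norm ((Y1 r - Y2 r) - (Y1 r' - Y2 r')) <= (K1 * n) * r - (K1 * n) * r'"
    proof (rule derivative_bound[where f="%r. Y1 r - Y2 r" and \<phi>'="%_. K1 * n" and
      f'="%r. (1 / (r^2 * q1 r)) *\<^sub>R cross3 (\<Lambda>1 r) (Y1 r) - (1 / (r^2 * q2 r)) *\<^sub>R cross3 (\<Lambda>2 r) (Y2 r)"])
     fix u assume u: "u \<in> {r'..r}"
     then have us: "u \<in> {0<..<s'}" "u \<in> {0<..<s}" using r' r s' by auto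
     note d1 = radD[OF R1 us(2)] and d2 = radD[OF R2 us(2)]
     show "((%r. Y1 r - Y2 r) has_vector_derivative
      (1 / (u^2 * q1 u)) *\<^sub>R cross3 (\<Lambda>1 u) (Y1 u) - (1 / (u^2 * q2 u)) *\<^sub>R cross3 (\<Lambda>2 u) (Y2 u)) (at u within {r'..r})"
      by (intro has_vector_derivative_diff has_vector_derivative_at_within[OF d1(8)] has_vector_derivative_at_within[OF d2(8)])
     define A1 where "A1 = cross3 (\<Lambda>1 u) (Y1 u)" define A2 where "A2 = cross3 (\<Lambda>2 u) (Y2 u)"
     have "norm (A1 - A2) <= E u * 1 + (b * u^2) * D u"
      using norm_cross_diff[of "\<Lambda>1 u" "Y1 u" "\<Lambda>2 u" "Y2 u"] mult_right_mono[OF d2(6), of "D u"] d1(3)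
      by (simp add: A1_def A2_def D_def E_def)
     also have "... <= (n * u^2) * 1 + (b * u^2) * n"
      using n us(1) kb by (intro add_mono mult_right_mono mult_left_mono) auto
     finally have A: "norm (A1 - A2) <= u^2 * ((1 + b) * n)" by (simp add: algebra_simps)
     have A2: "norm A2 <= u^2 * b" using norm_cross_le[of "\<Lambda>2 u" "Y2 u"] d2(3,6) by (simp add: A2_def mult.commute)
     have "u * n <= 1 * n" using us s' n0 by (intro mult_right_mono) auto
     then have "a * u * n <= a * n" using a0 mult_left_mono[of "u * n" "1 * n" a] by (simp add: mult.assoc)
     then have q: "\<bar>1 / q1 u - 1 / q2 u\<bar> <= a * n" using qd[OF us(1), of n] n us(1) by fastforce
     have "(1 / (u^2 * q1 u)) *\<^sub>R A1 - (1 / (u^2 * q2 u)) *\<^sub>R A2 = (1 / u^2) *\<^sub>R ((1 / q1 u) *\<^sub>R (A1 - A2) + (1 / q1 u - 1 / q2 u) *\<^sub>R A2)"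
      by (simp add: algebra_simps)
     also have "norm ... = (1 / u^2) * norm ((1 / q1 u) *\<^sub>R (A1 - A2) + (1 / q1 u - 1 / q2 u) *\<^sub>R A2)" by simp
     also have "... <= (1 / u^2) * ((1 / k) * (u^2 * ((1 + b) * n)) + (a * n) * (u^2 * b))"
     proof (rule mult_left_mono, rule norm_triangle_le, rule add_mono)
      have "1 / q1 u <= 1 / k" using d1(5) kb by (intro divide_left_mono) auto
      then show "norm ((1 / q1 u) *\<^sub>R (A1 - A2)) <= (1 / k) * (u^2 * ((1 + b) * n))"
       using d1(11) A kb unfolding norm_scaleR by (intro mult_mono) auto
      show "norm ((1 / q1 u - 1 / q2 u) *\<^sub>R A2) <= (a * n) * (u^2 * b)"
       unfolding norm_scaleR using q A2 a0 n0 by (intro mult_mono) auto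
     qed simp
     also have "... = K1 * n" using d1(10) by (simp add: K1_def field_simps)
     finally show "norm ((1 / (u^2 * q1 u)) *\<^sub>R cross3 (\<Lambda>1 u) (Y1 u) - (1 / (u^2 * q2 u)) *\<^sub>R cross3 (\<Lambda>2 u) (Y2 u)) <= K1 * n"
      by (simp add: A1_def A2_def)
    qed (use r' in \<open>auto intro!: derivative_eq_intros\<close>)
    moreover have "0 <= K1 * n * r'" using K0 n0 r' by simp
    ultimately show ?thesis using norm_triangle_ineq2[of "Y1 r - Y2 r" "Y1 r' - Y2 r'"] unfolding D_def by linarith
   qed
   have "D r <= K1 * n * r + 0"
    by (rule tendsto_lowerbound[OF tendsto_add[OF tendsto_const D0]])
     (use 1 r in \<open>auto simp: eventually_at_right_field intro!: exI[of _ r]\<close>)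
   then show ?thesis by simp
  qed
  \<comment> \<open>The difference of the outer forces is measured with the improved bound
    \<open>DK\<close> instead of \<open>n\<close>; the additional factor of the radius is what
    brings the result below \<open>r^2\<close>.\<close>
  have EK: "E r <= K2 * n * r * r^2" if r: "r \<in> {0<..<s'}" for r
  proof -
   have 1: "E r <= K2 * n * r * r^2 + n * r'^2" if r': "0 < r'" "r' < r" for r'
   proof -
    have "norm ((\<Lambda>1 r - \<Lambda>2 r) - (\<Lambda>1 r' - \<Lambda>2 r')) <= (K2 * n * r^2) * r - (K2 * n * r^2) * r'"
    proof (rule derivative_bound[where f="%r. \<Lambda>1 r - \<Lambda>2 r" and \<phi>'="%_. K2 * n * r^2" and
      f'="%r. (r / q1 r) *\<^sub>R cross3 (Y1 r) (g (r *\<^sub>R Y1 r)) - (r / q2 r) *\<^sub>R cross3 (Y2 r) (g (r *\<^sub>R Y2 r))"])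
     fix u assume u: "u \<in> {r'..r}"
     then have us: "u \<in> {0<..<s'}" "u \<in> {0<..<s}" using r' r s' by auto
     note d1 = radD[OF R1 us(2)] and d2 = radD[OF R2 us(2)]
     have u1: "norm (u *\<^sub>R Y1 u) <= s0" "norm (u *\<^sub>R Y2 u) <= s0" "u <= 1" "0 < u" using d1(3) d2(3) us s s' by auto
     show "((%r. \<Lambda>1 r - \<Lambda>2 r) has_vector_derivative
      (u / q1 u) *\<^sub>R cross3 (Y1 u) (g (u *\<^sub>R Y1 u)) - (u / q2 u) *\<^sub>R cross3 (Y2 u) (g (u *\<^sub>R Y2 u))) (at u within {r'..r})"
      by (intro has_vector_derivative_diff has_vector_derivative_at_within[OF d1(9)] has_vector_derivative_at_within[OF d2(9)])
     define A1 where "A1 = cross3 (Y1 u) (g (u *\<^sub>R Y1 u))" define A2 where "A2 = cross3 (Y2 u) (g (u *\<^sub>R Y2 u))"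
     have "norm (g (u *\<^sub>R Y1 u) - g (u *\<^sub>R Y2 u)) <= B * norm (u *\<^sub>R Y1 u - u *\<^sub>R Y2 u)" by (rule Lg[OF u1(1,2)])
     also have "norm (u *\<^sub>R Y1 u - u *\<^sub>R Y2 u) = u * D u" using u1 by (simp add: scaleR_diff_right[symmetric] D_def)
     also have "B * (u * D u) <= B * (1 * D u)" using u1 pos by (intro mult_left_mono mult_right_mono) (auto simp: D_def)
     finally have "norm (g (u *\<^sub>R Y1 u) - g (u *\<^sub>R Y2 u)) <= B * D u" by simp
     then have "norm (A1 - A2) <= D u * B + 1 * (B * D u)"
      using norm_cross_diff[of "Y1 u" "g (u *\<^sub>R Y1 u)" "Y2 u" "g (u *\<^sub>R Y2 u)", unfolded d2(3)]
       mult_left_mono[OF g[OF u1(1)] norm_ge_zero[of "Y1 u - Y2 u"]]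
      unfolding A1_def A2_def D_def by linarith
     also have "... = 2 * B * D u" by simp
     also have "... <= 2 * B * (K1 * n * u)" using DK[OF us(1)] pos by (intro mult_left_mono) auto
     finally have A: "norm (A1 - A2) <= 2 * B * (K1 * n * u)" .
     have A2: "norm A2 <= B" using norm_cross_le[of "Y2 u" "g (u *\<^sub>R Y2 u)"] g[OF u1(2)] d2(3) by (simp add: A2_def)
     have q: "\<bar>1 / q1 u - 1 / q2 u\<bar> <= a * u * n" using qd[OF us(1), of n] n us(1) by blast
     have "(u / q1 u) *\<^sub>R A1 - (u / q2 u) *\<^sub>R A2 = u *\<^sub>R ((1 / q1 u) *\<^sub>R (A1 - A2) + (1 / q1 u - 1 / q2 u) *\<^sub>R A2)"
      by (simp add: algebra_simps)
     also have "norm ... = u * norm ((1 / q1 u) *\<^sub>R (A1 - A2) + (1 / q1 u - 1 / q2 u) *\<^sub>R A2)" using u1 by simp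
     also have "... <= u * ((1 / k) * (2 * B * (K1 * n * u)) + (a * u * n) * B)"
     proof (rule mult_left_mono, rule norm_triangle_le, rule add_mono)
      have "1 / q1 u <= 1 / k" using d1(5) kb by (intro divide_left_mono) auto
      then show "norm ((1 / q1 u) *\<^sub>R (A1 - A2)) <= (1 / k) * (2 * B * (K1 * n * u))"
       using d1(11) A kb unfolding norm_scaleR by (intro mult_mono) auto
      show "norm ((1 / q1 u - 1 / q2 u) *\<^sub>R A2) <= (a * u * n) * B"
       unfolding norm_scaleR using q A2 a0 n0 u1 by (intro mult_mono) auto
     qed (use u1 in simp)
     also have "... = K2 * n * u^2" using kb by (simp add: K2_def field_simps power2_eq_square)
     also have "... <= K2 * n * r^2" using u u1 K0 n0 by (intro mult_left_mono power_mono) auto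
     finally show "norm ((u / q1 u) *\<^sub>R cross3 (Y1 u) (g (u *\<^sub>R Y1 u)) - (u / q2 u) *\<^sub>R cross3 (Y2 u) (g (u *\<^sub>R Y2 u))) <= K2 * n * r^2"
      by (simp add: A1_def A2_def)
    qed (use r' in \<open>auto intro!: derivative_eq_intros\<close>)
    moreover have "0 <= (K2 * n * r^2) * r'" using K0 n0 r' by simp
    moreover have "(K2 * n * r^2) * r = K2 * n * r * r^2" by simp
    moreover have "E r' <= n * r'^2" using n r r' by auto
    ultimately show ?thesis using norm_triangle_ineq2[of "\<Lambda>1 r - \<Lambda>2 r" "\<Lambda>1 r' - \<Lambda>2 r'"] unfolding E_def by linarith
   qed
   have "((%r'. K2 * n * r * r^2 + n * r'^2) \<longlongrightarrow> K2 * n * r * r^2 + n * 0^2) (at_right 0)" by (intro tendsto_intros)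
   then have "E r <= K2 * n * r * r^2 + n * 0^2"
    by (rule tendsto_lowerbound) (use 1 r in \<open>auto simp: eventually_at_right_field intro!: exI[of _ r]\<close>)
   then show ?thesis by simp
  qed
  show ?thesis
  proof (intro ballI conjI)
   fix r assume r: "r \<in> {0<..<s'}"
   have "(K1 * r) * n <= (1 / 2) * n" by (rule mult_right_mono[OF Ks(1)[OF r] n0])
   then show "D r <= n / 2" using DK[OF r] by (simp add: mult_ac)
   have "(K2 * r) * (n * r^2) <= (1 / 2) * (n * r^2)" by (rule mult_right_mono[OF Ks(2)[OF r]]) (use n0 in simp)
   then show "E r <= n / 2 * r^2" using EK[OF r] by (simp add: mult_ac)
  qed
 qed
 define n0 where "n0 = 2 + 2 * b"
 have it: "\<forall>r\<in>{0<..<s'}. D r <= n0 / 2 ^ j & E r <= (n0 / 2 ^ j) * r^2" for j :: nat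
 proof (induction j)
  case 0
  show ?case
  proof (intro ballI conjI)
   fix r assume r: "r \<in> {0<..<s'}"
   then have r': "r \<in> {0<..<s}" using s' by auto
   show "D r <= n0 / 2 ^ 0" using norm_triangle_ineq4[of "Y1 r" "Y2 r"] radD(3)[OF R1 r'] radD(3)[OF R2 r'] kb by (simp add: D_def n0_def)
   have "2 * b * r^2 <= n0 * r^2" unfolding n0_def by (intro mult_right_mono) auto
   then show "E r <= n0 / 2 ^ 0 * r^2" using E0[OF r'] by simp
  qed
 next
  case (Suc j)
  from half[OF Suc] show ?case by (simp add: mult.commute)
 qed
 have lim: "(%j. n0 / 2 ^ j) ----> 0"
  using tendsto_mult[OF tendsto_const[of n0] LIMSEQ_realpow_zero[of "1/2"]] by (simp add: power_divide)
 have z: "D r <= 0 & E r <= 0 * r^2" if r: "r \<in> {0<..<s'}" for r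
  by (intro conjI tendsto_lowerbound[OF lim] tendsto_lowerbound[OF tendsto_mult[OF lim tendsto_const]])
   (use it r in auto)
 have Yeq: "Y1 r = Y2 r" if "r \<in> {0<..<s'}" for r using z[OF that] by (simp add: D_def)
 have qeq: "1 / q1 r = 1 / q2 r" if r: "r \<in> {0<..<s'}" for r
  using qd[OF r, of 0] z[OF r] by simp
 \<comment> \<open>Equal radial speeds make the difference of the two times constant, and both times
   lie between 0 and \<open>r / k\<close>, so the constant is zero.\<close>
 have heq: "h1 r = h2 r" if r: "r \<in> {0<..<s'}" for r
 proof -
  have 1: "norm (h1 r - h2 r) <= 2 * r' / k" if r': "0 < r'" "r' < r" for r'
  proof -
   have "norm ((h1 r - h2 r) - (h1 r' - h2 r')) <= 0 - 0"
   proof (rule derivative_bound[where f="%r. h1 r - h2 r" and f'="%r. 1 / q1 r - 1 / q2 r" and \<phi>="%_. 0" and \<phi>'="%_. 0"])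
    fix u assume u: "u \<in> {r'..r}"
    then have us: "u \<in> {0<..<s'}" "u \<in> {0<..<s}" using r' r s' by auto
    have "((%r. h1 r - h2 r) hrd 1 / q1 u - 1 / q2 u) (at u within {r'..r})"
     by (intro DERIV_diff has_field_derivative_at_within[OF radD(4)[OF R1 us(2)]] has_field_derivative_at_within[OF radD(4)[OF R2 us(2)]])
    then show "((%r. h1 r - h2 r) hvd 1 / q1 u - 1 / q2 u) (at u within {r'..r})"
     by (simp only: has_real_derivative_iff_has_vector_derivative)
    show "norm (1 / q1 u - 1 / q2 u) <= 0" using qeq[OF us(1)] by simp
   qed (use r' in auto)
   then have "h1 r - h2 r = h1 r' - h2 r'" by simp
   moreover have r's: "r' \<in> {0<..<s}" using r r' s' by auto
   moreover have "h1 r' <= r' / k" "h2 r' <= r' / k"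
    using radD(2)[OF R1 r's] radD(2)[OF R2 r's] kb by (auto simp: pos_le_divide_eq mult.commute)
   ultimately show ?thesis using radD(1)[OF R1 r's] radD(1)[OF R2 r's] by simp
  qed
  have "((%r'. 2 * r' / k) \<longlongrightarrow> 2 * 0 / k) (at_right 0)" by (intro tendsto_intros) (use kb in auto)
  then have "norm (h1 r - h2 r) <= 2 * 0 / k"
   by (rule tendsto_lowerbound) (use 1 r in \<open>auto simp: eventually_at_right_field intro!: exI[of _ r]\<close>)
  then show ?thesis by simp
 qed
 show ?thesis by (rule that[OF s'(1,2)]) (use Yeq heq in auto)
qed

lemma ej_tendsto:
 assumes e: "ej x V \<epsilon>" shows "filterlim (%t. norm (x t)) (at_right 0) (at_right 0)"
proof -
 have e0: "0 < \<epsilon>" using e by (simp add: ej_def)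
 have "((%t. norm (x t)) \<longlongrightarrow> 0) (at_right 0)"
 proof (rule tendstoI)
  fix e' :: real assume "0 < e'"
  then obtain d where d: "0 < d" "\<forall>a\<in>{0<..<\<epsilon>}. a < d --> norm (x a) < e'" using ej_small[OF e] by blast
  show "\<forall>\<^sub>F a in at_right 0. dist (norm (x a)) 0 < e'"
   using d e0 by (auto simp: eventually_at_right_field intro!: exI[of _ "min d \<epsilon>"])
 qed
 moreover have "\<forall>\<^sub>F t in at_right 0. norm (x t) \<in> {0<..}"
  unfolding eventually_at_right_field using e0 ejD(6)[OF e] by (intro exI[of _ \<epsilon>]) auto
 ultimately show ?thesis by (simp add: filterlim_at eventually_mono)
qed

lemma rad_direction:
 assumes e: "ej x V \<epsilon>" and Y: "(Y \<longlongrightarrow> w) (at_right 0)" and t1: "0 < t1"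
  and r: "!!t. t \<in> {0<..<t1} ==> x t = norm (x t) *\<^sub>R Y (norm (x t))"
 shows "((%t. (1 / norm (x t)) *\<^sub>R x t) \<longlongrightarrow> w) (at_right 0)"
proof (rule Lim_transform_eventually)
 show "((%t. Y (norm (x t))) \<longlongrightarrow> w) (at_right 0)"
  by (rule filterlim_compose[OF Y ej_tendsto[OF e]])
 have e0: "0 < \<epsilon>" using e by (simp add: ej_def)
 show "\<forall>\<^sub>F t in at_right 0. Y (norm (x t)) = (1 / norm (x t)) *\<^sub>R x t"
  unfolding eventually_at_right_field
 proof (rule exI[of _ "min t1 \<epsilon>"], intro conjI allI impI)
  fix t assume t: "0 < t" "t < min t1 \<epsilon>"
  then have "x t ~= 0" using ejD(1)[OF e, of t] by simp
  moreover have "(1 / norm (x t)) *\<^sub>R x t = (1 / norm (x t)) *\<^sub>R (norm (x t) *\<^sub>R Y (norm (x t)))"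
   using arg_cong[OF r[of t], of "%z. (1 / norm (x t)) *\<^sub>R z"] t by simp
  ultimately show "Y (norm (x t)) = (1 / norm (x t)) *\<^sub>R x t" by simp
 qed (use e0 t1 in simp)
qed

lemma ejection_direction:
 assumes e: "ej x V \<epsilon>"
 shows "\<exists>w. norm w = 1 & ((%t. (1 / norm (x t)) *\<^sub>R x t) \<longlongrightarrow> w) (at_right 0)"
proof -
 obtain s h q Y \<Lambda> t1 where r: "0 < s" "s <= s0" "rad s h q Y \<Lambda>" "0 < t1"
  "!!t. t \<in> {0<..<t1} ==> norm (x t) \<in> {0<..<s} & h (norm (x t)) = t & x t = norm (x t) *\<^sub>R Y (norm (x t))"
  by (rule ej_rad[OF e]) (rule that)
 obtain w where w: "norm w = 1" "(Y \<longlongrightarrow> w) (at_right 0)" using rad_limit[OF r(3,1)] by blast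
 have "((%t. (1 / norm (x t)) *\<^sub>R x t) \<longlongrightarrow> w) (at_right 0)"
  by (rule rad_direction[OF e w(2) r(4)]) (use r(5) in blast)
 then show ?thesis using w(1) by blast
qed

lemma ejection_unique:
 assumes e1: "ej x1 V1 \<epsilon>1" and e2: "ej x2 V2 \<epsilon>2"
  and w: "((%t. (1 / norm (x1 t)) *\<^sub>R x1 t) \<longlongrightarrow> w) (at_right 0)" "((%t. (1 / norm (x2 t)) *\<^sub>R x2 t) \<longlongrightarrow> w) (at_right 0)"
 shows "\<exists>\<eta>>0. \<forall>t\<in>{0<..<\<eta>}. x1 t = x2 t"
proof -
 obtain s1 h1 q1 Y1 \<Lambda>1 t1 where r1: "0 < s1" "s1 <= s0" "rad s1 h1 q1 Y1 \<Lambda>1" "0 < t1"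
  "!!t. t \<in> {0<..<t1} ==> norm (x1 t) \<in> {0<..<s1} & h1 (norm (x1 t)) = t & x1 t = norm (x1 t) *\<^sub>R Y1 (norm (x1 t))"
  by (rule ej_rad[OF e1]) (rule that)
 obtain s2 h2 q2 Y2 \<Lambda>2 t2 where r2: "0 < s2" "s2 <= s0" "rad s2 h2 q2 Y2 \<Lambda>2" "0 < t2"
  "!!t. t \<in> {0<..<t2} ==> norm (x2 t) \<in> {0<..<s2} & h2 (norm (x2 t)) = t & x2 t = norm (x2 t) *\<^sub>R Y2 (norm (x2 t))"
  by (rule ej_rad[OF e2]) (rule that)
 obtain w1 where w1: "(Y1 \<longlongrightarrow> w1) (at_right 0)" using rad_limit[OF r1(3,1)] by blast
 obtain w2 where w2: "(Y2 \<longlongrightarrow> w2) (at_right 0)" using rad_limit[OF r2(3,1)] by blast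
 have "((%t. (1 / norm (x1 t)) *\<^sub>R x1 t) \<longlongrightarrow> w1) (at_right 0)"
  by (rule rad_direction[OF e1 w1 r1(4)]) (use r1(5) in blast)
 from tendsto_unique[OF trivial_limit_at_right_real this w(1)] have ww1: "w1 = w" .
 have "((%t. (1 / norm (x2 t)) *\<^sub>R x2 t) \<longlongrightarrow> w2) (at_right 0)"
  by (rule rad_direction[OF e2 w2 r2(4)]) (use r2(5) in blast)
 from tendsto_unique[OF trivial_limit_at_right_real this w(2)] have ww2: "w2 = w" .
 define s where "s = min s1 s2"
 have s: "0 < s" "s <= s1" "s <= s2" "s <= s0" using r1 r2 by (auto simp: s_def)
 obtain s' where s': "0 < s'" "s' <= s" "!!r. r \<in> {0<..<s'} ==> h1 r = h2 r & Y1 r = Y2 r"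
  by (rule rad_unique[OF rad_mono[OF r1(3) s(2)] rad_mono[OF r2(3) s(3)] s(1,4) w1[unfolded ww1] w2[unfolded ww2]]) (rule that)
 have "\<forall>\<^sub>F t in at_right 0. norm (x1 t) < s'"
  by (rule order_tendstoD(2)[OF _ s'(1)]) (use ej_tendsto[OF e1] in \<open>simp add: filterlim_at\<close>)
 moreover have "\<forall>\<^sub>F t in at_right 0. norm (x2 t) < s'"
  by (rule order_tendstoD(2)[OF _ s'(1)]) (use ej_tendsto[OF e2] in \<open>simp add: filterlim_at\<close>)
 ultimately have "\<forall>\<^sub>F t in at_right 0. norm (x1 t) < s' & norm (x2 t) < s'" by (rule eventually_conj)
 then obtain d where d: "0 < d" "!!t. 0 < t ==> t < d ==> norm (x1 t) < s' & norm (x2 t) < s'"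
  unfolding eventually_at_right_field by auto
 define \<eta> where "\<eta> = min d (min t1 t2)"
 show ?thesis
 proof (intro exI[of _ \<eta>] conjI ballI)
  show "0 < \<eta>" using d r1 r2 by (simp add: \<eta>_def)
  fix t assume t: "t \<in> {0<..<\<eta>}"
  have a: "norm (x1 t) \<in> {0<..<s'}" "h1 (norm (x1 t)) = t" "x1 t = norm (x1 t) *\<^sub>R Y1 (norm (x1 t))"
   using r1(5)[of t] d(2)[of t] t by (auto simp: \<eta>_def)
  have b: "norm (x2 t) \<in> {0<..<s'}" "h2 (norm (x2 t)) = t" "x2 t = norm (x2 t) *\<^sub>R Y2 (norm (x2 t))"
   using r2(5)[of t] d(2)[of t] t by (auto simp: \<eta>_def)
  have inj: "u = u'" if u: "u \<in> {0<..<s'}" "u' \<in> {0<..<s'}" "h1 u = h1 u'" for u u'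
  proof -
   have st: "h1 v < h1 v'" if "v \<in> {0<..<s'}" "v' \<in> {0<..<s'}" "v < v'" for v v'
   proof (rule DERIV_pos_imp_increasing[OF that(3)])
    fix z assume "v <= z" "z <= v'"
    then have z: "z \<in> {0<..<s1}" using that s' s by auto
    show "\<exists>y. (h1 hrd y) (at z) & 0 < y"
     by (rule exI[of _ "1 / q1 z"], rule conjI[OF radD(4)[OF r1(3) z]]) (use radD(11)[OF r1(3) z] in simp)
   qed
   show ?thesis using st[of u u'] st[of u' u] u by (cases u u' rule: linorder_cases) auto
  qed
  \<comment> \<open>Uniqueness so far concerns functions of the radius. Since time is an injective
    function of the radius, common to both orbits, equal times mean equal radii.\<close>
  have "h1 (norm (x2 t)) = t" using s'(3)[OF b(1)] b(2) by simp
  then have eq: "norm (x1 t) = norm (x2 t)" using inj[OF a(1) b(1)] a(2) by simp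
  have "x1 t = norm (x2 t) *\<^sub>R Y1 (norm (x2 t))" using a(3) unfolding eq .
  also have "Y1 (norm (x2 t)) = Y2 (norm (x2 t))" using s'(3)[OF b(1)] by simp
  finally show "x1 t = x2 t" using b(3) by simp
 qed
qed

end

section \<open>The unsoftened centres and limits away from collisions\<close>

lemma half_less: "0 < a ==> a / 2 < (a::real)" by simp

lemma powr_lipschitz:
 fixes u w r p :: real
 assumes r: "0 < r" "r <= u" "r <= w" and p: "p <= 0"
 shows "\<bar>u powr p - w powr p\<bar> <= \<bar>p\<bar> * r powr (p - 1) * \<bar>u - w\<bar>"
proof -
 have le: "\<bar>b powr p - a powr p\<bar> <= \<bar>p\<bar> * r powr (p - 1) * (b - a)" if ab: "r <= a" "a <= b" for a b
 proof -
  have "norm (b powr p - a powr p) <= (\<bar>p\<bar> * r powr (p - 1)) * b - (\<bar>p\<bar> * r powr (p - 1)) * a"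
  proof (rule derivative_bound[OF ab(2), where f'="%x. p * x powr (p - 1)" and \<phi>'="%_. \<bar>p\<bar> * r powr (p - 1)"])
   fix x assume x: "x \<in> {a..b}"
   then have x0: "0 < x" "r <= x" using ab r by auto
   show "((%x. x powr p) hvd p * x powr (p - 1)) (at x within {a..b})"
    using has_field_derivative_at_within[OF has_real_derivative_powr[OF x0(1)]]
    by (simp only: has_real_derivative_iff_has_vector_derivative)
   have "x powr (p - 1) <= r powr (p - 1)" by (rule powr_mono2') (use r x0 p in auto)
   then show "norm (p * x powr (p - 1)) <= \<bar>p\<bar> * r powr (p - 1)" by (simp add: abs_mult mult_left_mono)
  qed (auto intro!: derivative_eq_intros)
  then show ?thesis by (simp add: right_diff_distrib)
 qed
 show ?thesis using le[of u w] le[of w u] r by (cases "u <= w") (auto simp: abs_minus_commute)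
qed

context ncentre
begin

lemma Vd0: "Vd 0 x = (\<Sum>i = 1..N. m i / \<alpha> * norm (x - c i) powr (- \<alpha>))"
 unfolding Vd_def
proof (rule sum.cong)
 fix i
 \<comment> \<open>At the centre itself both sides vanish, since \<open>0 powr p\<close> is
   0.\<close>
 show "m i / \<alpha> * ((norm (x - c i))^2 + 0^2) powr - (\<alpha> / 2) = m i / \<alpha> * norm (x - c i) powr - \<alpha>"
  by (cases "x = c i") (simp_all add: powr_powr flip: powr_numeral)
qed simp

lemma Fd0: "Fd 0 x = (\<Sum>i = 1..N. (- m i * norm (x - c i) powr (- \<alpha> - 2)) *\<^sub>R (x - c i))"
 unfolding Fd_def
proof (rule sum.cong)
 fix i
 have "((norm (x - c i))^2 + 0^2) powr (- (\<alpha> / 2) - 1) = norm (x - c i) powr (- \<alpha> - 2)" if "x ~= c i"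
  using that by (simp add: powr_powr left_diff_distrib flip: powr_numeral)
 then show "(- m i * ((norm (x - c i))^2 + 0^2) powr (- (\<alpha> / 2) - 1)) *\<^sub>R (x - c i) =
   (- m i * norm (x - c i) powr (- \<alpha> - 2)) *\<^sub>R (x - c i)"
  by (cases "x = c i") simp_all
qed simp

lemma potential_Vd: "potential N c m \<alpha> x = Vd 0 x"
 unfolding potential_def Vd0 by (rule sum.cong) (simp_all add: powr_minus divide_inverse)

lemma force_Fd: "force N c m \<alpha> x = Fd 0 x"
 unfolding force_def Fd0 sum_negf[symmetric]
proof (rule sum.cong)
 fix i
 have "m i / norm (x - c i) powr (\<alpha> + 2) = m i * norm (x - c i) powr (- \<alpha> - 2)"
  using powr_minus[of "norm (x - c i)" "\<alpha> + 2"] by (simp add: divide_inverse)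
 then show "- ((m i / norm (x - c i) powr (\<alpha> + 2)) *\<^sub>R (x - c i)) = (- m i * norm (x - c i) powr (- \<alpha> - 2)) *\<^sub>R (x - c i)"
  by simp
qed simp

lemma centres_apart:
 assumes inj: "inj_on c {1..N}" and i0: "i0 \<in> {1..N}"
 obtains r where "0 < r" "!!i x. i \<in> {1..N} - {i0} ==> norm x <= r ==> r <= norm (c i0 + x - c i)"
proof -
 have fin: "finite (c ` {1..N})" by simp
 obtain d where d: "0 < d" "!!x. x \<in> c ` {1..N} ==> x ~= c i0 ==> d <= dist (c i0) x"
  using finite_set_avoid[OF fin, of "c i0"] by metis
 show ?thesis
 proof (rule that[of "d / 2"])
  fix i x assume i: "i \<in> {1..N} - {i0}" and x: "norm (x :: real ^ 3) <= d / 2"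
  have "c i ~= c i0" using inj_onD[OF inj, of i i0] i i0 by blast
  then have "d <= norm (c i0 - c i)" using d(2)[OF imageI[of i "{1..N}"]] i unfolding dist_norm by blast
  moreover have "norm (c i0 - c i) <= norm (c i0 + x - c i) + norm x"
   using norm_triangle_ineq4[of "c i0 + x - c i" x] by simp
  ultimately show "d / 2 <= norm (c i0 + x - c i)" using x by linarith
 qed (use d in simp)
qed

text \<open>Stated for a set of centres, as it is needed both for the force of all other centres
  near a given one and for the full force away from all of them.\<close>

lemma Fpart_lipschitz:
 assumes I: "I \<subseteq> {1..N}" and r: "0 < r" "!!i. i \<in> I ==> r <= norm (x - c i)" "!!i. i \<in> I ==> r <= norm (y - c i)"
  and D: "!!i. i \<in> I ==> norm (y - c i) <= D" and D0: "0 <= D"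
 shows "norm ((\<Sum>i\<in>I. (- m i * norm (x - c i) powr (- \<alpha> - 2)) *\<^sub>R (x - c i)) -
   (\<Sum>i\<in>I. (- m i * norm (y - c i) powr (- \<alpha> - 2)) *\<^sub>R (y - c i)))
  <= M * (r powr (- \<alpha> - 2) + (\<alpha> + 2) * r powr (- \<alpha> - 3) * D) * norm (x - y)"
proof -
 define L where "L = r powr (- \<alpha> - 2) + (\<alpha> + 2) * r powr (- \<alpha> - 3) * D"
 have L0: "0 <= L" using al D0 by (simp add: L_def)
 have m: "0 <= m i" if "i \<in> {1..N}" for i using mpos[OF that] by simp
 have "(\<Sum>i\<in>I. (- m i * norm (x - c i) powr (- \<alpha> - 2)) *\<^sub>R (x - c i)) - (\<Sum>i\<in>I. (- m i * norm (y - c i) powr (- \<alpha> - 2)) *\<^sub>R (y - c i))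
  = (\<Sum>i\<in>I. (- m i) *\<^sub>R (norm (x - c i) powr (- \<alpha> - 2) *\<^sub>R (x - y) +
    (norm (x - c i) powr (- \<alpha> - 2) - norm (y - c i) powr (- \<alpha> - 2)) *\<^sub>R (y - c i)))"
  unfolding sum_subtractf[symmetric] by (rule sum.cong) (simp_all add: algebra_simps)
 also have "norm ... <= (\<Sum>i\<in>I. m i * (L * norm (x - y)))"
 proof (rule sum_norm_le)
  fix i assume i: "i \<in> I"
  have i': "i \<in> {1..N}" using i I by blast
  have "norm (x - c i) powr (- \<alpha> - 2) <= r powr (- \<alpha> - 2)"
   using plummer_le[OF r(1) r(2)[OF i], of "\<alpha> + 2"] al by simp
  then have 1: "norm (x - c i) powr (- \<alpha> - 2) * norm (x - y) <= r powr (- \<alpha> - 2) * norm (x - y)"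
   by (rule mult_right_mono) simp
  have e: "\<bar>- \<alpha> - 2\<bar> = \<alpha> + 2" "- \<alpha> - 2 - 1 = - \<alpha> - 3" using al by auto
  have "\<bar>norm (x - c i) powr (- \<alpha> - 2) - norm (y - c i) powr (- \<alpha> - 2)\<bar>
    <= (\<alpha> + 2) * r powr (- \<alpha> - 3) * \<bar>norm (x - c i) - norm (y - c i)\<bar>"
   using powr_lipschitz[OF r(1) r(2)[OF i] r(3)[OF i], of "- \<alpha> - 2", unfolded e] al by simp
  also have "... <= (\<alpha> + 2) * r powr (- \<alpha> - 3) * norm (x - y)"
   using norm_triangle_ineq3[of "x - c i" "y - c i"] al by (intro mult_left_mono) auto
  finally have 2: "\<bar>norm (x - c i) powr (- \<alpha> - 2) - norm (y - c i) powr (- \<alpha> - 2)\<bar> * norm (y - c i)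
    <= ((\<alpha> + 2) * r powr (- \<alpha> - 3) * norm (x - y)) * D"
   using D[OF i] al by (intro mult_mono) auto
  have "norm (norm (x - c i) powr (- \<alpha> - 2) *\<^sub>R (x - y) +
   (norm (x - c i) powr (- \<alpha> - 2) - norm (y - c i) powr (- \<alpha> - 2)) *\<^sub>R (y - c i)) <= L * norm (x - y)"
  proof (rule norm_triangle_le)
   have "L * norm (x - y) = r powr (- \<alpha> - 2) * norm (x - y) + ((\<alpha> + 2) * r powr (- \<alpha> - 3) * norm (x - y)) * D"
    by (simp add: L_def algebra_simps)
   then show "norm (norm (x - c i) powr (- \<alpha> - 2) *\<^sub>R (x - y)) +
    norm ((norm (x - c i) powr (- \<alpha> - 2) - norm (y - c i) powr (- \<alpha> - 2)) *\<^sub>R (y - c i)) <= L * norm (x - y)"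
    using 1 2 by simp
  qed
  then show "norm ((- m i) *\<^sub>R (norm (x - c i) powr (- \<alpha> - 2) *\<^sub>R (x - y) +
   (norm (x - c i) powr (- \<alpha> - 2) - norm (y - c i) powr (- \<alpha> - 2)) *\<^sub>R (y - c i))) <= m i * (L * norm (x - y))"
   unfolding norm_scaleR using m[OF i'] by (simp add: mult_left_mono)
 qed
 also have "... <= (\<Sum>i = 1..N. m i * (L * norm (x - y)))" by (rule sum_mono2) (use I m L0 in auto)
 also have "... = M * L * norm (x - y)" by (simp add: M_def sum_distrib_right mult.assoc)
 finally show ?thesis by (simp add: L_def)
qed

lemma ejection_centre:
 assumes inj: "inj_on c {1..N}" and i0: "i0 \<in> {1..N}"
 obtains B s0 W g where "ejection (m i0) \<alpha> B s0 W g"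
  "!!x. Fd 0 (c i0 + x) = ejection.F (m i0) \<alpha> g x" "!!x. H + Vd 0 (c i0 + x) = ejection.U (m i0) \<alpha> W x"
proof -
 obtain r where r: "0 < r" "!!i x. i \<in> {1..N} - {i0} ==> norm x <= r ==> r <= norm (c i0 + x - c i)"
  by (rule centres_apart[OF inj i0]) (rule that)
 let ?I = "{1..N} - {i0}"
 define W where "W = (%x. H + (\<Sum>i\<in>?I. m i / \<alpha> * norm (c i0 + x - c i) powr (- \<alpha>)))"
 define g where "g = (%x. \<Sum>i\<in>?I. (- m i * norm (c i0 + x - c i) powr (- \<alpha> - 2)) *\<^sub>R (c i0 + x - c i))"
 define D where "D = 1 + 2 * C0"
 have D: "0 < D" using C00 by (simp add: D_def)
 define L where "L = r powr (- \<alpha> - 2) + (\<alpha> + 2) * r powr (- \<alpha> - 3) * D"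
 define B where "B = 1 + H + M * (r powr (- \<alpha>) + r powr (- \<alpha> - 2) * D + r powr (- \<alpha> - 1) + L)"
 have L0: "0 <= L" using al D by (simp add: L_def)
 have Bs: "H + M * r powr (- \<alpha>) <= B" "M * (r powr (- \<alpha> - 2) * D) <= B" "M * r powr (- \<alpha> - 1) <= B" "M * L <= B" "0 < B"
  using M0 H0 L0 D unfolding B_def distrib_left
  by (smt (verit, best) mult_nonneg_nonneg powr_ge_zero)+
 have m: "0 <= m i" if "i \<in> {1..N}" for i using mpos[OF that] by simp
 have sumM: "(\<Sum>i\<in>?I. m i * z) <= M * z" if "0 <= z" for z
 proof -
  have "(\<Sum>i\<in>?I. m i * z) <= (\<Sum>i = 1..N. m i * z)" by (rule sum_mono2) (use m that in auto)
  then show ?thesis by (simp add: M_def sum_distrib_right)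
 qed
 \<comment> \<open>The factor 2 in the denominator leaves room for the strict inequality
   \<open>sB\<close>; the other two caps keep the remaining centres at distance \<open>r\<close> and
   the radius below 1.\<close>
 define s0 where "s0 = min (min 1 r) ((2 / \<alpha> - 1) * m i0 / (2 * B))"
 have a1: "0 < (2 / \<alpha> - 1) * m i0" using al mpos[OF i0] by (simp add: field_simps)
 have s0: "0 < s0" "s0 <= 1" "s0 <= r" "s0 <= (2 / \<alpha> - 1) * m i0 / (2 * B)" using r a1 Bs by (auto simp: s0_def)
 have nD: "norm (c i0 + x - c i) <= D" if "norm x <= s0" "i \<in> {1..N}" for x i
  using norm_triangle_ineq4[of "c i0 + x" "c i"] norm_triangle_ineq[of "c i0" x] c_le[OF i0] c_le[OF that(2)] that(1) s0
  by (simp add: D_def)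
 have nr: "r <= norm (c i0 + x - c i)" if "norm x <= s0" "i \<in> ?I" for x i using r(2)[OF that(2)] that(1) s0 by simp
 have dn: "\<bar>norm (c i0 + x - c i) - norm (c i0 + y - c i)\<bar> <= norm (x - y)" for x y i
  using norm_triangle_ineq3[of "c i0 + x - c i" "c i0 + y - c i"] by simp
 have pl: "\<bar>norm (c i0 + x - c i) powr p - norm (c i0 + y - c i) powr p\<bar> <= \<bar>p\<bar> * r powr (p - 1) * norm (x - y)"
  if "norm x <= s0" "norm y <= s0" "i \<in> ?I" "p <= 0" for x y i p
 proof -
  have "\<bar>norm (c i0 + x - c i) powr p - norm (c i0 + y - c i) powr p\<bar>
   <= \<bar>p\<bar> * r powr (p - 1) * \<bar>norm (c i0 + x - c i) - norm (c i0 + y - c i)\<bar>"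
   by (rule powr_lipschitz[OF r(1) nr nr]) (use that in auto)
  also have "... <= \<bar>p\<bar> * r powr (p - 1) * norm (x - y)" by (intro mult_left_mono dn) simp
  finally show ?thesis .
 qed
 have e: "ejection (m i0) \<alpha> B s0 W g"
 proof
  show "1 <= \<alpha>" "\<alpha> < 2" "0 < m i0" "0 < B" "0 < s0" "s0 <= 1" using al mpos[OF i0] Bs s0 by auto
  have "s0 * B <= ((2 / \<alpha> - 1) * m i0 / (2 * B)) * B" using s0 Bs by (intro mult_right_mono) auto
  also have "... = ((2 / \<alpha> - 1) * m i0) / 2" using Bs by simp
  also have "... < (2 / \<alpha> - 1) * m i0" by (rule half_less[OF a1])
  finally show "s0 * B < (2 / \<alpha> - 1) * m i0" .
 next
  fix x :: "real ^ 3" assume x: "norm x <= s0"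
  show "0 <= W x" unfolding W_def using H0 m al by (intro add_nonneg_nonneg sum_nonneg mult_nonneg_nonneg) auto
  have "(\<Sum>i\<in>?I. m i / \<alpha> * norm (c i0 + x - c i) powr (- \<alpha>)) <= (\<Sum>i\<in>?I. m i * r powr (- \<alpha>))"
  proof (rule sum_mono, rule mult_mono)
   fix i assume i: "i \<in> ?I"
   show "m i / \<alpha> <= m i" using al m[of i] i by (simp add: divide_le_eq mult_left_le mult_le_cancel_left1)
   show "norm (c i0 + x - c i) powr (- \<alpha>) <= r powr (- \<alpha>)" by (rule plummer_le[OF r(1) nr[OF x i]]) (use al in simp)
  qed (use m in auto)
  also have "... <= M * r powr (- \<alpha>)" by (rule sumM) simp
  finally show "W x <= B" using Bs(1) by (simp add: W_def)
  have "norm (g x) <= (\<Sum>i\<in>?I. m i * (r powr (- \<alpha> - 2) * D))"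
   unfolding g_def
  proof (rule sum_norm_le)
   fix i assume i: "i \<in> ?I"
   have "norm (c i0 + x - c i) powr (- \<alpha> - 2) <= r powr (- \<alpha> - 2)"
    using plummer_le[OF r(1) nr[OF x i], of "\<alpha> + 2"] al by simp
   then have "norm (c i0 + x - c i) powr (- \<alpha> - 2) * norm (c i0 + x - c i) <= r powr (- \<alpha> - 2) * D"
    using nD[OF x, of i] i by (intro mult_mono) auto
   then have "m i * (norm (c i0 + x - c i) powr (- \<alpha> - 2) * norm (c i0 + x - c i)) <= m i * (r powr (- \<alpha> - 2) * D)"
    using m[of i] i by (intro mult_left_mono) auto
   then show "norm ((- m i * norm (c i0 + x - c i) powr (- \<alpha> - 2)) *\<^sub>R (c i0 + x - c i)) <= m i * (r powr (- \<alpha> - 2) * D)"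
    using m[of i] i by (simp add: abs_mult mult.assoc)
  qed
  also have "... <= M * (r powr (- \<alpha> - 2) * D)" by (rule sumM) (use D in simp)
  finally show "norm (g x) <= B" using Bs(2) by linarith
 next
  fix x y :: "real ^ 3" assume xy: "norm x <= s0" "norm y <= s0"
  have "\<bar>W x - W y\<bar> = norm (\<Sum>i\<in>?I. m i / \<alpha> * (norm (c i0 + x - c i) powr (- \<alpha>) - norm (c i0 + y - c i) powr (- \<alpha>)))"
   by (simp add: W_def right_diff_distrib sum_subtractf)
  also have "... <= (\<Sum>i\<in>?I. m i * (r powr (- \<alpha> - 1) * norm (x - y)))"
  proof (rule sum_norm_le)
   fix i assume i: "i \<in> ?I"
   have "m i / \<alpha> * \<bar>norm (c i0 + x - c i) powr (- \<alpha>) - norm (c i0 + y - c i) powr (- \<alpha>)\<bar>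
    <= m i / \<alpha> * (\<alpha> * r powr (- \<alpha> - 1) * norm (x - y))"
    using pl[OF xy i, of "- \<alpha>"] m[of i] i al by (intro mult_left_mono) auto
   then show "norm (m i / \<alpha> * (norm (c i0 + x - c i) powr (- \<alpha>) - norm (c i0 + y - c i) powr (- \<alpha>))) <= m i * (r powr (- \<alpha> - 1) * norm (x - y))"
    using m[of i] i al by (simp add: abs_mult)
  qed
  also have "... <= M * (r powr (- \<alpha> - 1) * norm (x - y))" by (rule sumM) simp
  also have "... <= B * norm (x - y)" using mult_right_mono[OF Bs(3) norm_ge_zero] by (simp add: mult.assoc)
  finally show "\<bar>W x - W y\<bar> <= B * norm (x - y)" .
  have "norm (g x - g y) <= M * L * norm ((c i0 + x) - (c i0 + y))"
   unfolding g_def L_def by (rule Fpart_lipschitz[OF _ r(1) nr[OF xy(1)] nr[OF xy(2)] nD[OF xy(2)]]) (use D in auto)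
  also have "... <= B * norm (x - y)" using mult_right_mono[OF Bs(4) norm_ge_zero] by simp
  finally show "norm (g x - g y) <= B * norm (x - y)" .
 qed
 show ?thesis
 proof (rule that[OF e])
  fix x
  show "Fd 0 (c i0 + x) = ejection.F (m i0) \<alpha> g x"
   unfolding Fd0 ejection.F_def[OF e] unfolding g_def by (subst sum.remove[OF _ i0]) simp_all
  show "H + Vd 0 (c i0 + x) = ejection.U (m i0) \<alpha> W x"
   unfolding Vd0 ejection.U_def[OF e] unfolding W_def by (subst sum.remove[OF _ i0]) simp_all
 qed
qed

lemma Fd_cont: "continuous_on (- c ` {1..N}) (Fd \<delta>)"
 unfolding continuous_on_sequentially
proof (intro allI ballI impI)
 fix X and x :: "real ^ 3"
 assume "x \<in> - c ` {1..N}" and X: "(\<forall>n. X n \<in> - c ` {1..N}) & X ----> x"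
 then show "(Fd \<delta> \<circ> X) ----> Fd \<delta> x" using Vd_Fd_lim(2)[OF tendsto_const[of \<delta>], of X x] by (simp add: o_def)
qed

definition flow where
 "flow \<delta> y v s \<longleftrightarrow> (y hvd v s) (at s) & (v hvd Fd \<delta> (y s)) (at s) &
  (norm (v s))^2 = 2 * H + 2 * Vd \<delta> (y s)"

text \<open>\<open>S\<close> consists of times at which the limit is not at a centre. Near such a
  time the approximating orbits keep a fixed distance from the centres, forces are bounded and
  \<open>solutions_limit\<close> applies. The velocity is expressed by
  \<open>vector_derivative\<close>, so that the local statements fit together without
  patching.\<close>

lemma orb_limit:
 fixes y v :: "nat => real => real ^ 3"
 assumes d: "\<delta> ----> 0" and S: "open S"
  and loc: "!!t. t \<in> S ==> \<exists>e>0. \<forall>\<^sub>F n in sequentially. \<forall>s\<in>{t - e..t + e}. flow (\<delta> n) (y n) (v n) s"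
  and uc: "!!(k::nat) e. 0 < e ==> \<exists>n0. \<forall>n\<ge>n0. \<forall>t\<in>{- real k..real k}. norm (y n t - Y t) < e"
  and cY: "continuous_on UNIV Y" and nc: "!!t. t \<in> S ==> Y t \<notin> c ` {1..N}" and t: "t \<in> S"
 shows "(%n. v n t) ----> vector_derivative Y (at t)"
  "(Y hvd vector_derivative Y (at t)) (at t)"
  "((%t. vector_derivative Y (at t)) hvd Fd 0 (Y t)) (at t)"
  "(norm (vector_derivative Y (at t)))^2 = 2 * H + 2 * Vd 0 (Y t)"
proof -
 have fin: "finite (c ` {1..N})" by simp
 obtain r0 where r0: "0 < r0" "!!x. x \<in> c ` {1..N} ==> x ~= Y t ==> r0 <= dist (Y t) x"
  using finite_set_avoid[OF fin, of "Y t"] by metis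
 define r where "r = r0 / 2"
 have r: "0 < r" "2 * r <= norm (Y t - c i)" if "i \<in> {1..N}" for i
 proof -
  have "c i \<in> c ` {1..N}" using that by (rule imageI)
  moreover from this have "c i ~= Y t" using nc[OF t] by metis
  ultimately show "0 < r" "2 * r <= norm (Y t - c i)" using r0(1) r0(2)[of "c i"] by (auto simp: r_def dist_norm)
 qed
 have r': "0 < r" using r0 by (simp add: r_def)
 obtain e1 where e1: "0 < e1" "\<forall>\<^sub>F n in sequentially. \<forall>s\<in>{t - e1..t + e1}. flow (\<delta> n) (y n) (v n) s"
  using loc[OF t] by blast
 have "\<exists>e>0. \<forall>s. dist s t < e --> dist (Y s) (Y t) < r / 2"
  using cY r' unfolding continuous_on_iff by (metis UNIV_I half_gt_zero)
 then obtain e2 where e2: "0 < e2" "!!s. dist s t < e2 ==> dist (Y s) (Y t) < r / 2" by blast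
 obtain e3 where e3: "0 < e3" "cball t e3 \<subseteq> S" using S t unfolding open_contains_cball by blast
 define e where "e = min e1 (min (e2 / 2) e3)"
 have e: "0 < e" "e <= e1" "e < e2" "e <= e3" using e1 e2 e3 by (auto simp: e_def)
 obtain k :: nat where k: "\<bar>t\<bar> + e <= real k" using real_arch_simple by blast
 obtain n1 where n1: "!!n s. n \<ge> n1 ==> s \<in> {- real k..real k} ==> norm (y n s - Y s) < r / 2"
  using uc[OF half_gt_zero[OF r'], of k] by blast
 obtain n2 where n2: "!!n s. n \<ge> n2 ==> s \<in> {t - e1..t + e1} ==> flow (\<delta> n) (y n) (v n) s"
  using e1(2) unfolding eventually_sequentially by blast
 let ?I = "{t - e..t + e}"
 have Ik: "s \<in> {- real k..real k}" "s \<in> {t - e1..t + e1}" "dist s t < e2" if "s \<in> ?I" for s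
  using that k e by (auto simp: dist_real_def abs_le_iff)
 define p where "p = n1 + n2"
 have der: "(y (n + p) hvd v (n + p) s) (at s)" "(v (n + p) hvd Fd (\<delta> (n + p)) (y (n + p) s)) (at s)"
  "(norm (v (n + p) s))^2 = 2 * H + 2 * Vd (\<delta> (n + p)) (y (n + p) s)" if "s \<in> ?I" for n s
  using n2[OF _ Ik(2)[OF that], of "n + p"] by (auto simp: p_def flow_def)
 have rn: "r <= norm (y (n + p) s - c i)" if "s \<in> ?I" "i \<in> {1..N}" for n s i
 proof -
  have "norm (y (n + p) s - Y s) < r / 2" by (rule n1) (use Ik[OF that(1)] in \<open>auto simp: p_def\<close>)
  moreover have "norm (Y s - Y t) < r / 2" using e2(2)[OF Ik(3)[OF that(1)]] by (simp add: dist_norm)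
  moreover have "norm (Y t - c i) <= norm (y (n + p) s - c i) + norm (y (n + p) s - Y s) + norm (Y s - Y t)"
  proof -
   have eq: "Y t - c i = (y (n + p) s - c i) - (y (n + p) s - Y s) - (Y s - Y t)" by simp
   show ?thesis unfolding eq by (rule order_trans[OF norm_triangle_ineq4 add_right_mono[OF norm_triangle_ineq4]])
  qed
  ultimately show ?thesis using r(2)[OF that(2)] by linarith
 qed
 have rY: "Y s \<notin> c ` {1..N}" if "s \<in> ?I" for s
 proof (rule nc)
  show "s \<in> S" using e3(2) that e by (auto simp: cball_def dist_real_def subset_iff)
 qed
 have ly: "(%n. y (n + p) s) ----> Y s" for s
 proof (rule LIMSEQ_ignore_initial_segment, rule LIMSEQ_I)
  fix e' :: real assume "0 < e'"
  obtain k' :: nat where "\<bar>s\<bar> <= real k'" using real_arch_simple by blast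
  then have "s \<in> {- real k'..real k'}" by auto
  then show "\<exists>n0. \<forall>n\<ge>n0. norm (y n s - Y s) < e'" using uc[OF \<open>0 < e'\<close>, of k'] by blast
 qed
 have d': "(%n. \<delta> (n + p)) ----> 0" by (rule LIMSEQ_ignore_initial_segment[OF d])
 obtain v0 where v0: "!!s. s \<in> ?I ==> (%n. v (n + p) s) ----> v0 s"
  "!!s. s \<in> ?I ==> (Y hvd v0 s) (at s within ?I)"
  "!!s. s \<in> ?I ==> (v0 hvd Fd 0 (Y s)) (at s within ?I)"
 proof (rule solutions_limit[of "t - e" "t + e" "%n. y (n + p)" "%n. v (n + p)" "%n s. Fd (\<delta> (n + p)) (y (n + p) s)" "M * r powr (- \<alpha> - 1)" Y "%s. Fd 0 (Y s)"])
  show "t - e < t + e" using e by simp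
  fix n s assume s: "s \<in> ?I"
  show "(y (n + p) hvd v (n + p) s) (at s within ?I)" by (rule has_vector_derivative_at_within[OF der(1)[OF s]])
  show "(v (n + p) hvd Fd (\<delta> (n + p)) (y (n + p) s)) (at s within ?I)" by (rule has_vector_derivative_at_within[OF der(2)[OF s]])
  show "norm (Fd (\<delta> (n + p)) (y (n + p) s)) <= M * r powr (- \<alpha> - 1)" by (rule Fd_bound[OF r' rn[OF s]])
 next
  fix n
  have "y (n + p) ` ?I \<subseteq> - c ` {1..N}"
  proof (rule image_subsetI, rule ComplI)
   fix s assume s: "s \<in> ?I" "y (n + p) s \<in> c ` {1..N}"
   then obtain i where "i \<in> {1..N}" "y (n + p) s = c i" by blast
   then show False using rn[OF s(1), of i n] r' by simp
  qed
  moreover have "continuous_on ?I (y (n + p))"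
   by (rule continuous_on_vector_derivative[OF has_vector_derivative_at_within[OF der(1)]])
  ultimately show "continuous_on ?I (%s. Fd (\<delta> (n + p)) (y (n + p) s))"
   by (intro continuous_on_compose2[OF Fd_cont])
 next
  fix s assume s: "s \<in> ?I"
  show "(%n. y (n + p) s) ----> Y s" by (rule ly)
  show "(%n. Fd (\<delta> (n + p)) (y (n + p) s)) ----> Fd 0 (Y s)" by (rule Vd_Fd_lim(2)[OF d' ly rY[OF s]])
 next
  show "continuous_on ?I (%s. Fd 0 (Y s))"
   by (rule continuous_on_compose2[OF Fd_cont continuous_on_subset[OF cY subset_UNIV]], rule image_subsetI, rule ComplI, rule notE[OF rY])
 qed (rule that)
 have tI: "t \<in> ?I" using e by simp
 have at: "at s within ?I = at s" if "s \<in> {t - e<..<t + e}" for s by (rule at_within_Icc_at) (use that in auto)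
 have Yd: "(Y hvd v0 s) (at s)" if "s \<in> {t - e<..<t + e}" for s
  using v0(2)[of s] at[OF that] that by simp
 have V: "vector_derivative Y (at s) = v0 s" if "s \<in> {t - e<..<t + e}" for s
  by (rule vector_derivative_at[OF Yd[OF that]])
 have tt: "t \<in> {t - e<..<t + e}" using e by simp
 have lv: "(%n. v (n + p) t) ----> v0 t" by (rule v0(1)[OF tI])
 show "(%n. v n t) ----> vector_derivative Y (at t)"
  unfolding V[OF tt] by (rule LIMSEQ_offset[OF lv])
 show "(Y hvd vector_derivative Y (at t)) (at t)" unfolding V[OF tt] by (rule Yd[OF tt])
 have "(v0 hvd Fd 0 (Y t)) (at t)" using v0(3)[OF tI] at[OF tt] by simp
 then show "((%t. vector_derivative Y (at t)) hvd Fd 0 (Y t)) (at t)"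
  by (rule has_vector_derivative_transform_within_open[of _ _ _ "{t - e<..<t + e}"]) (use V e in auto)
 have "(%n. (norm (v (n + p) t))^2) ----> (norm (v0 t))^2" by (intro tendsto_intros lv)
 moreover have "(%n. (norm (v (n + p) t))^2) ----> 2 * H + 2 * Vd 0 (Y t)"
  unfolding der(3)[OF tI] by (intro tendsto_intros Vd_Fd_lim(1)[OF d' ly rY[OF tI]])
 ultimately show "(norm (vector_derivative Y (at t)))^2 = 2 * H + 2 * Vd 0 (Y t)"
  unfolding V[OF tt] by (rule LIMSEQ_unique)
qed

end

section \<open>Minimal rays\<close>

text \<open>Two integrations bound the largest distance by \<open>L * e^2\<close> times itself, and
  that factor is at most one half.\<close>

lemma ode_unique:
 fixes Y1 Y2 V1 V2 :: "real => 'a::real_normed_vector" and F :: "'a => 'a"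
 assumes e: "0 < e" "L * e^2 <= 1 / 2" and L: "0 <= L"
  and Y1: "!!t. t \<in> {a..a + e} ==> (Y1 hvd V1 t) (at t) & (V1 hvd F (Y1 t)) (at t)"
  and Y2: "!!t. t \<in> {a..a + e} ==> (Y2 hvd V2 t) (at t) & (V2 hvd F (Y2 t)) (at t)"
  and lip: "!!t. t \<in> {a..a + e} ==> norm (F (Y1 t) - F (Y2 t)) <= L * norm (Y1 t - Y2 t)"
  and i: "Y1 a = Y2 a" "V1 a = V2 a" and t: "t \<in> {a..a + e}"
 shows "Y1 t = Y2 t"
proof -
 let ?D = "%t. Y1 t - Y2 t" and ?E = "%t. V1 t - V2 t"
 have dD: "(?D hvd ?E s) (at s)" "(?E hvd F (Y1 s) - F (Y2 s)) (at s)"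
  if "s \<in> {a..a + e}" for s
  using Y1[OF that] Y2[OF that] by (auto intro: has_vector_derivative_diff)
 have "continuous_on {a..a + e} ?D"
  by (rule continuous_on_vector_derivative[OF has_vector_derivative_at_within[OF dD(1)]])
 then have cn: "continuous_on {a..a + e} (%t. norm (?D t))" by (rule continuous_on_norm)
 have "{a..a + e} ~= {}" using e by simp
 from continuous_attains_sup[OF compact_Icc this cn] obtain u where u: "u \<in> {a..a + e}" "!!s. s \<in> {a..a + e} ==> norm (?D s) <= norm (?D u)"
  by blast
 define n where "n = norm (?D u)"
 have n0: "0 <= n" by (simp add: n_def)
 have E: "norm (?E s) <= L * n * e" if s: "s \<in> {a..a + e}" for s
 proof -
  have "norm (?E s - ?E a) <= (L * n) * s - (L * n) * a"
  proof (rule derivative_bound[where f'="%s. F (Y1 s) - F (Y2 s)" and \<phi>="%s. (L * n) * s" and \<phi>'="%_. L * n"])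
   fix z assume "z \<in> {a..s}"
   then have z: "z \<in> {a..a + e}" using s by auto
   show "(?E hvd F (Y1 z) - F (Y2 z)) (at z within {a..s})"
    by (rule has_vector_derivative_at_within[OF dD(2)[OF z]])
   show "norm (F (Y1 z) - F (Y2 z)) <= L * n"
    by (rule order_trans[OF lip[OF z]]) (unfold n_def, intro mult_left_mono u(2)[OF z] L)
  qed (use s in \<open>auto intro!: derivative_eq_intros\<close>)
  also have "... = L * n * (s - a)" by (simp add: right_diff_distrib)
  also have "... <= L * n * e" using s L n0 by (intro mult_left_mono) auto
  finally show ?thesis using i by simp
 qed
 have "norm (?D u - ?D a) <= (L * n * e) * u - (L * n * e) * a"
 proof (rule derivative_bound[where f'="?E" and \<phi>="%s. (L * n * e) * s" and \<phi>'="%_. L * n * e"])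
  fix z assume "z \<in> {a..u}"
  then have z: "z \<in> {a..a + e}" using u by auto
  show "(?D hvd ?E z) (at z within {a..u})"
   by (rule has_vector_derivative_at_within[OF dD(1)[OF z]])
  show "norm (?E z) <= L * n * e" by (rule E[OF z])
 qed (use u in \<open>auto intro!: derivative_eq_intros\<close>)
 also have "... = L * n * e * (u - a)" by (simp add: right_diff_distrib)
 also have "... <= L * n * e * e" using u L n0 e by (intro mult_left_mono) auto
 also have "... = (L * e^2) * n" by (simp add: power2_eq_square)
 also have "... <= (1 / 2) * n" by (rule mult_right_mono[OF e(2) n0])
 finally have "n <= (1 / 2) * n" using i by (simp add: n_def)
 then have "n = 0" using n0 by simp
 then show ?thesis using u(2)[OF t] by (simp add: n_def)
qed

lemma last_exit:
 fixes f :: "real => real"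
 assumes f: "continuous_on {0..T} f" and T: "0 <= T" and a: "f 0 <= a" "a < f T"
 obtains t where "0 <= t" "t < T" "f t = a" "!!s. t < s ==> s <= T ==> a < f s"
proof -
 define Z where "Z = {0..T} \<inter> f -` {..a}"
 have "closed Z" unfolding Z_def by (rule continuous_closed_preimage[OF f]) auto
 then have cZ: "compact Z" using compact_Int_closed[OF compact_Icc[of 0 T]] by (metis Z_def inf.absorb_iff2 inf_le1)
 have Z0: "0 \<in> Z" using T a by (auto simp: Z_def)
 obtain t where t: "t \<in> Z" "!!s. s \<in> Z ==> s <= t" using compact_attains_sup[OF cZ] Z0 by blast
 have tT: "0 <= t" "t <= T" "f t <= a" using t(1) by (auto simp: Z_def)
 have gt: "a < f s" if "t < s" "s <= T" for s using t(2)[of s] that tT by (cases "a < f s") (auto simp: Z_def not_less)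
 have "a <= f t"
 proof (rule ccontr)
  assume n: "\<not> a <= f t"
  have "\<exists>s\<ge>t. s <= T & f s = a"
   by (rule IVT') (use n a tT in \<open>auto intro: continuous_on_subset[OF f]\<close>)
  then obtain s where "t <= s" "s <= T" "f s = a" by blast
  then show False using gt[of s] n by (cases "s = t") auto
 qed
 then show ?thesis using that[of t] tT gt a by (cases "t = T") auto
qed

text \<open>Moves the time origin to \<open>\<tau>\<close> and freezes the motion beyond its ends.
  Orbits with different lifetimes thus become functions on the whole line, as the compactness lemma
  requires.\<close>

definition ext :: "real => real => (real => 'a) => real => 'a" where
 "ext T \<tau> f t = f (max 0 (min (t + \<tau>) T))"

lemma ext_eq: "0 <= t + \<tau> ==> t + \<tau> <= T ==> ext T \<tau> f t = f (t + \<tau>)"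
 by (simp add: ext_def)

lemma ext_holder:
 assumes h: "!!s t. s \<in> {0..T} ==> t \<in> {0..T} ==> \<bar>s - \<tau>\<bar> <= k ==> \<bar>t - \<tau>\<bar> <= k ==> (norm (y s - y t))^2 <= C * \<bar>s - t\<bar>"
  and \<tau>: "\<tau> \<in> {0..T}" and C: "0 <= C" and st: "s \<in> {- k..k}" "t \<in> {- k..k}"
 shows "(norm (ext T \<tau> y s - ext T \<tau> y t))^2 <= C * \<bar>s - t\<bar>"
proof -
 let ?s = "max 0 (min (s + \<tau>) T)" and ?t = "max 0 (min (t + \<tau>) T)"
 have "(norm (y ?s - y ?t))^2 <= C * \<bar>?s - ?t\<bar>" by (rule h) (use \<tau> st in \<open>auto simp: max_def min_def\<close>)
 also have "... <= C * \<bar>s - t\<bar>" by (rule mult_left_mono[OF _ C]) (auto simp: max_def min_def)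
 finally show ?thesis by (simp add: ext_def)
qed

context ncentre
begin

lemma ext_der:
 assumes o: "orb \<delta> T y v" and s: "0 < s + \<tau>" "s + \<tau> < T"
 shows "flow \<delta> (ext T \<tau> y) (ext T \<tau> v) s"
proof -
 have sT: "s + \<tau> \<in> {0..T}" using s by auto
 have e: "ext T \<tau> f s = f (s + \<tau>)" for f :: "real => real ^ 3" by (rule ext_eq) (use s in auto)
 have at: "at (s + \<tau>) within {0..T} = at (s + \<tau>)" by (rule at_within_Icc_at) (use s in auto)
 have ch: "(ext T \<tau> f hvd f') (at s)" if "(f hvd f') (at (s + \<tau>) within {0..T})"
  for f :: "real => real ^ 3" and f'
 proof -
  have "((%s. s + \<tau>) hvd 1) (at s)" by (auto intro!: derivative_eq_intros)
  from vector_diff_chain_at[OF this that[unfolded at]]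
  have "((%s. f (s + \<tau>)) hvd f') (at s)" by (simp add: o_def)
  then show ?thesis
   by (rule has_vector_derivative_transform_within_open[of _ _ _ "{- \<tau><..<T - \<tau>}"])
    (use s in \<open>auto simp: ext_def max_def min_def\<close>)
 qed
 show ?thesis
  unfolding flow_def e by (intro conjI ch[OF orb_der(1)[OF o sT]] ch[OF orb_der(2)[OF o sT]] orb_der(3)[OF o sT])
qed

text \<open>If the distance is never smaller later on, its derivative cannot be negative now. This
  supplies the sign that \<open>escape\<close> asks for.\<close>

lemma outward:
 assumes o: "orb \<delta> T y v" and t: "0 <= t" "t < T" and m: "!!s. t < s ==> s <= T ==> norm (y t) <= norm (y s)"
 shows "0 <= y t \<bullet> v t"
proof (rule ccontr)
 assume "\<not> 0 <= y t \<bullet> v t"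
 then have neg: "2 * ((y t - 0) \<bullet> v t) < 0" by simp
 have tT: "t \<in> {0..T}" using t by auto
 from has_real_derivative_neg_dec_right[OF orb_norm_der(1)[OF o tT, of 0] neg]
 obtain d where d: "0 < d" "!!h. 0 < h ==> t + h \<in> {0..T} ==> h < d ==> (norm (y (t + h) - 0))^2 < (norm (y t - 0))^2" by blast
 define h where "h = min (d / 2) (T - t)"
 have h: "0 < h" "t + h \<in> {0..T}" "h < d" using d t by (auto simp: h_def)
 have "(norm (y t))^2 <= (norm (y (t + h)))^2" by (intro power_mono m) (use h in auto)
 then show False using d(2)[OF h] unfolding diff_0_right by linarith
qed

lemma orb_exit:
 assumes o: "orb \<delta> T y v" and T: "0 <= T" and r: "0 <= r" "norm (y 0) <= r" "r < norm (y T)"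
 obtains t where "0 <= t" "t < T" "norm (y t) = r" "0 <= y t \<bullet> v t"
proof -
 have c: "continuous_on {0..T} (%t. norm (y t))" by (intro continuous_on_norm orb_cont(1)[OF o])
 obtain t where t: "0 <= t" "t < T" "norm (y t) = r" "!!s. t < s ==> s <= T ==> r < norm (y s)"
  by (rule last_exit[OF c T r(2,3)]) (rule that)
 have "0 <= y t \<bullet> v t" by (rule outward[OF o t(1,2)]) (use t(3,4) in \<open>auto simp: less_imp_le\<close>)
 then show ?thesis using that t by blast
qed

definition minorb where
 "minorb \<delta> T y v a b \<longleftrightarrow> orb \<delta> T y v & 0 < T & y 0 = a & y T = b & act v 0 T = jac (Gd \<delta>) a b"

lemma minorb_ex:
 assumes d: "\<delta> ~= 0" and ab: "a ~= b" shows "\<exists>T y v. minorb \<delta> T y v a b"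
proof -
 obtain \<Lambda> \<Gamma> B where so: "soft (Gd \<delta>) (Fd \<delta>) H \<Lambda> \<Gamma> B" using soft_Gd[OF d] by blast
 show ?thesis using soft.minimizer[OF so ab] by (simp add: minorb_def act_def orb_orbit[OF d]) blast
qed

lemma jac_tri: "\<delta> ~= 0 ==> jac (Gd \<delta>) a b <= jac (Gd \<delta>) a x + jac (Gd \<delta>) x b"
 and jac_sy: "\<delta> ~= 0 ==> jac (Gd \<delta>) a b = jac (Gd \<delta>) b a"
 and jac_length: "\<delta> ~= 0 ==> sqrt (2 * H) * norm (b - a) <= jac (Gd \<delta>) a b"
proof -
 assume d: "\<delta> ~= 0"
 obtain \<Lambda> \<Gamma> B where so: "soft (Gd \<delta>) (Fd \<delta>) H \<Lambda> \<Gamma> B" using soft_Gd[OF d] by blast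
 show "jac (Gd \<delta>) a b <= jac (Gd \<delta>) a x + jac (Gd \<delta>) x b" by (rule soft.jac_triangle[OF so])
 show "jac (Gd \<delta>) a b = jac (Gd \<delta>) b a" by (rule soft.jac_sym[OF so])
 show "sqrt (2 * H) * norm (b - a) <= jac (Gd \<delta>) a b" by (rule soft.jac_ge[OF so])
qed

text \<open>A piece of a minimiser is a minimiser: replacing it by something cheaper would
  contradict the triangle inequality for the whole.\<close>

lemma minorb_sub:
 assumes d: "\<delta> ~= 0" and m: "minorb \<delta> T y v a b" and st: "0 <= s" "s <= t" "t <= T"
 shows "act v s t <= jac (Gd \<delta>) (y s) (y t)"
proof -
 have o: "orb \<delta> T y v" "y 0 = a" "y T = b" "act v 0 T = jac (Gd \<delta>) a b" using m by (auto simp: minorb_def)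
 have "act v 0 s + act v s t + act v t T = act v 0 T"
  using orb_act_split[OF d o(1), of 0 s t] orb_act_split[OF d o(1), of 0 t T] st by simp
 moreover have "jac (Gd \<delta>) a b <= jac (Gd \<delta>) a (y s) + (jac (Gd \<delta>) (y s) (y t) + jac (Gd \<delta>) (y t) b)"
  using jac_tri[OF d, of a b "y s"] jac_tri[OF d, of "y s" b "y t"] by linarith
 moreover have "jac (Gd \<delta>) a (y s) <= act v 0 s" "jac (Gd \<delta>) (y t) b <= act v t T"
  using orb_act(1)[OF d o(1), of 0 s] orb_act(1)[OF d o(1), of t T] st o by auto
 ultimately show ?thesis using o(4) by linarith
qed

definition AA where "AA = sqrt (2 * H) + K"

lemma modu_le: "0 <= l ==> modu l <= AA * (1 + l)"
proof -
 assume l: "0 <= l"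
 have "l powr \<kappa> <= 1 + l"
 proof (cases "l <= 1")
  case True
  then show ?thesis using powr_mono2[of \<kappa> l 1] kap l by simp
 next
  case False
  then show ?thesis using powr_mono[of \<kappa> 1 l] kap by simp
 qed
 then have "K * l powr \<kappa> <= K * (1 + l)" by (rule mult_left_mono[OF _ K0])
 moreover have "sqrt (2 * H) * l <= sqrt (2 * H) * (1 + l)" using H0 by (intro mult_left_mono) auto
 ultimately show ?thesis by (simp add: modu_def AA_def distrib_right)
qed

lemma AA_pos: "0 < AA" using H0 K0 by (simp add: AA_def add_pos_nonneg)

lemma modu_tendsto:
 assumes f: "(f \<longlongrightarrow> l) F" and nn: "!!x. 0 <= f x" shows "((%x. modu (f x)) \<longlongrightarrow> modu l) F"
proof -
 have "((%x. f x powr \<kappa>) \<longlongrightarrow> l powr \<kappa>) F"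
  by (rule tendsto_powr'[OF f tendsto_const]) (simp add: nn kap)
 then show ?thesis unfolding modu_def by (intro tendsto_add tendsto_mult tendsto_const f)
qed

lemma modu_right:
 assumes b: "0 <= b" and e: "0 < e" shows "\<exists>l>0. modu (b + l) < modu b + e"
proof -
 have "((%l. modu \<bar>b + l\<bar>) \<longlongrightarrow> modu b) (at_right 0)"
  by (rule modu_tendsto) (use b in \<open>auto intro!: tendsto_eq_intros\<close>)
 then have "\<forall>\<^sub>F l in at_right 0. modu \<bar>b + l\<bar> < modu b + e" by (rule order_tendstoD(2)) (use e in simp)
 then have "\<forall>\<^sub>F l in at_right 0. modu \<bar>b + l\<bar> < modu b + e & 0 < l" by (intro eventually_conj eventually_at_right_less)
 then obtain l where "modu \<bar>b + l\<bar> < modu b + e" "0 < l" using eventually_happens trivial_limit_at_right_real by blast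
 then show ?thesis using b by (intro exI[of _ l]) simp
qed

lemma modu_small: "0 < e ==> \<exists>l>0. modu l < e"
 using modu_right[of 0 e] kap by (simp add: modu_def)

lemma modu_mono: "0 <= l ==> l <= l' ==> modu l <= modu l'"
 unfolding modu_def using K0 H0 kap by (intro add_mono mult_left_mono powr_mono2) auto

text \<open>Speeds are not bounded uniformly near the centres, but the displacement is: its square
  is at most elapsed time times action, and the action is at most affine in the
  displacement.\<close>

lemma growth:
 assumes d: "\<delta> ~= 0" and o: "orb \<delta> T y v" and st: "0 <= s" "s <= t" "t <= T" and a: "act v s t <= AA * (1 + norm (y t - y s))"
 shows "norm (y t - y s) <= 1 + 2 * AA * (t - s)"
proof (cases "norm (y t - y s) <= 1")
 case False
 define l where "l = norm (y t - y s)"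
 have l: "1 < l" using False by (simp add: l_def)
 have "l^2 <= (t - s) * (AA * (1 + l))"
  using orb_act(3)[OF d o st] mult_left_mono[OF a, of "t - s"] st by (simp add: l_def)
 also have "... <= (t - s) * (AA * (2 * l))" using l st AA_pos by (intro mult_left_mono) auto
 finally have "l * l <= (2 * AA * (t - s)) * l" by (simp add: power2_eq_square mult_ac)
 then show ?thesis using l unfolding l_def[symmetric] by simp
next
 case True
 moreover have "0 <= 2 * AA * (t - s)" using AA_pos st by simp
 ultimately show ?thesis by linarith
qed

text \<open>The approximating minimisers are kept together with their limit \<open>r\<close>,
  because rays are compared through costs, and these have a meaning only for finite
  \<open>n\<close>.\<close>

definition ray_seq where
 "ray_seq \<delta> R \<xi> i T y v r \<longleftrightarrow> (\<forall>n. \<delta> n ~= 0) & \<delta> ----> 0 & filterlim R at_top sequentially & (\<forall>n. 0 <= R n) & norm \<xi> = 1 &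
  (\<forall>n. minorb (\<delta> n) (T n) (y n) (v n) (c i) (R n *\<^sub>R \<xi>)) & filterlim T at_top sequentially & continuous_on UNIV r &
  (\<forall>(k::nat) e. 0 < e --> (\<exists>n0. \<forall>n\<ge>n0. \<forall>t\<in>{- real k..real k}. norm (ext (T n) 0 (y n) t - r t) < e))"

lemma ray_exists:
 assumes d: "!!n. \<delta> n ~= 0" "\<delta> ----> 0" and R: "filterlim R at_top sequentially" "!!n. norm (c i) < R n" and x: "norm \<xi> = 1"
 obtains \<sigma> T y v r where "strict_mono (\<sigma> :: nat => nat)" "ray_seq (\<delta> \<circ> \<sigma>) (R \<circ> \<sigma>) \<xi> i T y v r"
proof -
 have R0: "0 <= R n" for n using R(2)[of n] norm_ge_zero[of "c i"] by linarith
 have "c i ~= R n *\<^sub>R \<xi>" for n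
 proof
  assume "c i = R n *\<^sub>R \<xi>"
  then have "norm (c i) = R n" using R0[of n] x by simp
  then show False using R(2)[of n] by simp
 qed
 then have "\<forall>n. \<exists>T y v. minorb (\<delta> n) T y v (c i) (R n *\<^sub>R \<xi>)" using minorb_ex[OF d(1)] by blast
 then obtain T y v where m: "!!n. minorb (\<delta> n) (T n) (y n) (v n) (c i) (R n *\<^sub>R \<xi>)" by metis
 have o: "orb (\<delta> n) (T n) (y n) (v n)" "0 < T n" "y n 0 = c i" "y n (T n) = R n *\<^sub>R \<xi>" for n using m[of n] by (auto simp: minorb_def)
 have act: "act (v n) s t <= AA * (1 + norm (y n t - y n s))" if "0 <= s" "s <= t" "t <= T n" for n s t
  using minorb_sub[OF d(1) m that] jac_le_modu[OF d(1), of n "y n s" "y n t"] modu_le[of "norm (y n t - y n s)"] by simp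
 have gr: "norm (y n t - y n s) <= 1 + 2 * AA * (t - s)" if "0 <= s" "s <= t" "t <= T n" for n s t
  by (rule growth[OF d(1) o(1) that act[OF that]])
 have hol: "(norm (y n s - y n t))^2 <= (AA * (2 + 2 * AA * k)) * \<bar>s - t\<bar>"
  if st: "s \<in> {0..T n}" "t \<in> {0..T n}" "\<bar>s - 0\<bar> <= k" "\<bar>t - 0\<bar> <= k" for n s t k
 proof -
  have *: "(norm (y n t - y n s))^2 <= (AA * (2 + 2 * AA * k)) * (t - s)" if st: "0 <= s" "s <= t" "t <= T n" "t <= k" for s t
  proof -
   have "act (v n) s t <= AA * (1 + norm (y n t - y n s))" by (rule act[OF st(1-3)])
   also have "... <= AA * (1 + (1 + 2 * AA * (t - s)))" using gr[OF st(1-3)] AA_pos by (intro mult_left_mono) auto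
   also have "... <= AA * (1 + (1 + 2 * AA * k))" using AA_pos st by (intro mult_left_mono add_left_mono) auto
   finally have "(t - s) * act (v n) s t <= (t - s) * (AA * (2 + 2 * AA * k))" using st by (intro mult_left_mono) auto
   then show ?thesis using orb_act(3)[OF d(1) o(1) st(1-3)] by (simp add: mult.commute)
  qed
  show ?thesis using *[of s t] *[of t s] st by (cases "s <= t") (auto simp: norm_minus_commute abs_if)
 qed
 have T: "filterlim T at_top sequentially"
 proof (rule filterlim_at_top_mono)
  show "filterlim (%n. (1 / (2 * AA)) * (- (norm (c i) + 1) + R n)) at_top sequentially"
   by (rule filterlim_tendsto_pos_mult_at_top[OF tendsto_const _ filterlim_tendsto_add_at_top[OF tendsto_const R(1)]]) (use AA_pos in simp)
  have "(1 / (2 * AA)) * (- (norm (c i) + 1) + R n) <= T n" for n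
  proof -
   have "R n - norm (c i) <= norm (y n (T n) - y n 0)"
    using norm_triangle_ineq2[of "R n *\<^sub>R \<xi>" "c i"] R0[of n] x by (simp add: o)
   also have "... <= 1 + 2 * AA * (T n - 0)" by (rule gr) (use o(2)[of n] in auto)
   finally show ?thesis using AA_pos by (simp add: field_simps)
  qed
  then show "\<forall>\<^sub>F n in sequentially. (1 / (2 * AA)) * (- (norm (c i) + 1) + R n) <= T n" by simp
 qed
 have ext0: "ext (T n) 0 (y n) 0 = c i" for n using o(2,3)[of n] by (simp add: ext_def)
 obtain \<sigma> r where s: "strict_mono (\<sigma> :: nat => nat)"
  "!!(k::nat) e. 0 < e ==> \<exists>n0. \<forall>n\<ge>n0. \<forall>t\<in>{- real k..real k}. norm (ext (T (\<sigma> n)) 0 (y (\<sigma> n)) t - r t) < e"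
  "continuous_on UNIV r"
 proof (rule equicontinuous_limit[of "%n. ext (T n) 0 (y n)" "norm (c i)"])
  fix k :: nat
  have C: "0 <= AA * (2 + 2 * AA * real k)" using AA_pos by (intro mult_nonneg_nonneg add_nonneg_nonneg) auto
  show "\<exists>C. \<forall>n. \<forall>s\<in>{- real k..real k}. \<forall>t\<in>{- real k..real k}. (norm (ext (T n) 0 (y n) s - ext (T n) 0 (y n) t))^2 <= C * \<bar>s - t\<bar>"
   by (rule exI[of _ "AA * (2 + 2 * AA * real k)"], intro allI ballI, rule ext_holder[OF hol _ C]) (use o(2) in \<open>auto simp: less_imp_le\<close>)
 qed (use ext0 that in auto)
 have sf: "filterlim \<sigma> at_top sequentially" by (rule filterlim_subseq[OF s(1)])
 show ?thesis
 proof (rule that[OF s(1)])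
  show "ray_seq (\<delta> \<circ> \<sigma>) (R \<circ> \<sigma>) \<xi> i (T \<circ> \<sigma>) (y \<circ> \<sigma>) (v \<circ> \<sigma>) r"
   unfolding ray_seq_def o_def using d(1) R0 x m s(2,3)
    filterlim_compose[OF d(2) sf] filterlim_compose[OF R(1) sf] filterlim_compose[OF T sf] by blast
 qed
qed

text \<open>Needed to let two rays from the same centre run along one common sequence.\<close>

lemma ray_sub:
 assumes r: "ray_seq \<delta> R \<xi> i T y v r" and s: "strict_mono \<sigma>"
 shows "ray_seq (\<delta> \<circ> \<sigma>) (R \<circ> \<sigma>) \<xi> i (T \<circ> \<sigma>) (y \<circ> \<sigma>) (v \<circ> \<sigma>) r"
proof -
 have sf: "filterlim \<sigma> at_top sequentially" by (rule filterlim_subseq[OF s])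
 have sg: "n <= \<sigma> n" for n by (rule seq_suble[OF s])
 have "\<exists>n0. \<forall>n\<ge>n0. \<forall>t\<in>{- real k..real k}. norm (ext (T (\<sigma> n)) 0 (y (\<sigma> n)) t - r t) < e" if e0: "0 < e" for k :: nat and e
 proof -
  obtain n0 where "\<forall>n\<ge>n0. \<forall>t\<in>{- real k..real k}. norm (ext (T n) 0 (y n) t - r t) < e" using r e0 unfolding ray_seq_def by blast
  then show ?thesis using sg by (intro exI[of _ n0]) (meson order_trans)
 qed
 then show ?thesis using r filterlim_compose[OF _ sf, of \<delta>] filterlim_compose[OF _ sf, of R] filterlim_compose[OF _ sf, of T]
  unfolding ray_seq_def o_def by blast
qed

context
 fixes \<delta> R :: "nat => real" and \<xi> i T y v r assumes ray: "ray_seq \<delta> R \<xi> i T y v r"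
begin

lemma rayD:
 shows "\<delta> n ~= 0" "\<delta> ----> 0" "filterlim R at_top sequentially" "0 <= R n" "norm \<xi> = 1"
  "minorb (\<delta> n) (T n) (y n) (v n) (c i) (R n *\<^sub>R \<xi>)" "filterlim T at_top sequentially" "continuous_on UNIV r"
  "orb (\<delta> n) (T n) (y n) (v n)" "0 < T n" "y n 0 = c i" "y n (T n) = R n *\<^sub>R \<xi>"
  "act (v n) 0 (T n) = jac (Gd (\<delta> n)) (c i) (R n *\<^sub>R \<xi>)"
 using ray by (auto simp: ray_seq_def minorb_def)

lemma ray_uc: "0 < e ==> \<exists>n0. \<forall>n\<ge>n0. \<forall>t\<in>{- real k..real k}. norm (ext (T n) 0 (y n) t - r t) < e"
 using ray by (simp add: ray_seq_def)

lemma ray_ev: "\<forall>\<^sub>F n in sequentially. t < T n"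
 using rayD(7) by (simp add: filterlim_at_top_dense)

lemma ray_conv: assumes t: "0 <= t" shows "(%n. y n t) ----> r t"
proof (rule Lim_transform_eventually)
 show "(%n. ext (T n) 0 (y n) t) ----> r t"
 proof (rule LIMSEQ_I)
  fix e :: real assume e: "0 < e"
  obtain k :: nat where "\<bar>t\<bar> <= real k" using real_arch_simple by blast
  then have "t \<in> {- real k..real k}" by auto
  then show "\<exists>n0. \<forall>n\<ge>n0. norm (ext (T n) 0 (y n) t - r t) < e" using ray_uc[OF e, of k] by blast
 qed
 show "\<forall>\<^sub>F n in sequentially. ext (T n) 0 (y n) t = y n t"
  using ray_ev[of t] by eventually_elim (use t in \<open>simp add: ext_def\<close>)
qed

lemma ray_0: "r 0 = c i"
 using ray_conv[of 0] by (simp add: rayD(11) LIMSEQ_const_iff)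

lemma ray_cost:
 assumes "0 <= t" "t <= T n"
 shows "jac (Gd (\<delta> n)) (c i) (y n t) + jac (Gd (\<delta> n)) (y n t) (R n *\<^sub>R \<xi>) <= jac (Gd (\<delta> n)) (c i) (R n *\<^sub>R \<xi>)"
  "2 * H * t + jac (Gd (\<delta> n)) (y n t) (R n *\<^sub>R \<xi>) <= jac (Gd (\<delta> n)) (c i) (R n *\<^sub>R \<xi>)"
proof -
 note o = rayD(9)[of n] and d = rayD(1)[of n]
 have s: "act (v n) 0 t + act (v n) t (T n) = jac (Gd (\<delta> n)) (c i) (R n *\<^sub>R \<xi>)"
  using orb_act_split[OF d o _ assms(1), of "T n"] assms rayD(13)[of n] by simp
 have 2: "jac (Gd (\<delta> n)) (y n t) (R n *\<^sub>R \<xi>) <= act (v n) t (T n)"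
  using orb_act(1)[OF d o assms order_refl] by (simp add: rayD(12))
 show "jac (Gd (\<delta> n)) (c i) (y n t) + jac (Gd (\<delta> n)) (y n t) (R n *\<^sub>R \<xi>) <= jac (Gd (\<delta> n)) (c i) (R n *\<^sub>R \<xi>)"
  using orb_act(1)[OF d o order_refl assms] s 2 by (simp add: rayD(11))
 show "2 * H * t + jac (Gd (\<delta> n)) (y n t) (R n *\<^sub>R \<xi>) <= jac (Gd (\<delta> n)) (c i) (R n *\<^sub>R \<xi>)"
  using orb_act(2)[OF d o order_refl assms] s 2 by simp
qed

lemma ray_near:
 assumes t: "0 <= t" and p: "norm (r t - p) < l"
 shows "\<forall>\<^sub>F n in sequentially. jac (Gd (\<delta> n)) p (R n *\<^sub>R \<xi>) <= modu l + jac (Gd (\<delta> n)) (y n t) (R n *\<^sub>R \<xi>)"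
proof -
 have "(%n. norm (y n t - p)) ----> norm (r t - p)" by (intro tendsto_intros ray_conv t)
 from order_tendstoD(2)[OF this p] show ?thesis
 proof eventually_elim
  case (elim n)
  have "jac (Gd (\<delta> n)) p (y n t) <= modu (norm (y n t - p))" by (rule jac_le_modu[OF rayD(1)])
  also have "... <= modu l" by (rule modu_mono) (use elim in auto)
  finally show ?case using jac_tri[OF rayD(1)[of n], of p "R n *\<^sub>R \<xi>" "y n t"] by linarith
 qed
qed

text \<open>Passing through \<open>p\<close> at time \<open>t\<close> shows that the remaining cost
  from \<open>p\<close> is smaller than the cost from \<open>c i\<close> by
  \<open>2 * H * t\<close>, up to any \<open>e\<close>. With \<open>p = c i\<close> this forbids a
  return; with \<open>p\<close> another centre it contradicts the choice of \<open>i\<close> once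
  both rays pass through \<open>p\<close>.\<close>

lemma ray_hit:
 assumes t: "0 <= t" and p: "r t = p" and e: "0 < e"
 shows "\<forall>\<^sub>F n in sequentially. 2 * H * t + jac (Gd (\<delta> n)) p (R n *\<^sub>R \<xi>) <= jac (Gd (\<delta> n)) (c i) (R n *\<^sub>R \<xi>) + e"
proof -
 obtain l where l: "modu l < e" "0 < l" using modu_small[OF e] by blast
 have "norm (r t - p) < l" using p l by simp
 from ray_near[OF t this] ray_ev[of t] show ?thesis
 proof eventually_elim
  case (elim n)
  then show ?case using ray_cost(2)[OF t, of n] l by simp
 qed
qed

lemma ray_not_start: assumes t: "0 < t" shows "r t ~= c i"
proof
 assume "r t = c i"
 moreover have Ht: "0 < H * t" using H0 t by simp
 ultimately have "\<forall>\<^sub>F n::nat in sequentially. False"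
  using ray_hit[OF less_imp_le[OF t], of "c i" "H * t"] by (auto elim!: eventually_mono)
 then show False by simp
qed

definition "rS = {t. 0 < t & r t \<notin> c ` {1..N}}"

lemma ray_limit:
 assumes t: "0 < t" "r t \<notin> c ` {1..N}"
 shows "(%n. v n t) ----> vector_derivative r (at t)" "(r hvd vector_derivative r (at t)) (at t)"
  "((%t. vector_derivative r (at t)) hvd Fd 0 (r t)) (at t)"
  "(norm (vector_derivative r (at t)))^2 = 2 * H + 2 * Vd 0 (r t)"
proof -
 have "closed (c ` {1..N})" by (rule finite_imp_closed) simp
 then have "open (r -` (- c ` {1..N}))" by (intro open_vimage rayD(8)) auto
 moreover have "rS = {0<..} \<inter> r -` (- c ` {1..N})" by (auto simp: rS_def)
 ultimately have op: "open rS" by auto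
 have loc: "\<exists>e>0. \<forall>\<^sub>F n in sequentially. \<forall>s\<in>{t - e..t + e}. flow (\<delta> n) (ext (T n) 0 (y n)) (ext (T n) 0 (v n)) s" if "t \<in> rS" for t
 proof (intro exI[of _ "t / 2"] conjI)
  show "0 < t / 2" using that by (simp add: rS_def)
  show "\<forall>\<^sub>F n in sequentially. \<forall>s\<in>{t - t / 2..t + t / 2}. flow (\<delta> n) (ext (T n) 0 (y n)) (ext (T n) 0 (v n)) s"
   using ray_ev[of "2 * t"] by eventually_elim (rule ballI, rule ext_der[OF rayD(9)], use that in \<open>auto simp: rS_def\<close>)
 qed
 have nc: "r t \<notin> c ` {1..N}" if "t \<in> rS" for t using that by (simp add: rS_def)
 have tS: "t \<in> rS" using t by (simp add: rS_def)
 note L = orb_limit[where y="%n. ext (T n) 0 (y n)" and v="%n. ext (T n) 0 (v n)" and Y=r, OF rayD(2) op loc ray_uc rayD(8) nc tS]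
 have "(%n. ext (T n) 0 (v n) t) ----> vector_derivative r (at t)" by (rule L(1))
 moreover have "\<forall>\<^sub>F n in sequentially. ext (T n) 0 (v n) t = v n t"
  using ray_ev[of t] by eventually_elim (use t in \<open>simp add: ext_def\<close>)
 ultimately show "(%n. v n t) ----> vector_derivative r (at t)" by (rule Lim_transform_eventually)
 show "(r hvd vector_derivative r (at t)) (at t)" by (rule L(2))
 show "((%t. vector_derivative r (at t)) hvd Fd 0 (r t)) (at t)" by (rule L(3))
 show "(norm (vector_derivative r (at t)))^2 = 2 * H + 2 * Vd 0 (r t)" by (rule L(4))
qed

lemma ray_asymptotics:
 assumes i: "i \<in> {1..N}" shows "((%t. r t /\<^sub>R norm (r t)) \<longlongrightarrow> \<xi>) at_top"
proof -
 have "0 <= 4 * M / H" using M0 H0 by simp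
 then have ci: "norm (c i) <= \<rho>1" using c_le[OF i] C00 unfolding \<rho>1_def by linarith
 have "\<forall>\<^sub>F n in sequentially. \<rho>1 < R n" using rayD(3) by (simp add: filterlim_at_top_dense)
 then obtain p where p: "!!n. n \<ge> p ==> \<rho>1 < R n" unfolding eventually_sequentially by blast
 have "\<exists>t. 0 <= t & t < T n & norm (y n t) = \<rho>1 & 0 <= y n t \<bullet> v n t" if n: "n \<ge> p" for n
 proof -
  have T0: "0 <= T n" using rayD(10)[of n] by simp
  have n0: "norm (y n 0) <= \<rho>1" using ci by (simp add: rayD(11))
  have nT: "\<rho>1 < norm (y n (T n))" using p[OF n] rayD(4)[of n] by (simp add: rayD(12) rayD(5))
  show ?thesis by (rule orb_exit[OF rayD(9) T0 _ n0 nT]) (use rho1 in auto)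
 qed
 then obtain t0 where t0: "!!n. n \<ge> p ==> 0 <= t0 n & t0 n < T n & norm (y n (t0 n)) = \<rho>1 & 0 <= y n (t0 n) \<bullet> v n (t0 n)" by metis
 \<comment> \<open>A minimiser pays at least \<open>2 * H\<close> per unit of time and at most
   \<open>modu (2 * \<rho>1)\<close> between its start and the exit point, which bounds the exit
   times uniformly.\<close>
 define \<tau> where "\<tau> = modu (2 * \<rho>1) / (2 * H)"
 have t0\<tau>: "t0 n <= \<tau>" if n: "n \<ge> p" for n
 proof -
  note t = t0[OF n]
  have "2 * H * (t0 n - 0) <= act (v n) 0 (t0 n)" by (rule orb_act(2)[OF rayD(1,9)]) (use t in auto)
  also have "... <= jac (Gd (\<delta> n)) (y n 0) (y n (t0 n))" by (rule minorb_sub[OF rayD(1,6)]) (use t in auto)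
  also have "... <= modu (norm (y n (t0 n) - y n 0))" by (rule jac_le_modu[OF rayD(1)])
  also have "... <= modu (2 * \<rho>1)"
   by (rule modu_mono) (use t ci norm_triangle_ineq4[of "y n (t0 n)" "c i"] in \<open>auto simp: rayD(11)\<close>)
  finally show ?thesis using H0 by (simp add: \<tau>_def pos_le_divide_eq mult.commute)
 qed
 have tau0: "0 <= \<tau>" using t0\<tau>[of p] t0[of p] by simp
 have off: "r t \<notin> c ` {1..N} & 0 < t" if t: "\<tau> < t" for t
 proof
  show "0 < t" using t tau0 by simp
  have "\<rho>1 <= norm (r t)"
  proof (rule tendsto_lowerbound[OF tendsto_norm[OF ray_conv]])
   show "\<forall>\<^sub>F n in sequentially. \<rho>1 <= norm (y n t)"
    using ray_ev[of t] eventually_ge_at_top[of p]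
   proof eventually_elim
    case (elim n)
    note t' = t0[OF elim(2)] t0\<tau>[OF elim(2)]
    show ?case by (rule escape(1)[OF rayD(9)[of n], of "t0 n"]) (use t' t elim in auto)
   qed
  qed (use t tau0 in auto)
  then show "r t \<notin> c ` {1..N}" by (rule far(4))
 qed
 show ?thesis
 proof (rule asymptotics[of "%n. \<delta> (n + p)" "%n. T (n + p)" "%n. y (n + p)" "%n. v (n + p)" "%n. t0 (n + p)" \<tau>
   "%n. R (n + p)" \<xi> r "%t. vector_derivative r (at t)"])
  fix n
  have np: "n + p \<ge> p" by simp
  show "orb (\<delta> (n + p)) (T (n + p)) (y (n + p)) (v (n + p))" by (rule rayD(9))
  show "0 <= t0 (n + p)" "t0 (n + p) <= \<tau>" "\<rho>1 <= norm (y (n + p) (t0 (n + p)))" "0 <= y (n + p) (t0 (n + p)) \<bullet> v (n + p) (t0 (n + p))"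
   using t0[OF np] t0\<tau>[OF np] by auto
  show "y (n + p) (T (n + p)) = R (n + p) *\<^sub>R \<xi>" "0 <= R (n + p)" by (rule rayD)+
 next
  show "norm \<xi> = 1" by (rule rayD(5))
  show "filterlim (%n. T (n + p)) at_top sequentially"
   by (rule filterlim_compose[OF rayD(7)]) (rule filterlim_add_const_nat_at_top)
 next
  fix t assume t: "\<tau> < t"
  show "(%n. y (n + p) t) ----> r t" by (rule LIMSEQ_ignore_initial_segment[OF ray_conv]) (use off[OF t] in auto)
  show "(%n. v (n + p) t) ----> vector_derivative r (at t)"
   by (rule LIMSEQ_ignore_initial_segment[OF ray_limit(1)]) (use off[OF t] in auto)
  show "(r hvd vector_derivative r (at t)) (at t)" by (rule ray_limit(2)) (use off[OF t] in auto)
 qed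
qed

text \<open>Shortly after leaving, the ray is off all centres: it does not return to its own, and
  the others are too far. Its regular part therefore qualifies for the uniqueness of
  ejections.\<close>

lemma ray_ejection:
 assumes inj: "inj_on c {1..N}" and i: "i \<in> {1..N}" and e: "ejection (m i) \<alpha> B s0 W g"
  and F: "!!x. Fd 0 (c i + x) = ejection.F (m i) \<alpha> g x" and U: "!!x. H + Vd 0 (c i + x) = ejection.U (m i) \<alpha> W x"
 shows "\<exists>\<epsilon>. ejection.ej (m i) \<alpha> B s0 W g (%t. r t - c i) (%t. vector_derivative r (at t)) \<epsilon>"
proof -
 obtain q where q: "0 < q" "!!j x. j \<in> {1..N} - {i} ==> norm x <= q ==> q <= norm (c i + x - c j)"
  by (rule centres_apart[OF inj i]) (rule that)
 have s0: "0 < s0" "0 < B" and al': "0 < m i / \<alpha>" using e al mpos[OF i] by (auto simp: ejection_def)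
 have "\<exists>d>0. \<forall>t. dist t 0 < d --> dist (r t) (r 0) < min s0 q"
 proof -
  have "0 < min s0 q" using s0 q by simp
  then show ?thesis using rayD(8) unfolding continuous_on_iff by (metis UNIV_I)
 qed
 then obtain d where d: "0 < d" "!!t. dist t 0 < d ==> dist (r t) (r 0) < min s0 q" by blast
 define \<epsilon> where "\<epsilon> = min d (sqrt (m i / \<alpha>) / B)"
 have eps: "0 < \<epsilon>" "\<epsilon> <= d" "\<epsilon> <= sqrt (m i / \<alpha>) / B" using d s0 al' by (auto simp: \<epsilon>_def)
 have close: "norm (r t - c i) <= s0" "norm (r t - c i) <= q" if "t \<in> {0<..<\<epsilon>}" for t
  using d(2)[of t] that eps by (auto simp: ray_0 dist_norm)
 have off: "r t \<notin> c ` {1..N}" if t: "t \<in> {0<..<\<epsilon>}" for t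
 proof
  assume "r t \<in> c ` {1..N}"
  then obtain j where j: "j \<in> {1..N}" "r t = c j" by blast
  have "j ~= i" using ray_not_start[of t] t j by auto
  then show False using q(2)[of j "r t - c i"] close(2)[OF t] j q(1) by simp
 qed
 have "B * \<epsilon> <= sqrt (m i / \<alpha>)" using eps(3) s0 by (simp add: pos_le_divide_eq mult.commute)
 then have "(B * \<epsilon>)^2 <= (sqrt (m i / \<alpha>))^2" using s0 eps by (intro power_mono) auto
 then have Be: "B^2 * \<epsilon>^2 <= m i / \<alpha>" using al' by (simp add: power_mult_distrib)
 show ?thesis
  unfolding ejection.ej_def[OF e]
 proof (intro exI[of _ \<epsilon>] conjI ballI)
  show "continuous_on {0..\<epsilon>} (%t. r t - c i)"
   by (intro continuous_on_diff continuous_on_const continuous_on_subset[OF rayD(8)]) auto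
  fix t assume t: "t \<in> {0<..<\<epsilon>}"
  have t0: "0 < t" using t by simp
  note L = ray_limit[OF t0 off[OF t]]
  show "r t - c i ~= 0" using ray_not_start[OF t0] by simp
  show "((%t. r t - c i) hvd vector_derivative r (at t)) (at t)"
   using has_vector_derivative_diff[OF L(2) has_vector_derivative_const[of "c i"]] by simp
  show "((%t. vector_derivative r (at t)) hvd ejection.F (m i) \<alpha> g (r t - c i)) (at t)"
   using L(3) F[of "r t - c i"] by simp
  show "(norm (vector_derivative r (at t)))^2 = 2 * ejection.U (m i) \<alpha> W (r t - c i)"
   using L(4) U[of "r t - c i"] by simp
 qed (use eps(1) Be ray_0 close(1) in auto)
qed

end

end

section \<open>Lowering the minimax level\<close>

lemma cont_dist: "continuous_on UNIV f ==> 0 < q ==> \<exists>d>0. \<forall>t. dist t a < d --> dist (f t) (f a) < q"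
 unfolding continuous_on_iff by (metis UNIV_I)

context ncentre
begin

text \<open>Coincidence near the centre is carried on by uniqueness for the equation of motion,
  which would stop at a collision with another centre. As long as both rays coincide, such a
  collision is excluded by the minimality of \<open>i\<close>, so they coincide forever.\<close>

lemma ray_directions:
 assumes inj: "inj_on c {1..N}" and i: "i \<in> {1..N}"
  and rm: "ray_seq \<delta> R \<xi>m i Tm ym vm rm" and rp: "ray_seq \<delta> R \<xi>p i Tp yp vp rp" and ne: "\<xi>m ~= \<xi>p"
  and min: "!!n k. k \<in> {1..N} ==> jac (Gd (\<delta> n)) (c i) (R n *\<^sub>R \<xi>m) + jac (Gd (\<delta> n)) (c i) (R n *\<^sub>R \<xi>p)
   <= jac (Gd (\<delta> n)) (c k) (R n *\<^sub>R \<xi>m) + jac (Gd (\<delta> n)) (c k) (R n *\<^sub>R \<xi>p)"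
 shows "\<exists>wm wp. norm wm = 1 & norm wp = 1 & wm ~= wp &
  ((%t. (1 / norm (rm t - c i)) *\<^sub>R (rm t - c i)) \<longlongrightarrow> wm) (at_right 0) &
  ((%t. (1 / norm (rp t - c i)) *\<^sub>R (rp t - c i)) \<longlongrightarrow> wp) (at_right 0)"
proof -
 obtain B s0 W g where e: "ejection (m i) \<alpha> B s0 W g" and F: "!!x. Fd 0 (c i + x) = ejection.F (m i) \<alpha> g x"
  and U: "!!x. H + Vd 0 (c i + x) = ejection.U (m i) \<alpha> W x"
  by (rule ejection_centre[OF inj i]) (rule that)
 obtain \<epsilon>m where em: "ejection.ej (m i) \<alpha> B s0 W g (%t. rm t - c i) (%t. vector_derivative rm (at t)) \<epsilon>m"
  using ray_ejection[OF rm inj i e F U] by blast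
 obtain \<epsilon>p where ep: "ejection.ej (m i) \<alpha> B s0 W g (%t. rp t - c i) (%t. vector_derivative rp (at t)) \<epsilon>p"
  using ray_ejection[OF rp inj i e F U] by blast
 obtain wm where wm: "norm wm = 1" "((%t. (1 / norm (rm t - c i)) *\<^sub>R (rm t - c i)) \<longlongrightarrow> wm) (at_right 0)"
  using ejection.ejection_direction[OF e em] by blast
 obtain wp where wp: "norm wp = 1" "((%t. (1 / norm (rp t - c i)) *\<^sub>R (rp t - c i)) \<longlongrightarrow> wp) (at_right 0)"
  using ejection.ejection_direction[OF e ep] by blast
 have "wm ~= wp"
 proof
  assume eq: "wm = wp"
  obtain \<eta> where eta: "0 < \<eta>" "!!t. t \<in> {0<..<\<eta>} ==> rm t = rp t"
   using ejection.ejection_unique[OF e em ep wm(2) wp(2)[folded eq]] by auto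
  \<comment> \<open>Only a common collision is excluded. From the other centre both targets would be
    cheaper by nearly \<open>2 * H * t\<close>, and the sum of the two savings contradicts
    \<open>min\<close>.\<close>
  have nohit: "rm t \<notin> c ` {1..N}" if t: "0 < t" "rm t = rp t" for t
  proof
   assume "rm t \<in> c ` {1..N}"
   then obtain k where k: "k \<in> {1..N}" "rm t = c k" by blast
   have Ht: "0 < H * t" using H0 t by simp
   have "\<forall>\<^sub>F n::nat in sequentially. False"
    using ray_hit[OF rm less_imp_le[OF t(1)] k(2) Ht] ray_hit[OF rp less_imp_le[OF t(1)] k(2)[unfolded t(2)] Ht]
   proof eventually_elim
    case (elim n)
    then show False using min[OF k(1), of n] Ht by simp
   qed
   then show False by simp
  qed
  have all: "rm t = rp t" if t: "0 <= t" for t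
  proof (rule ccontr)
   assume n: "rm t ~= rp t"
   define Z where "Z = {u. 0 <= u & rm u ~= rp u}"
   have Z: "t \<in> Z" "bdd_below Z" using n t by (auto simp: Z_def intro: bdd_belowI[of _ 0])
   \<comment> \<open>The first time of separation. It is positive by uniqueness of ejections, and at
     this time the rays still agree in position and velocity, off the centres.\<close>
   define a where "a = Inf Z"
   have lt: "rm u = rp u" if "0 <= u" "u < a" for u
   proof (rule ccontr)
    assume "rm u ~= rp u"
    then have "a <= u" unfolding a_def by (intro cInf_lower Z(2)) (use that in \<open>simp add: Z_def\<close>)
    then show False using that by simp
   qed
   have "\<eta> <= a" unfolding a_def
   proof (rule cInf_greatest)
    show "Z ~= {}" using Z(1) by blast
    fix u assume u: "u \<in> Z"
    have "u ~= 0" using u ray_0[OF rm] ray_0[OF rp] by (auto simp: Z_def)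
    then show "\<eta> <= u" using u eta(2)[of u] by (cases "u < \<eta>") (auto simp: Z_def)
   qed
   then have a0: "0 < a" using eta by simp
   have ci: "continuous (at_left a) rm" "continuous (at_left a) rp"
    using rayD(8)[OF rm] rayD(8)[OF rp] by (auto simp: continuous_on_eq_continuous_at continuous_at_imp_continuous_at_within)
   have "(rp \<longlongrightarrow> rm a) (at_left a)"
   proof (rule Lim_transform_eventually)
    show "(rm \<longlongrightarrow> rm a) (at_left a)" using ci(1) by (simp add: continuous_within)
    show "\<forall>\<^sub>F u in at_left a. rm u = rp u"
     unfolding eventually_at_left_field using a0 lt by (intro exI[of _ 0]) auto
   qed
   moreover have "(rp \<longlongrightarrow> rp a) (at_left a)" using ci(2) by (simp add: continuous_within)
   ultimately have ea: "rm a = rp a" by (rule tendsto_unique[OF trivial_limit_at_left_real])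
   define p where "p = rm a"
   have pc: "p \<notin> c ` {1..N}" unfolding p_def by (rule nohit[OF a0 ea])
   have fin: "finite (c ` {1..N})" by simp
   obtain q0 where q0: "0 < q0" "!!x. x \<in> c ` {1..N} ==> x ~= p ==> q0 <= dist p x"
    using finite_set_avoid[OF fin, of p] by metis
   define q where "q = q0 / 2"
   have q: "0 < q" using q0 by (simp add: q_def)
   have nq: "q <= norm (x - c k) & norm (x - c k) <= q + norm p + C0" if x: "dist x p < q" and k: "k \<in> {1..N}" for x k
   proof
    have "c k ~= p" using pc k by blast
    then have "2 * q <= norm (p - c k)" using q0(2)[OF imageI[OF k]] by (simp add: q_def dist_norm)
    moreover have "norm (p - c k) <= norm (x - c k) + norm (x - p)"
     using norm_triangle_ineq4[of "x - c k" "x - p"] by simp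
    ultimately show "q <= norm (x - c k)" using x by (simp add: dist_norm)
    show "norm (x - c k) <= q + norm p + C0"
     using norm_triangle_ineq4[of x "c k"] norm_triangle_sub[of x p] c_le[OF k] x by (simp add: dist_norm)
   qed
   define L where "L = M * (q powr (- \<alpha> - 2) + (\<alpha> + 2) * q powr (- \<alpha> - 3) * (q + norm p + C0))"
   have D0: "0 <= q + norm p + C0" using q C00 by simp
   have L0: "0 <= L" using M0 al D0 by (simp add: L_def)
   have "\<exists>d>0. \<forall>t. dist t a < d --> dist (rm t) (rm a) < q" "\<exists>d>0. \<forall>t. dist t a < d --> dist (rp t) (rp a) < q"
    by (rule cont_dist[OF rayD(8)[OF rm] q], rule cont_dist[OF rayD(8)[OF rp] q])
   then obtain d1 d2 where d: "0 < d1" "!!t. dist t a < d1 ==> dist (rm t) p < q" "0 < d2" "!!t. dist t a < d2 ==> dist (rp t) p < q"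
    unfolding p_def using ea by auto
   define e' where "e' = min (min (d1 / 2) (d2 / 2)) (1 / (2 * (L + 1)))"
   have e': "0 < e'" "e' < d1" "e' < d2" "e' <= 1 / (2 * (L + 1))" using d L0 by (auto simp: e'_def)
   \<comment> \<open>This is the smallness condition of \<open>ode_unique\<close>.\<close>
   have ee: "L * e'^2 <= 1 / 2"
   proof -
    have "(L + 1) * e' <= 1 / 2" using e'(4) L0 by (simp add: field_simps)
    moreover have "L * e' + e' = (L + 1) * e'" by (simp add: distrib_right)
    moreover have "0 <= L * e'" using L0 e' by simp
    ultimately have 1: "L * e' <= 1 / 2" "e' <= 1" using e' by linarith+
    have "(L * e') * e' <= (1 / 2) * 1" using 1 e' L0 by (intro mult_mono) auto
    then show ?thesis by (simp add: power2_eq_square mult.assoc)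
   qed
   have nr: "dist (rm t) p < q" "dist (rp t) p < q" "0 < t" if "t \<in> {a..a + e'}" for t
    using d(2)[of t] d(4)[of t] that e' a0 by (auto simp: dist_real_def)
   have off: "rm t \<notin> c ` {1..N}" "rp t \<notin> c ` {1..N}" if t: "t \<in> {a..a + e'}" for t
    using nq[OF nr(1)[OF t]] nq[OF nr(2)[OF t]] q by force+
   let ?Vm = "%t. vector_derivative rm (at t)" and ?Vp = "%t. vector_derivative rp (at t)"
   have aI: "a \<in> {a..a + e'}" using e' by simp
   have Va: "?Vm a = ?Vp a"
   proof -
    have "(rm hvd ?Vm a) (at a within {0..a})"
     by (rule has_vector_derivative_at_within[OF ray_limit(2)[OF rm a0 off(1)[OF aI]]])
    moreover have "(rm hvd ?Vp a) (at a within {0..a})"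
    proof (rule has_vector_derivative_transform[of _ _ _ rp])
     show "(rp hvd ?Vp a) (at a within {0..a})"
      by (rule has_vector_derivative_at_within[OF ray_limit(2)[OF rp a0 off(2)[OF aI]]])
     show "rm u = rp u" if "u \<in> {0..a}" for u using lt[of u] ea that by (cases "u = a") auto
    qed (use a0 in auto)
    ultimately show ?thesis
     using vector_derivative_unique_within_closed_interval[of 0 a a rm] a0 by simp
   qed
   have ext: "rm t = rp t" if t: "t \<in> {a..a + e'}" for t
   proof (rule ode_unique[where F="Fd 0" and ?Y1.0=rm and ?Y2.0=rp and ?V1.0="?Vm" and ?V2.0="?Vp", OF e'(1) ee L0 _ _ _ ea Va t])
    fix t assume t: "t \<in> {a..a + e'}"
    show "(rm hvd ?Vm t) (at t) & (?Vm hvd Fd 0 (rm t)) (at t)"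
     using ray_limit(2,3)[OF rm nr(3)[OF t] off(1)[OF t]] by (rule conjI)
    show "(rp hvd ?Vp t) (at t) & (?Vp hvd Fd 0 (rp t)) (at t)"
     using ray_limit(2,3)[OF rp nr(3)[OF t] off(2)[OF t]] by (rule conjI)
    show "norm (Fd 0 (rm t) - Fd 0 (rp t)) <= L * norm (rm t - rp t)"
     unfolding Fd0 L_def
     by (rule Fpart_lipschitz[OF order_refl q]) (use nq[OF nr(1)[OF t]] nq[OF nr(2)[OF t]] D0 in auto)
   qed
   have "a + e' <= a" unfolding a_def
   proof (rule cInf_greatest)
    show "Z ~= {}" using Z(1) by blast
    fix u assume u: "u \<in> Z"
    then have "\<not> u < a" "u \<notin> {a..a + e'}" using lt ext by (auto simp: Z_def)
    then show "Inf Z + e' <= u" by (auto simp: a_def)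
   qed
   then show False using e' by simp
  qed
  have "((%t. rm t /\<^sub>R norm (rm t)) \<longlongrightarrow> \<xi>p) at_top"
  proof (rule Lim_transform_eventually[OF ray_asymptotics[OF rp i]])
   show "\<forall>\<^sub>F t in at_top. rp t /\<^sub>R norm (rp t) = rm t /\<^sub>R norm (rm t)"
    using eventually_ge_at_top[of "0::real"] by eventually_elim (simp add: all)
  qed
  from tendsto_unique[OF trivial_limit_at_top_linorder this ray_asymptotics[OF rm i]] ne show False by simp
 qed
 then show ?thesis using wm wp by blast
qed

text \<open>Starting from a point near the ray at distance \<open>s\<close> saves the cost of the
  way out of the centre, which the radial calibration bounds below by
  \<open>(mu i / \<kappa>) * s powr \<kappa>\<close>. Missing the ray by \<open>b\<close> costs at
  most \<open>modu b\<close>.\<close>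

lemma ray_gain:
 assumes ray: "ray_seq \<delta> R \<xi> i T y v r" and i: "i \<in> {1..N}" and t: "0 <= t" and s: "norm (r t - c i) = s"
  and p: "norm (r t - p) <= b" and e: "0 < e"
 shows "\<forall>\<^sub>F n in sequentially. jac (Gd (\<delta> n)) p (R n *\<^sub>R \<xi>) + (mu i / \<kappa>) * s powr \<kappa> <= jac (Gd (\<delta> n)) (c i) (R n *\<^sub>R \<xi>) + modu b + e"
proof -
 have b0: "0 <= b" using p norm_ge_zero order_trans by blast
 have s0: "0 <= s" using s by auto
 obtain l where l: "modu (b + l) < modu b + e / 2" "0 < l" using modu_right[OF b0 half_gt_zero[OF e]] by blast
 have p': "norm (r t - p) < b + l" using p l by linarith
 let ?f = "%n. (mu i / \<kappa>) * (((norm (y n t - c i))^2 + (\<delta> n)^2) powr (\<kappa> / 2) - ((norm (c i - c i))^2 + (\<delta> n)^2) powr (\<kappa> / 2))"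
 have pw: "(%n. (u n) powr (\<kappa> / 2)) ----> z powr (\<kappa> / 2)" if "u ----> z" "!!n. 0 <= u n" for u :: "nat => real" and z
  by (rule tendsto_powr'[OF that(1) tendsto_const]) (simp add: that(2) kap)
 have "?f ----> (mu i / \<kappa>) * (((norm (r t - c i))^2 + 0^2) powr (\<kappa> / 2) - ((norm (c i - c i))^2 + 0^2) powr (\<kappa> / 2))"
  by (intro tendsto_mult tendsto_const tendsto_diff pw tendsto_add tendsto_power tendsto_norm ray_conv[OF ray t] rayD(2)[OF ray]) auto
 moreover have "((norm (r t - c i))^2 + 0^2) powr (\<kappa> / 2) = s powr \<kappa>"
  using s0 by (cases "s = 0") (simp_all add: s powr_powr flip: powr_numeral)
 ultimately have "?f ----> (mu i / \<kappa>) * s powr \<kappa>" by simp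
 then have "\<forall>\<^sub>F n in sequentially. (mu i / \<kappa>) * s powr \<kappa> - e / 2 < ?f n" by (rule order_tendstoD(1)) (use e in simp)
 from this ray_near[OF ray t p'] ray_ev[OF ray, of t] show ?thesis
 proof eventually_elim
  case (elim n)
  have "?f n <= jac (Gd (\<delta> n)) (c i) (y n t)" by (rule jac_radial[OF rayD(1)[OF ray] i])
  then show ?case using ray_cost(1)[OF ray t, of n] elim l b0 by simp
 qed
qed

text \<open>The error is proportional to the radius; only then does its cost scale like the saving
  in \<open>ray_gain\<close>.\<close>

lemma ray_radius:
 assumes ray: "ray_seq \<delta> R \<xi> i T y v r" and e: "0 < e"
  and w: "((%t. (1 / norm (r t - c i)) *\<^sub>R (r t - c i)) \<longlongrightarrow> w) (at_right 0)"
 shows "\<exists>s1>0. \<forall>s\<in>{0<..<s1}. \<exists>t\<ge>0. norm (r t - c i) = s & norm (r t - (c i + s *\<^sub>R w)) <= e * s"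
proof -
 have "\<forall>\<^sub>F t in at_right 0. dist ((1 / norm (r t - c i)) *\<^sub>R (r t - c i)) w < e" by (rule tendstoD[OF w e])
 then obtain d where d: "0 < d" "!!t. 0 < t ==> t < d ==> dist ((1 / norm (r t - c i)) *\<^sub>R (r t - c i)) w < e"
  unfolding eventually_at_right_field by auto
 define t1 where "t1 = d / 2"
 have t1: "0 < t1" "t1 < d" using d by (auto simp: t1_def)
 show ?thesis
 proof (rule exI[of _ "norm (r t1 - c i)"], intro conjI ballI)
  show "0 < norm (r t1 - c i)" using ray_not_start[OF ray t1(1)] by simp
  fix s assume s: "s \<in> {0<..<norm (r t1 - c i)}"
  have "\<exists>t\<ge>0. t <= t1 & norm (r t - c i) = s"
   by (rule IVT'[of "%t. norm (r t - c i)"])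
    (use s t1 ray_0[OF ray] in \<open>auto intro!: continuous_on_norm continuous_on_diff continuous_on_const continuous_on_subset[OF rayD(8)[OF ray]]\<close>)
  then obtain t where t: "0 <= t" "t <= t1" "norm (r t - c i) = s" by blast
  have "t ~= 0" using t s ray_0[OF ray] by auto
  then have "norm ((1 / s) *\<^sub>R (r t - c i) - w) < e" using d(2)[of t] t t1 by (simp add: dist_norm)
  moreover have "r t - (c i + s *\<^sub>R w) = s *\<^sub>R ((1 / s) *\<^sub>R (r t - c i) - w)" using s by (simp add: scaleR_diff_right)
  ultimately have "norm (r t - (c i + s *\<^sub>R w)) <= e * s" using s by simp
  then show "\<exists>t\<ge>0. norm (r t - c i) = s & norm (r t - (c i + s *\<^sub>R w)) <= e * s" using t by blast
 qed
qed

lemma Gd_near: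
 assumes inj: "inj_on c {1..N}" and i: "i \<in> {1..N}"
 shows "\<exists>h\<ge>0. \<exists>q>0. \<forall>\<delta> x. x ~= c i --> norm (x - c i) <= q --> Gd \<delta> x <= h + (mu i)^2 / 2 * norm (x - c i) powr (- \<alpha>)"
proof -
 obtain q where q: "0 < q" "!!j x. j \<in> {1..N} - {i} ==> norm x <= q ==> q <= norm (c i + x - c j)"
  by (rule centres_apart[OF inj i]) (rule that)
 have pl: "((norm z)^2 + \<delta>^2) powr (- (\<alpha> / 2)) <= l powr (- \<alpha>)" if l: "0 < l" "l <= norm z" for l \<delta> and z :: "real ^ 3"
 proof -
  have "l^2 <= (norm z)^2" using l by (intro power_mono) auto
  then have "((norm z)^2 + \<delta>^2) powr (- (\<alpha> / 2)) <= (l^2) powr (- (\<alpha> / 2))"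
   by (intro plummer_le) (use l al in \<open>auto simp: add_increasing2\<close>)
  also have "... = l powr (- \<alpha>)" using l by (simp add: powr_powr flip: powr_numeral)
  finally show ?thesis .
 qed
 define h where "h = H + (\<Sum>j\<in>{1..N} - {i}. m j / \<alpha> * q powr (- \<alpha>))"
 have m: "0 <= m j / \<alpha>" if "j \<in> {1..N}" for j using mpos[OF that] al by simp
 have "0 <= h" unfolding h_def using m H0 by (intro add_nonneg_nonneg sum_nonneg mult_nonneg_nonneg) auto
 moreover have "Gd \<delta> x <= h + (mu i)^2 / 2 * norm (x - c i) powr (- \<alpha>)" if x: "x ~= c i" "norm (x - c i) <= q" for \<delta> x
 proof -
  have "m i / \<alpha> * ((norm (x - c i))^2 + \<delta>^2) powr (- (\<alpha> / 2)) <= m i / \<alpha> * norm (x - c i) powr (- \<alpha>)"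
   by (intro mult_left_mono pl m i) (use x in auto)
  moreover have "(mu i)^2 / 2 = m i / \<alpha>" using mpos[OF i] al by (simp add: mu_def)
  moreover have "(\<Sum>j\<in>{1..N} - {i}. m j / \<alpha> * ((norm (x - c j))^2 + \<delta>^2) powr (- (\<alpha> / 2))) <= (\<Sum>j\<in>{1..N} - {i}. m j / \<alpha> * q powr (- \<alpha>))"
  proof (rule sum_mono, rule mult_left_mono[OF pl[OF q(1)]])
   fix j assume j: "j \<in> {1..N} - {i}"
   show "q <= norm (x - c j)" using q(2)[OF j x(2)] by simp
   show "0 <= m j / \<alpha>" using m j by simp
  qed
  ultimately show ?thesis unfolding Gd_def Vd_def h_def by (subst sum.remove[OF _ i]) simp_all
 qed
 ultimately show ?thesis using q(1) by blast
qed

definition pass where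
 "pass \<delta> a b l u T y v \<longleftrightarrow> orb \<delta> T y v & 0 < T & y 0 = a & y T = b & l <= act v 0 T & act v 0 T <= u"

text \<open>In units of \<open>s powr \<kappa>\<close> the two rays save \<open>2 * A\<close> and
  the arcs cost \<open>2 * A * Y\<close> to leading order. The surplus \<open>A * (1 - Y)\<close> on
  each side is divided in thirds: one for the regular part of the potential, one for the deviation
  of the rays from their initial directions, one as net gain.\<close>

theorem level_drop:
 assumes inj: "inj_on c {1..N}" and i: "i \<in> {1..N}"
  and rm: "ray_seq \<delta> R \<xi>m i Tm ym vm rm" and rp: "ray_seq \<delta> R \<xi>p i Tp yp vp rp" and ne: "\<xi>m ~= \<xi>p"
  and min: "!!n k. k \<in> {1..N} ==> jac (Gd (\<delta> n)) (c i) (R n *\<^sub>R \<xi>m) + jac (Gd (\<delta> n)) (c i) (R n *\<^sub>R \<xi>p)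
   <= jac (Gd (\<delta> n)) (c k) (R n *\<^sub>R \<xi>m) + jac (Gd (\<delta> n)) (c k) (R n *\<^sub>R \<xi>p)"
  and Rp: "!!n. 0 < R n" and e: "\<xi>p ~= - \<xi>m"
 shows "\<exists>\<eta>>0. \<forall>\<^sub>F n in sequentially. \<exists>T y v. pass (\<delta> n) (R n *\<^sub>R \<xi>m) (R n *\<^sub>R \<xi>p)
  (sqrt (2 * H) * (2 * R n - 2 * norm (c i)))
  (jac (Gd (\<delta> n)) (c i) (R n *\<^sub>R \<xi>m) + jac (Gd (\<delta> n)) (c i) (R n *\<^sub>R \<xi>p) - \<eta>) T y v"
proof -
 obtain wm wp where w: "norm wm = 1" "norm wp = 1" "wm ~= wp"
  "((%t. (1 / norm (rm t - c i)) *\<^sub>R (rm t - c i)) \<longlongrightarrow> wm) (at_right 0)"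
  "((%t. (1 / norm (rp t - c i)) *\<^sub>R (rp t - c i)) \<longlongrightarrow> wp) (at_right 0)"
  using ray_directions[OF inj i rm rp ne min] by blast
 obtain h q where h: "0 <= h" "0 < q" "!!\<delta> x. x ~= c i ==> norm (x - c i) <= q ==> Gd \<delta> x <= h + (mu i)^2 / 2 * norm (x - c i) powr (- \<alpha>)"
  using Gd_near[OF inj i] by blast
 have mu0: "0 < mu i" using mpos[OF i] al by (simp add: mu_def)
 have ar: "arcs \<alpha> (mu i) s wm wp" if "0 < s" for s using that al mu0 w by (simp add: arcs_def)
 \<comment> \<open>The constant depends only on the two directions and not on the radius, so the
   radius may be chosen afterwards.\<close>
 define Y where "Y = arcs.Y0 \<alpha> wm wp"
 have Y: "0 < Y" "Y < 1" using arcs.CY(2,3)[OF ar, of 1] by (auto simp: Y_def)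
 define A where "A = mu i / \<kappa>"
 have A: "0 < A" using mu0 kap by (simp add: A_def)
 have AY: "0 < A * (1 - Y)" using A Y by simp
 obtain \<epsilon> where eps: "modu \<epsilon> < A * (1 - Y) / 3" "0 < \<epsilon>" using modu_small[of "A * (1 - Y) / 3"] AY by auto
 obtain sm where sm: "0 < sm" "!!s. s \<in> {0<..<sm} ==> \<exists>t\<ge>0. norm (rm t - c i) = s & norm (rm t - (c i + s *\<^sub>R wm)) <= \<epsilon> * s"
  using ray_radius[OF rm eps(2) w(4)] by blast
 obtain sp where sp: "0 < sp" "!!s. s \<in> {0<..<sp} ==> \<exists>t\<ge>0. norm (rp t - c i) = s & norm (rp t - (c i + s *\<^sub>R wp)) <= \<epsilon> * s"
  using ray_radius[OF rp eps(2) w(5)] by blast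
 define hY where "hY = h * Y / (\<kappa> * mu i)"
 have hY: "0 <= hY" using h Y kap mu0 by (simp add: hY_def)
 \<comment> \<open>The last cap absorbs the higher order term \<open>hY * s powr \<alpha>\<close> of
   \<open>cost\<close> into the first third; \<open>s <= 1\<close> allows
   \<open>s powr \<alpha> <= s\<close> and \<open>s <= s powr \<kappa>\<close>.\<close>
 define s where "s = min (min (min (sm / 2) (sp / 2)) (min q 1)) (A * (1 - Y) / (3 * (hY + 1)))"
 have s: "0 < s" "s < sm" "s < sp" "s <= q" "s <= 1" "s <= A * (1 - Y) / (3 * (hY + 1))"
  using sm sp h AY hY by (auto simp: s_def)
 obtain tm where tm: "0 <= tm" "norm (rm tm - c i) = s" "norm (rm tm - (c i + s *\<^sub>R wm)) <= \<epsilon> * s" using sm(2)[of s] s by auto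
 obtain tp where tp: "0 <= tp" "norm (rp tp - c i) = s" "norm (rp tp - (c i + s *\<^sub>R wp)) <= \<epsilon> * s" using sp(2)[of s] s by auto
 interpret ar: arcs \<alpha> "mu i" s "c i" wm wp using s by (simp add: arcs_def al mu0 w)
 have ark: "ar.\<kappa> = \<kappa>" by (simp add: ar.\<kappa>_def \<kappa>_def)
 have cost: "ar.cost h <= s powr \<kappa> * (A * Y + A * (1 - Y) / 3)"
 proof -
  have "s powr \<alpha> <= s powr 1" using s al by (intro powr_mono') auto
  then have "hY * s powr \<alpha> <= hY * s" using hY s by (intro mult_left_mono) auto
  also have "... <= (hY + 1) * s" using s by (intro mult_right_mono) auto
  also have "... <= A * (1 - Y) / 3" using s(6) hY by (simp add: field_simps)
  finally have "s powr \<kappa> * (A * Y + hY * s powr \<alpha>) <= s powr \<kappa> * (A * Y + A * (1 - Y) / 3)" by (intro mult_left_mono) auto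
  moreover have "ar.cost h = s powr \<kappa> * (A * Y + hY * s powr \<alpha>)"
   unfolding ar.cost_def ark A_def hY_def Y_def by (simp add: algebra_simps)
  ultimately show ?thesis by simp
 qed
 have mo: "modu (\<epsilon> * s) < s powr \<kappa> * (A * (1 - Y) / 3)"
 proof -
  have "s <= s powr \<kappa>" using powr_mono'[of \<kappa> 1 s] s kap by simp
  then have "sqrt (2 * H) * (\<epsilon> * s) <= s powr \<kappa> * (sqrt (2 * H) * \<epsilon>)" using eps H0 by (simp add: mult.commute mult.left_commute mult_left_mono)
  then have "modu (\<epsilon> * s) <= s powr \<kappa> * modu \<epsilon>"
   using eps s by (simp add: modu_def powr_mult distrib_left mult_ac)
  also have "... < s powr \<kappa> * (A * (1 - Y) / 3)" using eps(1) s by (intro mult_strict_left_mono) auto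
  finally show ?thesis .
 qed
 \<comment> \<open>What remains of one third of the surplus. Half of it is taken as
   \<open>\<eta>'\<close>, since three such amounts are spent: two error terms in
   \<open>ray_gain\<close> and the drop itself.\<close>
 define \<gamma> where "\<gamma> = s powr \<kappa> * (A * (1 - Y) / 3) - modu (\<epsilon> * s)"
 have g: "0 < \<gamma>" using mo by (simp add: \<gamma>_def)
 define \<eta>' where "\<eta>' = \<gamma> / 2"
 have eta': "0 < \<eta>'" using g by (simp add: \<eta>'_def)
 let ?M = "%n. jac (Gd (\<delta> n)) (c i) (R n *\<^sub>R \<xi>m) + jac (Gd (\<delta> n)) (c i) (R n *\<^sub>R \<xi>p) - \<eta>'"
 show ?thesis
 proof (intro exI[of _ \<eta>'] conjI eta')
  show "\<forall>\<^sub>F n in sequentially. \<exists>T y v. pass (\<delta> n) (R n *\<^sub>R \<xi>m) (R n *\<^sub>R \<xi>p)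
  (sqrt (2 * H) * (2 * R n - 2 * norm (c i))) (?M n) T y v"
   using ray_gain[OF rm i tm eta'] ray_gain[OF rp i tp eta']
  proof eventually_elim
   case (elim n)
   have d: "\<delta> n ~= 0" by (rule rayD(1)[OF rm])
   let ?a = "R n *\<^sub>R \<xi>m" and ?b = "R n *\<^sub>R \<xi>p" and ?G = "Gd (\<delta> n)"
   obtain \<Lambda> \<Gamma> B where so: "soft (Gd (\<delta> n)) (Fd (\<delta> n)) H \<Lambda> \<Gamma> B" using soft_Gd[OF d] by blast
   have ab: "?a ~= ?b" using ne Rp[of n] by simp
   have av: "X t ~= c i" if X: "C1 X D" "X 0 = ?a" "X 1 = ?b" "jlen ?G X D <= ?M n" "t \<in> {0..1}" for X D t
   proof
    assume "X t = c i"
    then have "jac ?G ?a (c i) + jac ?G (c i) ?b <= jlen ?G X D"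
     using soft.jac_split[OF so X(1) _ X(5)] X ab by simp
    then show False using X(4) jac_sy[OF d, of ?a "c i"] eta' by simp
   qed
   have Gle: "Gd (\<delta> n) x <= h + (mu i)^2 / 2 * norm (x - c i) powr (- \<alpha>)" if "x ~= c i" "norm (x - c i) <= s" for x
    using h(3)[OF that(1)] that(2) s by simp
   have lt: "jac ?G ?a (c i + s *\<^sub>R wm) + jac ?G (c i + s *\<^sub>R wp) ?b + 2 * ar.cost h < ?M n"
   proof -
    have "2 * (s powr \<kappa> * (A * Y + A * (1 - Y) / 3)) + 2 * modu (\<epsilon> * s) + 3 * \<eta>' < 2 * (A * s powr \<kappa>)"
    proof -
     have "s powr \<kappa> * (A * Y + A * (1 - Y) / 3) = A * s powr \<kappa> - 2 * (s powr \<kappa> * (A * (1 - Y) / 3))"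
      by (simp add: field_simps)
     moreover have "0 < s powr \<kappa> * (A * (1 - Y) / 3)" using AY s by simp
     moreover have "2 * x + 2 * u + 3 * ((p - u) / 2) < 2 * z" if "x = z - 2 * p" "0 < p" "0 < p - u" for x u p z :: real
      using that by (simp add: field_simps)
     ultimately show ?thesis using g unfolding \<eta>'_def \<gamma>_def by (simp only:)
    qed
    then show ?thesis using elim cost jac_sy[OF d, of ?a "c i + s *\<^sub>R wm"] by (simp add: A_def)
   qed
   have "\<exists>X D. fam (circ ar.E) X D & (\<forall>v\<in>circ ar.E. X v 0 = ?a & X v 1 = ?b & jlen ?G (X v) (D v) <= ?M n) & ess ar.E (c i) X"
    by (rule ar.gain[OF so h(1) _ lt]) (erule (1) Gle, erule (4) av)
   then obtain X D where X: "fam (circ ar.E) X D" "!!v. v \<in> circ ar.E ==> X v 0 = ?a & X v 1 = ?b & jlen ?G (X v) (D v) <= ?M n" "ess ar.E (c i) X"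
    by blast
   have e0: "\<xi>m + \<xi>p ~= 0" using e by (metis add.commute eq_neg_iff_add_eq_0)
   have n1: "norm \<xi>m = 1" "norm \<xi>p = 1" using rayD(5)[OF rm] rayD(5)[OF rp] by auto
   \<comment> \<open>The barrier ray points away from both ends: \<open>\<xi>m\<close> and
     \<open>\<xi>p\<close> make no obtuse angle with their sum, so moving along the ray only
     increases the distance to either end.\<close>
   have far1: "R n - norm (c i) <= norm (R n *\<^sub>R \<xi> - (c i - u *\<^sub>R (\<xi>m + \<xi>p)))"
    if u: "0 <= u" and x: "norm \<xi> = 1" "0 <= \<xi> \<bullet> (\<xi>m + \<xi>p)" for u \<xi>
   proof -
    have "(R n)^2 <= (norm (R n *\<^sub>R \<xi> + u *\<^sub>R (\<xi>m + \<xi>p)))^2"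
    proof -
     have "(norm (R n *\<^sub>R \<xi> + u *\<^sub>R (\<xi>m + \<xi>p)))^2 = (norm (R n *\<^sub>R \<xi>))^2 + (norm (u *\<^sub>R (\<xi>m + \<xi>p)))^2 + 2 * (R n * u * (\<xi> \<bullet> (\<xi>m + \<xi>p)))"
     proof -
      have "(norm (x + z))^2 = (norm x)^2 + (norm z)^2 + 2 * (x \<bullet> z)" for x z :: "real ^ 3"
       using dot_norm[of x z] by simp
      then show ?thesis by (simp only: inner_scaleR_left inner_scaleR_right mult.assoc mult.left_commute)
     qed
     moreover have "0 <= R n * u * (\<xi> \<bullet> (\<xi>m + \<xi>p))" using u x Rp[of n] by simp
     moreover have "(norm (R n *\<^sub>R \<xi>))^2 = (R n)^2" using x by simp
     ultimately show ?thesis using zero_le_power2[of "norm (u *\<^sub>R (\<xi>m + \<xi>p))"] by linarith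
    qed
    then have "R n <= norm (R n *\<^sub>R \<xi> + u *\<^sub>R (\<xi>m + \<xi>p))" by (rule power2_le_imp_le) simp
    moreover have "norm (R n *\<^sub>R \<xi> + u *\<^sub>R (\<xi>m + \<xi>p)) - norm (c i) <= norm (R n *\<^sub>R \<xi> + u *\<^sub>R (\<xi>m + \<xi>p) - c i)" by (rule norm_triangle_ineq2)
    moreover have eq: "R n *\<^sub>R \<xi> - (c i - u *\<^sub>R (\<xi>m + \<xi>p)) = R n *\<^sub>R \<xi> + u *\<^sub>R (\<xi>m + \<xi>p) - c i" by simp
    ultimately show ?thesis unfolding eq by linarith
   qed
   have ip: "0 <= \<xi>m \<bullet> (\<xi>m + \<xi>p)" "0 <= \<xi>p \<bullet> (\<xi>m + \<xi>p)"
    using Cauchy_Schwarz_ineq2[of \<xi>m \<xi>p] n1 by (auto simp: inner_add_right dot_square_norm inner_commute abs_le_iff)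
   have lb: "sqrt (2 * H) * (2 * R n - 2 * norm (c i)) <= jac ?G ?a (c i - u *\<^sub>R (\<xi>m + \<xi>p)) + jac ?G (c i - u *\<^sub>R (\<xi>m + \<xi>p)) ?b" if u: "0 <= u" for u
   proof -
    have "sqrt (2 * H) * (R n - norm (c i)) <= jac ?G (c i - u *\<^sub>R (\<xi>m + \<xi>p)) ?a" "sqrt (2 * H) * (R n - norm (c i)) <= jac ?G (c i - u *\<^sub>R (\<xi>m + \<xi>p)) ?b"
     by (rule order_trans[OF mult_left_mono[OF far1[OF u]] jac_length[OF d]]; use n1 ip H0 in simp)+
    then show ?thesis using jac_sy[OF d, of ?a "c i - u *\<^sub>R (\<xi>m + \<xi>p)"] by (simp add: algebra_simps)
   qed
   have "\<exists>T>0. \<exists>y v. soft.orbit ?G (Fd (\<delta> n)) T y v & y 0 = ?a & y T = ?b &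
    sqrt (2 * H) * (2 * R n - 2 * norm (c i)) <= integral {0..T} (%t. (norm (v t))^2) & integral {0..T} (%t. (norm (v t))^2) <= ?M n"
    by (rule loop_orbit[OF so ar.wE(3) ab _ X e0 lb]) (erule (4) av)
   then show ?case unfolding pass_def act_def orb_orbit[OF d] by blast
  qed
 qed
qed

end

section \<open>Confinement, compactness and the scattering solution\<close>

context ncentre
begin

lemma orb_shift:
 assumes o: "orb \<delta> T y v" and s: "0 <= s" shows "orb \<delta> (T - s) (%t. y (t + s)) (%t. v (t + s))"
proof -
 have ch: "((%t. f (t + s)) hvd f') (at t within {0..T - s})"
  if "(f hvd f') (at (t + s) within {0..T})" for f :: "real => real ^ 3" and f' t
 proof -
  have "((%t. t + s) hvd 1) (at t within {0..T - s})" by (auto intro!: derivative_eq_intros)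
  moreover have "(f hvd f') (at (t + s) within (%t. t + s) ` {0..T - s})"
   by (rule has_vector_derivative_within_subset[OF that]) (use s in auto)
  ultimately show ?thesis
   using vector_diff_chain_within[of "%t. t + s" "1" t "{0..T - s}" f f'] by (simp add: o_def)
 qed
 show ?thesis
  unfolding orb_def solves_def
 proof (intro conjI ballI)
  fix t assume "t \<in> {0..T - s}"
  then have t: "t + s \<in> {0..T}" using s by auto
  show "((%t. y (t + s)) hvd v (t + s)) (at t within {0..T - s})" by (rule ch[OF orb_der(1)[OF o t]])
  show "((%t. v (t + s)) hvd Fd \<delta> (y (t + s))) (at t within {0..T - s})" by (rule ch[OF orb_der(2)[OF o t]])
  show "(norm (v (t + s)))^2 / 2 = Gd \<delta> (y (t + s))" using o t by (simp add: orb_def)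
 qed
qed

text \<open>From the point of closest approach the orbit escapes in both time directions, so its
  squared distance is at least \<open>\<rho>^2 + H * (s - a)^2\<close>. The force is then integrable
  over the whole orbit, with a total that is small for large \<open>\<rho>\<close>.\<close>

lemma outside_velocity:
 assumes o: "orb \<delta> T y v" and T: "0 < T" and \<rho>: "\<rho>1 <= \<rho>" and out: "!!t. t \<in> {0..T} ==> \<rho> <= norm (y t)"
  and st: "t \<in> {0..T}"
 shows "norm (v t - v 0) <= 4 * M / (\<rho> * sqrt H) * pi"
proof -
 have c: "continuous_on {0..T} (%t. norm (y t))" by (intro continuous_on_norm orb_cont(1)[OF o])
 have "{0..T} ~= {}" using T by simp
 from continuous_attains_inf[OF compact_Icc this c] obtain a where a: "a \<in> {0..T}" "!!s. s \<in> {0..T} ==> norm (y a) <= norm (y s)" by blast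
 have \<rho>0: "0 < \<rho>" using \<rho> rho1 by linarith
 have ra: "\<rho>1 <= norm (y a)" using out[OF a(1)] \<rho> by linarith
 have grow: "\<rho>^2 + H * (s - a)^2 <= (norm (y s))^2" if s: "s \<in> {0..T}" for s
 proof -
  have ya: "\<rho>^2 <= (norm (y a))^2" using out[OF a(1)] \<rho>0 by (intro power_mono) auto
  consider "s = a" | "a < s" | "s < a" by linarith
  then have "(norm (y a))^2 + H * (s - a)^2 <= (norm (y s))^2"
  proof cases
   case 2
   have "0 <= y a \<bullet> v a" by (rule outward[OF o]) (use a 2 s in auto)
   then show ?thesis using escape(2)[OF o, of a s] a(1) 2 s ra by auto
  next
   case 3
   note orv = orb_reverse[OF o]
   have "0 <= y (T - (T - a)) \<bullet> - v (T - (T - a))"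
    by (rule outward[OF orv]) (use a 3 s in auto)
   then show ?thesis using escape(2)[OF orv, of "T - a" "T - s"] a(1) 3 s ra by (auto simp: power2_commute)
  qed simp
  then show ?thesis using ya by linarith
 qed
 \<comment> \<open>The arctangent is the primitive of the bound on the force; its total variation is
   below pi.\<close>
 let ?K = "4 * M / (\<rho> * sqrt H)"
 let ?\<phi> = "%s. ?K * arctan (sqrt H * (s - a) / \<rho>)"
 have "norm (v t - v 0) <= ?\<phi> t - ?\<phi> 0"
 proof (rule derivative_bound[where f'="%s. Fd \<delta> (y s)" and \<phi>="?\<phi>" and \<phi>'="%s. 4 * M / (\<rho>^2 + H * (s - a)^2)"])
  fix s assume "s \<in> {0..t}"
  then have s: "s \<in> {0..T}" "{0..t} \<subseteq> {0..T}" using st by auto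
  show "(v hvd Fd \<delta> (y s)) (at s within {0..t})"
   by (rule has_vector_derivative_within_subset[OF orb_der(2)[OF o s(1)] s(2)])
  let ?x = "sqrt H * (s - a) / \<rho>"
  have "((%s. sqrt H * (s - a) / \<rho>) hrd sqrt H / \<rho>) (at s within {0..t})"
   by (auto intro!: derivative_eq_intros) (use \<rho>0 in simp)
  from DERIV_cmult[OF DERIV_chain2[where f=arctan, OF DERIV_arctan this], of ?K]
  have "(?\<phi> hrd ?K * (inverse (1 + ?x^2) * (sqrt H / \<rho>))) (at s within {0..t})" .
  moreover have "?K * (inverse (1 + ?x^2) * (sqrt H / \<rho>)) = 4 * M / (\<rho>^2 + H * (s - a)^2)"
  proof -
   have "?x^2 = H * (s - a)^2 / \<rho>^2" using H0 by (simp add: power_divide power_mult_distrib)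
   then have "\<rho>^2 * (1 + ?x^2) = \<rho>^2 + H * (s - a)^2" using \<rho>0 by (simp add: distrib_left)
   moreover have "?K * (inverse (1 + ?x^2) * (sqrt H / \<rho>)) = 4 * M / (\<rho>^2 * (1 + ?x^2))"
    using H0 \<rho>0 by (simp add: divide_simps power2_eq_square)
   ultimately show ?thesis by simp
  qed
  ultimately show "(?\<phi> hrd 4 * M / (\<rho>^2 + H * (s - a)^2)) (at s within {0..t})" by simp
  have "\<rho>1 <= norm (y s)" using out[OF s(1)] \<rho> by linarith
  then have "norm (Fd \<delta> (y s)) <= 4 * M / (norm (y s))^2" by (rule far(1))
  also have "... <= 4 * M / (\<rho>^2 + H * (s - a)^2)"
  proof (rule divide_left_mono[OF grow[OF s(1)]])
   have "0 < \<rho>^2 + H * (s - a)^2" using \<rho>0 H0 by (intro add_pos_nonneg) auto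
   then show "0 < (norm (y s))^2 * (\<rho>^2 + H * (s - a)^2)" using grow[OF s(1)] by (intro mult_pos_pos) auto
  qed (use M0 in simp)
  finally show "norm (Fd \<delta> (y s)) <= 4 * M / (\<rho>^2 + H * (s - a)^2)" .
 qed (use st in auto)
 also have "... = ?K * (arctan (sqrt H * (t - a) / \<rho>) - arctan (sqrt H * (0 - a) / \<rho>))" by (simp only: right_diff_distrib)
 also have "... <= ?K * pi"
 proof (rule mult_left_mono)
  show "arctan (sqrt H * (t - a) / \<rho>) - arctan (sqrt H * (0 - a) / \<rho>) <= pi"
   using arctan_ubound[of "sqrt H * (t - a) / \<rho>"] arctan_lbound[of "sqrt H * (0 - a) / \<rho>"] by simp
  show "0 <= ?K" using M0 H0 \<rho>0 by simp
 qed
 finally show ?thesis .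
qed

text \<open>An orbit that stays outside a large ball is almost straight with speed close to
  \<open>q\<close>, so it costs about \<open>q * R * \<zeta>\<close>. As \<open>\<zeta> < 2\<close>
  for directions that are not opposite, this contradicts the lower bound
  \<open>q * (2 * R - 2 * C0)\<close>.\<close>

lemma enters_ball:
 assumes x: "norm \<xi>m = 1" "norm \<xi>p = 1" "\<xi>p ~= - \<xi>m"
 shows "\<exists>\<rho> R0. \<rho>1 <= \<rho> & (\<forall>\<delta> T y v R. \<delta> ~= 0 --> orb \<delta> T y v --> 0 < T --> y 0 = R *\<^sub>R \<xi>m --> y T = R *\<^sub>R \<xi>p -->
  sqrt (2 * H) * (2 * R - 2 * C0) <= act v 0 T --> R0 < R --> (\<exists>t\<in>{0..T}. norm (y t) <= \<rho>))"
proof -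
 define \<zeta> where "\<zeta> = norm (\<xi>p - \<xi>m)"
 have z: "0 <= \<zeta>" "\<zeta> < 2"
 proof -
  have "norm (\<xi>p + - \<xi>m) ~= norm \<xi>p + norm (- \<xi>m)"
  proof
   assume "norm (\<xi>p + - \<xi>m) = norm \<xi>p + norm (- \<xi>m)"
   then have "norm \<xi>p *\<^sub>R - \<xi>m = norm (- \<xi>m) *\<^sub>R \<xi>p" by (simp only: norm_triangle_eq)
   then show False using x by simp
  qed
  then show "\<zeta> < 2" using norm_triangle_ineq4[of \<xi>p \<xi>m] x unfolding \<zeta>_def by simp
 qed (simp add: \<zeta>_def)
 define q where "q = sqrt (2 * H)"
 have q: "0 < q" "q * q = 2 * H" using H0 by (auto simp: q_def)
 let ?e = "%\<rho>. (4 * M * pi / sqrt H) / \<rho>" and ?b = "%\<rho>. (4 * M) / \<rho>"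
 have t0: "((%\<rho>. k / \<rho>) \<longlongrightarrow> 0) at_top" for k :: real
  by (rule real_tendsto_divide_at_top[OF tendsto_const filterlim_ident])
 \<comment> \<open>The factor \<open>1 + \<zeta> / 2\<close> is the mean of \<open>\<zeta>\<close>
   and 2; half of the gap pays for the error terms in \<open>\<rho>\<close>, the other half for
   \<open>C0\<close>.\<close>
 have "((%\<rho>. \<zeta> * (q * q + ?b \<rho>) - q * (1 + \<zeta> / 2) * (q - ?e \<rho>)) \<longlongrightarrow> \<zeta> * (q * q + 0) - q * (1 + \<zeta> / 2) * (q - 0)) at_top"
  by (intro tendsto_diff tendsto_mult tendsto_add tendsto_const t0)
 moreover have "\<zeta> * (q * q + 0) - q * (1 + \<zeta> / 2) * (q - 0) < 0"
 proof -
  have "(q * q) * (\<zeta> / 2 - 1) < 0" using q z H0 by (intro mult_pos_neg) auto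
  then show ?thesis by (simp add: algebra_simps)
 qed
 ultimately have e1: "\<forall>\<^sub>F \<rho> in at_top. \<zeta> * (q * q + ?b \<rho>) - q * (1 + \<zeta> / 2) * (q - ?e \<rho>) < 0" by (rule order_tendstoD(2))
 have e2: "\<forall>\<^sub>F \<rho> in at_top. ?e \<rho> < q" by (rule order_tendstoD(2)[OF t0 q(1)])
 have "\<forall>\<^sub>F \<rho> in at_top. \<zeta> * (q * q + ?b \<rho>) - q * (1 + \<zeta> / 2) * (q - ?e \<rho>) < 0 & ?e \<rho> < q & \<rho>1 <= \<rho>"
  by (intro eventually_conj e1 e2 eventually_ge_at_top)
 then obtain \<rho> where \<rho>: "\<zeta> * (q * q + ?b \<rho>) < q * (1 + \<zeta> / 2) * (q - ?e \<rho>)" "?e \<rho> < q" "\<rho>1 <= \<rho>"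
  using eventually_happens'[OF trivial_limit_at_top_linorder] by force
 have \<rho>0: "0 < \<rho>" using \<rho>(3) rho1 by linarith
 \<comment> \<open>From this value on, \<open>2 * R - 2 * C0\<close> is at least
   \<open>R * (1 + \<zeta> / 2)\<close>.\<close>
 define R0 where "R0 = 4 * C0 / (2 - \<zeta>)"
 show ?thesis
 proof (rule exI[of _ \<rho>], rule exI[of _ R0], intro conjI \<rho>(3) allI impI, rule ccontr)
  fix \<delta> T y v R assume d: "\<delta> ~= 0" and o: "orb \<delta> T y v" and T: "0 < T" and ab: "y 0 = R *\<^sub>R \<xi>m" "y T = R *\<^sub>R \<xi>p"
   and l: "sqrt (2 * H) * (2 * R - 2 * C0) <= act v 0 T" and R: "R0 < R" and n: "\<not> (\<exists>t\<in>{0..T}. norm (y t) <= \<rho>)"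
  have out: "\<rho> <= norm (y t)" if "t \<in> {0..T}" for t using n that by (metis linear)
  have "0 <= R0" using C00 z by (simp add: R0_def)
  then have Rp: "0 < R" using R by linarith
  have dv: "norm (v t - v 0) <= ?e \<rho>" if t: "t \<in> {0..T}" for t
   using outside_velocity[OF o T \<rho>(3) out t] by (simp add: mult.commute mult.left_commute)
  have "norm ((y T - T *\<^sub>R v 0) - (y 0 - 0 *\<^sub>R v 0)) <= ?e \<rho> * T - ?e \<rho> * 0"
  proof (rule derivative_bound[where f="%s. y s - s *\<^sub>R v 0" and f'="%s. v s - v 0" and \<phi>="%s. ?e \<rho> * s" and \<phi>'="%_. ?e \<rho>"])
   fix s assume s: "s \<in> {0..T}"
   show "((%s. y s - s *\<^sub>R v 0) hvd v s - v 0) (at s within {0..T})"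
    using orb_der(1)[OF o s] by (auto intro!: derivative_eq_intros)
   show "((%s. ?e \<rho> * s) hrd ?e \<rho>) (at s within {0..T})" by (rule DERIV_cmult_Id)
  qed (use T dv in auto)
  then have "norm (y T - y 0 - T *\<^sub>R v 0) <= ?e \<rho> * T" by (simp add: algebra_simps)
  moreover have "norm (T *\<^sub>R v 0) - norm (y T - y 0) <= norm (T *\<^sub>R v 0 - (y T - y 0))" by (rule norm_triangle_ineq2)
  moreover have "norm (y T - y 0) = R * \<zeta>" using Rp by (simp add: ab scaleR_diff_right[symmetric] \<zeta>_def)
  moreover have "T * q <= norm (T *\<^sub>R v 0)" using orb_der(4)[OF o, of 0] T by (simp add: q_def)
  ultimately have 1: "T * (q - ?e \<rho>) <= R * \<zeta>" by (simp add: norm_minus_commute right_diff_distrib mult.commute)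
  have vb: "(norm (v t))^2 <= q * q + ?b \<rho>" if t: "t \<in> {0..T}" for t
  proof -
   have r1: "\<rho>1 <= norm (y t)" using out[OF t] \<rho>(3) by linarith
   have "Vd \<delta> (y t) <= 2 * M / norm (y t)" by (rule far(2)[OF r1])
   also have "... <= 2 * M / \<rho>" using out[OF t] \<rho>0 M0 by (intro divide_left_mono) (auto intro!: mult_pos_pos)
   finally show ?thesis using orb_der(3)[OF o t] q by simp
  qed
  have "act v 0 T <= integral {0..T} (%_. q * q + ?b \<rho>)" unfolding act_def
   by (rule integral_le) (use vb in \<open>auto intro!: integrable_continuous_real continuous_on_power continuous_on_norm orb_cont(2)[OF o]\<close>)
  also have "... = T * (q * q + ?b \<rho>)" using T by simp
  finally have "q * (2 * R - 2 * C0) <= T * (q * q + ?b \<rho>)" using l by (simp add: q_def)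
  then have "q * (2 * R - 2 * C0) * (q - ?e \<rho>) <= T * (q * q + ?b \<rho>) * (q - ?e \<rho>)" by (rule mult_right_mono) (use \<rho>(2) in simp)
  also have "... = (T * (q - ?e \<rho>)) * (q * q + ?b \<rho>)" by (simp add: mult_ac)
  also have "... <= (R * \<zeta>) * (q * q + ?b \<rho>)" by (rule mult_right_mono[OF 1]) (use M0 \<rho>0 q H0 in \<open>simp add: add_nonneg_nonneg\<close>)
  also have "... = R * (\<zeta> * (q * q + ?b \<rho>))" by simp
  also have "... < R * (q * (1 + \<zeta> / 2) * (q - ?e \<rho>))" by (rule mult_strict_left_mono[OF \<rho>(1) Rp])
  also have "... = (R * (q * (1 + \<zeta> / 2))) * (q - ?e \<rho>)" by simp
  finally have "q * (2 * R - 2 * C0) < R * (q * (1 + \<zeta> / 2))" using \<rho>(2) by (simp only: mult_less_cancel_right)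
  then have "q * (2 * R - 2 * C0) < q * (R * (1 + \<zeta> / 2))" by (simp only: mult_ac)
  then have "2 * R - 2 * C0 < R * (1 + \<zeta> / 2)" using q(1) by (simp only: mult_less_cancel_left_pos)
  then have "(2 - \<zeta>) * R < 4 * C0" by (simp add: algebra_simps)
  then show False using R z by (simp add: R0_def pos_divide_less_eq mult.commute)
 qed
qed

lemma half_asymptotics:
 assumes o: "!!n. orb (\<delta> n) (T n) (y n) (v n)" and s: "!!n. s n \<in> {0..T n}" and \<rho>: "\<rho>1 <= \<rho>"
  and ys: "!!n. norm (y n (s n)) <= \<rho>" and e: "!!n. y n (T n) = R n *\<^sub>R \<xi>" "norm \<xi> = 1" "!!n. \<rho> < R n"
  and Ts: "filterlim (%n. T n - s n) at_top sequentially"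
  and tb: "!!n t. t \<in> {s n..T n} ==> norm (y n t) <= \<rho> ==> t - s n <= \<tau>"
  and ly: "!!t. 0 < t ==> (%n. y n (t + s n)) ----> Y t" and lv: "!!t. 0 < t ==> (%n. v n (t + s n)) ----> V t"
  and d: "!!t. (Y hvd V t) (at t)"
 shows "((%t. Y t /\<^sub>R norm (Y t)) \<longlongrightarrow> \<xi>) at_top"
proof -
 have \<rho>0: "0 < \<rho>" using \<rho> rho1 by linarith
 have os: "orb (\<delta> n) (T n - s n) (%t. y n (t + s n)) (%t. v n (t + s n))" for n by (rule orb_shift[OF o]) (use s in auto)
 have "\<exists>t. 0 <= t & t < T n - s n & norm (y n (t + s n)) = \<rho> & 0 <= y n (t + s n) \<bullet> v n (t + s n)" for n
 proof (rule orb_exit[OF os[of n], of \<rho>])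
  show "\<rho> < norm (y n (T n - s n + s n))" using e(1,3)[of n] e(2) \<rho>0 by simp
 qed (use s[of n] ys[of n] \<rho>0 in auto)
 then obtain t0 where t0: "!!n. 0 <= t0 n & t0 n < T n - s n & norm (y n (t0 n + s n)) = \<rho> & 0 <= y n (t0 n + s n) \<bullet> v n (t0 n + s n)" by metis
 have t0b: "t0 n <= \<tau>" for n using tb[of "t0 n + s n" n] t0[of n] by auto
 have tau: "0 <= \<tau>" using t0b[of 0] t0[of 0] by linarith
 show ?thesis
 proof (rule asymptotics[OF os])
  show "filterlim (%n. T n - s n) at_top sequentially" by (rule Ts)
  show "norm \<xi> = 1" by (rule e)
  fix n
  show "0 <= t0 n" "t0 n <= \<tau>" "\<rho>1 <= norm (y n (t0 n + s n))" "0 <= y n (t0 n + s n) \<bullet> v n (t0 n + s n)"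
   using t0[of n] t0b \<rho> by auto
  show "y n (T n - s n + s n) = R n *\<^sub>R \<xi>" "0 <= R n" using e(1,3)[of n] \<rho>0 by (simp_all add: less_imp_le order_less_trans)
 next
  fix t assume t: "\<tau> < t"
  show "(%n. y n (t + s n)) ----> Y t" "(%n. v n (t + s n)) ----> V t" by (rule ly lv, use t tau in simp)+
  show "(Y hvd V t) (at t)" by (rule d)
 qed
qed

text \<open>Orbits cheaper by \<open>\<eta>\<close> than any passage through a centre are compared
  with the detour over a centre \<open>c k\<close>. The one resulting inequality
  \<open>inner\<close> keeps them away from the centres and bounds the time spent in a ball.\<close>

theorem final_limit:
 assumes d: "!!n. \<delta> n ~= 0" "\<delta> ----> 0" and R: "filterlim R at_top sequentially"
  and x: "norm \<xi>m = 1" "norm \<xi>p = 1" "\<xi>p ~= - \<xi>m" and N: "1 <= N" and eta: "0 < \<eta>"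
  and min: "!!n k. k \<in> {1..N} ==> J n <= jac (Gd (\<delta> n)) (c k) (R n *\<^sub>R \<xi>m) + jac (Gd (\<delta> n)) (c k) (R n *\<^sub>R \<xi>p)"
  and o: "!!n. orb (\<delta> n) (T n) (y n) (v n)" "!!n. 0 < T n" and ends: "!!n. y n 0 = R n *\<^sub>R \<xi>m" "!!n. y n (T n) = R n *\<^sub>R \<xi>p"
  and l: "!!n. sqrt (2 * H) * (2 * R n - 2 * C0) <= act (v n) 0 (T n)" and u: "!!n. act (v n) 0 (T n) <= J n - \<eta>"
 shows "\<exists>x. is_solution N c m \<alpha> x & has_energy N c m \<alpha> x H &
  ((%t. x t /\<^sub>R norm (x t)) \<longlongrightarrow> \<xi>p) at_top & ((%t. x t /\<^sub>R norm (x t)) \<longlongrightarrow> \<xi>m) at_bot"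
proof -
 note jt = jac_tri[OF d(1)] and js = jac_sy[OF d(1)] and jm = jac_le_modu[OF d(1)] and oa = orb_act[OF d(1) o(1)]
 have split: "act (v n) 0 s + act (v n) s t + act (v n) t (T n) = act (v n) 0 (T n)" if "0 <= s" "s <= t" "t <= T n" for n s t
  using orb_act_split[OF d(1) o(1), of 0 s t n] orb_act_split[OF d(1) o(1), of 0 t "T n" n] that by simp
 \<comment> \<open>Going to \<open>c k\<close> at time \<open>s\<close> and back to the orbit at
   time \<open>t\<close> would make a path through a centre, which costs at least
   \<open>J n\<close>. So the piece in between costs less than the two connections, by
   \<open>\<eta>\<close>.\<close>
 have inner: "act (v n) s t <= modu (norm (y n s - c k)) + modu (norm (y n t - c k)) - \<eta>"
  if st: "0 <= s" "s <= t" "t <= T n" and k: "k \<in> {1..N}" for n s t k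
 proof -
  have "jac (Gd (\<delta> n)) (R n *\<^sub>R \<xi>m) (y n s) <= act (v n) 0 s" using oa(1)[of 0 s n] st by (simp add: ends)
  moreover have "jac (Gd (\<delta> n)) (y n t) (R n *\<^sub>R \<xi>p) <= act (v n) t (T n)" using oa(1)[of t "T n" n] st by (simp add: ends)
  ultimately show ?thesis
   using split[OF st] u[of n] min[OF k, of n] jt[of n "c k" "R n *\<^sub>R \<xi>m" "y n s"] jt[of n "c k" "R n *\<^sub>R \<xi>p" "y n t"]
    jm[of n "c k" "y n s"] jm[of n "c k" "y n t"] js[of n "y n s" "R n *\<^sub>R \<xi>m"] by linarith
 qed
 obtain q where q: "modu q < \<eta> / 2" "0 < q" using modu_small[OF half_gt_zero[OF eta]] by blast
 have off: "q <= norm (y n t - c k)" if t: "t \<in> {0..T n}" and k: "k \<in> {1..N}" for n t k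
 proof (rule ccontr)
  assume "\<not> q <= norm (y n t - c k)"
  then have "modu (norm (y n t - c k)) <= modu q" by (intro modu_mono) auto
  moreover have "0 <= act (v n) t t" by (simp add: act_def)
  ultimately show False using inner[of t t n k] t k q by simp
 qed
 define L where "L = sqrt (2 * H + 2 * (M * q powr (- \<alpha>)))"
 have L: "0 < L" using H0 M0 by (simp add: L_def add_pos_nonneg)
 have vL: "norm (v n t) <= L" if t: "t \<in> {0..T n}" for n t
 proof -
  have "Vd (\<delta> n) (y n t) <= M * q powr (- \<alpha>)" by (rule Vd_bound[OF q(2) off[OF t]])
  then have "(norm (v n t))^2 <= 2 * H + 2 * (M * q powr (- \<alpha>))" using orb_der(3)[OF o(1) t] by simp
  then show ?thesis unfolding L_def by (rule real_le_rsqrt)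
 qed
 have lip: "norm (y n t - y n s) <= L * (t - s)" if st: "0 <= s" "s <= t" "t <= T n" for n s t
 proof -
  have "norm (y n t - y n s) <= L * t - L * s"
  proof (rule derivative_bound[OF st(2), where f'="v n" and \<phi>="%t. L * t" and \<phi>'="%_. L"])
   fix w assume w: "w \<in> {s..t}"
   then have wT: "w \<in> {0..T n}" using st by auto
   show "(y n hvd v n w) (at w within {s..t})"
    by (rule has_vector_derivative_within_subset[OF orb_der(1)[OF o(1) wT]]) (use st in auto)
   show "((%t. L * t) hrd L) (at w within {s..t})" by (rule DERIV_cmult_Id)
   show "norm (v n w) <= L" by (rule vL[OF wT])
  qed
  then show ?thesis by (simp add: right_diff_distrib)
 qed
 obtain \<rho> R0 where \<rho>: "\<rho>1 <= \<rho>" and enter: "!!\<delta> T y v R. \<delta> ~= 0 ==> orb \<delta> T y v ==> 0 < T ==> y 0 = R *\<^sub>R \<xi>m ==> y T = R *\<^sub>R \<xi>p ==>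
  sqrt (2 * H) * (2 * R - 2 * C0) <= act v 0 T ==> R0 < R ==> \<exists>t\<in>{0..T}. norm (y t) <= \<rho>"
  using enters_ball[OF x] by metis
 have "\<forall>\<^sub>F n in sequentially. R0 < R n & \<rho> < R n" using R by (intro eventually_conj) (simp_all add: filterlim_at_top_dense)
 then obtain p where p: "!!n. n \<ge> p ==> R0 < R n & \<rho> < R n" unfolding eventually_sequentially by auto
 have "\<exists>t\<in>{0..T n}. norm (y n t) <= \<rho>" if "n \<ge> p" for n
  using enter[of "\<delta> n" "T n" "y n" "v n" "R n", OF d(1) o(1) o(2) ends(1) ends(2) l] p[OF that] by blast
 then obtain s where s: "!!n. n \<ge> p ==> s n \<in> {0..T n} & norm (y n (s n)) <= \<rho>" by metis
 \<comment> \<open>From \<open>inner\<close> with the first centre: both connections from the ball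
   cost at most \<open>modu (\<rho> + C0)\<close>, and time costs at least \<open>2 * H\<close> per
   unit.\<close>
 define \<tau> where "\<tau> = modu (\<rho> + C0) / H"
 have tb: "t - w <= \<tau>" if wt: "0 <= w" "w <= t" "t <= T n" "norm (y n w) <= \<rho>" "norm (y n t) <= \<rho>" for n w t
 proof -
  have k: "1 \<in> {1..N}" using N by simp
  have m: "modu (norm (z - c 1)) <= modu (\<rho> + C0)" if "norm z <= \<rho>" for z
   by (rule modu_mono) (use norm_triangle_ineq4[of z "c 1"] c_le[OF k] that in auto)
  have "2 * H * (t - w) <= 2 * modu (\<rho> + C0)"
   using oa(2)[of w t n] inner[OF wt(1-3) k] m[OF wt(4)] m[OF wt(5)] wt eta by linarith
  then show ?thesis using H0 by (simp add: \<tau>_def pos_le_divide_eq mult.commute)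
 qed
 have far_time: "(1 / L) * (- \<rho> + R n) <= T n - s n" "(1 / L) * (- \<rho> + R n) <= s n" if n: "n \<ge> p" for n
 proof -
  note sn = s[OF n]
  have \<rho>0: "0 < R n" using p[OF n] \<rho> rho1 by linarith
  have "R n - \<rho> <= norm (y n (T n) - y n (s n))"
   using norm_triangle_ineq2[of "y n (T n)" "y n (s n)"] sn x \<rho>0 by (simp add: ends)
  also have "... <= L * (T n - s n)" by (rule lip) (use sn in auto)
  finally show "(1 / L) * (- \<rho> + R n) <= T n - s n" using L by (simp add: field_simps)
  have "R n - \<rho> <= norm (y n (s n) - y n 0)"
   using norm_triangle_ineq2[of "y n 0" "y n (s n)"] sn x \<rho>0 by (simp add: ends norm_minus_commute)
  also have "... <= L * (s n - 0)" by (rule lip) (use sn in auto)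
  finally show "(1 / L) * (- \<rho> + R n) <= s n" using L by (simp add: field_simps)
 qed
 have big: "filterlim (%n. (1 / L) * (- \<rho> + R n)) at_top sequentially"
  by (rule filterlim_tendsto_pos_mult_at_top[OF tendsto_const _ filterlim_tendsto_add_at_top[OF tendsto_const R]]) (use L in simp)
 have evp: "\<forall>\<^sub>F n in sequentially. n \<ge> p" by (rule eventually_ge_at_top)
 have sT: "filterlim (%n. T n - s n) at_top sequentially" "filterlim s at_top sequentially"
  by (rule filterlim_at_top_mono[OF big eventually_mono[OF evp far_time(1)]], assumption)
   (rule filterlim_at_top_mono[OF big eventually_mono[OF evp far_time(2)]], assumption)
 \<comment> \<open>Time zero is moved to a moment inside the ball of radius \<open>\<rho>\<close>;
   otherwise the limit would escape with the starting points.\<close>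
 let ?ey = "%n. ext (T (n + p)) (s (n + p)) (y (n + p))"
 obtain \<sigma> X where X: "strict_mono (\<sigma> :: nat => nat)"
  "!!(k::nat) e. 0 < e ==> \<exists>n0. \<forall>n\<ge>n0. \<forall>t\<in>{- real k..real k}. norm (?ey (\<sigma> n) t - X t) < e"
  "!!t. (%n. ?ey (\<sigma> n) t) ----> X t" "continuous_on UNIV X"
 proof (rule equicontinuous_limit[of ?ey \<rho>])
  fix k :: nat
  show "\<exists>C. \<forall>n. \<forall>w\<in>{- real k..real k}. \<forall>t\<in>{- real k..real k}. (norm (?ey n w - ?ey n t))^2 <= C * \<bar>w - t\<bar>"
  proof (rule exI[of _ "L^2 * (2 * real k)"], intro allI ballI)
   fix n w t assume wt: "w \<in> {- real k..real k}" "t \<in> {- real k..real k}"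
   show "(norm (?ey n w - ?ey n t))^2 <= L^2 * (2 * real k) * \<bar>w - t\<bar>"
   proof (rule ext_holder[OF _ _ _ wt])
    fix a b assume ab: "a \<in> {0..T (n + p)}" "b \<in> {0..T (n + p)}" "\<bar>a - s (n + p)\<bar> <= real k" "\<bar>b - s (n + p)\<bar> <= real k"
    have "norm (y (n + p) a - y (n + p) b) <= L * \<bar>a - b\<bar>"
     using lip[of a b "n + p"] lip[of b a "n + p"] ab by (cases "a <= b") (auto simp: norm_minus_commute)
    then have "(norm (y (n + p) a - y (n + p) b))^2 <= (L * \<bar>a - b\<bar>)^2" by (rule power_mono) simp
    also have "... = L^2 * (\<bar>a - b\<bar> * \<bar>a - b\<bar>)" by (simp add: power2_eq_square mult_ac)
    also have "... <= L^2 * (2 * real k * \<bar>a - b\<bar>)" by (intro mult_left_mono mult_right_mono) (use ab in auto)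
    finally show "(norm (y (n + p) a - y (n + p) b))^2 <= L^2 * (2 * real k) * \<bar>a - b\<bar>" by (simp add: mult.assoc)
   qed (use s[of "n + p"] in auto)
  qed
 next
  fix n
  have "?ey n 0 = y (n + p) (0 + s (n + p))" by (rule ext_eq) (use s[of "n + p"] in auto)
  then show "norm (?ey n 0) <= \<rho>" using s[of "n + p"] by simp
 qed (rule that)
 define j where "j = (%n. \<sigma> n + p)"
 have jp: "j n \<ge> p" for n by (simp add: j_def)
 have jf: "filterlim j at_top sequentially"
  unfolding j_def by (rule filterlim_compose[OF filterlim_add_const_nat_at_top filterlim_subseq[OF X(1)]])
 have jd: "\<sigma> n + p = j n" for n by (simp add: j_def)
 note X' = X(2,3)[unfolded jd]
 note jl = filterlim_compose[OF _ jf]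
 have ev: "\<forall>\<^sub>F n in sequentially. z < s (j n) & z < T (j n) - s (j n)" for z
  using jl[OF sT(1)] jl[OF sT(2)] by (intro eventually_conj) (simp_all add: filterlim_at_top_dense)
 have nc: "X t \<notin> c ` {1..N}" for t
 proof
  assume "X t \<in> c ` {1..N}"
  then obtain k where k: "k \<in> {1..N}" "X t = c k" by blast
  have "(%n. norm (ext (T (j n)) (s (j n)) (y (j n)) t - c k)) ----> norm (X t - c k)" by (intro tendsto_intros X'(2))
  then have "q <= norm (X t - c k)"
   by (rule tendsto_lowerbound) (use off[OF _ k(1)] o(2) in \<open>auto simp: ext_def less_imp_le\<close>)
  then show False using k q by simp
 qed
 let ?V = "%t. vector_derivative X (at t)"
 note OL = orb_limit[where \<delta>="%n. \<delta> (j n)" and y="%n. ext (T (j n)) (s (j n)) (y (j n))" and v="%n. ext (T (j n)) (s (j n)) (v (j n))" and Y=X and S=UNIV,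
   OF jl[OF d(2)] open_UNIV _ X'(1) X(4) nc UNIV_I]
 have loc: "\<exists>e>0. \<forall>\<^sub>F n in sequentially. \<forall>w\<in>{t - e..t + e}.
  flow (\<delta> (j n)) (ext (T (j n)) (s (j n)) (y (j n))) (ext (T (j n)) (s (j n)) (v (j n))) w" for t
 proof (rule exI[of _ 1], rule conjI[OF zero_less_one])
  show "\<forall>\<^sub>F n in sequentially. \<forall>w\<in>{t - 1..t + 1}. flow (\<delta> (j n)) (ext (T (j n)) (s (j n)) (y (j n))) (ext (T (j n)) (s (j n)) (v (j n))) w"
   using ev[of "\<bar>t\<bar> + 1"] by eventually_elim (rule ballI, rule ext_der[OF o(1)], auto)
 qed
 have Vl: "(%n. ext (T (j n)) (s (j n)) (v (j n)) t) ----> ?V t" for t by (rule OL(1)[OF loc])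
 have Xd: "(X hvd ?V t) (at t)" for t by (rule OL(2)[OF loc])
 have Vd': "(?V hvd Fd 0 (X t)) (at t)" for t by (rule OL(3)[OF loc])
 have en: "(norm (?V t))^2 = 2 * H + 2 * Vd 0 (X t)" for t by (rule OL(4)[OF loc])
 have sol: "is_solution N c m \<alpha> X"
  unfolding is_solution_def force_Fd
  by (intro conjI allI nc, rule exI[of _ ?V], intro allI conjI Xd Vd')
 have ene: "has_energy N c m \<alpha> X H"
  unfolding has_energy_def potential_Vd en by (simp add: field_simps)
 have conv: "(%n. f (j n) (t + s (j n))) ----> z" if "(%n. ext (T (j n)) (s (j n)) (f (j n)) t) ----> z"
  for f :: "nat => real => real ^ 3" and t z
 proof (rule Lim_transform_eventually[OF that])
  show "\<forall>\<^sub>F n in sequentially. ext (T (j n)) (s (j n)) (f (j n)) t = f (j n) (t + s (j n))"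
   using ev[of "\<bar>t\<bar>"] by eventually_elim (rule ext_eq, auto)
 qed
 have sj: "s (j n) \<in> {0..T (j n)}" "norm (y (j n) (s (j n))) <= \<rho>" "\<rho> < R (j n)" for n using s[OF jp[of n]] p[OF jp[of n]] by auto
 have plus: "((%t. X t /\<^sub>R norm (X t)) \<longlongrightarrow> \<xi>p) at_top"
 proof (rule half_asymptotics[OF o(1) sj(1) \<rho> sj(2) ends(2) x(2) sj(3) jl[OF sT(1)]])
  show "t - s (j n) <= \<tau>" if "t \<in> {s (j n)..T (j n)}" "norm (y (j n) t) <= \<rho>" for n t
   by (rule tb) (use that sj[of n] in auto)
  show "(%n. y (j n) (t + s (j n))) ----> X t" for t by (rule conv[OF X'(2)])
  show "(%n. v (j n) (t + s (j n))) ----> ?V t" for t by (rule conv[OF Vl])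
  show "(X hvd ?V t) (at t)" for t by (rule Xd)
 qed
 \<comment> \<open>The same statement for the reversed orbits, with the time origin seen from the
   other end.\<close>
 have minus: "((%t. X (- t) /\<^sub>R norm (X (- t))) \<longlongrightarrow> \<xi>m) at_top"
 proof (rule half_asymptotics[OF orb_reverse[OF o(1)], where s="%n. T (j n) - s (j n)" and \<rho>=\<rho> and R="%n. R (j n)" and \<tau>=\<tau>])
  show "T (j n) - s (j n) \<in> {0..T (j n)}" "norm (y (j n) (T (j n) - (T (j n) - s (j n)))) <= \<rho>" "\<rho> < R (j n)" for n using sj[of n] by auto
  show "y (j n) (T (j n) - T (j n)) = R (j n) *\<^sub>R \<xi>m" for n by (simp add: ends)
  show "filterlim (%n. T (j n) - (T (j n) - s (j n))) at_top sequentially" using jl[OF sT(2)] by simp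
  show "t - (T (j n) - s (j n)) <= \<tau>" if "t \<in> {T (j n) - s (j n)..T (j n)}" "norm (y (j n) (T (j n) - t)) <= \<rho>" for n t
   using tb[of "T (j n) - t" "s (j n)" "j n"] that sj[of n] by auto
  have e: "T (j n) - (t + (T (j n) - s (j n))) = - t + s (j n)" for n t by simp
  show "(%n. y (j n) (T (j n) - (t + (T (j n) - s (j n))))) ----> X (- t)" for t unfolding e by (rule conv[OF X'(2)])
  show "(%n. - v (j n) (T (j n) - (t + (T (j n) - s (j n))))) ----> - ?V (- t)" for t
   unfolding e by (rule tendsto_minus[OF conv[OF Vl]])
  show "((%t. X (- t)) hvd - ?V (- t)) (at t)" for t
  proof -
   have "((%t. - t) hvd - 1) (at t)" by (auto intro!: derivative_eq_intros)
   from vector_diff_chain_at[OF this Xd] show ?thesis by (simp add: o_def)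
  qed
 qed (use \<rho> x in auto)
 then have "((%t. X t /\<^sub>R norm (X t)) \<longlongrightarrow> \<xi>m) at_bot" by (simp add: filterlim_at_bot_mirror)
 then show ?thesis using sol ene plus by blast
qed

end

theorem theorem1p1:
  fixes N :: nat and c :: "nat \<Rightarrow> real ^ 3" and m :: "nat \<Rightarrow> real"
    and \<alpha> H :: real and \<xi>m \<xi>p :: "real ^ 3"
  assumes "N \<ge> 2"
    and "inj_on c {1..N}"
    and "\<And>i. i \<in> {1..N} \<Longrightarrow> m i > 0"
    and "\<alpha> \<in> {1..<2}"
    and "\<xi>m \<in> sphere 0 1" and "\<xi>p \<in> sphere 0 1"
    and "\<xi>p \<noteq> \<xi>m" and "\<xi>p \<noteq> - \<xi>m"
    and "H > 0"
  shows "\<exists>x :: real \<Rightarrow> real ^ 3.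
           is_solution N c m \<alpha> x \<and> has_energy N c m \<alpha> x H \<and>
           ((\<lambda>t. x t /\<^sub>R norm (x t)) \<longlongrightarrow> \<xi>p) at_top \<and>
           ((\<lambda>t. x t /\<^sub>R norm (x t)) \<longlongrightarrow> \<xi>m) at_bot"
proof -
 interpret ncentre N c m \<alpha> H using assms by unfold_locales auto
 have x: "norm \<xi>m = 1" "norm \<xi>p = 1" using assms by auto
 define \<delta> where "\<delta> = (%n. inverse (real (Suc n)))"
 \<comment> \<open>Exceeds the norm of every centre, as the construction of rays requires.\<close>
 define R where "R = (%n. C0 + 1 + real n)"
 have d: "\<delta> n ~= 0" for n unfolding \<delta>_def by simp
 have d0: "\<delta> ----> 0" unfolding \<delta>_def by (rule LIMSEQ_inverse_real_of_nat)
 have R: "filterlim R at_top sequentially"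
  unfolding R_def by (rule filterlim_tendsto_add_at_top[OF tendsto_const filterlim_real_sequentially])
 define f where "f = (%n k. jac (Gd (\<delta> n)) (c k) (R n *\<^sub>R \<xi>m) + jac (Gd (\<delta> n)) (c k) (R n *\<^sub>R \<xi>p))"
 have "\<exists>i\<in>{1..N}. \<forall>k\<in>{1..N}. f n i <= f n k" for n
 proof -
  have S: "finite {1..N}" "{1..N} ~= {}" using assms(1) by auto
  show ?thesis using arg_min_if_finite(1)[OF S, of "f n"] arg_min_least[OF S, of _ "f n"] by blast
 qed
 \<comment> \<open>The best centre may change with \<open>n\<close>; by the pigeonhole principle it
   is constant along a subsequence, so that all minimal rays start from the same point.\<close>
 then obtain i where i: "!!n. i n \<in> {1..N}" "!!n k. k \<in> {1..N} ==> f n (i n) <= f n k" by metis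
 have "finite (range i)" by (rule finite_subset[of _ "{1..N}"]) (use i in auto)
 then obtain n0 where n0: "infinite {n. i n = i n0}" using pigeonhole_infinite[of UNIV i] by auto
 define i0 where "i0 = i n0"
 have i0: "i0 \<in> {1..N}" unfolding i0_def by (rule i)
 obtain \<sigma>1 :: "nat => nat" where s1: "strict_mono \<sigma>1" "!!n. i (\<sigma>1 n) = i0"
  using infinite_enumerate[OF n0] by (auto simp: i0_def)
 have sub: "filterlim \<sigma>1 at_top sequentially" by (rule filterlim_subseq[OF s1(1)])
 have cR: "norm (c i0) < R n" for n using c_le[OF i0] by (simp add: R_def)
 obtain \<sigma>2 Tm ym vm rm where s2: "strict_mono (\<sigma>2 :: nat => nat)" "ray_seq ((\<delta> \<circ> \<sigma>1) \<circ> \<sigma>2) ((R \<circ> \<sigma>1) \<circ> \<sigma>2) \<xi>m i0 Tm ym vm rm"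
  by (rule ray_exists[of "\<delta> \<circ> \<sigma>1" "R \<circ> \<sigma>1" i0 \<xi>m]) (use d x cR filterlim_compose[OF d0 sub] filterlim_compose[OF R sub] in \<open>auto simp: o_def\<close>)
 note r2 = s2(2)
 \<comment> \<open>The second ray is extracted along the subsequence of the first; the first ray is
   then restricted to the new subsequence.\<close>
 obtain \<sigma>3 Tp yp vp rp where s3: "strict_mono (\<sigma>3 :: nat => nat)"
  "ray_seq (((\<delta> \<circ> \<sigma>1) \<circ> \<sigma>2) \<circ> \<sigma>3) (((R \<circ> \<sigma>1) \<circ> \<sigma>2) \<circ> \<sigma>3) \<xi>p i0 Tp yp vp rp"
  by (rule ray_exists[OF rayD(1,2,3)[OF r2] _ x(2), of i0]) (use cR in auto)
 define \<sigma> where "\<sigma> = \<sigma>1 \<circ> \<sigma>2 \<circ> \<sigma>3"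
 define \<delta>' where "\<delta>' = \<delta> \<circ> \<sigma>" define R' where "R' = R \<circ> \<sigma>"
 have rm: "ray_seq \<delta>' R' \<xi>m i0 (Tm \<circ> \<sigma>3) (ym \<circ> \<sigma>3) (vm \<circ> \<sigma>3) rm"
  using ray_sub[OF r2 s3(1)] by (simp add: \<delta>'_def R'_def \<sigma>_def comp_assoc)
 have rp: "ray_seq \<delta>' R' \<xi>p i0 Tp yp vp rp"
  using s3(2) by (simp add: \<delta>'_def R'_def \<sigma>_def comp_assoc)
 have min: "jac (Gd (\<delta>' n)) (c i0) (R' n *\<^sub>R \<xi>m) + jac (Gd (\<delta>' n)) (c i0) (R' n *\<^sub>R \<xi>p)
   <= jac (Gd (\<delta>' n)) (c k) (R' n *\<^sub>R \<xi>m) + jac (Gd (\<delta>' n)) (c k) (R' n *\<^sub>R \<xi>p)" if "k \<in> {1..N}" for n k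
  using i(2)[OF that, of "\<sigma> n"] s1(2) by (simp add: f_def \<delta>'_def R'_def \<sigma>_def)
 have Rp: "0 < R' n" for n using C00 by (simp add: R'_def R_def)
 let ?J = "%n. jac (Gd (\<delta>' n)) (c i0) (R' n *\<^sub>R \<xi>m) + jac (Gd (\<delta>' n)) (c i0) (R' n *\<^sub>R \<xi>p)"
 let ?pass = "%n \<eta> T y v. pass (\<delta>' n) (R' n *\<^sub>R \<xi>m) (R' n *\<^sub>R \<xi>p) (sqrt (2 * H) * (2 * R' n - 2 * norm (c i0))) (?J n - \<eta>) T y v"
 obtain \<eta> where eta: "0 < \<eta>" "\<forall>\<^sub>F n in sequentially. \<exists>T y v. ?pass n \<eta> T y v"
  using level_drop[OF assms(2) i0 rm rp assms(7)[symmetric] min Rp assms(8)] by blast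
 obtain p where "!!n. n \<ge> p ==> \<exists>T y v. ?pass n \<eta> T y v" using eta(2) unfolding eventually_sequentially by blast
 then have "\<forall>n. \<exists>T y v. ?pass (n + p) \<eta> T y v" by simp
 then obtain T y v where ps: "!!n. ?pass (n + p) \<eta> (T n) (y n) (v n)" by metis
 then have o: "orb (\<delta>' (n + p)) (T n) (y n) (v n)" "0 < T n" "y n 0 = R' (n + p) *\<^sub>R \<xi>m" "y n (T n) = R' (n + p) *\<^sub>R \<xi>p"
  "sqrt (2 * H) * (2 * R' (n + p) - 2 * norm (c i0)) <= act (v n) 0 (T n)" "act (v n) 0 (T n) <= ?J (n + p) - \<eta>" for n
  by (simp_all add: pass_def)
 have l: "sqrt (2 * H) * (2 * R' (n + p) - 2 * C0) <= act (v n) 0 (T n)" for n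
 proof -
  have "sqrt (2 * H) * (2 * R' (n + p) - 2 * C0) <= sqrt (2 * H) * (2 * R' (n + p) - 2 * norm (c i0))"
   using c_le[OF i0] H0 by (intro mult_left_mono) auto
  then show ?thesis using o(5)[of n] by linarith
 qed
 have N1: "1 <= N" using assms(1) by simp
 show ?thesis
  by (rule final_limit[where \<delta>="%n. \<delta>' (n + p)" and R="%n. R' (n + p)",
    OF rayD(1)[OF rp] LIMSEQ_ignore_initial_segment[OF rayD(2)[OF rp]]
     filterlim_compose[OF rayD(3)[OF rp] filterlim_add_const_nat_at_top] x assms(8) N1 eta(1) min o(1,2,3,4) l o(6)])
qed

end
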